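(* In the standing setting below, there exists $\varepsilon_1\in(0,\varepsilon_0]$ such that for every $\varepsilon\in(0,\varepsilon_1]$ the shock profile $\phi_\varepsilon$ is spectrally stable. Spelled out: the Evans bundles $\mathcal{H}^\pm_\varepsilon$ possess analytic extensions to all of $\mathbb{H}^+$, including $\kappa=0$. Let $\mathcal{E}_\varepsilon$ be the Evans function formed from analytic bases of these extensions on $\mathbb{H}^+$. Then for $\kappa\in\mathbb{H}^+$ one has $\mathcal{E}_\varepsilon(\kappa)=0$ if and only if $\kappa=0$, and moreover $\mathcal{E}_\varepsilon'(0)\neq0$.
   Context: Standing setting. Basic data. Let $n\in\mathbb{N}$, let $\Omega\subset\mathbb{R}^n$ be open with $0\in\Omega$, and let $k\in\{1,n\}$ (an extreme shock). Let $f,g:\Omega\to\mathbb{R}^n$ be smooth with $f(0)=g(0)=0$. Consider the hyperbolically regularized conservation law $$g(v)_t+f(v)_x=v_{xx}-v_{tt},\qquad v(t,x)\in\mathbb{R}^n.$$ Assumptions. - (A1) $Df(v)$ and $Dg(v)$ are symmetric for all $v\in\Omega$, and $Dg(0)$ is positive definite. - (A2) The generalized eigenvalue problem $Df(0)r=\mu Dg(0)r$ has $n$ distinct real eigenvalues. - (A3) The $k$-th field is genuinely nonlinear at $0$, i.e. $\langle D\mu_k(0),r_k(0)\rangle\neq0$, with $\mu_k,r_k$ as defined below. - (A4) $Dg(0)\pm Df(0)$ are positive definite. Eigenvalues and eigenvectors. On a small ball $B_\delta(0)$, let $\mu_1(v)<\dots<\mu_n(v)$ be the smooth eigenvalues of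 $Df(v)$ relative to $Dg(v)$. Let $r_i(v)$ be smooth eigenvectors with $Df\,r_i=\mu_iDg\,r_i$ and $r_i^TDg\,r_j=\delta_{ij}$. The sign of $r_k$ is chosen so that $\langle D\mu_k(0),r_k(0)\rangle<0$. Coordinates. Coordinates are chosen, by an orthogonal change of variables, such that - $Df(0)-\mu_k(0)Dg(0)=\mathrm{diag}(\lambda_1,\dots,\lambda_n)$, with $\lambda_k=0$, $\lambda_j<0$ for $j<k$, and $\lambda_j>0$ for $j>k$; - $r_k(0)$ is a positive multiple of the unit vector $e_k$. Lorentz-boosted fluxes. For $s\in(-1,1)$ let $\gamma(s)=(1-s^2)^{-1/2}$, $f_s=\gamma(s)(f-sg)$ and $g_s=\gamma(s)(g-sf)$. $k$-shocks. A $k$-shock is a triple $(v^-,v^+,s)$ with - $f(v^+)-f(v^-)=s(g(v^+)-g(v^-))$, - $\mu_k(v^+)<s<\mu_k(v^-)$, - $(\mu_j(v^-)-s)(\mu_j(v^+)-s)>0$ for $j\neq k$. Shock family. Let $\{(v^-_\varepsilon,v^+_\varepsilon,s(\varepsilon))\}_{\varepsilon\in[0,\varepsilon_0]}$ be a smooth family such that: - (i) for $\varepsilon>0$ it is a $k$-shock; - (ii) $s(0)=\mu_k(0)$ and $s'(0)=0$; - (iii) $v^\pm_\varepsilon=\pm\varepsilon(e_k+O(\varepsilon))$ and $(v^\pm_\varepsilon)_k=\pm\varepsilon$; - (iv) $v^\pm_\varepsilon$ are the only solutions $v\in B_{3\varepsilon}(0)$ of $f(v)-s(\varepsilon)g(v)=f(v^-_\varepsilon)-s(\varepsilon)g(v^-_\varepsilon)$.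 Abbreviations. Put $f_\varepsilon=f_{s(\varepsilon)}$, $g_\varepsilon=g_{s(\varepsilon)}$, $\gamma_0=\gamma(\mu_k(0))$, $Df_0=Df_{s(0)}(0)$, $Dg_0=Dg_{s(0)}(0)$ and $a=\tfrac12(\partial_k^2f_k(0)-\mu_k(0)\partial_k^2g_k(0))$. One has $a<0$. Shock profile. For $\varepsilon\in(0,\varepsilon_0]$, let $\phi_\varepsilon$ be the shock profile: a solution of $$\phi'=f_\varepsilon(\phi)-f_\varepsilon(v^-_\varepsilon),\qquad \phi(\pm\infty)=v^\pm_\varepsilon,$$ with values in $B_{3\varepsilon}(0)$. For small $\varepsilon$ it exists, is unique up to translation and depends smoothly on $\varepsilon$. It defines the travelling wave $v(t,x)=\phi_\varepsilon(\gamma(s(\varepsilon))(x-s(\varepsilon)t))$. Eigenvalue equation. For $\kappa\in\mathbb{C}$ and $v$ near $0$ set $$A_{\varepsilon,\kappa}(v)=\begin{pmatrix}Df_\varepsilon(v)&I_n\\ \kappa^2I_n+\kappa Dg_\varepsilon(v)&0\end{pmatrix}\in\mathbb{C}^{2n\times2n}.$$ The Laplace-mode (eigenvalue) equation of the linearization $Dg_\varepsilon(\phi_\varepsilon)v_t+(Df_\varepsilon(\phi_\varepsilon)v)_x=v_{xx}-v_{tt}$ is $$\xi'=A_{\varepsilon,\kappa}(\phi_\varepsilon(x))\xi,\qquad \xi\in\mathbb{C}^{2n}.$$ Evans bundles. Let $\mathbb{H}^+=\{\kappa\in\mathbb{C}:\mathrm{Re}\,\kappa\ge0\}$. For $\kappa\in\mathbb{H}^+\setminus\{0\}$,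 the matrices $A_{\varepsilon,\kappa}(v^\pm_\varepsilon)$ have no purely imaginary eigenvalues and have $n$-dimensional stable and unstable subspaces. The Evans bundles $\mathcal{H}^\pm_\varepsilon(\kappa)$ are the $n$-dimensional subspaces of those initial values $\xi(0)$ whose solution tends to $0$ as $x\to\pm\infty$. They depend analytically on $\kappa$. Evans function and transversality. An Evans function is $$\mathcal{E}_\varepsilon(\kappa)=\det\big(h^-_1(\kappa),\dots,h^-_n(\kappa),h^+_1(\kappa),\dots,h^+_n(\kappa)\big)$$ for analytic bases $(h^\pm_j(\kappa))_j$ of $\mathcal{H}^\pm_\varepsilon(\kappa)$. The bundles are called transversal at $\kappa$ if $\mathcal{H}^-_\varepsilon(\kappa)\cap\mathcal{H}^+_\varepsilon(\kappa)=\{0\}$. *)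

theory Defs
  imports "HOL-Analysis.Analysis"
begin

text \<open>A function is smooth on S if it is differentiable on S and all its partial
  derivatives (along the basis directions) are again smooth on S.  Iterating, all
  partial derivatives of all orders exist (hence are continuous): C-infinity.\<close>

coinductive smooth_on :: "'a::euclidean_space set \<Rightarrow> ('a \<Rightarrow> 'b::real_normed_vector) \<Rightarrow> bool" where
  "f differentiable_on S \<Longrightarrow>
   (\<forall>i\<in>Basis. smooth_on S (\<lambda>x. frechet_derivative f (at x within S) i)) \<Longrightarrow>
   smooth_on S f"

definition jac :: "(real^'n \<Rightarrow> real^'m) \<Rightarrow> real^'n \<Rightarrow> real^'n^'m" where
  "jac f x = matrix (frechet_derivative f (at x))"

definition sym_mat :: "real^'n^'n \<Rightarrow> bool" where
  "sym_mat M \<longleftrightarrow> transpose M = M"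

definition pos_def :: "real^'n^'n \<Rightarrow> bool" where
  "pos_def M \<longleftrightarrow> sym_mat M \<and> (\<forall>x. x \<noteq> 0 \<longrightarrow> x \<bullet> (M *v x) > 0)"

definition lgamma :: "real \<Rightarrow> real" where
  "lgamma s = 1 / sqrt (1 - s\<^sup>2)"

definition fboost :: "(real^'n \<Rightarrow> real^'n) \<Rightarrow> (real^'n \<Rightarrow> real^'n) \<Rightarrow> real \<Rightarrow> real^'n \<Rightarrow> real^'n" where
  "fboost f g s v = lgamma s *\<^sub>R (f v - s *\<^sub>R g v)"

definition gboost :: "(real^'n \<Rightarrow> real^'n) \<Rightarrow> (real^'n \<Rightarrow> real^'n) \<Rightarrow> real \<Rightarrow> real^'n \<Rightarrow> real^'n" where
  "gboost f g s v = lgamma s *\<^sub>R (g v - s *\<^sub>R f v)"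

text \<open>mu j v is the j-th generalized eigenvalue (indices ordered by the linear order on 'n).\<close>
definition k_shock :: "(real^'n \<Rightarrow> real^'n) \<Rightarrow> (real^'n \<Rightarrow> real^'n) \<Rightarrow> ('n \<Rightarrow> real^'n \<Rightarrow> real)
    \<Rightarrow> 'n \<Rightarrow> real^'n \<Rightarrow> real^'n \<Rightarrow> real \<Rightarrow> bool" where
  "k_shock f g mu k vm vp s \<longleftrightarrow>
     f vp - f vm = s *\<^sub>R (g vp - g vm) \<and>
     mu k vp < s \<and> s < mu k vm \<and>
     (\<forall>j. j \<noteq> k \<longrightarrow> (mu j vm - s) * (mu j vp - s) > 0)"

definition is_profile :: "(real^'n \<Rightarrow> real^'n) \<Rightarrow> (real^'n \<Rightarrow> real^'n) \<Rightarrow> real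
    \<Rightarrow> real^'n \<Rightarrow> real^'n \<Rightarrow> real \<Rightarrow> (real \<Rightarrow> real^'n) \<Rightarrow> bool" where
  "is_profile f g s vm vp eps phi \<longleftrightarrow>
     (\<forall>x. (phi has_vector_derivative (fboost f g s (phi x) - fboost f g s vm)) (at x)) \<and>
     (phi \<longlongrightarrow> vm) at_bot \<and> (phi \<longlongrightarrow> vp) at_top \<and>
     (\<forall>x. phi x \<in> ball 0 (3 * eps))"

definition evans_mat :: "real^'n^'n \<Rightarrow> real^'n^'n \<Rightarrow> complex \<Rightarrow> complex^('n + 'n)^('n + 'n)" where
  "evans_mat Df Dg \<kappa> = (\<chi> a b. case (a, b) of
       (Inl i, Inl j) \<Rightarrow> complex_of_real (Df $ i $ j)
     | (Inl i, Inr j) \<Rightarrow> (if i = j then 1 else 0)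
     | (Inr i, Inl j) \<Rightarrow> \<kappa>\<^sup>2 * (if i = j then 1 else 0) + \<kappa> * complex_of_real (Dg $ i $ j)
     | (Inr i, Inr j) \<Rightarrow> 0)"

definition A_mat :: "(real^'n \<Rightarrow> real^'n) \<Rightarrow> (real^'n \<Rightarrow> real^'n) \<Rightarrow> real \<Rightarrow> complex
    \<Rightarrow> real^'n \<Rightarrow> complex^('n + 'n)^('n + 'n)" where
  "A_mat f g s \<kappa> v = evans_mat (jac (fboost f g s) v) (jac (gboost f g s) v) \<kappa>"

definition evans_plus :: "(real^'n \<Rightarrow> real^'n) \<Rightarrow> (real^'n \<Rightarrow> real^'n) \<Rightarrow> real
    \<Rightarrow> (real \<Rightarrow> real^'n) \<Rightarrow> complex \<Rightarrow> (complex^('n + 'n)) set" where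
  "evans_plus f g s phi \<kappa> = {\<xi>0. \<exists>\<xi>. \<xi> 0 = \<xi>0 \<and>
      (\<forall>x. (\<xi> has_vector_derivative (A_mat f g s \<kappa> (phi x) *v \<xi> x)) (at x)) \<and>
      (\<xi> \<longlongrightarrow> 0) at_top}"

definition evans_minus :: "(real^'n \<Rightarrow> real^'n) \<Rightarrow> (real^'n \<Rightarrow> real^'n) \<Rightarrow> real
    \<Rightarrow> (real \<Rightarrow> real^'n) \<Rightarrow> complex \<Rightarrow> (complex^('n + 'n)) set" where
  "evans_minus f g s phi \<kappa> = {\<xi>0. \<exists>\<xi>. \<xi> 0 = \<xi>0 \<and>
      (\<forall>x. (\<xi> has_vector_derivative (A_mat f g s \<kappa> (phi x) *v \<xi> x)) (at x)) \<and>
      (\<xi> \<longlongrightarrow> 0) at_bot}"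

definition Hplus :: "complex set" where
  "Hplus = {\<kappa>. 0 \<le> Re \<kappa>}"

definition cindep :: "('n::finite \<Rightarrow> complex^'m) \<Rightarrow> bool" where
  "cindep h \<longleftrightarrow> (\<forall>c. (\<Sum>j\<in>UNIV. c j *s h j) = 0 \<longrightarrow> (\<forall>j. c j = 0))"

definition cspan :: "('n::finite \<Rightarrow> complex^'m) \<Rightarrow> (complex^'m) set" where
  "cspan h = {(\<Sum>j\<in>UNIV. c j *s h j) | c. True}"

text \<open>h is an analytic basis on Hplus of an analytic extension of the bundle H
  (which is given on Hplus minus 0).\<close>
definition analytic_basis :: "(complex \<Rightarrow> (complex^'m) set) \<Rightarrow> ('n::finite \<Rightarrow> complex \<Rightarrow> complex^'m) \<Rightarrow> bool" where
  "analytic_basis H h \<longleftrightarrow>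
     (\<forall>j r. (\<lambda>\<kappa>. h j \<kappa> $ r) analytic_on Hplus) \<and>
     (\<forall>\<kappa>\<in>Hplus. cindep (\<lambda>j. h j \<kappa>)) \<and>
     (\<forall>\<kappa>\<in>Hplus - {0}. cspan (\<lambda>j. h j \<kappa>) = H \<kappa>)"

definition evans_fun :: "('n::finite \<Rightarrow> complex \<Rightarrow> complex^('n + 'n)) \<Rightarrow> ('n \<Rightarrow> complex \<Rightarrow> complex^('n + 'n))
    \<Rightarrow> complex \<Rightarrow> complex" where
  "evans_fun hm hp \<kappa> = det (\<chi> r c. case c of Inl j \<Rightarrow> hm j \<kappa> $ r | Inr j \<Rightarrow> hp j \<kappa> $ r)"

definition spectrally_stable :: "(real^'n \<Rightarrow> real^'n) \<Rightarrow> (real^'n \<Rightarrow> real^'n) \<Rightarrow> real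
    \<Rightarrow> (real \<Rightarrow> real^'n) \<Rightarrow> bool" where
  "spectrally_stable f g s phi \<longleftrightarrow>
     (\<exists>(hm :: 'n \<Rightarrow> complex \<Rightarrow> complex^('n + 'n)) (hp :: 'n \<Rightarrow> complex \<Rightarrow> complex^('n + 'n)). analytic_basis (evans_minus f g s phi) hm \<and> analytic_basis (evans_plus f g s phi) hp) \<and>
     (\<forall>(hm :: 'n \<Rightarrow> complex \<Rightarrow> complex^('n + 'n)) (hp :: 'n \<Rightarrow> complex \<Rightarrow> complex^('n + 'n)). analytic_basis (evans_minus f g s phi) hm \<and> analytic_basis (evans_plus f g s phi) hp \<longrightarrow>
        (\<forall>\<kappa>\<in>Hplus. evans_fun hm hp \<kappa> = 0 \<longleftrightarrow> \<kappa> = 0) \<and>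
        deriv (evans_fun hm hp) 0 \<noteq> 0)"

end

theory Submission
  imports Defs "HOL-Complex_Analysis.Conformal_Mappings" "HOL-Real_Asymp.Real_Asymp"
begin

text \<open>A reflection of the line exchanges the two extreme fields, so one may assume that all
  characteristics at one end enter the shock. For \<open>Re \<kappa> \<ge> 0\<close>, \<open>\<kappa> \<noteq> 0\<close>, a Goodman type weighted energy
  estimate, with a weight that absorbs the sign of the genuinely nonlinear term, excludes common
  elements of the two Evans bundles. Near \<open>\<kappa> = 0\<close> the modes at each end split into fast
  and slow ones, whose invariant graphs depend holomorphically on \<open>\<kappa>\<close>; this yields the
  extensions of the bundles, and at \<open>\<kappa> = 0\<close> the same energy argument leaves only the line spanned by the
  derivative of the profile, on which the first-order term in \<open>\<kappa>\<close> is nonzero.\<close>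

text \<open>With \<open>w = ka u\<close> the Evans system \<open>v' = F v + w\<close>,
  \<open>w' = (ka^2 + ka G) v\<close> becomes, for \<open>p = v + u\<close> and
  \<open>q = v - u\<close>, the diagonal system \<open>p' = ka p + (G + F) v\<close>,
  \<open>q' = - ka q - (G - F) v\<close>. By (A4) both \<open>G + F\<close> and \<open>G - F\<close>
  are positive definite near the base state, so the indefinite form
  \<open>p . (G + F)^-1 p - q . (G - F)^-1 q\<close> gains \<open>4 |v|^2\<close> along solutions,
  up to derivatives of the coefficients. Monotonicity of such forms yields the bundles, as graphs of
  p over q. The obstacle is \<open>u\<close>: its dissipation carries the derivative of the profile
  as a factor and fades at both ends. For \<open>ka \<noteq> 0\<close> a skew correction of the form
  restores it; near 0 a conjugation by exponential weights does. In the variables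
  \<open>(v, u)\<close> the two graphs are transversal on all of \<open>Hplus\<close>, 0 included.
  Going back to \<open>(v, ka u)\<close> multiplies n rows by \<open>ka\<close>, while n - 1 columns
  of the minus basis, constants at \<open>ka = 0\<close>, can be divided by \<open>ka\<close>. So
  the Evans function is \<open>ka\<close> times a zero-free function, which is why its zero is
  simple.\<close>

abbreviation (input) dotp (infix "#." 70) where "x #. y == inner x y"
abbreviation (input) scal (infixr "*R" 75) where "c *R x == scaleR c x"
abbreviation (input) hvd (infix "hvd" 50) where "(f hvd d) F == (f has_vector_derivative d) F"
abbreviation (input) tends (infixr "--->" 55) where "(f ---> l) F == filterlim f (nhds l) F"
abbreviation (input) sqr ("_^2" [1000] 999) where "x^2 == power2 x"



section \<open>Linear differential equations with continuous coefficients\<close>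

lemma antiderivative_on_real:
 fixes f :: "real => 'a::euclidean_space"
 assumes "continuous_on UNIV f"
 shows "EX F. F 0 = 0 & (ALL x. (F hvd f x) (at x))"
proof -
 define I where "I u = (LBINT y=0..u. f y)" for u :: real
 have I: "(I hvd f x) (at x)" for x
 proof -
 have "((%u. LBINT y=0..u. f y) hvd f x) (at x within {-(\<bar>x\<bar>+1)..\<bar>x\<bar>+1})"
 using interval_integral_FTC2[of "-(\<bar>x\<bar>+1)" 0 "\<bar>x\<bar>+1" f x] continuous_on_subset[OF assms]
 by (simp add: zero_ereal_def)
 then show ?thesis unfolding I_def by (subst (asm) at_within_Icc_at) auto
 qed
 show ?thesis
 by (rule exI[of _ "%u. I u - I 0"]) (auto intro!: derivative_eq_intros I)
qed

lemma linear_euclidean_expand: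
 fixes B :: "'a::euclidean_space => 'b::real_vector"
 assumes "linear B"
 shows "B w = (\<Sum>b\<in>Basis. (w #. b) *R B b)"
proof -
 have "B (\<Sum>b\<in>Basis. (w #. b) *R b) = (\<Sum>b\<in>Basis. (w #. b) *R B b)"
 unfolding linear_sum[OF assms] by (simp add: linear_cmul[OF assms])
 then show ?thesis by (simp only: euclidean_representation)
qed

lemma continuous_linear_family_apply:
 fixes B :: "real => 'a::euclidean_space => 'b::real_normed_vector"
 assumes "!!t. linear (B t)" "!!xq. continuous_on S (%t. B t xq)" "continuous_on S w"
 shows "continuous_on S (%t. B t (w t))"
proof -
 have "(%t. B t (w t)) = (%t. \<Sum>b\<in>Basis. (w t #. b) *R B t b)"
 using linear_euclidean_expand[OF assms(1)] by blast
 moreover have "continuous_on S (%t. \<Sum>b\<in>Basis. (w t #. b) *R B t b)"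
 by (intro continuous_on_sum continuous_on_scaleR continuous_on_inner continuous_on_const assms(2,3))
 ultimately show ?thesis by (simp only:)
qed

lemma linear_family_local_bound:
 fixes B :: "real => 'a::euclidean_space => 'b::real_normed_vector"
 assumes lin: "!!t. linear (B t)" and cont: "!!xq. continuous_on UNIV (%t. B t xq)"
 shows "EX K>=0. ALL t:{-N..N}. ALL w. norm (B t w) <= K * norm w"
proof -
 have "EX K. ALL t:{-N..N}. norm (B t b) <= K" for b
 proof -
 have "continuous_on {-N..N} (%t. B t b)"
 by (rule continuous_on_subset[OF cont]) simp
 then have "bounded ((%t. B t b) ` {-N..N})"
 by (intro compact_imp_bounded compact_continuous_image) simp_all
 then show ?thesis unfolding bounded_iff by simp
 qed
 then have "ALL b. EX K. ALL t:{-N..N}. norm (B t b) <= K" by simp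
 from choice[OF this] obtain K where K: "ALL b. ALL t:{-N..N}. norm (B t b) <= K b" ..
 have "norm (B t w) <= (\<Sum>b\<in>Basis. \<bar>K b\<bar>) * norm w" if t: "t : {-N..N}" for t w
 proof -
 have "norm (B t w) = norm (\<Sum>b\<in>Basis. (w #. b) *R B t b)"
 by (rule arg_cong[where f = norm]) (rule linear_euclidean_expand[OF lin])
 also have "... <= (\<Sum>b\<in>Basis. norm ((w #. b) *R B t b))" by (rule norm_sum)
 also have "... <= (\<Sum>b\<in>Basis. \<bar>K b\<bar> * norm w)"
 proof (rule sum_mono)
 fix b :: 'a assume b: "b : Basis"
 have "norm (B t b) <= \<bar>K b\<bar>" using K t by (meson abs_ge_self order_trans)
 then have "norm (B t b) * \<bar>w #. b\<bar> <= \<bar>K b\<bar> * norm w"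
 using Basis_le_norm[OF b, of w] by (intro mult_mono) auto
 then show "norm ((w #. b) *R B t b) <= \<bar>K b\<bar> * norm w" by (simp add: mult.commute)
 qed
 also have "... = (\<Sum>b\<in>Basis. \<bar>K b\<bar>) * norm w" by (simp only: sum_distrib_right)
 finally show ?thesis .
 qed
 moreover have "0 <= (\<Sum>b\<in>Basis. \<bar>K b\<bar>)" by (rule sum_nonneg) simp
 ultimately show ?thesis by blast
qed

lemma has_vector_derivative_reflect:
 assumes "(w hvd d) (at (- t))"
 shows "((%t::real. w (- t)) hvd - d) (at t)"
proof -
 have "(uminus hvd (- 1::real)) (at t)"
 by (auto intro!: derivative_eq_intros)
 from vector_diff_chain_at[OF this assms] show ?thesis by (simp add: o_def)
qed

lemma has_real_derivative_inner:
 assumes "(f hvd f') (at t)" "(g hvd g') (at t)"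
 shows "((%t::real. f t #. g t) has_real_derivative f' #. g t + f t #. g') (at t)"
 using bounded_bilinear.has_vector_derivative[OF bounded_bilinear_inner assms]
 by (simp add: has_real_derivative_iff_has_vector_derivative add.commute)

text \<open>Each integration gains a factor \<open>K * \<bar>t\<bar>\<close> and the new factorial
  arises from integrating the power. Negative times reduce to positive ones by reflection.\<close>

lemma picard_iterate_step:
 fixes u w :: "real => 'a::real_normed_vector"
 assumes w: "!!x. (w hvd B x (u x)) (at x)" "w 0 = 0"
 and B: "!!t v. \<bar>t\<bar> <= N ==> norm (B t v) <= K * norm v" and K: "0 <= K"
 and u: "!!t. \<bar>t\<bar> <= N ==> norm (u t) <= (K * \<bar>t\<bar>)^m / fact m * c"
 and x: "\<bar>x\<bar> <= N"
 shows "norm (w x) <= (K * \<bar>x\<bar>)^(Suc m) / fact (Suc m) * c"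
proof -
 have key: "norm (f x) <= (K * x)^(Suc m) / fact (Suc m) * c"
 if f: "!!t. (f hvd f' t) (at t)" "f 0 = 0"
 "!!t. 0 <= t ==> t <= x ==> norm (f' t) <= K * ((K * t)^m / fact m * c)" and x: "0 <= x"
 for f f' :: "real => 'a" and x
 proof (cases "x = 0")
 case True then show ?thesis using f(2) by simp
 next
 case False
 let ?p = "%t. (K * t)^(Suc m) / fact (Suc m) * c"
 have "norm (f x - f 0) <= ?p x - ?p 0"
 proof (rule differentiable_bound_general)
 show "0 < x" using x False by simp
 show "continuous_on {0..x} f"
 using f(1) by (meson continuous_at_imp_continuous_on has_vector_derivative_continuous)
 show "continuous_on {0..x} ?p" by (intro continuous_intros) auto
 show "(f hvd f' t) (at t)" for t by (rule f)
 show "(?p hvd (K * ((K * t)^m / fact m * c))) (at t)" for t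
 proof -
 have p: "?p = (%t. (K ^ Suc m / fact (Suc m) * c) * t ^ Suc m)"
 by (simp add: power_mult_distrib fun_eq_iff)
 have "((%t. (K ^ Suc m / fact (Suc m) * c) * t ^ Suc m) has_real_derivative
 (K ^ Suc m / fact (Suc m) * c) * (real (Suc m) * t ^ m)) (at t)"
 by (rule DERIV_cmult) (use DERIV_pow[of "Suc m" t] in simp)
 moreover have "(K ^ Suc m / fact (Suc m) * c) * (real (Suc m) * t ^ m) = K * ((K * t)^m / fact m * c)"
 by (simp add: power_mult_distrib fact_Suc del: of_nat_Suc)
 ultimately show ?thesis
 unfolding p has_real_derivative_iff_has_vector_derivative[symmetric] by (simp only:)
 qed
 show "norm (f' t) <= K * ((K * t)^m / fact m * c)" if "0 < t" "t < x" for t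
 by (rule f(3)) (use that in auto)
 qed
 then show ?thesis using f(2) by simp
 qed
 show ?thesis
 proof (cases "0 <= x")
 case True
 have "norm (B t (u t)) <= K * ((K * t)^m / fact m * c)" if "0 <= t" "t <= x" for t
 using order_trans[OF B[of t "u t"] mult_left_mono[OF u[of t] K]] that x by (simp only: abs_of_nonneg)
 have "norm (w x) <= (K * x)^(Suc m) / fact (Suc m) * c"
 by (rule key[OF w _ True]) (use \<open>!!t. 0 <= t ==> t <= x ==> norm (B t (u t)) <= K * ((K * t)^m / fact m * c)\<close> in blast)
 then show ?thesis by (simp only: abs_of_nonneg[OF True])
 next
 case False
 have d: "((%t. w (- t)) hvd - B (-t) (u (-t))) (at t)" for t
 by (rule has_vector_derivative_reflect[OF w(1)])
 have "norm (- B (-t) (u (-t))) <= K * ((K * t)^m / fact m * c)" if "0 <= t" "t <= - x" for t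
 proof -
 have "\<bar>-t\<bar> <= N" and a: "\<bar>-t\<bar> = t" using that x by auto
 from order_trans[OF B[OF this(1)] mult_left_mono[OF u[OF this(1)] K]]
 show ?thesis unfolding a norm_minus_cancel .
 qed
 have "norm (w (- (- x))) <= (K * (- x))^(Suc m) / fact (Suc m) * c"
 by (rule key[OF d]) (use False w(2) \<open>!!t. 0 <= t ==> t <= - x ==> norm (- B (-t) (u (-t))) <= K * ((K * t)^m / fact m * c)\<close> in auto)
 moreover have "\<bar>x\<bar> = - x" using False by simp
 ultimately show ?thesis by (metis minus_minus)
 qed
qed

text \<open>The Picard increments are bounded by the terms of an exponential series, so their sum
  converges uniformly on every bounded interval, and so do the derivatives of the partial sums. The
  coefficients are a family of linear maps, not a matrix, so that the result applies directly to
  pairs of complex vectors.\<close>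

theorem linear_ode_exists:
 fixes B :: "real => 'a::euclidean_space => 'a"
 assumes lin: "!!t. linear (B t)" and cont: "!!xq. continuous_on UNIV (%t. B t xq)"
 shows "EX xq. xq 0 = xq0 & (ALL t. (xq hvd B t (xq t)) (at t))"
proof -
 \<comment> \<open>The antiderivative vanishes at 0, so every increment after the first leaves the
   initial value unchanged.\<close>
 define anti where "anti f = (SOME F. F 0 = 0 & (ALL x. (F hvd f x) (at x)))"
 for f :: "real => 'a"
 have anti: "anti f 0 = 0" "(anti f hvd f x) (at x)"
 if "continuous_on UNIV f" for f x
 using someI_ex[OF antiderivative_on_real[OF that]] unfolding anti_def by auto
 define u where "u = rec_nat (%_. xq0) (%m v. anti (%t. B t (v t)))"
 have u0: "u 0 = (%_. xq0)" and uS: "u (Suc m) = anti (%t. B t (u m t))" for m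
 by (simp_all add: u_def)
 have cu: "continuous_on UNIV (u m)" for m
 proof (induction m)
 case 0 then show ?case by (simp add: u0)
 next
 case (Suc m)
 have "continuous_on UNIV (%t. B t (u m t))"
 by (rule continuous_linear_family_apply[OF lin cont Suc])
 then show ?case unfolding uS
 using anti(2) by (meson continuous_at_imp_continuous_on has_vector_derivative_continuous)
 qed
 have cBu: "continuous_on UNIV (%t. B t (u m t))" for m
 by (rule continuous_linear_family_apply[OF lin cont cu])
 have du: "(u (Suc m) hvd B t (u m t)) (at t)" and uS0: "u (Suc m) 0 = 0" for m t
 unfolding uS using anti[OF cBu] by auto
 define xq where "xq t = (\<Sum>m. u m t)" for t
 define S where "S n t = (\<Sum>m<n. u m t)" for n t
 \<comment> \<open>The derivative of a partial sum is the field applied to the preceding one;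
   because of this shift the limit theorem for derivatives is applied to
   \<open>S (Suc n)\<close>.\<close>
 have dS: "(S (Suc n) hvd B t (S n t)) (at t)" for n t
 proof (induction n)
 case 0 show ?case by (simp add: S_def u0 linear_0[OF lin] fun_eq_iff)
 next
 case (Suc n)
 have "((%t. S (Suc n) t + u (Suc n) t) hvd (B t (S n t) + B t (u n t))) (at t)"
 by (intro derivative_intros Suc du)
 then show ?case by (simp add: S_def linear_add[OF lin, symmetric])
 qed
 have main: "(xq hvd B t (xq t)) (at t) & (%n. S n t) \<longlonglongrightarrow> xq t"
 if t: "t : {-N<..<N}" for t N
 proof -
 obtain K where K: "0 <= K" "!!s w. \<bar>s\<bar> <= N ==> norm (B s w) <= K * norm w"
 proof -
 obtain K where "0 <= K" "ALL t:{-N..N}. ALL w. norm (B t w) <= K * norm w"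
 using linear_family_local_bound[OF lin cont, of N] by blast
 then show ?thesis by (intro that[of K]) (simp_all add: abs_le_iff)
 qed
 have ub: "\<bar>s\<bar> <= N ==> norm (u m s) <= (K * \<bar>s\<bar>)^m / fact m * norm xq0" for m s
 proof (induction m arbitrary: s)
 case 0 then show ?case by (simp add: u0)
 next
 case (Suc m)
 show ?case by (rule picard_iterate_step[OF du uS0 K(2) K(1) Suc.IH Suc.prems]) auto
 qed
 have ub': "norm (u m s) <= (K * N)^m / fact m * norm xq0" if "s : {-N<..<N}" for m s
 proof -
 have "(K * \<bar>s\<bar>)^m / fact m * norm xq0 <= (K * N)^m / fact m * norm xq0"
 using that K(1) by (intro mult_right_mono divide_right_mono power_mono mult_left_mono) auto
 then show ?thesis by (intro order_trans[OF ub[of s m]]) (use that in auto)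
 qed
 have sm: "summable (%m. (K * N)^m / fact m * norm xq0)"
 using summable_exp_generic[of "K*N"] by (intro summable_mult2) (simp add: scaleR_conv_of_real divide_inverse mult.commute)
 have ul: "uniform_limit {-N<..<N} S xq sequentially"
 unfolding S_def[abs_def] xq_def[abs_def]
 by (rule Weierstrass_m_test[OF ub' sm])
 have pl: "(%n. S n s) \<longlonglongrightarrow> xq s" if "s : {-N<..<N}" for s
 using tendsto_uniform_limitI[OF ul that] .
 have "EX g. ALL x:{-N<..<N}. (%n. S (Suc n) x) \<longlonglongrightarrow> g x & (g has_derivative (%h. h *R B x (xq x))) (at x within {-N<..<N})"
 proof (rule has_derivative_sequence[where f' = "%n x h. h *R B x (S n x)"])
 show "convex {-N<..<N}" by simp
 show "(S (Suc n) has_derivative (%h. h *R B x (S n x))) (at x within {-N<..<N})" for n x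
 using dS[of n x] has_derivative_at_withinI unfolding has_vector_derivative_def by blast
 show "t : {-N<..<N}" by (rule t)
 show "(%n. S (Suc n) t) \<longlonglongrightarrow> xq t" using pl[OF t] LIMSEQ_Suc by blast
 fix e :: real assume e: "e > 0"
 have "\<forall>\<^sub>F n in sequentially. ALL x:{-N<..<N}. dist (S n x) (xq x) < e / (K + 1)"
 using ul e K(1) by (intro uniform_limitD) auto
 then show "\<forall>\<^sub>F n in sequentially. ALL x:{-N<..<N}. ALL h. norm (h *R B x (S n x) - h *R B x (xq x)) <= e * norm h"
 proof (rule eventually_mono, safe)
 fix n x and h :: real assume a: "ALL x:{-N<..<N}. dist (S n x) (xq x) < e / (K + 1)" and x: "x : {-N<..<N}"
 have "norm (B x (S n x - xq x)) <= K * norm (S n x - xq x)" using x K(2)[of x] by auto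
 also have "... <= K * (e / (K+1))" using a x K(1) by (intro mult_left_mono) (auto simp: dist_norm less_imp_le)
 also have "... <= e" using K(1) e by (simp add: field_simps)
 finally have "norm (B x (S n x) - B x (xq x)) <= e" by (simp add: linear_diff[OF lin])
 then have "\<bar>h\<bar> * norm (B x (S n x) - B x (xq x)) <= \<bar>h\<bar> * e" by (intro mult_left_mono) auto
 then show "norm (h *R B x (S n x) - h *R B x (xq x)) <= e * norm h"
 by (simp add: scaleR_diff_right[symmetric] mult.commute)
 qed
 qed
 then obtain g where g: "!!x. x\<in>{-N<..<N} ==> (%n. S (Suc n) x) \<longlonglongrightarrow> g x"
 "!!x. x\<in>{-N<..<N} ==> (g has_derivative (%h. h *R B x (xq x))) (at x within {-N<..<N})" by blast
 have geq: "g x = xq x" if "x : {-N<..<N}" for x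
 using g(1)[OF that] LIMSEQ_Suc[OF pl[OF that]] LIMSEQ_unique by blast
 have "(g hvd B t (xq t)) (at t)"
 using g(2)[OF t] at_within_open[OF t] by (simp add: has_vector_derivative_def)
 then have "(xq hvd B t (xq t)) (at t)"
 by (rule has_vector_derivative_transform_within_open[OF _ _ t]) (auto simp: geq)
 then show ?thesis using pl[OF t] by blast
 qed
 have "(xq hvd B t (xq t)) (at t)" for t
 using main[of t "\<bar>t\<bar>+1"] by (simp add: abs_if split: if_splits)
 moreover have "xq 0 = xq0"
 proof -
 have "S (Suc n) 0 = xq0" for n by (induction n) (simp_all add: S_def u0 uS0)
 then show ?thesis using LIMSEQ_Suc[of "%n. S n 0" "xq 0"] main[of 0 1] by (simp add: LIMSEQ_const_iff)
 qed
 ultimately show ?thesis by blast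
qed

text \<open>\<open>exp (- (2*K*t)) * \<bar>xq\<bar>^2\<close> is nonincreasing and starts at 0.
  Besides uniqueness of solutions this gives propagation of zeros for single components that satisfy
  a closed inequality.\<close>

lemma differential_inequality_zero:
 fixes xq :: "real => 'a::real_inner"
 assumes d: "!!t. a <= t ==> t <= b ==> (xq hvd xq' t) (at t)"
 and bd: "!!t. a <= t ==> t <= b ==> norm (xq' t) <= K * norm (xq t)"
 and z: "xq a = 0" and ab: "a <= b"
 shows "xq b = 0"
proof -
 let ?g = "%t. exp (- (2*K*t)) * (xq t #. xq t)"
 have "?g b <= ?g a"
 proof (rule DERIV_nonpos_imp_nonincreasing[OF ab])
 fix t assume t: "a <= t" "t <= b"
 have e: "((%t. exp (- (2*K*t))) has_real_derivative - 2 * K * exp (- (2*K*t))) (at t)"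
 by (auto intro!: derivative_eq_intros)
 have "(?g has_real_derivative (exp (- (2*K*t)) * (2 * (xq t #. xq' t)) - 2*K * exp (- (2*K*t)) * (xq t #. xq t))) (at t)"
 using DERIV_mult[OF e has_real_derivative_inner[OF d[OF t] d[OF t]]]
 by (simp add: algebra_simps inner_commute)
 moreover have "xq t #. xq' t <= K * (xq t #. xq t)"
 using norm_cauchy_schwarz[of "xq t" "xq' t"] mult_left_mono[OF bd[OF t], of "norm (xq t)"]
 by (simp add: power2_norm_eq_inner[symmetric] power2_eq_square algebra_simps)
 then have "exp (- (2*K*t)) * (2 * (xq t #. xq' t)) - 2*K * exp (- (2*K*t)) * (xq t #. xq t) <= 0"
 by (simp add: algebra_simps)
 ultimately show "EX y. (?g has_real_derivative y) (at t) & y <= 0" by blast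
 qed
 then have "xq b #. xq b <= 0" using z by (simp add: mult_le_0_iff)
 then show ?thesis by (metis inner_ge_zero inner_eq_zero_iff order_antisym)
qed

section \<open>Gronwall estimates and indefinite forms along linear flows\<close>

lemma gronwall_upper:
 fixes y :: "real => real"
 assumes d: "!!t. 0 <= t ==> (y has_real_derivative y' t) (at t)"
 and le: "!!t. 0 <= t ==> y' t <= - al * y t + be" and al: "0 < al" and t: "0 <= t"
 shows "y t - be / al <= (y 0 - be / al) * exp (- al * t)"
proof -
 let ?g = "%t. exp (al * t) * (y t - be / al)"
 have "?g t <= ?g 0"
 proof (rule DERIV_nonpos_imp_nonincreasing[OF t])
 fix s assume s: "0 <= s" "s <= t"
 have e: "((%t. exp (al * t)) has_real_derivative al * exp (al * s)) (at s)"
 by (auto intro!: derivative_eq_intros)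
 have "((%t. y t - be / al) has_real_derivative y' s) (at s)"
 using d[OF s(1)] by (auto intro!: derivative_eq_intros)
 from DERIV_mult[OF e this]
 have "(?g has_real_derivative exp (al * s) * (al * y s - be + y' s)) (at s)"
 using al by (simp add: algebra_simps)
 moreover have "exp (al * s) * (al * y s - be + y' s) <= 0"
 using le[OF s(1)] by (intro mult_nonneg_nonpos) auto
 ultimately show "EX z. (?g has_real_derivative z) (at s) & z <= 0" by blast
 qed
 then have "exp (- al * t) * ?g t <= exp (- al * t) * (y 0 - be / al)"
 by (intro mult_left_mono) auto
 moreover have "exp (- al * t) * exp (al * t) = 1" by (simp add: exp_minus)
 then have "exp (- al * t) * ?g t = y t - be / al"
 by (simp only: mult.assoc[symmetric] mult_1_left)
 ultimately show ?thesis by (simp only: mult.commute)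
qed

text \<open>An excess over \<open>be / al\<close> at one time grows at least like
  \<open>exp (al * (s - t))\<close> from then on, which no bounded function can do. The bound
  \<open>S\<close> is only qualitative and does not enter the conclusion.\<close>

lemma gronwall_bounded:
 fixes y :: "real => real"
 assumes d: "!!t. 0 <= t ==> (y has_real_derivative y' t) (at t)"
 and ge: "!!t. 0 <= t ==> y' t >= al * y t - be" and al: "0 < al"
 and bd: "!!t. 0 <= t ==> y t <= S" and t: "0 <= t"
 shows "y t <= be / al"
proof (rule ccontr)
 assume "\<not> ?thesis"
 then have pos: "0 < y t - be / al" by simp
 have grow: "exp (al * (s - t)) * (y t - be / al) <= y s - be / al" if s: "t <= s" for s
 proof -
 let ?g = "%t. exp (- al * t) * (y t - be / al)"
 have "?g t <= ?g s"
 proof (rule DERIV_nonneg_imp_nondecreasing[OF s])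
 fix r assume r: "t <= r" "r <= s"
 then have r0: "0 <= r" using t by simp
 have e: "((%t. exp (- al * t)) has_real_derivative - al * exp (- al * r)) (at r)"
 by (auto intro!: derivative_eq_intros)
 have "((%t. y t - be / al) has_real_derivative y' r) (at r)"
 using d[OF r0] by (auto intro!: derivative_eq_intros)
 from DERIV_mult[OF e this]
 have "(?g has_real_derivative exp (- al * r) * (y' r - (al * y r - be))) (at r)"
 using al by (simp add: algebra_simps)
 moreover have "exp (- al * r) * (y' r - (al * y r - be)) >= 0"
 using ge[OF r0] by (intro mult_nonneg_nonneg) auto
 ultimately show "EX z. (?g has_real_derivative z) (at r) & z >= 0" by blast
 qed
 then have "exp (al * s) * ?g t <= exp (al * s) * ?g s" by (intro mult_left_mono) auto
 moreover have "exp (al * s) * ?g s = y s - be / al"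
 by (simp add: exp_minus)
 moreover have "exp (al * (s - t)) = exp (al * s) * exp (- al * t)"
 by (simp add: exp_add[symmetric] right_diff_distrib)
 ultimately show ?thesis by (simp only: mult.assoc)
 qed
 \<comment> \<open>At this time the linear lower bound \<open>1 + x <= exp x\<close> for the growth
   already pushes the excess beyond \<open>S - be / al\<close>.\<close>
 define s where "s = t + (\<bar>S - be / al\<bar> + 1) / ((y t - be / al) * al)"
 have s: "t <= s" using pos al by (simp add: s_def)
 have "(1 + al * (s - t)) * (y t - be / al) <= exp (al * (s - t)) * (y t - be / al)"
 using pos by (intro mult_right_mono exp_ge_add_one_self) auto
 also have "... <= S - be / al" using grow[OF s] bd[of s] s t by linarith
 finally have "al * (s - t) * (y t - be / al) + (y t - be / al) <= S - be / al" by (simp add: algebra_simps)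
 moreover have "al * (s - t) * (y t - be / al) = \<bar>S - be / al\<bar> + 1"
 using pos al unfolding s_def by (simp add: field_simps)
 ultimately have "\<bar>S - be / al\<bar> + 1 + (y t - be / al) <= S - be / al" by simp
 then show False using pos abs_ge_self[of "S - be / al"] by linarith
qed

text \<open>\<open>x #. L t x\<close> is a quadratic form that is positive definite on the first and
  negative definite on the second component, uniformly for \<open>t >= 0\<close>, with mixed terms
  absorbed into the constants. \<open>derivL\<close> packages the symmetry of \<open>L t\<close> and
  its derivative in t: \<open>dL t x\<close> stands for the form of the derivative of
  \<open>L\<close>.\<close>

locale indefinite_form =
 fixes L :: "real => ('e::euclidean_space) \<times> 'e => 'e \<times> 'e" and dL :: "real => 'e \<times> 'e => real" and c C :: real
 assumes linL: "linear (L t)"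
 and derivL: "0 <= t ==> (xq hvd xq') (at t) ==>
 ((%t. xq t #. L t (xq t)) has_real_derivative dL t (xq t) + 2 * (xq' #. L t (xq t))) (at t)"
 and normL: "0 <= t ==> norm (L t x) <= C * norm x"
 and lower: "0 <= t ==> c * (norm a)^2 - C * (norm b)^2 <= (a, b) #. L t (a, b)"
 and upper: "0 <= t ==> (a, b) #. L t (a, b) <= C * (norm a)^2 - c * (norm b)^2"
 and c: "0 < c" and C: "0 < C"
begin

lemma lower': "0 <= t ==> c * (norm (fst x))^2 - C * (norm (snd x))^2 <= x #. L t x"
 and upper': "0 <= t ==> x #. L t x <= C * (norm (fst x))^2 - c * (norm (snd x))^2"
 using lower[of t "fst x" "snd x"] upper[of t "fst x" "snd x"] by simp_all

text \<open>The expression bounded from below is the derivative of the form along solutions of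
  \<open>x' = B t x\<close>; a generator is strict if the form grows at a rate proportional to the
  full norm. This is the substitute for hyperbolicity, and it survives small perturbations.\<close>

definition strict :: "(real => 'e \<times> 'e => 'e \<times> 'e) => real => real => bool" where
 "strict B e K \<longleftrightarrow> 0 < e & 0 <= K & (ALL t>=0. ALL x. e * (norm x)^2 <= dL t x + 2 * (B t x #. L t x)
 & norm (B t x) <= K * norm x)"

lemma strictD:
 assumes "strict B e K"
 shows "0 < e" "0 <= K" "0 <= t ==> e * (norm x)^2 <= dL t x + 2 * (B t x #. L t x)"
 "0 <= t ==> norm (B t x) <= K * norm x"
 using assms unfolding strict_def by blast+

text \<open>With \<open>M = (2 * K + 2) / e\<close> the derivative of \<open>M\<close> times the
  form exceeds \<open>(2 * K + 2) * \<bar>x\<bar>^2\<close>, while that of the squared norm is at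
  most \<open>2 * K * \<bar>x\<bar>^2\<close>. The number \<open>M * C + 1\<close> then bounds
  \<open>\<bar>x\<bar>^2 + M * q\<close> and \<open>\<bar>x\<bar>^2 - M * q\<close> in terms of
  \<open>\<bar>x\<bar>^2\<close>.\<close>

definition rate :: "real => real => real" where
 "rate e K = (2 * K + 2) / e * C + 1"

lemma rate_ge_1: "0 < e ==> 0 <= K ==> 1 <= rate e K"
 using C by (simp add: rate_def)

text \<open>Both \<open>M q + |xq|\<^sup>2\<close> (which a bounded curve keeps small, as it would grow
 exponentially otherwise) and \<open>- M q + |xq|^2\<close> (which decays) satisfy scalar differential
 inequalities; adding the two resulting bounds controls the whole curve.\<close>

lemma energy_inequalities:
 assumes B: "strict B e K"
 and d: "!!t. 0 <= t ==> (xq hvd xq' t) (at t)"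
 and H: "!!t. 0 <= t ==> norm (xq' t - B t (xq t)) <= H" and t: "0 <= t"
 defines "M \<equiv> (2 * K + 2) / e" and "N \<equiv> rate e K"
 defines "y1 \<equiv> %t. M * (xq t #. L t (xq t)) + xq t #. xq t" and "y2 \<equiv> %t. xq t #. xq t - M * (xq t #. L t (xq t))"
 shows "EX d1. (y1 has_real_derivative d1) (at t) & d1 >= (1 / N) * y1 t - N^2 * H^2"
 and "EX d2. (y2 has_real_derivative d2) (at t) & d2 <= - (1 / N) * y2 t + N^2 * H^2"
 and "\<bar>xq t #. L t (xq t)\<bar> <= C * (xq t #. xq t)"
proof -
 have e: "0 < e" and K: "0 <= K"
 and st: "e * (norm x)^2 <= dL t x + 2 * (B t x #. L t x)" and nB: "norm (B t x) <= K * norm x" for x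
 using strictD[OF B] t by blast+
 define x where "x = xq t"
 define h where "h = xq' t - B t x"
 have hH: "norm h <= H" unfolding h_def x_def by (rule H[OF t])
 have H0: "0 <= H" using hH norm_ge_zero order_trans by blast
 have M: "0 < M" "M * e = 2 * K + 2" using e K by (auto simp: M_def)
 have N: "N = M * C + 1" "1 <= N" using rate_ge_1[OF e K] by (simp_all add: N_def M_def rate_def)
 define q where "q = x #. L t x"
 have q: "\<bar>q\<bar> <= C * (norm x)^2"
 using Cauchy_Schwarz_ineq2[of x "L t x"] mult_left_mono[OF normL[OF t, of x], of "norm x"]
 by (simp add: q_def power2_eq_square algebra_simps)
 then show "\<bar>xq t #. L t (xq t)\<bar> <= C * (xq t #. xq t)"
 by (simp add: q_def x_def power2_norm_eq_inner)
 define q' where "q' = dL t x + 2 * (xq' t #. L t x)"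
 have dq: "((%t. xq t #. L t (xq t)) has_real_derivative q') (at t)"
 unfolding q'_def x_def by (rule derivL[OF t d[OF t]])
 have dn: "((%t. xq t #. xq t) has_real_derivative 2 * (x #. xq' t)) (at t)"
 using has_real_derivative_inner[OF d[OF t] d[OF t]] by (simp add: x_def inner_commute)
 have hL: "\<bar>h #. L t x\<bar> <= H * (C * norm x)"
 using Cauchy_Schwarz_ineq2[of h "L t x"] mult_mono[OF hH normL[OF t, of x] H0] by simp
 have xi': "xq' t = B t x + h" by (simp add: h_def)
 have q': "q' >= e * (norm x)^2 - 2 * H * C * norm x"
 unfolding q'_def xi' using st[of x] hL by (simp add: inner_add_left algebra_simps abs_le_iff)
 have "\<bar>x #. xq' t\<bar> <= norm x * (K * norm x + H)"
 using Cauchy_Schwarz_ineq2[of x "xq' t"] norm_triangle_ineq[of "B t x" h] nB[of x] hH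
 mult_left_mono[of "norm (xq' t)" "K * norm x + H" "norm x"] by (auto simp: xi')
 then have n': "\<bar>2 * (x #. xq' t)\<bar> <= 2 * K * (norm x)^2 + 2 * H * norm x"
 by (simp add: power2_eq_square algebra_simps)
 have Mq': "M * q' >= (2 * K + 2) * (norm x)^2 - 2 * (M * C) * H * norm x"
 proof -
 have "M * (e * (norm x)^2) = (2 * K + 2) * (norm x)^2" unfolding M(2)[symmetric] by (simp only: mult.assoc)
 moreover have "M * (e * (norm x)^2 - 2 * H * C * norm x) = M * (e * (norm x)^2) - 2 * (M * C) * H * norm x"
 by (simp add: algebra_simps)
 ultimately show ?thesis using mult_left_mono[OF q' less_imp_le[OF M(1)]] by linarith
 qed
 have sq: "2 * N * H * norm x <= (norm x)^2 + N^2 * H^2"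
 using sum_squares_bound[of "norm x" "N * H"] by (simp add: algebra_simps power_mult_distrib)
 have dominate: "M * q' - \<bar>2 * (x #. xq' t)\<bar> >= (norm x)^2 - N^2 * H^2"
 using Mq' n' sq N(1) by (simp add: algebra_simps)
 have Mq: "\<bar>M * q\<bar> <= (M * C) * (norm x)^2"
 using mult_left_mono[OF q less_imp_le[OF M(1)]] M(1) by (simp add: abs_mult algebra_simps)
 have xx: "x #. x = (norm x)^2" by (simp add: power2_norm_eq_inner)
 have y1: "y1 t <= N * (norm x)^2" and y2: "y2 t <= N * (norm x)^2"
 using Mq unfolding y1_def y2_def x_def[symmetric] q_def[symmetric] xx N(1) by (auto simp: algebra_simps abs_le_iff)
 have y1': "(1 / N) * y1 t <= (norm x)^2" and y2': "(1 / N) * y2 t <= (norm x)^2"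
 using y1 y2 N(2) by (simp_all add: field_simps)
 have "(y1 has_real_derivative M * q' + 2 * (x #. xq' t)) (at t)"
 unfolding y1_def by (intro DERIV_add DERIV_cmult dq dn)
 moreover have "M * q' + 2 * (x #. xq' t) >= (1 / N) * y1 t - N^2 * H^2"
 using dominate y1' by linarith
 ultimately show "EX d1. (y1 has_real_derivative d1) (at t) & d1 >= (1 / N) * y1 t - N^2 * H^2" by blast
 have "(y2 has_real_derivative 2 * (x #. xq' t) - M * q') (at t)"
 unfolding y2_def by (intro DERIV_diff DERIV_cmult dq dn)
 moreover have "2 * (x #. xq' t) - M * q' <= - (1 / N) * y2 t + N^2 * H^2"
 using dominate y2' by linarith
 ultimately show "EX d2. (y2 has_real_derivative d2) (at t) & d2 <= - (1 / N) * y2 t + N^2 * H^2" by blast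
qed

text \<open>\<open>2 * \<bar>xq\<bar>^2 = y1 + y2\<close>. Boundedness caps \<open>y1\<close> at the
  level of the forcing, while \<open>y2\<close> relaxes from its initial value, which exceeds
  \<open>y1 0\<close> only by a multiple of the squared second component because the form is
  nonnegative apart from it. The a priori bound \<open>S\<close> disappears from the result, so this
  one estimate gives uniqueness, linearity and parameter dependence of bounded solutions.\<close>

lemma bounded_curve_estimate:
 assumes B: "strict B e K"
 and d: "!!t. 0 <= t ==> (xq hvd xq' t) (at t)"
 and H: "!!t. 0 <= t ==> norm (xq' t - B t (xq t)) <= H"
 and S: "!!t. 0 <= t ==> norm (xq t) <= S" and t: "0 <= t"
 shows "norm (xq t) <= (rate e K)^2 * (H + norm (snd (xq 0)))"
proof -
 define M where "M = (2 * K + 2) / e"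
 define N where "N = rate e K"
 define b where "b = norm (snd (xq 0))"
 have e: "0 < e" and K: "0 <= K" using strictD[OF B] by blast+
 have M: "0 < M" using e K by (auto simp: M_def)
 have N: "N = M * C + 1" "1 <= N" using rate_ge_1[OF e K] by (simp_all add: N_def M_def rate_def)
 have H0: "0 <= H" using H[of 0] norm_ge_zero order_trans by blast
 define y1 where "y1 t = M * (xq t #. L t (xq t)) + xq t #. xq t" for t
 define y2 where "y2 t = xq t #. xq t - M * (xq t #. L t (xq t))" for t
 note en = energy_inequalities[OF B d H, folded M_def N_def, folded y1_def y2_def]
 from en(1) have "ALL t. EX d1. 0 <= t --> (y1 has_real_derivative d1) (at t) & d1 >= (1 / N) * y1 t - N^2 * H^2" by metis
 from choice[OF this] obtain y1' where y1': "!!t. 0 <= t ==> (y1 has_real_derivative y1' t) (at t)"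
 "!!t. 0 <= t ==> y1' t >= (1 / N) * y1 t - N^2 * H^2" by blast
 from en(2) have "ALL t. EX d2. 0 <= t --> (y2 has_real_derivative d2) (at t) & d2 <= - (1 / N) * y2 t + N^2 * H^2" by metis
 from choice[OF this] obtain y2' where y2': "!!t. 0 <= t ==> (y2 has_real_derivative y2' t) (at t)"
 "!!t. 0 <= t ==> y2' t <= - (1 / N) * y2 t + N^2 * H^2" by blast
 have N0: "0 < 1 / N" using N by simp
 have simpN: "N^2 * H^2 / (1 / N) = N ^ 3 * H^2" by (simp add: power2_eq_square power3_eq_cube)
 have y1b: "y1 t <= N * S^2" if t: "0 <= t" for t
 proof -
 have "M * (xq t #. L t (xq t)) <= M * (C * (xq t #. xq t))"
 using en(3)[OF _ _ t] M by (intro mult_left_mono) auto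
 then have "y1 t <= N * (xq t #. xq t)" unfolding y1_def N(1) by (simp add: algebra_simps)
 also have "... <= N * S^2" using S[OF t] N(2) by (intro mult_left_mono) (auto simp: power2_norm_eq_inner[symmetric] power_mono)
 finally show ?thesis .
 qed
 have A1: "y1 t <= N ^ 3 * H^2" if "0 <= t" for t
 using gronwall_bounded[OF y1'(1) y1'(2) N0 y1b that] unfolding simpN .
 have "0 <= c * (norm (fst (xq 0)))^2" using c by simp
 then have "C * b^2 >= - (xq 0 #. L 0 (xq 0))"
 using lower'[of 0 "xq 0"] by (simp add: b_def)
 from mult_left_mono[OF this less_imp_le[OF M]]
 have "y2 0 <= y1 0 + 2 * (M * C) * b^2" unfolding y1_def y2_def by simp
 also have "... <= N ^ 3 * H^2 + 2 * N * b^2" proof -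
 have "M * C * b^2 <= N * b^2" using N(1) by (intro mult_right_mono) auto
 then show ?thesis using A1[of 0] by simp
 qed
 finally have y20: "y2 0 <= N ^ 3 * H^2 + 2 * N * b^2" .
 have "y2 t - N ^ 3 * H^2 <= (y2 0 - N ^ 3 * H^2) * exp (- (1 / N) * t)"
 using gronwall_upper[OF y2'(1) y2'(2) N0 t] unfolding simpN .
 also have "... <= (2 * N * b^2) * exp (- (1 / N) * t)" using y20 by (intro mult_right_mono) auto
 also have "... <= (2 * N * b^2) * 1" using N t by (intro mult_left_mono) auto
 finally have A2: "y2 t <= N ^ 3 * H^2 + 2 * N * b^2" by simp
 have "2 * (norm (xq t))^2 = y1 t + y2 t" by (simp add: y1_def y2_def power2_norm_eq_inner)
 also have "... <= 2 * (N ^ 3 * H^2 + N * b^2)" using A1[OF t] A2 by simp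
 also have "... <= 2 * (N ^ 4 * H^2 + N ^ 4 * b^2)"
 using power_increasing[of 3 4 N] power_increasing[of 1 4 N] N(2)
 by (intro mult_left_mono add_mono mult_right_mono) auto
 also have "... <= 2 * (N^2 * (H + b))^2"
 using H0 N(2) by (simp add: power_mult_distrib power2_sum b_def algebra_simps flip: power_mult)
 finally have "(norm (xq t))^2 <= (N^2 * (H + b))^2" by simp
 then show ?thesis unfolding N_def[symmetric] b_def[symmetric]
 by (rule power2_le_imp_le) (use H0 in \<open>simp add: b_def\<close>)
qed

text \<open>While the form \<open>q\<close> is nonpositive,
  \<open>y2 = \<bar>xq\<bar>^2 - M * q\<close> dominates the squared norm, and without forcing its
  differential inequality is homogeneous, hence gives an explicit exponential rate.\<close>

lemma nonpositive_curve_decay: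
 assumes B: "strict B e K"
 and d: "!!t. 0 <= t ==> (xq hvd B t (xq t)) (at t)"
 and q: "!!t. 0 <= t ==> xq t #. L t (xq t) <= 0" and t: "0 <= t"
 shows "(norm (xq t))^2 <= rate e K * (norm (xq 0))^2 * exp (- (1 / rate e K) * t)"
proof -
 define M where "M = (2 * K + 2) / e"
 define N where "N = rate e K"
 have e: "0 < e" and K: "0 <= K" using strictD[OF B] by blast+
 have M: "0 < M" using e K by (auto simp: M_def)
 have N: "N = M * C + 1" "1 <= N" using rate_ge_1[OF e K] by (simp_all add: N_def M_def rate_def)
 define y2 where "y2 t = xq t #. xq t - M * (xq t #. L t (xq t))" for t
 note en = energy_inequalities[OF B d, where H = 0, folded M_def N_def, folded y2_def]
 from en(2) have "ALL t. EX d2. 0 <= t --> (y2 has_real_derivative d2) (at t) & d2 <= - (1 / N) * y2 t + 0"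
 by simp
 from choice[OF this] obtain y2' where y2': "!!t. 0 <= t ==> (y2 has_real_derivative y2' t) (at t)"
 "!!t. 0 <= t ==> y2' t <= - (1 / N) * y2 t + 0" by blast
 have N0: "0 < 1 / N" using N by simp
 have "y2 t <= y2 0 * exp (- (1 / N) * t)"
 using gronwall_upper[OF y2'(1) y2'(2) N0 t] by simp
 also have "y2 0 <= N * (norm (xq 0))^2"
 proof -
 have "- (M * (xq 0 #. L 0 (xq 0))) <= M * (C * (xq 0 #. xq 0))"
 using en(3)[of 0] mult_left_mono[of "- (xq 0 #. L 0 (xq 0))" "C * (xq 0 #. xq 0)" M] M by auto
 then show ?thesis unfolding y2_def N(1) by (simp add: algebra_simps power2_norm_eq_inner)
 qed
 finally have "y2 t <= N * (norm (xq 0))^2 * exp (- (1 / N) * t)" by simp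
 moreover have "(norm (xq t))^2 <= y2 t"
 using mult_nonneg_nonpos[OF less_imp_le[OF M] q[OF t]] by (simp add: y2_def power2_norm_eq_inner)
 ultimately show ?thesis by (simp add: N_def)
qed

lemma form_mono:
 assumes B: "strict B e K"
 and d: "!!t. 0 <= t ==> (xq hvd B t (xq t)) (at t)"
 and st: "0 <= s" "s <= t"
 shows "xq s #. L s (xq s) <= xq t #. L t (xq t)"
proof (rule DERIV_nonneg_imp_nondecreasing[OF st(2)])
 fix r assume r: "s <= r" "r <= t"
 then have r0: "0 <= r" using st by simp
 have "0 <= e * (norm (xq r))^2" using strictD(1)[OF B] by simp
 also have "... <= dL r (xq r) + 2 * (B r (xq r) #. L r (xq r))" by (rule strictD(3)[OF B r0])
 finally show "EX y. ((%t. xq t #. L t (xq t)) has_real_derivative y) (at r) & 0 <= y"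
 using derivL[OF r0 d[OF r0]] by blast
qed

text \<open>Shooting with a receding target: for every n there is an initial value with second
  component \<open>b\<close> whose solution has first component 0 at time n. Its form is nonpositive
  at time n, hence by monotonicity on all of \<open>[0, n]\<close>, and this bounds the initial
  values; a limit point keeps the form nonpositive for all times.\<close>

theorem bounded_solution_exists:
 assumes B: "strict B e K" and lin: "!!t. linear (B t)" and cont: "!!x. continuous_on UNIV (%t. B t x)"
 shows "EX xq. (ALL t. (xq hvd B t (xq t)) (at t)) & snd (xq 0) = b
 & (ALL t>=0. xq t #. L t (xq t) <= 0)"
proof -
 have K: "!!t x. 0 <= t ==> norm (B t x) <= K * norm x" using strictD[OF B] by blast
 have "ALL x. EX xq. xq 0 = x & (ALL t. (xq hvd B t (xq t)) (at t))"
 using linear_ode_exists[OF lin cont] by blast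
 from choice[OF this] obtain Ph where Ph0: "!!x. Ph x 0 = x"
 and Ph: "!!x t. (Ph x hvd B t (Ph x t)) (at t)" by blast
 have uniq: "xq t = 0" if "!!t. (xq hvd B t (xq t)) (at t)" "xq 0 = 0" "0 <= t" for xq t
 by (rule differential_inequality_zero[OF that(1) K that(2,3)])
 have linPh: "linear (%x. Ph x t)" if t: "0 <= t" for t
 proof (rule linearI)
 fix x y
 have d: "((%t. Ph (x + y) t - Ph x t - Ph y t) has_vector_derivative
 B t (Ph (x + y) t - Ph x t - Ph y t)) (at t)" for t
 unfolding linear_diff[OF lin] by (intro derivative_intros Ph)
 have "Ph (x + y) t - Ph x t - Ph y t = 0" by (rule uniq[OF d _ t]) (simp add: Ph0)
 then show "Ph (x + y) t = Ph x t + Ph y t" by (simp add: algebra_simps)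
 next
 fix r x
 have d: "((%t. Ph (r *R x) t - r *R Ph x t) has_vector_derivative
 B t (Ph (r *R x) t - r *R Ph x t)) (at t)" for t
 unfolding linear_diff[OF lin] linear_cmul[OF lin]
 by (intro has_vector_derivative_diff Ph bounded_linear.has_vector_derivative[OF bounded_linear_scaleR_right])
 have "Ph (r *R x) t - r *R Ph x t = 0" by (rule uniq[OF d _ t]) (simp add: Ph0)
 then show "Ph (r *R x) t = r *R Ph x t" by simp
 qed
 have "EX x. snd x = b & fst (Ph x (real n)) = 0" for n
 proof -
 \<comment> \<open>The boundary value problem on \<open>[0, n]\<close> as a linear map of the
   initial value. If it vanishes at x, the form is at least \<open>c * \<bar>fst x\<bar>^2\<close>
   at time 0 and at most 0 at time n, so monotonicity gives injectivity and finite dimension gives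
   surjectivity.\<close>
 let ?La = "%x. (snd x, fst (Ph x (real n)))"
 have linPhi: "linear (%x. Ph x (real n))" by (rule linPh) simp
 have l: "linear ?La"
 by (rule linearI) (simp_all add: linear_add[OF linPhi] linear_cmul[OF linPhi])
 have "inj ?La"
 proof (rule linear_injective_0[OF l, THEN iffD2], safe)
 fix x1 x2 assume z: "(snd (x1, x2), fst (Ph (x1, x2) (real n))) = 0"
 define x where "x = (x1, x2)"
 have z1: "snd x = 0" "fst (Ph x (real n)) = 0"
 using z unfolding x_def[symmetric] by (auto simp only: zero_prod_def prod.inject)
 have "c * (norm (fst x))^2 <= x #. L 0 x"
 using lower'[of 0 x] z1(1) by simp
 also have "... <= Ph x (real n) #. L (real n) (Ph x (real n))"
 using form_mono[OF B Ph, of 0 "real n" x] by (simp add: Ph0)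
 also have "... <= C * (norm (fst (Ph x (real n))))^2 - c * (norm (snd (Ph x (real n))))^2"
 by (rule upper') simp
 also have "... <= 0" using c z1 by simp
 finally have "fst x = 0" using c by (simp add: mult_le_0_iff)
 then show "(x1, x2) = 0" using z1 by (simp add: x_def zero_prod_def)
 qed
 then have "surj ?La" by (intro linear_injective_imp_surjective[OF l]) simp_all
 from surjD[OF this, of "(b, 0)"] obtain x where "(b, 0) = ?La x" by (rule exE)
 then have "snd x = b & fst (Ph x (real n)) = 0" by simp
 then show ?thesis by (rule exI)
 qed
 then have "ALL n. EX x. snd x = b & fst (Ph x (real n)) = 0" by (rule allI)
 from choice[OF this] obtain X where X: "!!n. snd (X n) = b" "!!n. fst (Ph (X n) (real n)) = 0" by blast
 have qX: "Ph (X n) t #. L t (Ph (X n) t) <= 0" if "0 <= t" "t <= real n" for n t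
 proof -
 have "Ph (X n) t #. L t (Ph (X n) t) <= Ph (X n) (real n) #. L (real n) (Ph (X n) (real n))"
 by (rule form_mono[OF B Ph that])
 also have "... <= 0"
 using upper'[of "real n" "Ph (X n) (real n)"] X(2)[of n]
 mult_nonneg_nonneg[OF less_imp_le[OF c], of "(norm (snd (Ph (X n) (real n))))^2"] by simp
 finally show ?thesis .
 qed
 have "bounded (range X)"
 proof -
 have "norm (X n) <= sqrt (C / c * (norm b)^2) + norm b" for n
 proof -
 have "c * (norm (fst (X n)))^2 <= C * (norm b)^2"
 using qX[of 0 n] lower'[of 0 "X n"] X(1)[of n] by (simp add: Ph0)
 then have "(norm (fst (X n)))^2 <= C / c * (norm b)^2" using c by (simp add: field_simps)
 then have "norm (fst (X n)) <= sqrt (C / c * (norm b)^2)" by (rule real_le_rsqrt)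
 moreover have "norm (X n) <= norm (fst (X n)) + norm (snd (X n))"
 by (rule norm_Pair_le[of "fst (X n)" "snd (X n)", unfolded prod.collapse])
 moreover have "norm (snd (X n)) = norm b" by (simp only: X(1))
 ultimately show ?thesis by linarith
 qed
 then show ?thesis unfolding bounded_iff by (intro exI[of _ "sqrt (C / c * (norm b)^2) + norm b"]) (simp only: ball_simps, simp)
 qed
 from bounded_imp_convergent_subsequence[OF this] obtain x r where r: "strict_mono (r :: nat => nat)" and x: "(X \<circ> r) \<longlonglongrightarrow> x"
 by blast
 have "snd x = b"
 proof -
 have "(%n. snd ((X \<circ> r) n)) \<longlonglongrightarrow> snd x" by (rule tendsto_snd[OF x])
 then show ?thesis by (simp add: X(1) LIMSEQ_const_iff)
 qed
 moreover have "Ph x t #. L t (Ph x t) <= 0" if t: "0 <= t" for t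
 proof -
 have 1: "(%n. Ph (X (r n)) t) \<longlonglongrightarrow> Ph x t"
 using linear_continuous_at[OF linear_conv_bounded_linear[THEN iffD1, OF linPh[OF t]], of x] x
 unfolding o_def by (rule isCont_tendsto_compose)
 have 2: "(%n. L t (Ph (X (r n)) t)) \<longlonglongrightarrow> L t (Ph x t)"
 using linear_continuous_at[OF linear_conv_bounded_linear[THEN iffD1, OF linL[of t]]] 1
 by (rule isCont_tendsto_compose)
 show ?thesis
 proof (rule tendsto_upperbound[OF tendsto_inner[OF 1 2]])
 obtain m :: nat where m: "t <= real m" using real_arch_simple by blast
 have "Ph (X (r n)) t #. L t (Ph (X (r n)) t) <= 0" if "m <= n" for n
 using qX[OF t, of "r n"] m that seq_suble[OF r, of n] by simp
 then show "\<forall>\<^sub>F n in sequentially. Ph (X (r n)) t #. L t (Ph (X (r n)) t) <= 0"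
 unfolding eventually_sequentially by blast
 qed simp
 qed
 ultimately show ?thesis using Ph Ph0 by (intro exI[of _ "Ph x"]) auto
qed

end

section \<open>Holomorphic dependence of decaying graphs on the spectral parameter\<close>

text \<open>The difference quotients satisfy a Cauchy condition with rate
  \<open>norm h + norm k\<close>, so they converge along one sequence and then along every approach
  to \<open>z\<close>. No candidate for the derivative has to be exhibited.\<close>

lemma field_differentiable_from_quotients:
 fixes f :: "complex => complex"
 assumes d: "0 < d" and C: "0 <= C"
 and q: "!!h k. h ~= 0 ==> k ~= 0 ==> norm h < d ==> norm k < d ==>
 norm ((f (z + h) - f z) / h - (f (z + k) - f z) / k) <= C * (norm h + norm k)"
 shows "f field_differentiable at z"
proof -
 define D where "D h = (f (z + h) - f z) / h" for h
 have q': "norm (D h - D k) <= C * (norm h + norm k)" if "h ~= 0" "k ~= 0" "norm h < d" "norm k < d" for h k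
 using q[OF that] unfolding D_def .
 \<comment> \<open>The offset 2 makes all steps strictly shorter than \<open>d\<close>, also for n =
   0, as the Cauchy condition requires.\<close>
 define s where "s n = complex_of_real (d / (real n + 2))" for n
 have s: "s n ~= 0" "norm (s n) < d" "norm (s n) = d / (real n + 2)" for n
 proof -
 have "0 < d / (real n + 2)" "d / (real n + 2) < d" using d by (simp_all add: pos_divide_less_eq add_pos_nonneg)
 then show "s n ~= 0" "norm (s n) < d" "norm (s n) = d / (real n + 2)"
 unfolding s_def norm_of_real of_real_eq_0_iff by linarith+
 qed
 have s0: "(%n. norm (s n)) \<longlonglongrightarrow> 0"
 unfolding s(3)
 by (intro real_tendsto_divide_at_top[OF tendsto_const] filterlim_at_top_mono[OF filterlim_real_sequentially])
 (simp add: eventually_sequentially)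
 have "Cauchy (%n. D (s n))"
 proof (rule CauchyI)
 fix e :: real assume e: "0 < e"
 have "(%n. C * norm (s n)) \<longlonglongrightarrow> C * 0" by (intro tendsto_intros s0)
 then have "\<forall>\<^sub>F n in sequentially. C * norm (s n) < e / 2" using e by (intro order_tendstoD) auto
 then obtain M where M: "!!n. M <= n ==> C * norm (s n) < e / 2" unfolding eventually_sequentially by blast
 have "norm (D (s m) - D (s n)) < e" if "M <= m" "M <= n" for m n
 using q'[OF s(1) s(1) s(2) s(2), of m n] M[OF that(1)] M[OF that(2)] by (simp add: distrib_left)
 then show "EX M. ALL m>=M. ALL n>=M. norm (D (s m) - D (s n)) < e" by blast
 qed
 then obtain l where l: "(%n. D (s n)) \<longlonglongrightarrow> l" using Cauchy_convergent_iff convergentD by blast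
 have b: "norm (D h - l) <= C * norm h" if h: "h ~= 0" "norm h < d" for h
 proof (rule LIMSEQ_le)
 show "(%n. norm (D h - D (s n))) \<longlonglongrightarrow> norm (D h - l)" by (intro tendsto_intros l)
 have "(%n. C * (norm h + norm (s n))) \<longlonglongrightarrow> C * (norm h + 0)" by (intro tendsto_intros s0)
 then show "(%n. C * (norm h + norm (s n))) \<longlonglongrightarrow> C * norm h" by simp
 show "EX N. ALL n>=N. norm (D h - D (s n)) <= C * (norm h + norm (s n))"
 using q'[OF h(1) s(1) h(2) s(2)] by blast
 qed
 have "(%h. D h - l) \<midarrow>0\<rightarrow> 0"
 proof (rule Lim_null_comparison)
 have "\<forall>\<^sub>F h in at (0::complex). h ~= 0 & norm h < d"
 using d by (auto simp: eventually_at dist_norm)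
 then show "\<forall>\<^sub>F h in at 0. norm (D h - l) <= C * norm h"
 by (rule eventually_mono) (use b in auto)
 have "(%h::complex. C * norm h) \<midarrow>0\<rightarrow> C * norm (0::complex)" by (intro tendsto_intros)
 then show "(%h::complex. C * norm h) \<midarrow>0\<rightarrow> 0" by simp
 qed
 then have "D \<midarrow>0\<rightarrow> l" by (simp add: LIM_zero_iff)
 then have "(f has_field_derivative l) (at z)" unfolding DERIV_def D_def .
 then show ?thesis unfolding field_differentiable_def by blast
qed

lemma norm_vector_smult [simp]: "norm (h *s (x :: complex^'n)) = norm h * norm x"
proof -
 have "norm (h *s x) = L2_set (%i. norm h * norm (x $ i)) UNIV"
 by (simp add: norm_vec_def norm_mult)
 then show ?thesis by (simp add: norm_vec_def L2_set_right_distrib)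
qed

text \<open>Complex scaling of pairs. The product type has only its real structure, which is the one
  used by the inner product and the differential equations, so complex linearity has to be carried
  separately.\<close>

definition sc :: "complex => (complex^'n) \<times> (complex^'n) => (complex^'n) \<times> (complex^'n)" where
 "sc h x = (h *s fst x, h *s snd x)"

lemma fst_sc [simp]: "fst (sc h x) = h *s fst x" and snd_sc [simp]: "snd (sc h x) = h *s snd x"
 by (simp_all add: sc_def)

lemma norm_sc [simp]: "norm (sc h x) = norm h * norm x"
proof -
 have "(norm (sc h x))^2 = (norm h * norm x)^2"
 by (cases x) (simp add: sc_def norm_Pair power_mult_distrib distrib_left)
 then show ?thesis by (rule power2_eq_imp_eq) auto
qed

lemma sc_diff: "sc h (x - y) = sc h x - sc h y" and sc_add: "sc h (x + y) = sc h x + sc h y"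
 by (simp_all add: sc_def prod_eq_iff vector_ssub_ldistrib vector_add_ldistrib)

lemma sc_add_left: "sc (h + k) x = sc h x + sc k x"
 by (simp add: sc_def prod_eq_iff vec_eq_iff distrib_right)

lemma sc_sc [simp]: "sc h (sc k x) = sc (h * k) x" and sc_1 [simp]: "sc 1 x = x" and sc_0 [simp]: "sc 0 x = 0"
 by (simp_all add: sc_def prod_eq_iff vector_smult_assoc vec_eq_iff)

lemma sc_of_real: "sc (complex_of_real r) x = r *R x"
 unfolding sc_def prod_eq_iff vec_eq_iff by (simp add: scaleR_conv_of_real[where 'a = complex])

lemma bounded_linear_sc: "bounded_linear (sc h)"
proof (rule bounded_linear_intro[where K = "norm h"])
 show "sc h (r *R x) = r *R sc h x" for r x
 by (simp add: sc_of_real[symmetric] mult.commute)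
qed (simp_all add: sc_add mult.commute)

type_synonym 'n cpair = "(complex^'n) \<times> (complex^'n)"

text \<open>Families that are holomorphic in \<open>ka\<close> with a second-order Taylor estimate
 uniform in \<open>t >= 0\<close>.\<close>

definition uhol_with :: "complex set => (complex => real => 'n::finite cpair => 'n cpair) =>
 (complex => real => 'n cpair => 'n cpair) => real => bool" where
 "uhol_with U B B' K \<longleftrightarrow> 0 <= K & (ALL ka t. linear (B ka t)) & (ALL ka t. linear (B' ka t)) &
 (ALL ka t h x. B ka t (sc h x) = sc h (B ka t x)) &
 (ALL ka t x. ka : U --> 0 <= t --> norm (B ka t x) <= K * norm x) &
 (ALL ka t x. ka : U --> 0 <= t --> norm (B' ka t x) <= K * norm x) &
 (ALL ka ka' t x. ka : U --> ka' : U --> 0 <= t -->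
 norm (B ka' t x - B ka t x - sc (ka' - ka) (B' ka t x)) <= K * (norm (ka' - ka))^2 * norm x)"

definition uhol :: "complex set => (complex => real => 'n::finite cpair => 'n cpair) => bool" where
 "uhol U B \<longleftrightarrow> (EX B' K. uhol_with U B B' K)"

lemma uhol_withD:
 assumes "uhol_with U B B' K"
 shows "0 <= K" "linear (B ka t)" "linear (B' ka t)"
 "B ka t (sc h x) = sc h (B ka t x)"
 "ka : U ==> 0 <= t ==> norm (B ka t x) <= K * norm x"
 "ka : U ==> 0 <= t ==> norm (B' ka t x) <= K * norm x"
 "ka : U ==> ka' : U ==> 0 <= t ==>
 norm (B ka' t x - B ka t x - sc (ka' - ka) (B' ka t x)) <= K * (norm (ka' - ka))^2 * norm x"
 using assms[unfolded uhol_with_def] by (simp_all del: split_paired_All)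

lemma uholI:
 assumes "0 <= K" "!!ka t. linear (B ka t)" "!!ka t. linear (B' ka t)"
 "!!ka t h x. B ka t (sc h x) = sc h (B ka t x)"
 "!!ka t x. ka : U ==> 0 <= t ==> norm (B ka t x) <= K * norm x"
 "!!ka t x. ka : U ==> 0 <= t ==> norm (B' ka t x) <= K * norm x"
 "!!ka ka' t x. ka : U ==> ka' : U ==> 0 <= t ==>
 norm (B ka' t x - B ka t x - sc (ka' - ka) (B' ka t x)) <= K * (norm (ka' - ka))^2 * norm x"
 shows "uhol U B"
proof -
 have "uhol_with U B B' K" unfolding uhol_with_def by (intro conjI allI impI assms)
 then show ?thesis unfolding uhol_def by (intro exI)
qed

lemma uholD:
 assumes "uhol U B"
 shows "linear (B ka t)" "B ka t (sc h x) = sc h (B ka t x)"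
 using assms uhol_withD(2,4) unfolding uhol_def by metis+

lemma uhol_mono:
 assumes "uhol U B" "V \<subseteq> U"
 shows "uhol V B"
proof -
 from assms(1) obtain B' K where *: "uhol_with U B B' K" unfolding uhol_def by (elim exE)
 have "uhol_with V B B' K" using *[unfolded uhol_with_def] assms(2)[THEN subsetD] unfolding uhol_with_def by simp
 then show ?thesis unfolding uhol_def by (intro exI)
qed

lemma uhol_lipschitz:
 assumes "uhol U B" "!!z w. z : U ==> w : U ==> norm (w - z) <= 1"
 obtains K where "0 <= K" "!!ka ka' t x. ka : U ==> ka' : U ==> 0 <= t ==>
 norm (B ka' t x - B ka t x) <= K * norm (ka' - ka) * norm x"
proof -
 from assms(1) obtain B' K where *: "uhol_with U B B' K" unfolding uhol_def by (elim exE)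
 note K = uhol_withD(1,6,7)[OF *]
 have "norm (B ka' t x - B ka t x) <= (2 * K) * norm (ka' - ka) * norm x"
 if h: "ka : U" "ka' : U" "0 <= t" for ka ka' t x
 proof -
 let ?d = "norm (ka' - ka)"
 have "?d^2 <= ?d" using assms(2)[OF h(1,2)] by (simp add: power2_eq_square mult_left_le)
 then have "K * ?d^2 * norm x <= K * ?d * norm x" using K(1) by (intro mult_right_mono mult_left_mono) auto
 moreover have "norm (sc (ka' - ka) (B' ka t x)) <= ?d * (K * norm x)"
 unfolding norm_sc by (intro mult_left_mono K(2) h) simp
 moreover have "norm (B ka' t x - B ka t x) <= norm (B ka' t x - B ka t x - sc (ka' - ka) (B' ka t x))
 + norm (sc (ka' - ka) (B' ka t x))"
 using norm_triangle_sub[of "B ka' t x - B ka t x" "sc (ka' - ka) (B' ka t x)"] by (simp only: add.commute)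
 ultimately show ?thesis using K(3)[OF h, of x] by (simp add: algebra_simps)
 qed
 then show thesis using that[of "2 * K"] K(1) by simp
qed

text \<open>The derivative in \<open>ka\<close> is obtained by estimating differences of difference
 quotients, which are again bounded curves with vanishing second component at \<open>0\<close>.\<close>

locale complex_form = indefinite_form L dL c C
 for L :: "real => (complex^'n) \<times> (complex^'n) => (complex^'n) \<times> (complex^'n)" and dL c C
begin

lemma graph_function_differentiable:
 assumes uh: "uhol U B" and st: "!!ka. ka : U ==> strict (B ka) e K0"
 and X: "!!ka t. ka : U ==> 0 <= t ==> (X ka hvd B ka t (X ka t)) (at t)"
 and X0: "!!ka. ka : U ==> snd (X ka 0) = b"
 and XS: "!!ka t. ka : U ==> 0 <= t ==> norm (X ka t) <= S"
 and d: "0 < d" "ball z d \<subseteq> U" "d <= 1/2"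
 shows "(%ka. fst (X ka 0) $ i) field_differentiable at z"
proof -
 have "uhol (ball z d) B" by (rule uhol_mono[OF uh d(2)])
 then obtain K1 where K1: "0 <= K1" "!!ka ka' t x. ka : ball z d ==> ka' : ball z d ==> 0 <= t ==>
 norm (B ka' t x - B ka t x) <= K1 * norm (ka' - ka) * norm x"
 proof (rule uhol_lipschitz)
 fix x y assume "x : ball z d" "y : ball z d"
 then have "dist y x < 2 * d" using dist_triangle_half_r[of z y "2*d" x] by (simp add: dist_commute)
 then show "norm (y - x) <= 1" using d(3) by (simp add: dist_norm)
 qed blast
 from uh obtain B' K where *: "uhol_with U B B' K" unfolding uhol_def by (elim exE)
 note lin = uhol_withD(2,3)[OF *] and scB = uhol_withD(4)[OF *] and K = uhol_withD(1,6,7)[OF *]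
 define M where "M = (rate e K0)^2"
 have zU: "z : U" using d by auto
 have M0: "0 <= M" by (simp add: M_def)
 have S0: "0 <= S" using XS[OF zU, of 0] norm_ge_zero order_trans by blast
 have hU: "z + h : U" "z + h : ball z d" if "norm h < d" for h
 using that d(2) by (auto simp: dist_norm subset_iff)
 \<comment> \<open>Lipschitz dependence: the difference of two solutions has vanishing second
   component at 0, is bounded, and is forced only by the change of the generator.\<close>
 have lipX: "norm (X (z + h) t - X z t) <= M * (K1 * norm h * S)" if h: "norm h < d" and t: "0 <= t" for h t
 proof -
 have "norm (X (z + h) t - X z t) <= (rate e K0)^2 * (K1 * norm h * S + norm (snd (X (z + h) 0 - X z 0)))"
 proof (rule bounded_curve_estimate[OF st[OF zU] _ _ _ t, where S = "S + S"])
 fix t :: real assume t: "0 <= t"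
 show "((%t. X (z + h) t - X z t) hvd (B (z + h) t (X (z + h) t) - B z t (X z t))) (at t)"
 by (intro derivative_intros X hU h zU t)
 have "norm (B (z + h) t (X (z + h) t) - B z t (X (z + h) t)) <= K1 * norm h * norm (X (z + h) t)"
 using K1(2)[of z "z + h" t "X (z + h) t"] hU(2)[OF h] d(1) t by simp
 also have "... <= K1 * norm h * S" by (intro mult_left_mono XS hU h t mult_nonneg_nonneg K1) auto
 finally show "norm (B (z + h) t (X (z + h) t) - B z t (X z t) - B z t (X (z + h) t - X z t)) <= K1 * norm h * S"
 by (simp add: linear_diff[OF lin(1)] algebra_simps)
 show "norm (X (z + h) t - X z t) <= S + S"
 by (rule order_trans[OF norm_triangle_ineq4]) (intro add_mono XS hU h zU t)
 qed
 then show ?thesis by (simp add: X0 hU[OF h] zU M_def)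
 qed
 \<comment> \<open>The forcing of the difference quotient relative to the generator at
   \<open>z\<close>. It differs from \<open>B' z t (X z t)\<close>, which does not involve
   \<open>h\<close>, by a term of order \<open>norm h\<close>; in the difference of two quotients
   the common part cancels.\<close>
 define g where "g h t = sc (1 / h) (B (z + h) t (X (z + h) t) - B z t (X (z + h) t))" for h t
 define C1 where "C1 = K * S + K * (M * (K1 * S))"
 have C1: "0 <= C1" unfolding C1_def by (intro add_nonneg_nonneg mult_nonneg_nonneg K K1 S0 M0)
 have g: "norm (g h t - B' z t (X z t)) <= C1 * norm h" if h: "norm h < d" "h ~= 0" and t: "0 <= t" for h t
 proof -
 let ?Y = "X (z + h) t"
 have "g h t - B' z t ?Y = sc (1 / h) (B (z + h) t ?Y - B z t ?Y - sc (z + h - z) (B' z t ?Y))"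
 using h(2) by (simp add: g_def sc_diff)
 also have "norm ... <= (1 / norm h) * (K * (norm (z + h - z))^2 * norm ?Y)"
 unfolding norm_sc norm_divide norm_one by (intro mult_left_mono K(3) zU hU(1)[OF h(1)] t) auto
 also have "... = K * norm h * norm ?Y" using h(2) by (simp add: power2_eq_square)
 also have "... <= K * norm h * S" by (intro mult_left_mono XS hU h t mult_nonneg_nonneg K) auto
 finally have 1: "norm (g h t - B' z t ?Y) <= K * norm h * S" .
 have "norm (B' z t (?Y - X z t)) <= K * norm (?Y - X z t)" by (rule K(2)[OF zU t])
 also have "... <= K * (M * (K1 * norm h * S))" by (intro mult_left_mono lipX[OF h(1) t] K)
 finally have 2: "norm (B' z t ?Y - B' z t (X z t)) <= K * (M * (K1 * norm h * S))"
 by (simp add: linear_diff[OF lin(2)])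
 have "norm (g h t - B' z t (X z t)) <= norm (g h t - B' z t ?Y) + norm (B' z t ?Y - B' z t (X z t))"
 using norm_triangle_ineq[of "g h t - B' z t ?Y" "B' z t ?Y - B' z t (X z t)"] by simp
 then show ?thesis using 1 2 by (simp add: C1_def algebra_simps)
 qed
 show ?thesis
 proof (rule field_differentiable_from_quotients[OF d(1), where C = "M * C1"])
 show "0 <= M * C1" by (intro mult_nonneg_nonneg M0 C1)
 fix h k :: complex assume hk: "h ~= 0" "k ~= 0" "norm h < d" "norm k < d"
 define D where "D h t = sc (1 / h) (X (z + h) t - X z t)" for h t
 define D' where "D' h t = sc (1 / h) (B (z + h) t (X (z + h) t) - B z t (X z t))" for h t
 have dD: "(D h hvd D' h t) (at t)" if "norm h < d" "0 <= t" for h t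
 unfolding D_def D'_def
 by (intro bounded_linear.has_vector_derivative[OF bounded_linear_sc] has_vector_derivative_diff X hU that zU)
 have D'g: "D' h t - B z t (D h t) = g h t" for h t
 by (simp add: D_def D'_def g_def scB sc_diff linear_diff[OF lin(1)])
 have Dn: "norm (D h t) <= norm (1 / h) * (S + S)" if "norm h < d" "0 <= t" for h t
 proof -
 have "norm (X (z + h) t - X z t) <= S + S"
 by (rule order_trans[OF norm_triangle_ineq4]) (intro add_mono XS hU zU that)
 then show ?thesis unfolding D_def norm_sc by (intro mult_left_mono) auto
 qed
 have "norm (D h 0 - D k 0) <= (rate e K0)^2 * (C1 * (norm h + norm k) + norm (snd (D h 0 - D k 0)))"
 proof (rule bounded_curve_estimate[OF st[OF zU], where xq = "%t. D h t - D k t" and t = 0 and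
 S = "norm (1 / h) * (S + S) + norm (1 / k) * (S + S)"])
 fix t :: real assume t: "0 <= t"
 show "((%t. D h t - D k t) hvd (D' h t - D' k t)) (at t)"
 by (intro has_vector_derivative_diff dD hk t)
 have "D' h t - D' k t - B z t (D h t - D k t) = (g h t - B' z t (X z t)) - (g k t - B' z t (X z t))"
 using D'g[of h t] D'g[of k t] by (simp add: linear_diff[OF lin(1)] algebra_simps)
 also have "norm ... <= norm (g h t - B' z t (X z t)) + norm (g k t - B' z t (X z t))"
 by (rule norm_triangle_ineq4)
 also have "... <= C1 * (norm h + norm k)" using g[OF hk(3,1) t] g[OF hk(4,2) t] by (simp add: algebra_simps)
 finally show "norm (D' h t - D' k t - B z t (D h t - D k t)) <= C1 * (norm h + norm k)" .
 show "norm (D h t - D k t) <= norm (1 / h) * (S + S) + norm (1 / k) * (S + S)"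
 by (rule order_trans[OF norm_triangle_ineq4]) (intro add_mono Dn hk t)
 qed simp
 then have "norm (D h 0 - D k 0) <= M * C1 * (norm h + norm k)"
 by (simp add: D_def X0 hU[OF hk(3)] hU[OF hk(4)] zU M_def)
 moreover have "norm (fst (D h 0 - D k 0) $ i) <= norm (D h 0 - D k 0)"
 using Finite_Cartesian_Product.norm_nth_le norm_fst_le[of "fst (D h 0 - D k 0)" "snd (D h 0 - D k 0)"] order_trans
 unfolding prod.collapse by blast
 moreover have "fst (D h 0 - D k 0) $ i = (fst (X (z + h) 0) $ i - fst (X z 0) $ i) / h - (fst (X (z + k) 0) $ i - fst (X z 0) $ i) / k"
 by (simp add: D_def diff_divide_distrib)
 ultimately show "norm ((fst (X (z + h) 0) $ i - fst (X z 0) $ i) / h - (fst (X (z + k) 0) $ i - fst (X z 0) $ i) / k)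
 <= M * C1 * (norm h + norm k)" by simp
 qed
qed

text \<open>The graph is taken over the second component, where the form is negative. Nonpositivity
  of the form for all times replaces decay, because it is the property preserved by limits and it
  implies decay with a rate.\<close>

definition decaying_graph :: "(real => (complex^'n) \<times> (complex^'n) => (complex^'n) \<times> (complex^'n)) => complex^'n^'n => bool" where
 "decaying_graph B R \<longleftrightarrow> (ALL b. EX xq. xq 0 = (R *v b, b) &
 (ALL t. (xq hvd B t (xq t)) (at t)) & (ALL t>=0. xq t #. L t (xq t) <= 0))"

text \<open>The columns of \<open>R\<close> come from the solutions over the axis vectors. That
  \<open>R\<close> represents the solution over every \<open>b\<close> is a consequence of
  uniqueness of bounded solutions, and holomorphy holds entry by entry.\<close>

theorem holomorphic_graph:
 assumes uh: "uhol U B" and st: "!!ka. ka : U ==> strict (B ka) e K"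
 and cont: "!!ka x. continuous_on UNIV (%t. B ka t x)" and U: "open U"
 shows "EX R. (ALL i j. (%ka. R ka $ i $ j) holomorphic_on U) & (ALL ka:U. decaying_graph (B ka) (R ka))"
proof -
 note lin = uholD(1)[OF uh] and scB = uholD(2)[OF uh]
 define P where "P ka b xq \<longleftrightarrow> (ALL t. (xq hvd B ka t (xq t)) (at t)) & snd (xq 0) = b
 & (ALL t>=0. xq t #. L t (xq t) <= 0)" for ka b xq
 \<comment> \<open>The solutions are merely selected, with no regularity in \<open>b\<close> or
   \<open>ka\<close>; both linearity and differentiability follow afterwards from
   \<open>bounded_curve_estimate\<close>.\<close>
 define X where "X b ka = (SOME xq. P ka b xq)" for b ka
 have "P ka b (X b ka)" if "ka : U" for ka b
 unfolding X_def using bounded_solution_exists[OF st[OF that] lin cont, of b, folded P_def] by (rule someI_ex)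
 then have X: "(X b ka hvd B ka t (X b ka t)) (at t)" and X0: "snd (X b ka 0) = b"
 and Xq: "0 <= t ==> X b ka t #. L t (X b ka t) <= 0" if "ka : U" for b ka t
 using that unfolding P_def by blast+
 define M where "M = (rate e K)^2"
 have XM: "norm (X b ka t) <= M * norm b" if ka: "ka : U" and t: "0 <= t" for b ka t
 proof -
 have N: "0 <= rate e K" using rate_ge_1 strictD(1,2)[OF st[OF ka]] by force
 define S where "S = sqrt (rate e K * (norm (X b ka 0))^2)"
 have "norm (X b ka t) <= S" if t: "0 <= t" for t
 proof -
 have "(norm (X b ka t))^2 <= rate e K * (norm (X b ka 0))^2 * exp (- (1 / rate e K) * t)"
 by (rule nonpositive_curve_decay[OF st[OF ka] X[OF ka] Xq[OF ka] t])
 also have "... <= rate e K * (norm (X b ka 0))^2 * 1"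
 using N t by (intro mult_left_mono) auto
 finally show ?thesis unfolding S_def by (intro real_le_rsqrt) simp
 qed
 from bounded_curve_estimate[OF st[OF ka] X[OF ka] _ this t, where H = 0]
 show ?thesis by (simp add: X0[OF ka] M_def)
 qed
 define R where "R ka = (\<chi> i j. fst (X (axis j 1) ka 0) $ i)" for ka
 have "(%ka. R ka $ i $ j) holomorphic_on U" for i j
 unfolding holomorphic_on_def
 proof
 fix z assume z: "z : U"
 then obtain d0 where d0: "0 < d0" "ball z d0 \<subseteq> U" using U open_contains_ball by blast
 have "(%ka. fst (X (axis j 1) ka 0) $ i) field_differentiable at z"
 by (rule graph_function_differentiable[OF uh st X X0 XM, where d = "min d0 (1/2)"]) (use d0 in auto)
 then show "(%ka. R ka $ i $ j) field_differentiable at z within U"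
 by (simp add: R_def field_differentiable_at_within)
 qed
 moreover have "decaying_graph (B ka) (R ka)" if ka: "ka : U" for ka
 unfolding decaying_graph_def
 proof
 fix b :: "complex^'n"
 \<comment> \<open>The defect of linearity in \<open>b\<close>: a bounded solution whose second
   component vanishes at 0, hence zero there.\<close>
 define Y where "Y t = X b ka t - (SUM j:UNIV. sc (b $ j) (X (axis j 1) ka t))" for t
 define S where "S = M * norm b + (SUM j:UNIV. norm (b $ j) * (M * norm (axis j 1 :: complex^'n)))"
 have dY: "(Y hvd B ka t (Y t)) (at t)" for t
 unfolding Y_def linear_diff[OF lin] linear_sum[OF lin] scB
 by (intro has_vector_derivative_diff X ka has_vector_derivative_sum bounded_linear.has_vector_derivative[OF bounded_linear_sc])
 have "norm (Y t) <= S" if t: "0 <= t" for t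
 unfolding Y_def S_def
 by (rule order_trans[OF norm_triangle_ineq4], intro add_mono XM ka t, rule order_trans[OF norm_sum], rule sum_mono)
 (auto intro!: mult_left_mono order_trans[OF XM[OF ka t]])
 from bounded_curve_estimate[OF st[OF ka] dY _ this, of 0 0]
 have "norm (Y 0) <= M * norm (snd (Y 0))" by (simp add: M_def)
 moreover have b: "(SUM j:UNIV. b $ j *s axis j 1) = b"
 by (simp add: vec_eq_iff axis_def if_distrib sum.delta cong: if_cong)
 have "snd (Y 0) = 0"
 by (simp add: Y_def snd_sum X0 ka b)
 ultimately have "Y 0 = 0" by simp
 then have "fst (X b ka 0) = (SUM j:UNIV. b $ j *s fst (X (axis j 1) ka 0))"
 by (simp add: Y_def fst_sum prod_eq_iff)
 also have "... = R ka *v b"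
 by (simp add: vec_eq_iff R_def matrix_vector_mult_def mult.commute)
 finally have "X b ka 0 = (R ka *v b, b)" using X0[OF ka, of b] by (simp add: prod_eq_iff)
 then show "EX xq. xq 0 = (R ka *v b, b) & (ALL t. (xq hvd B ka t (xq t)) (at t)) & (ALL t>=0. xq t #. L t (xq t) <= 0)"
 using X[OF ka] Xq[OF ka] by blast
 qed
 ultimately show ?thesis by blast
qed

text \<open>The difference from the decaying solution with the same second component is bounded and
  unforced, so its initial value is 0. Boundedness alone thus characterizes the graph.\<close>

lemma bounded_solution_in_graph:
 assumes st: "strict B e K" and lin: "!!t. linear (B t)" and R: "decaying_graph B R"
 and d: "!!t. 0 <= t ==> (xq hvd B t (xq t)) (at t)" and S: "!!t. 0 <= t ==> norm (xq t) <= S"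
 shows "fst (xq 0) = R *v snd (xq 0)"
proof -
 obtain et where et: "et 0 = (R *v snd (xq 0), snd (xq 0))" "!!t. (et hvd B t (et t)) (at t)"
 "!!t. 0 <= t ==> et t #. L t (et t) <= 0" using R unfolding decaying_graph_def by blast
 have N: "0 <= rate e K" using rate_ge_1 strictD(1,2)[OF st] by force
 define S' where "S' = sqrt (rate e K * (norm (et 0))^2)"
 have S': "norm (et t) <= S'" if t: "0 <= t" for t
 proof -
 have "(norm (et t))^2 <= rate e K * (norm (et 0))^2 * exp (- (1 / rate e K) * t)"
 by (rule nonpositive_curve_decay[OF st et(2,3) t])
 also have "... <= rate e K * (norm (et 0))^2 * 1" using N t by (intro mult_left_mono) auto
 finally show ?thesis unfolding S'_def by (intro real_le_rsqrt) simp
 qed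
 have "norm (xq 0 - et 0) <= (rate e K)^2 * (0 + norm (snd (xq 0 - et 0)))"
 proof (rule bounded_curve_estimate[OF st, where S = "S + S'" and t = 0 and xq' = "%t. B t (xq t - et t)"])
 fix t :: real assume t: "0 <= t"
 show "((%t. xq t - et t) hvd B t (xq t - et t)) (at t)"
 unfolding linear_diff[OF lin] by (intro has_vector_derivative_diff d t et)
 show "norm (xq t - et t) <= S + S'"
 by (rule order_trans[OF norm_triangle_ineq4]) (intro add_mono S S' t)
 qed auto
 then have "xq 0 = et 0" by (simp add: et(1))
 from arg_cong[OF this, of fst] show ?thesis unfolding et(1) by simp
qed

text \<open>Were the form 0 at time 0 for a nonzero solution, its derivative there, at least
  \<open>e * \<bar>x\<bar>^2\<close>, would make it positive immediately afterwards.\<close>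

lemma graph_negative:
 assumes st: "strict B e K" and d: "!!t. (xq hvd B t (xq t)) (at t)"
 and q: "!!t. 0 <= t ==> xq t #. L t (xq t) <= 0" and 0: "xq 0 #. L 0 (xq 0) = 0"
 shows "xq 0 = 0"
proof -
 have "((%t. xq t #. L t (xq t)) has_real_derivative dL 0 (xq 0) + 2 * (B 0 (xq 0) #. L 0 (xq 0))) (at 0)"
 by (rule derivL[OF order_refl d])
 moreover have "dL 0 (xq 0) + 2 * (B 0 (xq 0) #. L 0 (xq 0)) >= e * (norm (xq 0))^2"
 by (rule strictD(3)[OF st order_refl])
 moreover have "\<not> 0 < dL 0 (xq 0) + 2 * (B 0 (xq 0) #. L 0 (xq 0))"
 proof
 assume p: "0 < dL 0 (xq 0) + 2 * (B 0 (xq 0) #. L 0 (xq 0))"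
 obtain r where "0 < r" "!!h. 0 < h ==> h < r ==> xq 0 #. L 0 (xq 0) < xq (0 + h) #. L (0 + h) (xq (0 + h))"
 using DERIV_pos_inc_right[OF calculation(1) p] by blast
 from this(2)[of "r / 2"] this(1) q[of "r / 2"] 0 show False by simp
 qed
 ultimately have "e * (norm (xq 0))^2 <= 0" by linarith
 then show ?thesis using strictD(1)[OF st] by (simp add: mult_le_0_iff)
qed

end

context indefinite_form begin

text \<open>A change of size \<open>d\<close> alters the derivative of the form by at most
  \<open>2 * d * C * \<bar>x\<bar>^2\<close>, which the hypothesis makes half of the available
  rate.\<close>

lemma strict_perturb:
 assumes B: "strict B e K" and d: "0 <= d" "4 * d * C <= e"
 and B2: "!!t x. 0 <= t ==> norm (B2 t x - B t x) <= d * norm x"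
 shows "strict B2 (e / 2) (K + d)"
 unfolding strict_def
proof (intro conjI allI impI)
 show "0 < e / 2" "0 <= K + d" using strictD(1,2)[OF B] d by simp_all
 fix t :: real and x assume t: "0 <= t"
 have "norm (B2 t x) <= norm (B t x) + norm (B2 t x - B t x)" by (rule norm_triangle_sub)
 also have "... <= (K + d) * norm x" using strictD(4)[OF B t, of x] B2[OF t, of x] by (simp add: distrib_right)
 finally show "norm (B2 t x) <= (K + d) * norm x" .
 have "\<bar>(B2 t x - B t x) #. L t x\<bar> <= (d * norm x) * (C * norm x)"
 by (rule order_trans[OF Cauchy_Schwarz_ineq2]) (intro mult_mono B2 normL t norm_ge_zero mult_nonneg_nonneg d)
 then have "\<bar>(B2 t x - B t x) #. L t x\<bar> <= d * C * (norm x)^2" by (simp add: power2_eq_square algebra_simps)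
 moreover have "4 * d * C * (norm x)^2 <= e * (norm x)^2" by (intro mult_right_mono d) simp
 moreover have "B2 t x #. L t x = B t x #. L t x + (B2 t x - B t x) #. L t x" by (simp add: inner_diff_left)
 ultimately show "e / 2 * (norm x)^2 <= dL t x + 2 * (B2 t x #. L t x)"
 using strictD(3)[OF B t, of x] by linarith
qed

end

text \<open>Real matrices acting on complex vectors; \<open>\<bullet>\<close> is the real part of the Hermitian product.\<close>

definition cm :: "real^'n^'m => complex^'n => complex^'m" where
 "cm M v = (\<chi> i. SUM j:UNIV. M $ i $ j *R v $ j)"

lemma norm_cm: "norm (cm M v) <= norm M * norm v"
proof -
 have row: "norm (cm M v $ i) <= norm (M $ i) * norm v" for i
 proof -
 have "norm (cm M v $ i) <= (SUM j:UNIV. \<bar>M $ i $ j\<bar> * \<bar>norm (v $ j)\<bar>)"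
 unfolding cm_def vec_lambda_beta by (rule order_trans[OF norm_sum]) simp
 also have "... <= L2_set (%j. M $ i $ j) UNIV * L2_set (%j. norm (v $ j)) UNIV"
 by (rule L2_set_mult_ineq)
 finally show ?thesis by (simp add: norm_vec_def L2_set_def)
 qed
 have "norm (cm M v) <= L2_set (%i. norm (M $ i) * norm v) UNIV"
 unfolding norm_vec_def[of "cm M v"] by (rule L2_set_mono) (use row in auto)
 also have "... = norm M * norm v" by (simp add: norm_vec_def[of M] L2_set_left_distrib)
 finally show ?thesis .
qed

lemma bounded_bilinear_cm: "bounded_bilinear (cm :: real^'n^'m => complex^'n => complex^'m)"
proof (rule bounded_bilinear.intro)
 show "EX K. \<forall>(M :: real^'n^'m) v. norm (cm M v) <= norm M * norm v * K" by (rule exI[of _ 1]) (simp add: norm_cm)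
qed (simp_all add: cm_def vec_eq_iff sum.distrib scaleR_add_left scaleR_add_right scaleR_right.sum scaleR_sum_right mult_ac)

interpretation cm: bounded_bilinear "cm :: real^'n^'m => complex^'n => complex^'m" by (rule bounded_bilinear_cm)

lemma cm_smult: "cm M (h *s v) = h *s cm M v"
 by (simp add: cm_def vec_eq_iff sum_distrib_left scaleR_conv_of_real[where 'a = complex] mult_ac)

lemma cm_mult: "cm (M ** N) v = cm M (cm N v)"
proof -
 have "(SUM j:UNIV. (SUM k:UNIV. M $ i $ k * N $ k $ j) *R v $ j) = (SUM k:UNIV. M $ i $ k *R (SUM j:UNIV. N $ k $ j *R v $ j))" for i
 unfolding scaleR_left.sum scaleR_right.sum by (subst sum.swap) simp
 then show ?thesis by (simp add: cm_def vec_eq_iff matrix_matrix_mult_def)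
qed

lemma cm_mat1 [simp]: "cm (mat 1) v = v"
 by (simp add: cm_def vec_eq_iff mat_def if_distrib[of "%x. x *R _"] sum.delta cong: if_cong)

lemma cm_sym:
 assumes "sym_mat M"
 shows "cm M v #. w = v #. cm M w"
proof -
 have s: "M $ i $ j = M $ j $ i" for i j
 using assms unfolding sym_mat_def by (metis transpose_def vec_lambda_beta)
 have "cm M v #. w = (SUM i:UNIV. SUM j:UNIV. M $ i $ j * (v $ j #. w $ i))"
 by (simp add: inner_vec_def cm_def inner_sum_left)
 also have "... = (SUM j:UNIV. SUM i:UNIV. M $ j $ i * (v $ j #. w $ i))"
 by (subst sum.swap) (simp add: s)
 also have "... = v #. cm M w" by (simp add: inner_vec_def cm_def inner_sum_right)
 finally show ?thesis .
qed

lemma inner_smult_left: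
 fixes v w :: "complex^'n"
 shows "(h *s v) #. w = Re h * (v #. w) + Im h * ((\<i> *s v) #. w)"
 by (simp add: inner_vec_def inner_complex_def sum_distrib_left sum.distrib[symmetric] algebra_simps)

lemma inner_ii: fixes v w :: "complex^'n" shows "(\<i> *s v) #. (\<i> *s w) = v #. w" "(\<i> *s v) #. w = - (v #. (\<i> *s w))"
 by (simp_all add: inner_vec_def inner_complex_def sum_negf[symmetric] algebra_simps)

text \<open>The Hermitian square of \<open>v\<close> with respect to a real symmetric matrix is
  real, and the left-hand side is its imaginary part up to sign.\<close>

lemma inner_i_self_cm: "sym_mat M ==> (\<i> *s v) #. cm M v = 0"
proof -
 assume M: "sym_mat M"
 have "(\<i> *s v) #. cm M v = cm M (\<i> *s v) #. v" by (simp add: cm_sym[OF M])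
 also have "... = - ((\<i> *s v) #. cm M v)" unfolding cm_smult by (simp add: inner_ii(2) inner_commute)
 finally show ?thesis by simp
qed

lemma inner_smult_cm: "sym_mat M ==> (h *s v) #. cm M v = Re h * (v #. cm M v)"
 by (subst inner_smult_left) (simp add: inner_i_self_cm)

section \<open>Uniformly holomorphic families: sums, compositions, scalar factors\<close>

lemma uhol_add:
 assumes "uhol U S" "uhol U T"
 shows "uhol U (%ka t x. S ka t x + T ka t x)"
proof -
 obtain S' K where S: "uhol_with U S S' K" using assms(1) unfolding uhol_def by (elim exE)
 obtain T' M where T: "uhol_with U T T' M" using assms(2) unfolding uhol_def by (elim exE)
 note s = uhol_withD[OF S] and t = uhol_withD[OF T]
 show ?thesis
 proof (rule uholI[where B' = "%ka t x. S' ka t x + T' ka t x" and K = "K + M"])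
 show "0 <= K + M" using s(1) t(1) by simp
 show "linear (%x. S ka t' x + T ka t' x)" "linear (%x. S' ka t' x + T' ka t' x)" for ka t'
 by (intro linear_compose_add s t)+
 show "S ka t' (sc h x) + T ka t' (sc h x) = sc h (S ka t' x + T ka t' x)" for ka t' h x
 by (simp add: s(4) t(4) sc_add)
 show "norm (S ka t' x + T ka t' x) <= (K + M) * norm x" if "ka : U" "0 <= t'" for ka t' x
 unfolding distrib_right by (intro norm_triangle_mono s(5) t(5) that)
 show "norm (S' ka t' x + T' ka t' x) <= (K + M) * norm x" if "ka : U" "0 <= t'" for ka t' x
 unfolding distrib_right by (intro norm_triangle_mono s(6) t(6) that)
 fix ka ka' t' x assume a: "ka : U" "ka' : U" "(0::real) <= t'"
 have "S ka' t' x + T ka' t' x - (S ka t' x + T ka t' x) - sc (ka' - ka) (S' ka t' x + T' ka t' x)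
 = (S ka' t' x - S ka t' x - sc (ka' - ka) (S' ka t' x)) + (T ka' t' x - T ka t' x - sc (ka' - ka) (T' ka t' x))"
 by (simp add: sc_add)
 also have "norm ... <= K * (norm (ka' - ka))^2 * norm x + M * (norm (ka' - ka))^2 * norm x"
 by (intro norm_triangle_mono s(7) t(7) a)
 finally show "norm (S ka' t' x + T ka' t' x - (S ka t' x + T ka t' x) - sc (ka' - ka) (S' ka t' x + T' ka t' x))
 <= (K + M) * (norm (ka' - ka))^2 * norm x" by (simp add: algebra_simps)
 qed
qed

text \<open>The product rule with remainders. The restriction on the diameter of \<open>U\<close>
  turns quadratic remainders into linear ones, which makes \<open>T\<close> Lipschitz in
  \<open>ka\<close> and controls the mixed term.\<close>

lemma uhol_comp:
 assumes "uhol U S" "uhol U T" and U: "!!z w. z : U ==> w : U ==> norm (w - z) <= 1"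
 shows "uhol U (%ka t x. S ka t (T ka t x))"
proof -
 obtain S' K where S: "uhol_with U S S' K" using assms(1) unfolding uhol_def by (elim exE)
 obtain T' M where T: "uhol_with U T T' M" using assms(2) unfolding uhol_def by (elim exE)
 obtain M2 where M2: "0 <= M2" "!!ka ka' t x. ka : U ==> ka' : U ==> 0 <= t ==>
 norm (T ka' t x - T ka t x) <= M2 * norm (ka' - ka) * norm x"
 using uhol_lipschitz[OF assms(2) U, of thesis] by simp
 note s = uhol_withD[OF S] and t = uhol_withD[OF T]
 define C where "C = 2 * K * M + K * M2 + K * M"
 have C: "0 <= C" "K * M <= C" "2 * K * M <= C" using s(1) t(1) M2(1) by (simp_all add: C_def)
 show ?thesis
 proof (rule uholI[where B' = "%ka t x. S' ka t (T ka t x) + S ka t (T' ka t x)" and K = C])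
 show "0 <= C" by (rule C)
 show "linear (%x. S ka t' (T ka t' x))" for ka t'
 using linear_compose[OF t(2) s(2)] by (simp add: o_def)
 show "linear (%x. S' ka t' (T ka t' x) + S ka t' (T' ka t' x))" for ka t'
 using linear_compose_add[OF linear_compose[OF t(2) s(3)] linear_compose[OF t(3) s(2)]] by (simp add: o_def)
 show "S ka t' (T ka t' (sc h x)) = sc h (S ka t' (T ka t' x))" for ka t' h x
 by (simp add: s(4) t(4))
 have ST: "norm (S ka t' y) <= K * (M * norm x)" if "ka : U" "0 <= t'" "norm y <= M * norm x" for ka t' x y
 by (rule order_trans[OF s(5)[OF that(1,2)]]) (intro mult_left_mono that s)
 have ST': "norm (S' ka t' y) <= K * (M * norm x)" if "ka : U" "0 <= t'" "norm y <= M * norm x" for ka t' x y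
 by (rule order_trans[OF s(6)[OF that(1,2)]]) (intro mult_left_mono that s)
 show "norm (S ka t' (T ka t' x)) <= C * norm x" if "ka : U" "0 <= t'" for ka t' x
 by (rule order_trans[OF ST[OF that t(5)[OF that]]]) (use mult_right_mono[OF C(2) norm_ge_zero[of x]] in \<open>simp only: mult.assoc\<close>)
 show "norm (S' ka t' (T ka t' x) + S ka t' (T' ka t' x)) <= C * norm x" if "ka : U" "0 <= t'" for ka t' x
 by (rule order_trans[OF norm_triangle_mono[OF ST'[OF that t(5)[OF that]] ST[OF that t(6)[OF that]]]])
 (use mult_right_mono[OF C(3) norm_ge_zero[of x]] in \<open>simp add: mult.assoc\<close>)
 fix ka ka' t' x assume a: "ka : U" "ka' : U" "(0::real) <= t'"
 let ?d = "ka' - ka"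
 have eq: "S ka' t' (T ka' t' x) - S ka t' (T ka t' x) - sc ?d (S' ka t' (T ka t' x) + S ka t' (T' ka t' x))
 = (S ka' t' (T ka' t' x) - S ka t' (T ka' t' x) - sc ?d (S' ka t' (T ka' t' x)))
 + (sc ?d (S' ka t' (T ka' t' x - T ka t' x)) + S ka t' (T ka' t' x - T ka t' x - sc ?d (T' ka t' x)))"
 by (simp add: sc_add sc_diff linear_diff[OF s(3)] linear_diff[OF s(2)] s(4))
 have 1: "norm (S ka' t' (T ka' t' x) - S ka t' (T ka' t' x) - sc ?d (S' ka t' (T ka' t' x))) <= K * (norm ?d)^2 * (M * norm x)"
 by (rule order_trans[OF s(7)[OF a]]) (intro mult_left_mono t(5) a mult_nonneg_nonneg s zero_le_power2)
 have "norm (S' ka t' (T ka' t' x - T ka t' x)) <= K * (M2 * norm ?d * norm x)"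
 by (rule order_trans[OF s(6)[OF a(1,3)]]) (intro mult_left_mono M2 a s)
 then have 2: "norm (sc ?d (S' ka t' (T ka' t' x - T ka t' x))) <= norm ?d * (K * (M2 * norm ?d * norm x))"
 unfolding norm_sc by (rule mult_left_mono) simp
 have 3: "norm (S ka t' (T ka' t' x - T ka t' x - sc ?d (T' ka t' x))) <= K * (M * (norm ?d)^2 * norm x)"
 by (rule order_trans[OF s(5)[OF a(1,3)]]) (intro mult_left_mono t(7) a s)
 have "norm (S ka' t' (T ka' t' x) - S ka t' (T ka t' x) - sc ?d (S' ka t' (T ka t' x) + S ka t' (T' ka t' x)))
 <= K * (norm ?d)^2 * (M * norm x) + (norm ?d * (K * (M2 * norm ?d * norm x)) + K * (M * (norm ?d)^2 * norm x))"
 unfolding eq by (intro norm_triangle_mono 1 2 3)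
 also have "... = (2 * K * M + K * M2) * (norm ?d)^2 * norm x" by (simp add: power2_eq_square algebra_simps)
 also have "... <= C * (norm ?d)^2 * norm x"
 using s(1) t(1) by (intro mult_right_mono) (auto simp: C_def)
 finally show "norm (S ka' t' (T ka' t' x) - S ka t' (T ka t' x) - sc ?d (S' ka t' (T ka t' x) + S ka t' (T' ka t' x)))
 <= C * (norm ?d)^2 * norm x" .
 qed
qed

lemma uhol_const:
 assumes "!!t. linear (N t)" "!!t h x. N t (sc h x) = sc h (N t x)" "!!t x. 0 <= t ==> norm (N t x) <= K * norm x" "0 <= K"
 shows "uhol U (%ka. N)"
 by (rule uholI[where B' = "%ka t x. 0" and K = K]) (use assms in \<open>simp_all add: linear_zero sc_def prod_eq_iff vec_eq_iff\<close>)

text \<open>Halving the radius places the family on a compact disc on which \<open>f\<close> and its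
  first two derivatives are bounded, so the remainder in Taylor's formula is uniform.\<close>

lemma uhol_sc:
 assumes f: "f holomorphic_on ball z r" and r: "0 < r"
 shows "uhol (ball z (r / 2)) (%ka t x. sc (f ka) x)"
proof -
 define U where "U = cball z (r / 2)"
 have sub: "U \<subseteq> ball z r" using r by (auto simp: U_def)
 have hol: "f holomorphic_on ball z r" "deriv f holomorphic_on ball z r" "deriv (deriv f) holomorphic_on ball z r"
 using f by (auto intro!: holomorphic_deriv)
 have "EX K. ALL ka:U. norm (h ka) <= K" if "h holomorphic_on ball z r" for h
 proof -
 have "continuous_on U h" by (rule continuous_on_subset[OF holomorphic_on_imp_continuous_on[OF that] sub])
 then have "bounded (h ` U)" by (intro compact_imp_bounded compact_continuous_image) (simp_all add: U_def)
 then show ?thesis by (simp add: bounded_iff)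
 qed
 from this[OF hol(1)] this[OF hol(2)] this[OF hol(3)] obtain K0 K1 K2
 where K: "ALL ka:U. norm (f ka) <= K0" "ALL ka:U. norm (deriv f ka) <= K1" "ALL ka:U. norm (deriv (deriv f) ka) <= K2"
 by (elim exE) (rule that)
 have z: "z \<in> U" using r by (simp add: U_def)
 have K0: "0 \<le> K0" "0 \<le> K1" "0 \<le> K2" using K z norm_ge_zero order_trans by blast+
 have tay: "norm (f ka' - f ka - (ka' - ka) * deriv f ka) \<le> K2 * (norm (ka' - ka))\<^sup>2" if "ka \<in> U" "ka' \<in> U" for ka ka'
 proof -
 have "norm ((deriv ^^ 0) f ka' - (\<Sum>i\<le>1. (deriv ^^ i) f ka * (ka' - ka) ^ i / fact i)) \<le> K2 * norm (ka' - ka) ^ Suc 1 / fact 1"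
 proof (rule complex_Taylor[where S = U])
 show "convex U" by (simp add: U_def)
 show "((deriv ^^ i) f has_field_derivative (deriv ^^ Suc i) f x) (at x within U)" if "x \<in> U" "i \<le> 1" for i x
 proof -
 have "i = 0 \<or> i = 1" using that by auto
 then have "(deriv ^^ i) f holomorphic_on ball z r" using hol by auto
 then have "((deriv ^^ i) f has_field_derivative deriv ((deriv ^^ i) f) x) (at x)"
 by (rule holomorphic_derivI) (use that sub in auto)
 then show ?thesis by (simp add: has_field_derivative_at_within)
 qed
 show "cmod ((deriv ^^ Suc 1) f x) <= K2" if "x : U" for x using K(3) that by simp
 qed (use that in auto)
 then show ?thesis by (simp add: power2_eq_square algebra_simps)
 qed
 show ?thesis
 proof (rule uholI[where B' = "%ka t x. sc (if ka : U then deriv f ka else 0) x" and K = "K0 + K1 + K2"])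
 show "0 <= K0 + K1 + K2" using K0 by simp
 show "linear (sc (f ka))" "linear (sc (if ka : U then deriv f ka else 0))" for ka
 by (rule bounded_linear.linear[OF bounded_linear_sc])+
 show "sc (f ka) (sc h x) = sc h (sc (f ka) x)" for ka h x by (simp add: mult.commute)
 fix ka and x :: "'a cpair" assume "ka : ball z (r / 2)"
 then have ka: "ka : U" by (auto simp: U_def)
 show "norm (sc (f ka) x) <= (K0 + K1 + K2) * norm x" "norm (sc (if ka : U then deriv f ka else 0) x) <= (K0 + K1 + K2) * norm x"
 proof -
 have "norm (f ka) <= K0 + K1 + K2" "norm (deriv f ka) <= K0 + K1 + K2"
 using K(1,2) ka K0 by (metis add.commute add_increasing2 add_increasing)+
 then show "norm (sc (f ka) x) <= (K0 + K1 + K2) * norm x" "norm (sc (if ka : U then deriv f ka else 0) x) <= (K0 + K1 + K2) * norm x"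
 using ka by (simp_all add: mult_right_mono)
 qed
 fix ka' assume "ka' : ball z (r / 2)"
 then have ka': "ka' : U" by (auto simp: U_def)
 have "sc (f ka') x - sc (f ka) x - sc (ka' - ka) (sc (deriv f ka) x) = sc (f ka' - f ka - (ka' - ka) * deriv f ka) x"
 by (simp add: sc_def prod_eq_iff vec_eq_iff algebra_simps)
 also have "norm ... <= K2 * (norm (ka' - ka))^2 * norm x"
 unfolding norm_sc by (intro mult_right_mono tay ka ka') simp
 also have "... <= (K0 + K1 + K2) * (norm (ka' - ka))^2 * norm x"
 using K0 by (intro mult_right_mono) auto
 finally show "norm (sc (f ka') x - sc (f ka) x - sc (ka' - ka) (sc (if ka : U then deriv f ka else 0) x))
 <= (K0 + K1 + K2) * (norm (ka' - ka))^2 * norm x" using ka by simp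
 qed
qed

lemma bounded_on_half_line:
 fixes xq :: "real => 'a::real_normed_vector"
 assumes "!!t. (xq hvd xq' t) (at t)" "(xq ---> l) at_top"
 shows "EX S. ALL t>=0. norm (xq t) <= S"
proof -
 have "\<forall>\<^sub>F t in at_top. dist (xq t) l < 1" using assms(2) by (rule tendstoD) simp
 then obtain T where T: "!!t. T <= t ==> dist (xq t) l < 1" unfolding eventually_at_top_linorder by blast
 have "continuous_on {0..T} xq"
 by (intro continuous_at_imp_continuous_on ballI has_vector_derivative_continuous[OF assms(1)])
 then have "bounded (xq ` {0..T})" by (intro compact_imp_bounded compact_continuous_image) simp_all
 then obtain S where S: "ALL t:{0..T}. norm (xq t) <= S" by (auto simp: bounded_iff)
 have "norm (xq t) <= max S (norm l + 1)" if "0 <= t" for t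
 proof (cases "t <= T")
 case True then show ?thesis using S that by (simp add: le_max_iff_disj)
 next
 case False
 then have "norm (xq t - l) < 1" using T[of t] by (simp add: dist_norm)
 then show ?thesis using norm_triangle_sub[of "xq t" l] by linarith
 qed
 then show ?thesis by blast
qed

lemma exp_bound_tendsto_0:
 fixes xq :: "real => 'a::real_normed_vector"
 assumes b: "!!t. 0 <= t ==> (norm (xq t))^2 <= C * exp (- al * t)" and al: "0 < al"
 shows "(xq ---> 0) at_top"
proof -
 have "((%t. C * exp (- al * t)) ---> C * 0) at_top"
 proof (intro tendsto_mult tendsto_const)
 have "filterlim (%t. al * t) at_top at_top"
 using al by (intro filterlim_tendsto_pos_mult_at_top[OF tendsto_const] filterlim_ident)
 then have "filterlim (%t. - al * t) at_bot at_top" by (simp add: filterlim_uminus_at_top)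
 then show "((%t. exp (- al * t)) ---> 0) at_top" by (rule filterlim_compose[OF exp_at_bot])
 qed
 then have 1: "((%t. C * exp (- al * t)) ---> 0) at_top" by simp
 have "\<forall>\<^sub>F t in at_top. norm ((norm (xq t))^2) <= C * exp (- al * t)"
 unfolding eventually_at_top_linorder by (intro exI[of _ 0] allI impI) (simp add: b[simplified])
 from Lim_null_comparison[OF this 1] have "((%t. (norm (xq t))^2) ---> 0) at_top" .
 then have "((%t. sqrt ((norm (xq t))^2)) ---> sqrt 0) at_top" by (rule tendsto_real_sqrt)
 then show ?thesis by (simp add: tendsto_norm_zero_iff)
qed

lemma bounded_linear_smult: "bounded_linear (%x :: complex^'n. h *s x)"
proof (rule bounded_linear_intro[where K = "norm h"])
 show "h *s (r *R x) = r *R (h *s x)" for r and x :: "complex^'n"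
 by (simp add: vec_eq_iff mult_scaleR_right)
qed (simp_all add: vector_add_ldistrib mult.commute)

section \<open>The eigenvalue problem in relaxation variables on a half line\<close>

text \<open>For a pair \<open>(v + u, v - u)\<close> this is v, the original mode;
  \<open>dif\<close> below is u, that is \<open>w / ka\<close> in the first-order system.\<close>

definition mid :: "'n::finite cpair => complex^'n" where "mid x = (1/2) *R (fst x + snd x)"
definition dif :: "'n::finite cpair => complex^'n" where "dif x = (1/2) *R (fst x - snd x)"

lemma fst_mid_dif: "fst x = mid x + dif x" and snd_mid_dif: "snd x = mid x - dif x"
 by (simp_all add: mid_def dif_def algebra_simps flip: scaleR_add_left)

lemma norm_fst_snd: "(norm x)^2 = (norm (fst x))^2 + (norm (snd x))^2"
 by (simp add: norm_prod_def)

lemma norm_mid_dif: "(norm x)^2 = 2 * ((norm (mid x))^2 + (norm (dif x))^2)"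
 unfolding norm_fst_snd[of x] fst_mid_dif[of x] snd_mid_dif[of x]
 by (simp add: power2_norm_eq_inner inner_add_left inner_add_right inner_diff_left inner_diff_right inner_commute)

lemma inner_fst_snd: "fst x #. snd x = (norm (mid x))^2 - (norm (dif x))^2"
 unfolding fst_mid_dif[of x] snd_mid_dif[of x]
 by (simp add: power2_norm_eq_inner inner_add_left inner_add_right inner_diff_left inner_diff_right inner_commute)

lemma norm_mid_le: "norm (mid x) <= norm x" and norm_dif_le: "norm (dif x) <= norm x"
proof -
 show "norm (mid x) <= norm x"
 by (rule power2_le_imp_le) (use norm_mid_dif[of x] in \<open>simp_all\<close>)
 show "norm (dif x) <= norm x"
 by (rule power2_le_imp_le) (use norm_mid_dif[of x] in \<open>simp_all\<close>)
qed

lemma linear_mid: "linear mid" and linear_dif: "linear dif"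
 by (rule linearI; simp add: mid_def dif_def algebra_simps)+

lemma mid_sc: "mid (sc h x) = h *s mid x" and dif_sc: "dif (sc h x) = h *s dif x"
 by (simp_all add: mid_def dif_def vec_eq_iff algebra_simps)

text \<open>In the application \<open>A = G + F\<close>, \<open>D = G - F\<close>, and
  \<open>P\<close>, \<open>Q\<close> are weighted inverses of these. \<open>diss\<close> is the
  dissipation available at \<open>ka = 0\<close>: complete in \<open>mid\<close>, but in
  \<open>dif\<close> only with the factor \<open>py\<close>, which is positive without being bounded
  away from 0 on the half line.\<close>

locale relaxation =
 fixes A D P Q P' Q' :: "real => real^'n::finite^'n" and py :: "real => real" and c0 K0 :: real
 assumes contA: "continuous_on UNIV A" and contD: "continuous_on UNIV D"
 and bdA: "0 <= t ==> norm (A t) <= K0" and bdD: "0 <= t ==> norm (D t) <= K0"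
 and bdP: "0 <= t ==> norm (P t) <= K0" and bdQ: "0 <= t ==> norm (Q t) <= K0"
 and symP: "sym_mat (P t)" and symQ: "sym_mat (Q t)"
 and dP: "0 <= t ==> (P hvd P' t) (at t)" and dQ: "0 <= t ==> (Q hvd Q' t) (at t)"
 and posP: "0 <= t ==> c0 * (norm a)^2 <= a #. cm (P t) a" and posQ: "0 <= t ==> c0 * (norm a)^2 <= a #. cm (Q t) a"
 and diss: "0 <= t ==> c0 * ((norm (mid x))^2 + py t * (norm (dif x))^2) <=
 fst x #. cm (P' t) (fst x) - snd x #. cm (Q' t) (snd x)
 + 2 * (cm (A t) (mid x) #. cm (P t) (fst x)) + 2 * (cm (D t) (mid x) #. cm (Q t) (snd x))"
 and pypos: "0 <= t ==> 0 < py t" and contpy: "continuous_on {0..} py"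
 and c0: "0 < c0" and K0: "0 < K0"
begin

definition B :: "complex => real => 'n cpair => 'n cpair" where
 "B ka t x = (ka *s fst x + cm (A t) (mid x), - (ka *s snd x) - cm (D t) (mid x))"

text \<open>The form \<open>diag(P, - Q)\<close> plus a compensating Hermitian coupling of the two
  components with the imaginary unit. Against the \<open>ka\<close>-part of the generator the
  coupling produces \<open>ro * Im ka * (\<bar>dif\<bar>^2 - \<bar>mid\<bar>^2)\<close>, the control
  of \<open>dif\<close> that \<open>diss\<close> does not provide uniformly.\<close>

definition L :: "real => real => 'n cpair => 'n cpair" where
 "L ro t x = (cm (P t) (fst x) - (ro/4) *R (\<i> *s snd x), (ro/4) *R (\<i> *s fst x) - cm (Q t) (snd x))"

definition dL :: "real => 'n cpair => real" where
 "dL t x = fst x #. cm (P' t) (fst x) - snd x #. cm (Q' t) (snd x)"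

lemma linear_B: "linear (B ka t)"
 by (rule linearI)
 (simp_all add: B_def linear_add[OF linear_mid] linear_cmul[OF linear_mid] cm.add_right cm.scaleR_right
 linear_add[OF bounded_linear.linear[OF bounded_linear_smult]] linear_cmul[OF bounded_linear.linear[OF bounded_linear_smult]]
 algebra_simps)

lemma B_sc: "B ka t (sc h x) = sc h (B ka t x)"
 by (simp add: B_def sc_def mid_sc[unfolded sc_def] cm_smult vec_eq_iff algebra_simps)

lemma cont_B: "continuous_on UNIV (%t. B ka t x)"
 unfolding B_def by (intro continuous_intros cm.continuous_on contA contD)

lemma norm_B: "0 <= t ==> norm (B ka t x) <= 2 * (norm ka + K0) * norm x"
proof -
 assume t: "0 <= t"
 have f: "norm (fst x) <= norm x" and s: "norm (snd x) <= norm x" by (rule norm_fst_le[of "fst x" "snd x", unfolded prod.collapse] norm_snd_le[of "snd x" "fst x", unfolded prod.collapse])+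
 have A: "norm (cm (A t) (mid x)) <= K0 * norm x" by (rule order_trans[OF norm_cm]) (intro mult_mono bdA t norm_mid_le, use K0 in auto)
 have D: "norm (cm (D t) (mid x)) <= K0 * norm x" by (rule order_trans[OF norm_cm]) (intro mult_mono bdD t norm_mid_le, use K0 in auto)
 have k1: "norm (ka *s fst x) <= norm ka * norm x" and k2: "norm (ka *s snd x) <= norm ka * norm x"
 using f s by (auto intro: mult_left_mono)
 have "norm (B ka t x) <= norm (ka *s fst x + cm (A t) (mid x)) + norm (- (ka *s snd x) - cm (D t) (mid x))"
 unfolding B_def by (rule norm_Pair_le)
 moreover have "norm (ka *s fst x + cm (A t) (mid x)) <= norm ka * norm x + K0 * norm x" by (intro norm_triangle_mono k1 A)
 moreover have "norm (- (ka *s snd x) - cm (D t) (mid x)) <= norm ka * norm x + K0 * norm x"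
 by (rule order_trans[OF norm_triangle_ineq4]) (use k2 D in simp)
 ultimately show ?thesis by (simp add: algebra_simps)
qed

lemma deriv_form:
 assumes t: "0 <= t" and d: "(xq hvd xq') (at t)"
 shows "((%t. xq t #. L ro t (xq t)) has_real_derivative dL t (xq t) + 2 * (xq' #. L ro t (xq t))) (at t)"
proof -
 define a b where "a = fst (xq t)" and "b = snd (xq t)"
 define a' b' where "a' = fst xq'" and "b' = snd xq'"
 have da: "((%t. fst (xq t)) hvd a') (at t)" and db: "((%t. snd (xq t)) hvd b') (at t)"
 unfolding a'_def b'_def
 by (rule bounded_linear.has_vector_derivative[OF bounded_linear_fst d] bounded_linear.has_vector_derivative[OF bounded_linear_snd d])+
 note ism = bounded_linear.has_vector_derivative[OF bounded_linear_smult]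
 note rsm = bounded_linear.has_vector_derivative[OF bounded_linear_scaleR_right]
 define L' where "L' = (cm (P t) a' + cm (P' t) a - (ro/4) *R (\<i> *s b'), (ro/4) *R (\<i> *s a') - (cm (Q t) b' + cm (Q' t) b))"
 have dL': "((%t. L ro t (xq t)) hvd L') (at t)"
 unfolding L_def L'_def a_def b_def
 by (intro has_vector_derivative_Pair has_vector_derivative_diff rsm ism da db cm.has_vector_derivative dP dQ t)
 have x: "xq t = (a, b)" "xq' = (a', b')" by (simp_all add: a_def b_def a'_def b'_def)
 have s: "a #. cm (P t) a' = a' #. cm (P t) a" "b #. cm (Q t) b' = b' #. cm (Q t) b"
 using cm_sym[OF symP, of t a a'] cm_sym[OF symQ, of t b b'] by (simp_all add: inner_commute)
 have i: "a #. (\<i> *s b') = - (b' #. (\<i> *s a))" "b #. (\<i> *s a') = - (a' #. (\<i> *s b))"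
 using inner_ii(2)[of a b'] inner_ii(2)[of b a'] by (simp_all add: inner_commute)
 have "(a, b) #. L' = dL t (xq t) + (a', b') #. L ro t (a, b)"
 unfolding L'_def L_def dL_def x
 by (simp add: inner_Pair inner_diff_right inner_add_right s i algebra_simps)
 then show ?thesis using has_real_derivative_inner[OF d dL'] by (simp add: x add.commute)
qed

text \<open>For \<open>\<bar>ro\<bar> <= c0\<close> the coupling is at most \<open>c0 / 2\<close>
  times the squared norm, so it uses up at most half of the definiteness of \<open>P\<close> and
  \<open>Q\<close>.\<close>

lemma form:
 assumes ro: "\<bar>ro\<bar> <= c0"
 shows "complex_form (L ro) dL (c0 / 2) (K0 + c0)"
proof (unfold complex_form_def, rule indefinite_form.intro)
 show "linear (L ro t)" for t
 by (rule linearI) (simp_all add: L_def cm.add_right cm.scaleR_right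
 linear_add[OF bounded_linear.linear[OF bounded_linear_smult]] linear_cmul[OF bounded_linear.linear[OF bounded_linear_smult]]
 algebra_simps)
 show "((%t. xq t #. L ro t (xq t)) has_real_derivative dL t (xq t) + 2 * (xq' #. L ro t (xq t))) (at t)"
 if "0 <= t" "(xq hvd xq') (at t)" for t xq xq' by (rule deriv_form[OF that])
 fix t :: real assume t: "0 <= t"
 have nP: "norm (cm (P t) a) <= K0 * norm a" and nQ: "norm (cm (Q t) a) <= K0 * norm a" for a
 by (rule order_trans[OF norm_cm], intro mult_right_mono bdP bdQ t norm_ge_zero)+
 show "norm (L ro t x) <= (K0 + c0) * norm x" for x
 proof -
 have "L ro t x = (cm (P t) (fst x), - cm (Q t) (snd x)) + (ro/4) *R (- (\<i> *s snd x), \<i> *s fst x)"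
 by (simp add: L_def)
 also have "norm ... <= norm (cm (P t) (fst x), - cm (Q t) (snd x)) + \<bar>ro/4\<bar> * norm (- (\<i> *s snd x), \<i> *s fst x)"
 unfolding norm_scaleR[symmetric] by (rule norm_triangle_ineq)
 also have "norm (cm (P t) (fst x), - cm (Q t) (snd x)) <= K0 * norm x"
 proof (rule power2_le_imp_le)
 have "(norm (cm (P t) (fst x)))^2 + (norm (cm (Q t) (snd x)))^2 <= (K0 * norm (fst x))^2 + (K0 * norm (snd x))^2"
 by (intro add_mono power_mono nP nQ) auto
 then show "(norm (cm (P t) (fst x), - cm (Q t) (snd x)))^2 <= (K0 * norm x)^2"
 by (simp add: norm_Pair power_mult_distrib norm_fst_snd[of x] distrib_left)
 qed (use K0 in simp)
 also have "norm (- (\<i> *s snd x), \<i> *s fst x) = norm x"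
 by (rule power2_eq_imp_eq) (simp_all add: norm_Pair norm_fst_snd[of x])
 also have "K0 * norm x + \<bar>ro/4\<bar> * norm x <= K0 * norm x + c0 * norm x"
 using ro by (intro add_mono mult_right_mono) auto
 finally show ?thesis by (simp add: distrib_right)
 qed
 fix a b :: "complex^'n"
 have q: "(a, b) #. L ro t (a, b) = a #. cm (P t) a - b #. cm (Q t) b + (ro/2) * ((\<i> *s a) #. b)"
 using inner_ii(2)[of a b] by (simp add: L_def inner_diff_right inner_commute algebra_simps)
 have "\<bar>(ro/2) * ((\<i> *s a) #. b)\<bar> <= (c0/2) * (norm a * norm b)"
 unfolding abs_mult using ro Cauchy_Schwarz_ineq2[of "\<i> *s a" b] c0 by (intro mult_mono) auto
 also have "... <= (c0/2) * ((norm a)^2 + (norm b)^2)"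
 proof -
 have "0 <= norm a * norm b" by simp
 then have "norm a * norm b <= (norm a)^2 + (norm b)^2"
 using sum_squares_bound[of "norm a" "norm b"] by linarith
 then show ?thesis using c0 by (intro mult_left_mono) simp_all
 qed
 finally have r: "\<bar>(ro/2) * ((\<i> *s a) #. b)\<bar> <= (c0/2) * ((norm a)^2 + (norm b)^2)" .
 have uP: "a #. cm (P t) a <= K0 * (norm a)^2" and uQ: "a #. cm (Q t) a <= K0 * (norm a)^2" for a
 using norm_cauchy_schwarz[of a "cm (P t) a"] norm_cauchy_schwarz[of a "cm (Q t) a"]
 mult_left_mono[OF nP[of a], of "norm a"] mult_left_mono[OF nQ[of a], of "norm a"] by (auto simp: power2_eq_square algebra_simps)
 have nn: "0 <= c0 * (norm b)^2" "0 <= c0 * (norm a)^2" using c0 by simp_all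
 show "c0 / 2 * (norm a)^2 - (K0 + c0) * (norm b)^2 <= (a, b) #. L ro t (a, b)"
 using r posP[OF t, of a] uQ[of b] nn unfolding q abs_le_iff by (simp add: algebra_simps)
 show "(a, b) #. L ro t (a, b) <= (K0 + c0) * (norm a)^2 - c0 / 2 * (norm b)^2"
 using r posQ[OF t, of b] uP[of a] nn unfolding q abs_le_iff by (simp add: algebra_simps)
next
 show "0 < c0 / 2" "0 < K0 + c0" using c0 K0 by simp_all
qed

text \<open>Four sources: the dissipation at \<open>ka = 0\<close>; the real part of
  \<open>ka\<close>, which meets the positive matrices \<open>P\<close> and \<open>Q\<close> because
  the sign changes of \<open>B\<close> and \<open>L\<close> in the second component cancel; the
  imaginary part of \<open>ka\<close> through the coupling; and the coupling against the zero-order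
  terms, an error proportional to \<open>\<bar>ro\<bar>\<close>.\<close>

lemma generator_form:
 assumes t: "0 <= t" and si: "0 <= Re ka"
 shows "dL t x + 2 * (B ka t x #. L ro t x) >= c0 * ((norm (mid x))^2 + py t * (norm (dif x))^2)
 + 4 * Re ka * c0 * ((norm (mid x))^2 + (norm (dif x))^2)
 + ro * Im ka * ((norm (dif x))^2 - (norm (mid x))^2)
 - \<bar>ro\<bar> * K0 * ((norm (mid x))^2 + norm (mid x) * norm (dif x))"
proof -
 define a b v where "a = fst x" and "b = snd x" and "v = mid x"
 have ib: "(ka *s a) #. (\<i> *s b) + (ka *s b) #. (\<i> *s a) = 2 * Im ka * (a #. b)"
 unfolding inner_smult_left[of ka] inner_ii(1) using inner_ii(2)[of a b]
 by (simp add: inner_commute[of b] algebra_simps)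
 define E where "E = cm (A t) v #. (\<i> *s b) + cm (D t) v #. (\<i> *s a)"
 have e: "B ka t x #. L ro t x = Re ka * (a #. cm (P t) a) + cm (A t) v #. cm (P t) a
 + Re ka * (b #. cm (Q t) b) + cm (D t) v #. cm (Q t) b - (ro/4) * (2 * Im ka * (a #. b)) - (ro/4) * E"
 unfolding B_def L_def a_def[symmetric] b_def[symmetric] v_def[symmetric] ib[symmetric] E_def
 by (simp add: inner_add_left inner_diff_left inner_diff_right inner_add_right inner_smult_cm[OF symP] inner_smult_cm[OF symQ] algebra_simps)
 have nA: "norm (cm (A t) v) <= K0 * norm v" and nD: "norm (cm (D t) v) <= K0 * norm v"
 by (rule order_trans[OF norm_cm], intro mult_right_mono bdA bdD t norm_ge_zero)+
 have na: "norm a <= norm v + norm (dif x)" and nb: "norm b <= norm v + norm (dif x)"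
 unfolding a_def b_def v_def fst_mid_dif[of x] snd_mid_dif[of x] by (rule norm_triangle_ineq norm_triangle_ineq4)+
 have "\<bar>cm (A t) v #. (\<i> *s b)\<bar> <= (K0 * norm v) * (norm v + norm (dif x))"
 by (rule order_trans[OF Cauchy_Schwarz_ineq2]) (intro mult_mono nA, use nb K0 in auto)
 moreover have "\<bar>cm (D t) v #. (\<i> *s a)\<bar> <= (K0 * norm v) * (norm v + norm (dif x))"
 by (rule order_trans[OF Cauchy_Schwarz_ineq2]) (intro mult_mono nD, use na K0 in auto)
 ultimately have "\<bar>E\<bar> <= 2 * ((K0 * norm v) * (norm v + norm (dif x)))" unfolding E_def by linarith
 then have "\<bar>ro\<bar> * \<bar>E\<bar> <= \<bar>ro\<bar> * (2 * ((K0 * norm v) * (norm v + norm (dif x))))" by (intro mult_left_mono) auto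
 moreover have "ro * E <= \<bar>ro\<bar> * \<bar>E\<bar>" by (simp flip: abs_mult)
 ultimately have E: "(ro/2) * E <= \<bar>ro\<bar> * K0 * ((norm v)^2 + norm v * norm (dif x))"
 by (simp add: power2_eq_square algebra_simps)
 have "Re ka * (c0 * (norm a)^2 + c0 * (norm b)^2) <= Re ka * (a #. cm (P t) a + b #. cm (Q t) b)"
 by (intro mult_left_mono add_mono posP posQ t si)
 moreover have "c0 * (norm a)^2 + c0 * (norm b)^2 = 2 * c0 * ((norm v)^2 + (norm (dif x))^2)"
 proof -
 have "c0 * (norm a)^2 + c0 * (norm b)^2 = c0 * (norm x)^2"
 unfolding norm_fst_snd[of x] a_def b_def by (rule distrib_left[symmetric])
 then show ?thesis unfolding norm_mid_dif[of x] v_def by simp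
 qed
 ultimately have p: "2 * Re ka * c0 * ((norm v)^2 + (norm (dif x))^2) <= Re ka * (a #. cm (P t) a) + Re ka * (b #. cm (Q t) b)"
 by (simp add: algebra_simps)
 have ab: "a #. b = (norm v)^2 - (norm (dif x))^2" unfolding a_def b_def v_def by (rule inner_fst_snd)
 show ?thesis
 using diss[OF t, of x] p E unfolding e dL_def ab a_def[symmetric] b_def[symmetric] v_def[symmetric]
 by (simp add: algebra_simps)
qed

text \<open>Choosing \<open>ro\<close> proportional to \<open>Im ka\<close> gives \<open>dif\<close>
  a rate of order \<open>(Im ka)^2\<close>, paid for with a small part of the dissipation in
  \<open>mid\<close>; a positive real part of \<open>ka\<close> gives such a rate directly.\<close>

lemma strict_nonzero:
 assumes si: "0 <= Re ka" and ka: "ka ~= 0"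
 shows "EX ro e. \<bar>ro\<bar> <= c0 & indefinite_form.strict (L ro) dL (B ka) e (2 * (norm ka + K0))"
proof -
 define ta where "ta = Im ka"
 define G where "G = ta^2 + \<bar>ta\<bar> * K0 + K0^2 + 1"
 have G: "0 < G" "ta^2 + \<bar>ta\<bar> * K0 + K0^2 / 2 <= G"
 using K0 by (auto simp: G_def add_nonneg_pos)
 \<comment> \<open>The first bound keeps \<open>\<bar>ro\<bar> <= c0\<close>; the second keeps the
   losses in \<open>mid\<close>, whose coefficients are collected in \<open>G\<close>, below
   \<open>c0 / 2\<close>.\<close>
 define \<delta> where "\<delta> = min (c0 / (\<bar>ta\<bar> + 1)) (c0 / (2 * G))"
 have \<delta>: "0 < \<delta>" using c0 G by (simp add: \<delta>_def)
 define ro where "ro = \<delta> * ta"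
 have "\<bar>ta\<bar> * (c0 / (\<bar>ta\<bar> + 1)) <= c0" using c0 by (simp add: field_simps)
 moreover have "\<bar>ro\<bar> <= \<bar>ta\<bar> * (c0 / (\<bar>ta\<bar> + 1))"
 proof -
 have "\<bar>ro\<bar> = \<bar>ta\<bar> * \<delta>" using \<delta> by (simp add: ro_def abs_mult)
 moreover have "\<bar>ta\<bar> * \<delta> <= \<bar>ta\<bar> * (c0 / (\<bar>ta\<bar> + 1))"
 unfolding \<delta>_def by (intro mult_left_mono min.cobounded1) simp
 ultimately show ?thesis by simp
 qed
 ultimately have ro: "\<bar>ro\<bar> <= c0" by simp
 interpret F: complex_form "L ro" dL "c0 / 2" "K0 + c0" by (rule form[OF ro])
 \<comment> \<open>The rates left in \<open>mid\<close> and \<open>dif\<close>. Half of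
   \<open>\<delta> * ta^2\<close> is spent on the mixed term; the rest is positive since
   \<open>ta\<close> and \<open>Re ka\<close> do not both vanish.\<close>
 define e where "e = min (c0 / 2) (\<delta> * ta^2 / 2 + 4 * Re ka * c0)"
 have "ta ~= 0 \<or> 0 < Re ka" using ka si by (auto simp: ta_def complex_eq_iff)
 then have e: "0 < e"
 proof
 assume "ta ~= 0"
 then have "0 < \<delta> * ta^2 / 2" using \<delta> by simp
 moreover have "0 <= 4 * Re ka * c0" using si c0 by simp
 ultimately have "0 < \<delta> * ta^2 / 2 + 4 * Re ka * c0" by linarith
 then show ?thesis using c0 unfolding e_def by simp
 next
 assume "0 < Re ka"
 then have "0 < 4 * Re ka * c0" using c0 by simp
 moreover have "0 <= \<delta> * ta^2 / 2" using \<delta> by simp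
 ultimately have "0 < \<delta> * ta^2 / 2 + 4 * Re ka * c0" by linarith
 then show ?thesis using c0 unfolding e_def by simp
 qed
 have "F.strict (B ka) (e / 2) (2 * (norm ka + K0))"
 unfolding F.strict_def
 proof (intro conjI allI impI)
 show "0 < e / 2" "0 <= 2 * (norm ka + K0)" using e K0 by simp_all
 fix t :: real and x :: "'n cpair" assume t: "0 <= t"
 show "norm (B ka t x) <= 2 * (norm ka + K0) * norm x" by (rule norm_B[OF t])
 define v u where "v = (norm (mid x))^2" and "u = (norm (dif x))^2"
 have vu: "0 <= v" "0 <= u" by (simp_all add: v_def u_def)
 have "2 * ((K0 * norm (mid x)) * (\<bar>ta\<bar> * norm (dif x))) <= (K0 * norm (mid x))^2 + (\<bar>ta\<bar> * norm (dif x))^2"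
 using sum_squares_bound[of "K0 * norm (mid x)" "\<bar>ta\<bar> * norm (dif x)"] by (simp add: mult.assoc)
 then have "\<bar>ta\<bar> * K0 * (norm (mid x) * norm (dif x)) <= K0^2 / 2 * v + ta^2 / 2 * u"
 by (simp add: v_def u_def power_mult_distrib algebra_simps)
 from mult_left_mono[OF this less_imp_le[OF \<delta>]]
 have 1: "\<bar>ro\<bar> * K0 * (norm (mid x) * norm (dif x)) <= \<delta> * (K0^2 / 2) * v + \<delta> * (ta^2 / 2) * u"
 using \<delta> by (simp add: ro_def abs_mult algebra_simps)
 have "\<delta> * (ta^2 + \<bar>ta\<bar> * K0 + K0^2 / 2) <= (c0 / (2 * G)) * G"
 using \<delta> G K0 by (intro mult_mono) (auto simp: \<delta>_def)
 then have "\<delta> * (ta^2 + \<bar>ta\<bar> * K0 + K0^2 / 2) <= c0 / 2" using G by simp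
 from mult_right_mono[OF this vu(1)]
 have 2: "\<delta> * ta^2 * v + \<bar>ro\<bar> * K0 * v + \<delta> * (K0^2 / 2) * v <= c0 / 2 * v"
 using \<delta> by (simp add: ro_def abs_mult algebra_simps)
 have 3: "0 <= py t * u" using pypos[OF t] vu by simp
 have "0 <= c0 * (py t * u)" using 3 c0 by simp
 moreover have "0 <= 4 * Re ka * c0 * v" using si c0 vu by simp
 moreover have "ro * Im ka * (u - v) = \<delta> * ta^2 * u - \<delta> * ta^2 * v"
 by (simp add: ro_def ta_def power2_eq_square algebra_simps)
 ultimately have "dL t x + 2 * (B ka t x #. L ro t x) >= c0 / 2 * v + (\<delta> * ta^2 / 2 + 4 * Re ka * c0) * u"
 using generator_form[OF t si, of x ro] 1 2 unfolding v_def[symmetric] u_def[symmetric]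
 by (simp add: algebra_simps)
 moreover have "e * v <= c0 / 2 * v" "e * u <= (\<delta> * ta^2 / 2 + 4 * Re ka * c0) * u"
 unfolding e_def by (intro mult_right_mono min.cobounded1 min.cobounded2 vu)+
 moreover have "e / 2 * (norm x)^2 = e * v + e * u" using norm_mid_dif[of x] by (simp add: v_def u_def algebra_simps)
 ultimately show "e / 2 * (norm x)^2 <= dL t x + 2 * (B ka t x #. L ro t x)" by linarith
 qed
 then show ?thesis using ro by blast
qed

definition E :: "'n cpair => 'n cpair" where "E x = (fst x, - snd x)"

lemma norm_E [simp]: "norm (E x) = norm x"
 by (rule power2_eq_imp_eq) (simp_all add: E_def norm_Pair norm_fst_snd[of x])

lemma linear_E: "linear E"
 by (rule linearI) (simp_all add: E_def)

lemma E_sc: "E (sc h x) = sc h (E x)"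
 by (simp add: E_def sc_def vec_eq_iff)

lemma B_split: "B ka t x = B 0 t x + sc ka (E x)"
 by (simp add: B_def E_def sc_def algebra_simps)

lemma norm_B_diff: "norm (B ka' t x - B ka t x) = norm (ka' - ka) * norm x"
proof -
 have "B ka' t x - B ka t x = sc (ka' - ka) (E x)"
 unfolding B_split[of ka'] B_split[of ka] by (simp add: sc_def vec_eq_iff algebra_simps)
 then show ?thesis by simp
qed

lemma uhol_B:
 assumes r: "0 < r" "r <= 1/2"
 shows "uhol (ball z r) B"
proof -
 have U: "norm (y - x) <= 1" if "x : ball z r" "y : ball z r" for x y
 proof -
 have "dist y x < 2 * r" using dist_triangle_half_r[of z y "2*r" x] that by (simp add: dist_commute)
 then show "norm (y - x) <= 1" using r(2) by (simp add: dist_norm)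
 qed
 have "uhol (ball z (2 * r / 2)) (%ka t x. sc ka x)" by (rule uhol_sc) (use r in \<open>auto intro: holomorphic_intros\<close>)
 then have s: "uhol (ball z r) (%ka t. sc ka)" by simp
 have e: "uhol (ball z r) (%ka t. E)"
 by (rule uhol_const[where K = 1]) (simp_all add: linear_E E_sc)
 have b: "uhol (ball z r) (%ka. B 0)"
 by (rule uhol_const[where K = "2 * (norm (0::complex) + K0)"]) (use K0 in \<open>simp_all only: linear_B norm_B B_sc, simp\<close>)
 show ?thesis using uhol_add[OF b uhol_comp[OF s e U]] by (simp add: B_split[symmetric])
qed

definition decays :: "complex => (real => 'n cpair) => bool" where
 "decays ka xq \<longleftrightarrow> (ALL t. (xq hvd B ka t (xq t)) (at t)) & (xq ---> 0) at_top"

text \<open>The parameter \<open>ro\<close> is frozen at \<open>ka0\<close>, and strictness is an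
  open condition, so one form serves a whole disc. The disc also contains points with negative real
  part when \<open>ka0\<close> is imaginary, which is what analyticity on the closed half plane
  demands.\<close>

theorem graph_nonzero:
 assumes si: "0 <= Re ka0" and ka0: "ka0 ~= 0"
 shows "EX r>0. EX R. (ALL i j. (%ka. R ka $ i $ j) holomorphic_on ball ka0 r) &
 (ALL ka:ball ka0 r. ALL x. (EX xq. xq 0 = x & decays ka xq) \<longleftrightarrow> fst x = R ka *v snd x)"
proof -
 obtain ro e where ro: "\<bar>ro\<bar> <= c0" and st: "indefinite_form.strict (L ro) dL (B ka0) e (2 * (norm ka0 + K0))"
 using strict_nonzero[OF si ka0] by blast
 interpret F: complex_form "L ro" dL "c0 / 2" "K0 + c0" by (rule form[OF ro])
 note e = F.strictD(1)[OF st]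
 define r where "r = min (1/2) (e / (4 * (K0 + c0)))"
 have "0 < 4 * (K0 + c0)" using c0 K0 by simp
 moreover have "r <= e / (4 * (K0 + c0))" unfolding r_def by simp
 ultimately have "r * (4 * (K0 + c0)) <= e" by (simp only: pos_le_divide_eq)
 then have r: "0 < r" "r <= 1/2" "4 * r * (K0 + c0) <= e"
 proof -
 show "0 < r" "r <= 1/2" using e c0 K0 unfolding r_def by (simp_all only: min_less_iff_conj min.cobounded1, simp)
 have "4 * r * (K0 + c0) = r * (4 * (K0 + c0))" by (simp add: algebra_simps)
 then show "4 * r * (K0 + c0) <= e" using \<open>r * (4 * (K0 + c0)) <= e\<close> by (simp only:)
 qed
 have st': "F.strict (B ka) (e / 2) (2 * (norm ka0 + K0) + r)" if "ka : ball ka0 r" for ka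
 by (rule F.strict_perturb[OF st]) (use r that in \<open>auto simp: norm_B_diff dist_norm norm_minus_commute intro!: mult_right_mono\<close>)
 obtain R where R: "ALL i j. (%ka. R ka $ i $ j) holomorphic_on ball ka0 r" "ALL ka:ball ka0 r. F.decaying_graph (B ka) (R ka)"
 using F.holomorphic_graph[OF uhol_B[OF r(1,2)] st' cont_B open_ball] by blast
 have "(EX xq. xq 0 = x & decays ka xq) \<longleftrightarrow> fst x = R ka *v snd x" if ka: "ka : ball ka0 r" for ka x
 proof
 assume "EX xq. xq 0 = x & decays ka xq"
 then obtain xq where xq: "xq 0 = x" "!!t. (xq hvd B ka t (xq t)) (at t)" "(xq ---> 0) at_top"
 unfolding decays_def by blast
 obtain S where S: "!!t. 0 <= t ==> norm (xq t) <= S" using bounded_on_half_line[OF xq(2,3)] by blast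
 from F.bounded_solution_in_graph[OF st'[OF ka] linear_B R(2)[rule_format, OF ka] xq(2) S]
 show "fst x = R ka *v snd x" by (simp add: xq(1))
 next
 assume x: "fst x = R ka *v snd x"
 obtain xq where xq: "xq 0 = (R ka *v snd x, snd x)" "!!t. (xq hvd B ka t (xq t)) (at t)"
 "!!t. 0 <= t ==> xq t #. L ro t (xq t) <= 0"
 using R(2)[rule_format, OF ka] unfolding F.decaying_graph_def by blast
 define N where "N = F.rate (e / 2) (2 * (norm ka0 + K0) + r)"
 have N: "1 <= N" unfolding N_def by (rule F.rate_ge_1) (use F.strictD(1,2)[OF st'[OF ka]] in simp_all)
 have "(xq ---> 0) at_top"
 by (rule exp_bound_tendsto_0[OF F.nonpositive_curve_decay[OF st'[OF ka] xq(2,3)]]) (use N in \<open>simp_all add: N_def\<close>)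
 then have "decays ka xq" unfolding decays_def using xq(2) by blast
 moreover have "xq 0 = x" unfolding xq(1) by (rule prod_eqI) (simp_all add: x)
 ultimately show "EX xq. xq 0 = x & decays ka xq" by (intro exI conjI)
 qed
 then show ?thesis using r(1) R(1) by blast
qed

end

section \<open>Exponential conjugation at an end state, near the origin\<close>

text \<open>The generator with the constant coefficients of an end state.\<close>

definition bop :: "real^'n::finite^'n => real^'n^'n => complex => 'n cpair => 'n cpair" where
 "bop A D ka x = (ka *s fst x + cm A (mid x), - (ka *s snd x) - cm D (mid x))"

definition diagop :: "real^'n::finite^'n => real^'n^'n => 'n cpair => 'n cpair" where
 "diagop P Q x = (cm P (fst x), - cm Q (snd x))"

text \<open>The bracket is of order \<open>et * t * exp (tq / 2 * t)\<close>, and the factor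
  \<open>t\<close> is absorbed by another quarter of the rate. The factor \<open>et\<close> in front
  is essential: the gain from the conjugation is also only of order \<open>et\<close>.\<close>

lemma exp_shift_bound:
 fixes t et tq :: real
 assumes t: "0 <= t" and et: "0 < et" "4 * et <= tq"
 shows "exp (- tq * t) * \<bar>exp (- (2 * et * t)) - 1\<bar> <= et * (8 / tq) * exp (- (tq / 4) * t)"
 and "exp (- tq * t) * \<bar>exp (2 * et * t) - 1\<bar> <= et * (8 / tq) * exp (- (tq / 4) * t)"
proof -
 let ?y = "2 * et * t"
 have tq: "0 < tq" using et by simp
 have y: "0 <= ?y" using t et by simp
 have p: "exp ?y - 1 <= ?y * exp ?y"
 proof -
 have "(1 + - ?y) * exp ?y <= exp (- ?y) * exp ?y" by (intro mult_right_mono exp_ge_add_one_self) simp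
 then show ?thesis by (simp add: exp_minus algebra_simps)
 qed
 have "exp ?y <= exp (tq / 2 * t)" using mult_right_mono[OF et(2) t] by simp
 then have p2: "?y * exp ?y <= ?y * exp (tq / 2 * t)" using y by (rule mult_left_mono)
 have m: "1 - exp (- ?y) <= ?y * exp (tq / 2 * t)"
 proof -
 have "1 - exp (- ?y) <= ?y" using exp_ge_add_one_self[of "- ?y"] by simp
 also have "... <= ?y * exp (tq / 2 * t)" using y tq t by (simp add: mult_le_cancel_left1)
 finally show ?thesis .
 qed
 have k: "exp (- tq * t) * (?y * exp (tq / 2 * t)) <= et * (8 / tq) * exp (- (tq / 4) * t)"
 proof -
 have "tq / 4 * t <= exp (tq / 4 * t)" using exp_ge_add_one_self[of "tq / 4 * t"] by linarith
 then have "t <= (4 / tq) * exp (tq / 4 * t)" using tq by (simp add: field_simps)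
 then have "2 * et * t <= 2 * et * ((4 / tq) * exp (tq / 4 * t))" using et by (intro mult_left_mono) auto
 then have "?y <= et * (8 / tq) * exp (tq / 4 * t)" by (simp add: mult_ac)
 then have "exp (- tq * t) * (?y * exp (tq / 2 * t)) <= exp (- tq * t) * ((et * (8 / tq) * exp (tq / 4 * t)) * exp (tq / 2 * t))"
 by (intro mult_left_mono mult_right_mono) auto
 also have "... = et * (8 / tq) * (exp (- tq * t) * exp (tq / 4 * t) * exp (tq / 2 * t))" by simp
 also have "exp (- tq * t) * exp (tq / 4 * t) * exp (tq / 2 * t) = exp (- (tq / 4) * t)"
 by (simp add: exp_add[symmetric] field_simps)
 finally show ?thesis .
 qed
 have "\<bar>exp (- ?y) - 1\<bar> = 1 - exp (- ?y)" "\<bar>exp ?y - 1\<bar> = exp ?y - 1" using y by simp_all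
 then show "exp (- tq * t) * \<bar>exp (- ?y) - 1\<bar> <= et * (8 / tq) * exp (- (tq / 4) * t)"
 and "exp (- tq * t) * \<bar>exp ?y - 1\<bar> <= et * (8 / tq) * exp (- (tq / 4) * t)"
 using order_trans[OF mult_left_mono[OF m, of "exp (- tq * t)"] k]
 order_trans[OF mult_left_mono[OF order_trans[OF p p2], of "exp (- tq * t)"] k] by simp_all
qed

lemma norm_pair_const: "norm (u, - u) <= 2 * norm u" "norm (u, u) <= 2 * norm u"
 using norm_Pair_le[of u "- u"] norm_Pair_le[of u u] by simp_all

text \<open>\<open>Pr ka\<close> projects onto the slow modes that do not decay; it commutes with
  the limit generator and is holomorphic through \<open>ka = 0\<close>. The assumption
  \<open>pos\<close> concerns pairs \<open>(u, - u)\<close>, on which the limit generator at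
  \<open>ka = 0\<close> vanishes: adding \<open>et * (2 Pr - 1)\<close> to the generator makes the
  limit form grow there at a rate proportional to \<open>et\<close>.\<close>

locale relaxation_end = relaxation A D P Q P' Q' py c0 K0
 for A D P Q P' Q' :: "real => real^'n::finite^'n" and py c0 K0 +
 fixes Ai Di Pi Qi :: "real^'n^'n" and tq K1 r0 c1 :: real and Pr :: "complex => 'n cpair => 'n cpair"
 assumes tq: "0 < tq" and K1: "0 <= K1"
 and convA: "0 <= t ==> norm (A t - Ai) <= K1 * exp (- tq * t)"
 and convD: "0 <= t ==> norm (D t - Di) <= K1 * exp (- tq * t)"
 and convP: "(P ---> Pi) at_top" and convQ: "(Q ---> Qi) at_top"
 and r0: "0 < r0" "r0 <= 1/2" and uhPr: "uhol (ball 0 r0) (%ka t. Pr ka)"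
 and idem: "ka : ball 0 r0 ==> Pr ka (Pr ka x) = Pr ka x"
 and comm: "ka : ball 0 r0 ==> Pr ka (bop Ai Di ka x) = bop Ai Di ka (Pr ka x)"
 and c1: "0 < c1" and pos: "c1 * (norm u)^2 <= (2 *R Pr 0 (u, - u) - (u, - u)) #. diagop Pi Qi (u, - u)"
begin

definition N :: "real => 'n cpair => 'n cpair" where
 "N t x = (cm (A t - Ai) (mid x), - cm (D t - Di) (mid x))"

lemma B_N: "B ka t x = bop Ai Di ka x + N t x"
 by (simp add: B_def bop_def N_def cm.diff_left)

lemma linear_N: "linear (N t)"
 by (rule linearI) (simp_all add: N_def linear_add[OF linear_mid] linear_cmul[OF linear_mid] cm.add_right cm.scaleR_right)

lemma linear_bop: "linear (bop Ai Di ka)"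
proof -
 have "bop Ai Di ka = (%x. B ka 0 x - N 0 x)" by (simp add: B_N fun_eq_iff)
 then show ?thesis by (simp add: linear_compose_sub linear_B linear_N)
qed

lemma N_sc: "N t (sc h x) = sc h (N t x)"
 by (simp add: N_def mid_sc cm_smult) (simp add: sc_def vec_eq_iff)

lemma norm_N: "0 <= t ==> norm (N t x) <= 2 * K1 * exp (- tq * t) * norm x"
proof -
 assume t: "0 <= t"
 have "norm (cm (A t - Ai) (mid x)) <= (K1 * exp (- tq * t)) * norm x"
 by (rule order_trans[OF norm_cm]) (intro mult_mono convA t norm_mid_le, use K1 in auto)
 moreover have "norm (cm (D t - Di) (mid x)) <= (K1 * exp (- tq * t)) * norm x"
 by (rule order_trans[OF norm_cm]) (intro mult_mono convD t norm_mid_le, use K1 in auto)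
 ultimately show ?thesis using norm_Pair_le[of "cm (A t - Ai) (mid x)" "- cm (D t - Di) (mid x)"]
 by (simp add: N_def)
qed

lemma cont_N: "continuous_on UNIV f ==> continuous_on UNIV (%t. N t (f t))"
 unfolding N_def mid_def
 by (intro continuous_intros cm.continuous_on contA contD continuous_on_fst continuous_on_snd)

definition Co :: "complex => 'n cpair => 'n cpair" where "Co ka x = x - Pr ka x"

lemma linear_Pr: "linear (Pr ka)" using uholD(1)[OF uhPr] .
lemma linear_Co: "linear (Co ka)"
 unfolding Co_def[abs_def] by (intro linear_compose_sub linear_ident linear_Pr)

lemmas lin_simps = linear_add[OF linear_Pr] linear_diff[OF linear_Pr] linear_cmul[OF linear_Pr] linear_0[OF linear_Pr]
 linear_add[OF linear_Co] linear_diff[OF linear_Co] linear_cmul[OF linear_Co] linear_0[OF linear_Co]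
 linear_add[OF linear_N] linear_diff[OF linear_N] linear_cmul[OF linear_N] linear_0[OF linear_N]
 linear_add[OF linear_bop] linear_diff[OF linear_bop] linear_cmul[OF linear_bop] linear_0[OF linear_bop]

lemma Pr_Co: "ka : ball 0 r0 ==> Pr ka (Co ka x) = 0" and Co_Pr: "ka : ball 0 r0 ==> Co ka (Pr ka x) = 0"
 and Co_Co: "ka : ball 0 r0 ==> Co ka (Co ka x) = Co ka x"
 by (simp_all add: Co_def lin_simps idem)

lemma comm_Co: "ka : ball 0 r0 ==> Co ka (bop Ai Di ka x) = bop Ai Di ka (Co ka x)"
 by (simp add: Co_def lin_simps comm)

lemma Pr_plus_Co: "Pr ka x + Co ka x = x" by (simp add: Co_def)

text \<open>The generator of the curves \<open>Zt et ka t (xq t)\<close>, where \<open>Zt\<close>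
  weights the range of \<open>Pr\<close> by \<open>exp (et * t)\<close> and its complement by
  \<open>exp (- (et * t))\<close>. Since \<open>Pr\<close> commutes with the limit generator, only
  the blocks of \<open>N\<close> that map one part into the other acquire exponential factors; the
  last bracket is their change.\<close>

definition Bt :: "real => complex => real => 'n cpair => 'n cpair" where
 "Bt et ka t x = B ka t x + et *R (2 *R Pr ka x - x)
 + (Co ka ((exp (- (2 * et * t)) - 1) *R N t (Pr ka x)) + Pr ka ((exp (2 * et * t) - 1) *R N t (Co ka x)))"

definition Zt :: "real => complex => real => 'n cpair => 'n cpair" where
 "Zt et ka t x = exp (et * t) *R Pr ka x + exp (- (et * t)) *R Co ka x"

lemma Zt_inverse: "ka : ball 0 r0 ==> Zt et ka t (Zt (- et) ka t x) = x"
 by (simp add: Zt_def lin_simps idem Pr_Co Co_Pr Co_Co Pr_plus_Co exp_add[symmetric])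

lemma Zt_0: "Zt et ka 0 x = x" by (simp add: Zt_def Pr_plus_Co)

lemma shifted_solution:
 assumes ka: "ka : ball 0 r0" and d: "(xq hvd B ka t (xq t)) (at t)"
 shows "((%t. Zt et ka t (xq t)) hvd Bt et ka t (Zt et ka t (xq t))) (at t)"
proof -
 define p s where "p = Pr ka (xq t)" and "s = Co ka (xq t)"
 define e i where "e = exp (et * t)" and "i = exp (- (et * t))"
 have ei: "e * i = 1" "exp (2 * et * t) = e * e" "exp (- (2 * et * t)) = i * i"
 by (simp_all add: e_def i_def exp_add[symmetric])
 have cc: "(i * i - 1) * e = i - e" "(e * e - 1) * i = e - i"
 using ei(1) by (simp_all add: left_diff_distrib) (metis mult.assoc mult.commute mult_1)+
 have ps: "Pr ka p = p" "Pr ka s = 0" "Co ka p = 0" "Co ka s = s" "xq t = p + s"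
 using ka by (simp_all add: p_def s_def idem Pr_Co Co_Pr Co_Co Pr_plus_Co)
 define n1 n2 m1 m2 where "n1 = Pr ka (N t p)" and "n2 = Co ka (N t p)" and "m1 = Pr ka (N t s)" and "m2 = Co ka (N t s)"
 have Np: "N t p = n1 + n2" and Ns: "N t s = m1 + m2" by (simp_all add: n1_def n2_def m1_def m2_def Pr_plus_Co)
 have nm: "Pr ka n1 = n1" "Pr ka n2 = 0" "Co ka n1 = 0" "Co ka n2 = n2" "Pr ka m1 = m1" "Pr ka m2 = 0" "Co ka m1 = 0" "Co ka m2 = m2"
 using ka by (simp_all add: n1_def n2_def m1_def m2_def idem Pr_Co Co_Pr Co_Co)
 have PB: "Pr ka (B ka t (xq t)) = bop Ai Di ka p + n1 + m1" and CB: "Co ka (B ka t (xq t)) = bop Ai Di ka s + n2 + m2"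
 unfolding B_N ps(5) by (simp_all add: lin_simps comm[OF ka] comm_Co[OF ka] ps n1_def n2_def m1_def m2_def)
 have dP: "((%t. Pr ka (xq t)) hvd Pr ka (B ka t (xq t))) (at t)"
 and dC: "((%t. Co ka (xq t)) hvd Co ka (B ka t (xq t))) (at t)"
 using bounded_linear.has_vector_derivative[OF linear_conv_bounded_linear[THEN iffD1, OF linear_Pr] d]
 bounded_linear.has_vector_derivative[OF linear_conv_bounded_linear[THEN iffD1, OF linear_Co] d] by auto
 have de: "((%t. exp (et * t)) has_real_derivative et * e) (at t)" and di: "((%t. exp (- (et * t))) has_real_derivative - et * i) (at t)"
 unfolding e_def i_def by (auto intro!: derivative_eq_intros)
 have der: "((%t. Zt et ka t (xq t)) has_vector_derivative
 (e *R Pr ka (B ka t (xq t)) + (et * e) *R p) + (i *R Co ka (B ka t (xq t)) + (- et * i) *R s)) (at t)"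
 unfolding Zt_def p_def s_def e_def i_def
 by (intro has_vector_derivative_add has_vector_derivative_scaleR dP dC de[unfolded e_def] di[unfolded i_def])
 have Z: "Zt et ka t (xq t) = e *R p + i *R s" by (simp add: Zt_def p_def s_def e_def i_def)
 have "Bt et ka t (Zt et ka t (xq t)) = e *R (bop Ai Di ka p + n1 + n2) + i *R (bop Ai Di ka s + m1 + m2)
 + et *R (e *R p - i *R s) + ((i * i - 1) * e) *R n2 + ((e * e - 1) * i) *R m1"
 unfolding Bt_def Z B_N ei(2,3)
 by (simp add: lin_simps ps Np Ns nm) (simp add: algebra_simps, simp flip: scaleR_add_left)
 also have "... = (e *R Pr ka (B ka t (xq t)) + (et * e) *R p) + (i *R Co ka (B ka t (xq t)) + (- et * i) *R s)"
 unfolding cc PB CB by (simp add: algebra_simps)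
 finally show ?thesis using der by simp
qed

lemma unshifted_solution:
 assumes ka: "ka : ball 0 r0" and d: "(ze hvd Bt et ka t (ze t)) (at t)"
 shows "((%t. Zt (- et) ka t (ze t)) hvd B ka t (Zt (- et) ka t (ze t))) (at t)"
proof -
 define p s where "p = Pr ka (ze t)" and "s = Co ka (ze t)"
 define e i where "e = exp (et * t)" and "i = exp (- (et * t))"
 have ei: "e * i = 1" "exp (2 * et * t) = e * e" "exp (- (2 * et * t)) = i * i"
 by (simp_all add: e_def i_def exp_add[symmetric])
 have cc: "e * (i * i) = i" "i * (e * e) = e"
 using ei(1) by (metis mult.assoc mult.commute mult_1)+
 have ps: "Pr ka p = p" "Pr ka s = 0" "Co ka p = 0" "Co ka s = s" "ze t = p + s"
 using ka by (simp_all add: p_def s_def idem Pr_Co Co_Pr Co_Co Pr_plus_Co)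
 define n1 n2 m1 m2 where "n1 = Pr ka (N t p)" and "n2 = Co ka (N t p)" and "m1 = Pr ka (N t s)" and "m2 = Co ka (N t s)"
 have Np: "N t p = n1 + n2" and Ns: "N t s = m1 + m2" by (simp_all add: n1_def n2_def m1_def m2_def Pr_plus_Co)
 have nm: "Pr ka n1 = n1" "Pr ka n2 = 0" "Co ka n1 = 0" "Co ka n2 = n2" "Pr ka m1 = m1" "Pr ka m2 = 0" "Co ka m1 = 0" "Co ka m2 = m2"
 using ka by (simp_all add: n1_def n2_def m1_def m2_def idem Pr_Co Co_Pr Co_Co)
 have bp: "Pr ka (bop Ai Di ka p) = bop Ai Di ka p" "Pr ka (bop Ai Di ka s) = 0" "Co ka (bop Ai Di ka p) = 0" "Co ka (bop Ai Di ka s) = bop Ai Di ka s"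
 by (simp_all add: comm[OF ka] comm_Co[OF ka] ps lin_simps)
 have ze': "Bt et ka t (ze t) = bop Ai Di ka p + bop Ai Di ka s + (n1 + n2) + (m1 + m2) + et *R (p - s)
 + ((i * i - 1) *R n2 + (e * e - 1) *R m1)"
 unfolding Bt_def B_N ei(2,3) ps(5)
 by (simp add: lin_simps ps Np Ns nm) (simp add: algebra_simps scaleR_2)
 have PB: "Pr ka (Bt et ka t (ze t)) = bop Ai Di ka p + n1 + et *R p + (e * e) *R m1"
 and CB: "Co ka (Bt et ka t (ze t)) = bop Ai Di ka s + m2 - et *R s + (i * i) *R n2"
 unfolding ze' by (simp_all add: lin_simps ps nm bp) (simp_all add: algebra_simps)
 have dP: "((%t. Pr ka (ze t)) hvd Pr ka (Bt et ka t (ze t))) (at t)"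
 and dC: "((%t. Co ka (ze t)) hvd Co ka (Bt et ka t (ze t))) (at t)"
 using bounded_linear.has_vector_derivative[OF linear_conv_bounded_linear[THEN iffD1, OF linear_Pr] d]
 bounded_linear.has_vector_derivative[OF linear_conv_bounded_linear[THEN iffD1, OF linear_Co] d] by auto
 have de: "((%t. exp (et * t)) has_real_derivative et * e) (at t)" and di: "((%t. exp (- (et * t))) has_real_derivative - et * i) (at t)"
 unfolding e_def i_def by (auto intro!: derivative_eq_intros)
 have Zeq: "Zt (- et) ka t x = exp (- (et * t)) *R Pr ka x + exp (et * t) *R Co ka x" for t x
 by (simp add: Zt_def)
 have der: "((%t. Zt (- et) ka t (ze t)) has_vector_derivative
 (i *R Pr ka (Bt et ka t (ze t)) + (- et * i) *R p) + (e *R Co ka (Bt et ka t (ze t)) + (et * e) *R s)) (at t)"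
 unfolding Zeq p_def s_def e_def i_def
 by (intro has_vector_derivative_add has_vector_derivative_scaleR dP dC de[unfolded e_def] di[unfolded i_def])
 have "(i *R Pr ka (Bt et ka t (ze t)) + (- et * i) *R p) + (e *R Co ka (Bt et ka t (ze t)) + (et * e) *R s)
 = i *R (bop Ai Di ka p + n1) + (i * (e * e)) *R m1 + e *R (bop Ai Di ka s + m2) + (e * (i * i)) *R n2"
 unfolding PB CB by (simp add: algebra_simps)
 also have "... = B ka t (i *R p + e *R s)"
 unfolding cc B_N by (simp add: lin_simps Np Ns algebra_simps)
 also have "i *R p + e *R s = Zt (- et) ka t (ze t)" by (simp add: Zeq p_def s_def e_def i_def)
 finally show ?thesis using der by simp
qed

lemma linear_Bt: "linear (Bt et ka t)"
 by (rule linearI)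
 (simp_all add: Bt_def B_N lin_simps scaleR_add_right scaleR_diff_right algebra_simps)

lemma norm_Pr_bound: obtains CP where "1 <= CP" "!!ka x. ka : ball 0 r0 ==> norm (Pr ka x) <= CP * norm x"
 "!!ka x. ka : ball 0 r0 ==> norm (Co ka x) <= 2 * CP * norm x"
proof -
 obtain B' K where "uhol_with (ball 0 r0) (%ka t. Pr ka) B' K" using uhPr unfolding uhol_def by (elim exE)
 note K = uhol_withD(1,5)[OF this]
 have 1: "norm (Pr ka x) <= (K + 1) * norm x" if "ka : ball 0 r0" for ka x
 using K(2)[OF that order_refl, of x] norm_ge_zero[of x] unfolding distrib_right mult_1_left by linarith
 have 2: "norm (Co ka x) <= 2 * (K + 1) * norm x" if "ka : ball 0 r0" for ka x
 proof -
 have "norm (Co ka x) <= norm x + norm (Pr ka x)" unfolding Co_def by (rule norm_triangle_ineq4)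
 also have "... <= 1 * norm x + (K + 1) * norm x" using 1[OF that] by simp
 also have "... <= 2 * (K + 1) * norm x" unfolding distrib_right[symmetric] using K(1) by (intro mult_right_mono) auto
 finally show ?thesis .
 qed
 show thesis by (rule that[of "K + 1"]) (use K(1) 1 2 in auto)
qed

lemma norm_scaled_N:
 assumes t: "0 <= t" and et: "0 < et" "4 * et <= tq"
 shows "norm ((exp (- (2 * et * t)) - 1) *R N t x) <= et * (16 * K1 / tq) * exp (- (tq / 4) * t) * norm x"
 and "norm ((exp (2 * et * t) - 1) *R N t x) <= et * (16 * K1 / tq) * exp (- (tq / 4) * t) * norm x"
proof -
 have *: "norm (c *R N t x) <= et * (16 * K1 / tq) * exp (- (tq / 4) * t) * norm x"
 if c: "exp (- tq * t) * \<bar>c\<bar> <= et * (8 / tq) * exp (- (tq / 4) * t)" for c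
 proof -
 have "norm (c *R N t x) <= \<bar>c\<bar> * (2 * K1 * exp (- tq * t) * norm x)"
 unfolding norm_scaleR by (intro mult_left_mono norm_N t) simp
 also have "... = 2 * K1 * norm x * (exp (- tq * t) * \<bar>c\<bar>)" by simp
 also have "... <= 2 * K1 * norm x * (et * (8 / tq) * exp (- (tq / 4) * t))"
 using K1 by (intro mult_left_mono c) simp
 also have "... = et * (16 * K1 / tq) * exp (- (tq / 4) * t) * norm x" by simp
 finally show ?thesis .
 qed
 show "norm ((exp (- (2 * et * t)) - 1) *R N t x) <= et * (16 * K1 / tq) * exp (- (tq / 4) * t) * norm x"
 and "norm ((exp (2 * et * t) - 1) *R N t x) <= et * (16 * K1 / tq) * exp (- (tq / 4) * t) * norm x"
 by (rule *[OF exp_shift_bound(1)[OF t et]], rule *[OF exp_shift_bound(2)[OF t et]])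
qed

lemma uhol_Bt:
 assumes et: "0 < et" "4 * et <= tq"
 shows "uhol (ball 0 r0) (Bt et)"
proof -
 let ?U = "ball (0::complex) r0"
 have U: "norm (y - x) <= 1" if "x \<in> ?U" "y \<in> ?U" for x y
 using norm_triangle_ineq4[of y x] that r0(2) by simp
 have sc: "uhol ?U (%ka t x. c *R x)" for c
 by (rule uhol_const[where K = "\<bar>c\<bar>"]) (auto intro!: linearI simp: algebra_simps sc_def vec_eq_iff)
 have id: "uhol ?U (%ka t x. x)" using sc[of 1] by simp
 have Co: "uhol ?U (%ka t. Co ka)"
 using uhol_add[OF id uhol_comp[OF sc[of "-1"] uhPr U]] by (simp add: Co_def[abs_def])
 have lin: "linear (%x. c *R N t x)" "c *R N t (sc h x) = sc h (c *R N t x)" for c t h x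
 by (rule linear_compose_scale_right[OF linear_N], unfold N_sc, simp add: sc_def vec_eq_iff)
 have e1: "et * (16 * K1 / tq) * exp (- (tq / 4) * t) * norm x <= et * (16 * K1 / tq) * norm x" if "0 <= t" for t and x :: "'n cpair"
 using that et tq K1 by (intro mult_right_mono mult_right_le_one_le) auto
 have N1: "uhol ?U (%ka t x. (exp (- (2 * et * t)) - 1) *R N t x)"
 by (rule uhol_const[where K = "et * (16 * K1 / tq)"], rule lin, rule lin, rule order_trans[OF norm_scaled_N(1)[OF _ et] e1])
 (use et tq K1 in auto)
 have N2: "uhol ?U (%ka t x. (exp (2 * et * t) - 1) *R N t x)"
 by (rule uhol_const[where K = "et * (16 * K1 / tq)"], rule lin, rule lin, rule order_trans[OF norm_scaled_N(2)[OF _ et] e1])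
 (use et tq K1 in auto)
 have T1: "uhol ?U (%ka t x. Co ka ((exp (- (2 * et * t)) - 1) *R N t (Pr ka x)))"
 by (rule uhol_comp[OF Co uhol_comp[OF N1 uhPr U] U])
 have T2: "uhol ?U (%ka t x. Pr ka ((exp (2 * et * t) - 1) *R N t (Co ka x)))"
 by (rule uhol_comp[OF uhPr uhol_comp[OF N2 Co U] U])
 have T3: "uhol ?U (%ka t x. (2 * et) *R Pr ka x + (- et) *R x)"
 by (rule uhol_add[OF uhol_comp[OF sc uhPr U] sc])
 have eq: "Bt et = (%ka t x. (B ka t x + ((2 * et) *R Pr ka x + (- et) *R x)) +
 (Co ka ((exp (- (2 * et * t)) - 1) *R N t (Pr ka x)) + Pr ka ((exp (2 * et * t) - 1) *R N t (Co ka x))))"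
 by (simp add: Bt_def fun_eq_iff scaleR_diff_right mult.commute)
 show ?thesis unfolding eq
 by (rule uhol_add[OF uhol_add[OF uhol_B[OF r0] T3] uhol_add[OF T1 T2]])
qed

lemma cont_Bt: "continuous_on UNIV (%t. Bt et ka t x)"
 unfolding Bt_def
 by (intro continuous_on_add cont_B continuous_on_const
 bounded_linear.continuous_on[OF linear_conv_bounded_linear[THEN iffD1, OF linear_Pr]]
 bounded_linear.continuous_on[OF linear_conv_bounded_linear[THEN iffD1, OF linear_Co]]
 continuous_on_scaleR cont_N continuous_intros)

text \<open>Write x as \<open>(u, - u) + (v, v)\<close>: \<open>pos\<close> handles the first
  summand, and Young's inequality moves the mixed terms to \<open>v\<close> at the price of a
  quarter of \<open>c1\<close>.\<close>

lemma limit_form_lower: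
 obtains C3 where "0 <= C3" "!!x. (2 *R Pr 0 x - x) #. diagop Pi Qi x >= (3/4) * c1 * (norm (dif x))^2 - C3 * (norm (mid x))^2"
proof -
 obtain CP where CP: "1 <= CP" "!!ka x. ka : ball 0 r0 ==> norm (Pr ka x) <= CP * norm x" by (rule norm_Pr_bound) blast
 define W where "W x = 2 *R Pr 0 x - x" for x
 have nW: "norm (W x) <= (3 * CP) * norm x" for x
 proof -
 have "norm (W x) <= 2 * norm (Pr 0 x) + norm x" unfolding W_def by (rule order_trans[OF norm_triangle_ineq4]) simp
 also have "... <= 2 * (CP * norm x) + CP * norm x"
 using CP(2)[of 0 x] r0(1) mult_right_mono[OF CP(1) norm_ge_zero[of x]] by simp
 finally show ?thesis by simp
 qed
 define KL where "KL = norm Pi + norm Qi"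
 have nL: "norm (diagop Pi Qi x) <= KL * norm x" for x
 proof -
 have "norm (diagop Pi Qi x) <= norm (cm Pi (fst x)) + norm (cm Qi (snd x))"
 unfolding diagop_def by (rule order_trans[OF norm_Pair_le]) simp
 also have "norm (cm Pi (fst x)) <= norm Pi * norm x"
 by (rule order_trans[OF norm_cm]) (intro mult_left_mono norm_fst_le[of "fst x" "snd x", unfolded prod.collapse] norm_ge_zero)
 also have "norm (cm Qi (snd x)) <= norm Qi * norm x"
 by (rule order_trans[OF norm_cm]) (intro mult_left_mono norm_snd_le[of "snd x" "fst x", unfolded prod.collapse] norm_ge_zero)
 finally show ?thesis by (simp add: KL_def distrib_right)
 qed
 have KL: "0 <= KL" by (simp add: KL_def)
 define C2 where "C2 = 12 * CP * KL"
 have C2: "0 <= C2" using CP KL by (simp add: C2_def)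
 define C3 where "C3 = C2 + 4 * C2^2 / c1"
 have "W x #. diagop Pi Qi x >= (3/4) * c1 * (norm (dif x))^2 - C3 * (norm (mid x))^2" for x
 proof -
 define u v where "u = norm (dif x)" and "v = norm (mid x)"
 define y w where "y = (dif x, - dif x)" and "w = (mid x, mid x)"
 have x: "x = y + w" using fst_mid_dif[of x] snd_mid_dif[of x] by (simp add: y_def w_def prod_eq_iff)
 have Wadd: "W (y + w) = W y + W w" by (simp add: W_def lin_simps algebra_simps)
 have Ladd: "diagop Pi Qi (y + w) = diagop Pi Qi y + diagop Pi Qi w" by (simp add: diagop_def cm.add_right)
 have e: "W x #. diagop Pi Qi x = W y #. diagop Pi Qi y + W y #. diagop Pi Qi w + W w #. diagop Pi Qi (y + w)"
 unfolding x Wadd Ladd by (simp add: inner_add_left inner_add_right)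
 have ny: "norm y <= 2 * u" and nw: "norm w <= 2 * v" unfolding y_def w_def u_def v_def by (rule norm_pair_const)+
 have uv: "0 <= u" "0 <= v" by (simp_all add: u_def v_def)
 have bd: "\<bar>W z #. diagop Pi Qi z'\<bar> <= 3 * CP * KL * (m * m')" if "norm z <= m" "norm z' <= m'" for z z' m m'
 proof -
 have m: "0 <= m" "0 <= m'" using that norm_ge_zero order_trans by blast+
 have "\<bar>W z #. diagop Pi Qi z'\<bar> <= norm (W z) * norm (diagop Pi Qi z')" by (rule Cauchy_Schwarz_ineq2)
 also have "... <= (3 * CP * m) * (KL * m')"
 proof (rule mult_mono)
 show "norm (W z) <= 3 * CP * m"
 by (rule order_trans[OF nW]) (intro mult_left_mono that, use CP(1) in simp)
 show "norm (diagop Pi Qi z') <= KL * m'"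
 by (rule order_trans[OF nL]) (intro mult_left_mono that KL)
 qed (use CP m in auto)
 finally show ?thesis by (simp add: algebra_simps)
 qed
 have nyw: "norm (y + w) <= 2 * u + 2 * v" by (rule norm_triangle_mono[OF ny nw])
 have 1: "W y #. diagop Pi Qi y >= c1 * u^2" using pos[of "dif x"] by (simp add: W_def y_def u_def)
 have 2: "\<bar>W y #. diagop Pi Qi w\<bar> <= C2 * (u * v)" using bd[OF ny nw] by (simp add: C2_def algebra_simps)
 have 3: "\<bar>W w #. diagop Pi Qi (y + w)\<bar> <= C2 * (u * v) + C2 * v^2"
 using bd[OF nw nyw] by (simp add: C2_def algebra_simps power2_eq_square)
 have "0 <= (c1 / 2 * u - 2 * C2 * v)^2 / c1" using c1 by simp
 also have "(c1 / 2 * u - 2 * C2 * v)^2 / c1 = (c1/4) * u^2 - 2 * C2 * (u * v) + 4 * C2^2 / c1 * v^2"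
 using c1 by (simp add: power2_eq_square field_simps)
 finally have 4: "2 * (C2 * (u * v)) <= (c1/4) * u^2 + 4 * C2^2 / c1 * v^2" by simp
 have 5: "C3 * v^2 = C2 * v^2 + 4 * C2^2 / c1 * v^2" by (simp add: C3_def distrib_right)
 show ?thesis unfolding e u_def[symmetric] v_def[symmetric]
 using 1 2 3 4 5 by linarith
 qed
 moreover have "0 <= C3" using C2 c1 by (simp add: C3_def)
 ultimately show thesis using that unfolding W_def by blast
qed

text \<open>Far out the conjugation supplies the missing dissipation in \<open>dif\<close>, of order
  \<open>et\<close>; its cost in \<open>mid\<close> is of order \<open>et\<close> too and is covered
  by \<open>c0\<close>. Before that, on a compact interval, \<open>py\<close> has a positive minimum
  that outweighs the errors of order \<open>et\<close>.\<close>

lemma strict_zero: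
 assumes et1: "0 < et1"
 shows "EX et. 0 < et & et <= et1 & 4 * et <= tq & (EX e K. indefinite_form.strict (L 0) dL (Bt et 0) e K)"
proof -
 interpret F: complex_form "L 0" dL "c0 / 2" "K0 + c0" by (rule form) (use c0 in simp)
 obtain CP where CP: "1 <= CP" "!!ka x. ka : ball 0 r0 ==> norm (Pr ka x) <= CP * norm x"
 "!!ka x. ka : ball 0 r0 ==> norm (Co ka x) <= 2 * CP * norm x" by (rule norm_Pr_bound) blast
 have 0: "(0::complex) : ball 0 r0" using r0 by simp
 define W where "W x = 2 *R Pr 0 x - x" for x
 have nW: "norm (W x) <= (3 * CP) * norm x" for x
 proof -
 have "norm (W x) <= 2 * norm (Pr 0 x) + norm x" unfolding W_def by (rule order_trans[OF norm_triangle_ineq4]) simp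
 also have "... <= 2 * (CP * norm x) + CP * norm x"
 using CP(2)[OF 0, of x] mult_right_mono[OF CP(1) norm_ge_zero[of x]] by simp
 finally show ?thesis by simp
 qed
 obtain C3 where C3: "0 <= C3" "!!x. W x #. diagop Pi Qi x >= (3/4) * c1 * (norm (dif x))^2 - C3 * (norm (mid x))^2"
 unfolding W_def by (rule limit_form_lower) blast
 define er where "er t = norm (P t - Pi) + norm (Q t - Qi)" for t
 define CE where "CE = 4 * CP^2 * (16 * K1 / tq)"
 have CE: "0 <= CE" using K1 tq by (simp add: CE_def)
 define X where "X et t x = Co 0 ((exp (- (2 * et * t)) - 1) *R N t (Pr 0 x)) + Pr 0 ((exp (2 * et * t) - 1) *R N t (Co 0 x))" for et t x
 have nX: "norm (X et t x) <= et * CE * exp (- (tq / 4) * t) * norm x" if t: "0 <= t" and et: "0 < et" "4 * et <= tq" for et t x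
 proof -
 define k where "k = et * (16 * K1 / tq) * exp (- (tq / 4) * t)"
 have k: "0 <= k" using et tq K1 by (simp add: k_def)
 have "norm (Co 0 ((exp (- (2 * et * t)) - 1) *R N t (Pr 0 x))) <= 2 * CP * (k * (CP * norm x))"
 proof -
 have "norm (Co 0 ((exp (- (2 * et * t)) - 1) *R N t (Pr 0 x))) <= 2 * CP * norm ((exp (- (2 * et * t)) - 1) *R N t (Pr 0 x))"
 by (rule CP(3)[OF 0])
 also have "... <= 2 * CP * (k * norm (Pr 0 x))"
 unfolding k_def by (intro mult_left_mono norm_scaled_N t et) (use CP(1) in simp)
 also have "... <= 2 * CP * (k * (CP * norm x))"
 by (intro mult_left_mono CP(2)[OF 0] k) (use CP(1) in simp)
 finally show ?thesis .
 qed
 moreover have "norm (Pr 0 ((exp (2 * et * t) - 1) *R N t (Co 0 x))) <= CP * (k * (2 * CP * norm x))"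
 proof -
 have "norm (Pr 0 ((exp (2 * et * t) - 1) *R N t (Co 0 x))) <= CP * norm ((exp (2 * et * t) - 1) *R N t (Co 0 x))"
 by (rule CP(2)[OF 0])
 also have "... <= CP * (k * norm (Co 0 x))"
 unfolding k_def by (intro mult_left_mono norm_scaled_N t et) (use CP(1) in simp)
 also have "... <= CP * (k * (2 * CP * norm x))"
 by (intro mult_left_mono CP(3)[OF 0] k) (use CP(1) in simp)
 finally show ?thesis .
 qed
 ultimately have "norm (X et t x) <= 2 * CP * (k * (CP * norm x)) + CP * (k * (2 * CP * norm x))"
 unfolding X_def by (rule norm_triangle_mono)
 also have "... = et * CE * exp (- (tq / 4) * t) * norm x"
 by (simp add: CE_def k_def power2_eq_square algebra_simps)
 finally show ?thesis .
 qed
 \<comment> \<open>All error terms divided by \<open>et\<close>: the distance of \<open>P\<close>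
   and \<open>Q\<close> from their limits and the effect of the conjugation on \<open>N\<close>.
   Nothing here involves \<open>et\<close>, so the splitting time can be fixed before
   \<open>et\<close> is chosen.\<close>
 define g where "g t = 4 * (3 * CP * er t + CE * (K0 + c0) * exp (- (tq / 4) * t))" for t
 have er0: "0 <= er t" for t by (simp add: er_def)
 have lower: "dL t x + 2 * (Bt et 0 t x #. L 0 t x) >= c0 * v + c0 * py t * u + et * ((3/2) * c1 * u - 2 * C3 * v) - et * g t * (v + u)"
 if t: "0 <= t" and et: "0 < et" "4 * et <= tq" and v: "v = (norm (mid x))^2" and u: "u = (norm (dif x))^2" for et t x v u
 proof -
 have xx: "(norm x)^2 = 2 * (v + u)" unfolding v u by (rule norm_mid_dif)
 have "Bt et 0 t x = B 0 t x + et *R W x + X et t x" by (simp add: Bt_def W_def X_def)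
 then have e: "Bt et 0 t x #. L 0 t x = B 0 t x #. L 0 t x + et * (W x #. L 0 t x) + X et t x #. L 0 t x"
 by (simp add: inner_add_left)
 have 1: "dL t x + 2 * (B 0 t x #. L 0 t x) >= c0 * v + c0 * py t * u"
 using generator_form[OF t, of 0 x 0] by (simp add: v u algebra_simps)
 have "L 0 t x - diagop Pi Qi x = (cm (P t - Pi) (fst x), - cm (Q t - Qi) (snd x))"
 by (simp add: L_def diagop_def cm.diff_left)
 also have "norm ... <= norm (cm (P t - Pi) (fst x)) + norm (cm (Q t - Qi) (snd x))"
 by (rule order_trans[OF norm_Pair_le]) simp
 also have "norm (cm (P t - Pi) (fst x)) <= norm (P t - Pi) * norm x"
 by (rule order_trans[OF norm_cm]) (intro mult_left_mono norm_fst_le[of "fst x" "snd x", unfolded prod.collapse] norm_ge_zero)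
 also have "norm (cm (Q t - Qi) (snd x)) <= norm (Q t - Qi) * norm x"
 by (rule order_trans[OF norm_cm]) (intro mult_left_mono norm_snd_le[of "snd x" "fst x", unfolded prod.collapse] norm_ge_zero)
 finally have dL: "norm (L 0 t x - diagop Pi Qi x) <= er t * norm x" by (simp add: er_def distrib_right)
 have "\<bar>W x #. (L 0 t x - diagop Pi Qi x)\<bar> <= (3 * CP * norm x) * (er t * norm x)"
 by (rule order_trans[OF Cauchy_Schwarz_ineq2]) (intro mult_mono nW dL, use CP in auto)
 then have "\<bar>W x #. (L 0 t x - diagop Pi Qi x)\<bar> <= 3 * CP * er t * (2 * (v + u))"
 unfolding xx[symmetric] by (simp add: power2_eq_square algebra_simps)
 moreover have "W x #. L 0 t x = W x #. diagop Pi Qi x + W x #. (L 0 t x - diagop Pi Qi x)" by (simp add: inner_diff_right)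
 ultimately have "W x #. L 0 t x >= (3/4) * c1 * u - C3 * v - 3 * CP * er t * (2 * (v + u))"
 using C3(2)[of x] unfolding v u abs_le_iff by linarith
 from mult_left_mono[OF this less_imp_le[OF et(1)]]
 have 2: "et * (W x #. L 0 t x) >= et * ((3/4) * c1 * u - C3 * v) - et * (3 * CP * er t * (2 * (v + u)))"
 by (simp add: right_diff_distrib)
 have "\<bar>X et t x #. L 0 t x\<bar> <= (et * CE * exp (- (tq / 4) * t) * norm x) * ((K0 + c0) * norm x)"
 by (rule order_trans[OF Cauchy_Schwarz_ineq2]) (intro mult_mono nX F.normL t et, use CE et in auto)
 then have 3: "\<bar>X et t x #. L 0 t x\<bar> <= et * (CE * (K0 + c0) * exp (- (tq / 4) * t)) * (2 * (v + u))"
 unfolding xx[symmetric] by (simp add: power2_eq_square algebra_simps)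
 show ?thesis using 1 2 3 unfolding e g_def abs_le_iff by (simp add: algebra_simps)
 qed
 have g0: "0 <= g t" for t using CP er0[of t] CE K0 c0 by (simp add: g_def)
 have "((%t. 4 * (3 * CP * er t + CE * (K0 + c0) * exp (- (tq / 4) * t))) ---> 4 * (3 * CP * (norm (Pi - Pi) + norm (Qi - Qi)) + CE * (K0 + c0) * 0)) at_top"
 unfolding er_def
 proof (intro tendsto_mult tendsto_add tendsto_const tendsto_norm tendsto_diff convP convQ)
 have "filterlim (%t. tq / 4 * t) at_top at_top"
 using tq by (intro filterlim_tendsto_pos_mult_at_top[OF tendsto_const] filterlim_ident) simp
 then have "filterlim (%t. - (tq / 4) * t) at_bot at_top" by (simp add: filterlim_uminus_at_top)
 then show "((%t. exp (- (tq / 4) * t)) ---> 0) at_top" by (rule filterlim_compose[OF exp_at_bot])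
 qed
 then have "(g ---> 0) at_top" by (simp add: g_def[abs_def])
 then have "\<forall>\<^sub>F t in at_top. g t < c1 / 2" using c1 by (intro order_tendstoD) auto
 then obtain T0 where T0: "!!t. T0 <= t ==> g t < c1 / 2" unfolding eventually_at_top_linorder by blast
 \<comment> \<open>Beyond \<open>T\<close> the error \<open>g\<close> uses at most a third of the
   gain \<open>(3/2) * c1\<close>; up to \<open>T\<close> only the minimum of \<open>py\<close> is
   available.\<close>
 define T where "T = max T0 0"
 have T: "0 <= T" "!!t. T <= t ==> g t < c1 / 2" using T0 by (auto simp: T_def)
 have "EX x:{0..T}. ALL y:{0..T}. py x <= py y"
 by (rule continuous_attains_inf) (use T in \<open>auto intro: continuous_on_subset[OF contpy]\<close>)
 then obtain t0 where t0: "t0 : {0..T}" "!!y. y : {0..T} ==> py t0 <= py y" by blast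
 define py0 where "py0 = py t0"
 have py0: "0 < py0" using pypos t0 by (simp add: py0_def)
 define G where "G = 4 * (3 * CP * (2 * K0 + norm Pi + norm Qi) + CE * (K0 + c0)) + c1"
 have gG: "g t <= G" if t: "0 <= t" for t
 proof -
 have "er t <= 2 * K0 + norm Pi + norm Qi"
 using bdP[OF t] bdQ[OF t] norm_triangle_ineq4[of "P t" Pi] norm_triangle_ineq4[of "Q t" Qi] by (simp add: er_def)
 then have "3 * CP * er t <= 3 * CP * (2 * K0 + norm Pi + norm Qi)" using CP by (intro mult_left_mono) auto
 moreover have "CE * (K0 + c0) * exp (- (tq / 4) * t) <= CE * (K0 + c0) * 1"
 using CE K0 c0 tq t by (intro mult_left_mono) auto
 ultimately have "3 * CP * er t + CE * (K0 + c0) * exp (- (tq / 4) * t) <= 3 * CP * (2 * K0 + norm Pi + norm Qi) + CE * (K0 + c0) * 1"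
 by (rule add_mono)
 then have "g t <= 4 * (3 * CP * (2 * K0 + norm Pi + norm Qi) + CE * (K0 + c0) * 1)" unfolding g_def by (rule mult_left_mono) simp
 then show ?thesis using c1 unfolding G_def by simp
 qed
 have G: "c1 <= G" "0 < G" using CP K0 CE c0 c1 by (simp_all add: G_def add_nonneg_pos)
 \<comment> \<open>Constraints: the prescribed bound, the admissible weight \<open>tq / 4\<close>,
   the loss in \<open>mid\<close> against \<open>c0 / 2\<close>, and the loss in \<open>dif\<close>
   on \<open>[0, T]\<close> against half of \<open>c0 * py0\<close>.\<close>
 define et where "et = min (min et1 (tq / 4)) (min (c0 / (2 * (2 * C3 + G))) (c0 * py0 / (2 * G)))"
 have et: "0 < et" "et <= et1" "4 * et <= tq" "et <= c0 / (2 * (2 * C3 + G))" "et <= c0 * py0 / (2 * G)"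
 using et1 tq c0 C3 G py0 unfolding et_def by (auto simp: add_nonneg_pos)
 have etC: "et * (2 * C3 + G) <= c0 / 2" and etG: "et * G <= c0 * py0 / 2"
 proof -
 have 1: "0 < 2 * (2 * C3 + G)" and 2: "0 < 2 * G" using C3(1) G by simp_all
 have "et * (2 * (2 * C3 + G)) <= c0" "et * (2 * G) <= c0 * py0"
 using et(4,5) 1 2 by (simp_all only: pos_le_divide_eq)
 then show "et * (2 * C3 + G) <= c0 / 2" "et * G <= c0 * py0 / 2" by (simp_all add: algebra_simps)
 qed
 define e where "e = min (c0 / 2) (min (et * c1) (c0 * py0 / 2))"
 have e: "0 < e" using c0 et c1 py0 by (simp add: e_def)
 define K where "K = 2 * K0 + et * (3 * CP) + et * CE"
 have "F.strict (Bt et 0) (e / 2) K"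
 unfolding F.strict_def
 proof (intro conjI allI impI)
 show "0 < e / 2" "0 <= K" using e K0 et CP CE by (simp_all add: K_def)
 fix t :: real and x :: "'n cpair" assume t: "0 <= t"
 show "norm (Bt et 0 t x) <= K * norm x"
 proof -
 have "Bt et 0 t x = B 0 t x + et *R W x + X et t x" by (simp add: Bt_def W_def X_def)
 also have "norm ... <= 2 * (norm (0::complex) + K0) * norm x + et * (3 * CP * norm x) + et * CE * norm x"
 proof (intro norm_triangle_mono norm_B t)
 show "norm (et *R W x) <= et * (3 * CP * norm x)" using nW[of x] et(1) by (simp add: mult_left_mono)
 have "et * CE * exp (- (tq / 4) * t) * norm x <= et * CE * 1 * norm x"
 using et CE tq t by (intro mult_right_mono mult_left_mono) auto
 then show "norm (X et t x) <= et * CE * norm x" using nX[OF t et(1,3), of x] by simp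
 qed
 finally show ?thesis by (simp add: K_def algebra_simps)
 qed
 define v u where "v = (norm (mid x))^2" and "u = (norm (dif x))^2"
 have vu: "0 <= v" "0 <= u" by (simp_all add: v_def u_def)
 note lo = lower[OF t et(1,3) v_def u_def]
 have ev: "e * v <= c0 / 2 * v" using vu unfolding e_def by (intro mult_right_mono) auto
 have etCv: "et * (2 * C3 + G) * v <= c0 / 2 * v" by (intro mult_right_mono etC vu)
 have "e * v + e * u <= dL t x + 2 * (Bt et 0 t x #. L 0 t x)"
 proof (cases "T <= t")
 case True
 have "et * g t * (v + u) <= et * (c1 / 2) * (v + u)" using T(2)[OF True] et vu by (intro mult_right_mono mult_left_mono) auto
 moreover have "et * (c1 / 2) * v <= et * G * v" using G c1 et vu by (intro mult_right_mono mult_left_mono) auto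
 moreover have "e * u <= et * c1 * u" using vu unfolding e_def by (intro mult_right_mono) auto
 moreover have "0 <= c0 * py t * u" using c0 pypos[OF t] vu by simp
 ultimately show ?thesis using lo ev etCv by (simp add: algebra_simps)
 next
 case False
 then have "py0 <= py t" using t0(2)[of t] t by (simp add: py0_def)
 then have "c0 * py0 * u <= c0 * py t * u" using c0 vu by (intro mult_right_mono mult_left_mono) auto
 moreover have "et * g t * (v + u) <= et * G * (v + u)" using gG[OF t] et vu by (intro mult_right_mono mult_left_mono) auto
 moreover have "et * G * u <= c0 * py0 / 2 * u" by (intro mult_right_mono etG vu)
 moreover have "e * u <= c0 * py0 / 2 * u" using vu unfolding e_def by (intro mult_right_mono) auto
 moreover have "0 <= et * ((3/2) * c1 * u)" using et c1 vu by simp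
 ultimately show ?thesis using lo ev etCv by (simp add: algebra_simps)
 qed
 moreover have "e / 2 * (norm x)^2 = e * v + e * u" using norm_mid_dif[of x] by (simp add: v_def u_def algebra_simps)
 ultimately show "e / 2 * (norm x)^2 <= dL t x + 2 * (Bt et 0 t x #. L 0 t x)" by simp
 qed
 then show ?thesis using et(1-3) by blast
qed

text \<open>The graph construction is applied to the conjugated generator on a disc about 0 and the
  weights are then removed. As \<open>Zt\<close> is the identity at \<open>t = 0\<close>, initial
  values and the sign of the form are unaffected; only the class of admissible curves becomes
  boundedness after weighting.\<close>

theorem graph_zero:
 assumes et1: "0 < et1"
 shows "EX et r R. 0 < et & et <= et1 & 0 < r & r <= r0 & (ALL i j. (%ka. R ka $ i $ j) holomorphic_on ball 0 r) &
 (ALL ka:ball 0 r. (ALL b. EX xq. xq 0 = (R ka *v b, b) & (ALL t. (xq hvd B ka t (xq t)) (at t)) &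
 (EX S. ALL t>=0. norm (Zt et ka t (xq t)) <= S) & xq 0 #. L 0 0 (xq 0) <= 0 & (xq 0 #. L 0 0 (xq 0) = 0 --> xq 0 = 0)) &
 (ALL xq S. (ALL t. (xq hvd B ka t (xq t)) (at t)) --> (ALL t>=0. norm (Zt et ka t (xq t)) <= S) -->
 fst (xq 0) = R ka *v snd (xq 0)))"
proof -
 obtain et e K where et: "0 < et" "et <= et1" "4 * et <= tq" and st: "indefinite_form.strict (L 0) dL (Bt et 0) e K"
 using strict_zero[OF et1] by blast
 interpret F: complex_form "L 0" dL "c0 / 2" "K0 + c0" by (rule form) (use c0 in simp)
 have U: "norm (y - x) <= 1" if "x : ball 0 r0" "y : ball 0 r0" for x y :: complex
 using norm_triangle_ineq4[of y x] that r0(2) by simp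
 note uh = uhol_Bt[OF et(1,3)]
 obtain M where M: "0 <= M" "!!ka ka' t x. ka : ball 0 r0 ==> ka' : ball 0 r0 ==> 0 <= t ==>
 norm (Bt et ka' t x - Bt et ka t x) <= M * norm (ka' - ka) * norm x"
 using uhol_lipschitz[OF uh U, of thesis] by simp
 note e = F.strictD(1)[OF st]
 define r where "r = min r0 (e / (4 * (M + 1) * (K0 + c0)))"
 have p: "0 < 4 * (M + 1) * (K0 + c0)" using M c0 K0 by simp
 have r: "0 < r" "r <= r0" using r0 e p by (simp_all add: r_def)
 have "r <= e / (4 * (M + 1) * (K0 + c0))" by (simp add: r_def)
 then have re: "r * (4 * (M + 1) * (K0 + c0)) <= e" using p by (simp only: pos_le_divide_eq)
 have sub: "ka : ball 0 r0" if "ka : ball 0 r" for ka :: complex using that r(2) by simp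
 have "4 * (M * r) * (K0 + c0) <= r * (4 * (M + 1) * (K0 + c0))"
 using M r c0 K0 by (simp add: algebra_simps)
 then have dC: "4 * (M * r) * (K0 + c0) <= e" using re by simp
 have st': "F.strict (Bt et ka) (e / 2) (K + M * r)" if ka: "ka : ball 0 r" for ka
 proof (rule F.strict_perturb[OF st _ dC])
 show "0 <= M * r" using M r by simp
 fix t :: real and x :: "'n cpair" assume t: "0 <= t"
 have "norm (Bt et ka t x - Bt et 0 t x) <= M * norm (ka - 0) * norm x" by (rule M(2)) (use r0 sub[OF ka] t in auto)
 also have "... <= M * r * norm x" using ka M by (intro mult_right_mono mult_left_mono) auto
 finally show "norm (Bt et ka t x - Bt et 0 t x) <= M * r * norm x" .
 qed
 have uh': "uhol (ball 0 r) (Bt et)" by (rule uhol_mono[OF uh]) (use r in \<open>simp add: subset_ball\<close>)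
 obtain R where R: "ALL i j. (%ka. R ka $ i $ j) holomorphic_on ball 0 r" "ALL ka:ball 0 r. F.decaying_graph (Bt et ka) (R ka)"
 using F.holomorphic_graph[OF uh' st' cont_Bt open_ball] by blast
 have ex: "EX xq. xq 0 = (R ka *v b, b) & (ALL t. (xq hvd B ka t (xq t)) (at t)) &
 (EX S. ALL t>=0. norm (Zt et ka t (xq t)) <= S) & xq 0 #. L 0 0 (xq 0) <= 0 & (xq 0 #. L 0 0 (xq 0) = 0 --> xq 0 = 0)"
 if ka: "ka : ball 0 r" for ka b
 proof -
 obtain ze where ze: "ze 0 = (R ka *v b, b)" "!!t. (ze hvd Bt et ka t (ze t)) (at t)"
 "!!t. 0 <= t ==> ze t #. L 0 t (ze t) <= 0"
 using R(2)[rule_format, OF ka] unfolding F.decaying_graph_def by blast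
 define xq where "xq t = Zt (- et) ka t (ze t)" for t
 have xq0: "xq 0 = ze 0" by (simp add: xq_def Zt_0)
 have d: "(xq hvd B ka t (xq t)) (at t)" for t
 unfolding xq_def by (rule unshifted_solution[OF sub[OF ka] ze(2)])
 have "(ze ---> 0) at_top"
 by (rule exp_bound_tendsto_0[OF F.nonpositive_curve_decay[OF st'[OF ka] ze(2,3)]])
 (use F.rate_ge_1[of "e / 2" "K + M * r"] F.strictD(1,2)[OF st'[OF ka]] in simp_all)
 then obtain S where "ALL t>=0. norm (ze t) <= S" using bounded_on_half_line[OF ze(2)] by blast
 then have S: "EX S. ALL t>=0. norm (Zt et ka t (xq t)) <= S" unfolding xq_def Zt_inverse[OF sub[OF ka]] by blast
 have "xq 0 #. L 0 0 (xq 0) = 0 --> xq 0 = 0"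
 unfolding xq0 using F.graph_negative[OF st'[OF ka] ze(2,3)] by blast
 moreover have "xq 0 #. L 0 0 (xq 0) <= 0" unfolding xq0 by (rule ze(3)) simp
 moreover have "xq 0 = (R ka *v b, b)" unfolding xq0 by (rule ze(1))
 ultimately show ?thesis using d S by blast
 qed
 have un: "fst (xq 0) = R ka *v snd (xq 0)"
 if ka: "ka : ball 0 r" and d: "!!t. (xq hvd B ka t (xq t)) (at t)"
 and S: "!!t. 0 <= t ==> norm (Zt et ka t (xq t)) <= S" for ka xq S
 using F.bounded_solution_in_graph[OF st'[OF ka] linear_Bt R(2)[rule_format, OF ka]
 shifted_solution[OF sub[OF ka] d] S] by (simp add: Zt_0)
 show ?thesis using et(1,2) r R(1) ex un by (intro exI[of _ et] exI[of _ r] exI[of _ R]) blast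
qed

end

section \<open>From local to global analytic graphs\<close>

text \<open>Analyticity on the closed half plane requires one function on a neighbourhood, so local
  extensions must agree where their discs overlap outside the half plane. Any overlap of discs with
  centres in \<open>Hplus\<close> is convex and, if it leaves the half plane, also meets the open
  half plane, where both extensions equal \<open>f\<close>; the identity theorem applies.\<close>

lemma analytic_gluing:
 fixes f :: "complex => complex"
 assumes loc: "!!z. z : Hplus ==> EX r>0. EX h. h holomorphic_on ball z r & (ALL w:ball z r \<inter> Hplus. h w = f w)"
 shows "EX F. F analytic_on Hplus & (ALL w:Hplus. F w = f w)"
proof -
 have "ALL z. EX r h. z : Hplus --> 0 < r & h holomorphic_on ball z r & (ALL w:ball z r \<inter> Hplus. h w = f w)"
 using loc by blast
 from choice[OF this] obtain r where "ALL z. EX h. z : Hplus --> 0 < r z & h holomorphic_on ball z (r z) & (ALL w:ball z (r z) \<inter> Hplus. h w = f w)" ..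
 from choice[OF this] obtain h where
 rh0: "ALL z. z : Hplus --> 0 < r z & h z holomorphic_on ball z (r z) & (ALL w:ball z (r z) \<inter> Hplus. h z w = f w)" ..
 have rh: "0 < r z" "h z holomorphic_on ball z (r z)" "w : ball z (r z) ==> w : Hplus ==> h z w = f w" if "z : Hplus" for z w
 using rh0[rule_format, OF that] by blast+
 have agree: "h z w = h z' w" if z: "z : Hplus" "z' : Hplus" and w: "w : ball z (r z)" "w : ball z' (r z')" for z z' w
 proof (cases "w : Hplus")
 case True then show ?thesis using rh(3) z w by simp
 next
 case False
 define V where "V = ball z (r z) \<inter> ball z' (r z')"
 \<comment> \<open>The mirror image of \<open>w\<close> in the imaginary axis, which is closer to
   every point of \<open>Hplus\<close> than \<open>w\<close> is and so lies in both discs.\<close>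
 define w' where "w' = - cnj w"
 have wneg: "Re w < 0" using False by (simp add: Hplus_def)
 have closer: "dist y w' <= dist y w" if "y : Hplus" for y
 proof -
 have "0 <= Re y" using that by (simp add: Hplus_def)
 then have "\<bar>Re y + Re w\<bar> <= \<bar>Re y - Re w\<bar>" using wneg by linarith
 then have "(Re y + Re w)^2 <= (Re y - Re w)^2" by (simp only: abs_le_square_iff)
 then show ?thesis unfolding dist_norm cmod_def w'_def by (intro real_sqrt_le_mono) simp
 qed
 have w': "w' : V" using closer[OF z(1)] closer[OF z(2)] w by (simp add: V_def)
 have op: "open (V \<inter> {y. 0 < Re y})" unfolding V_def by (intro open_Int open_halfspace_Re_gt open_ball)
 show ?thesis
 proof (rule analytic_continuation_open[where s = "V \<inter> {y. 0 < Re y}" and s' = V and f = "h z" and g = "h z'" and z = w])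
 show "V \<inter> {y. 0 < Re y} ~= {}" using w' wneg by (auto simp: w'_def)
 show "connected V" by (simp add: V_def convex_Int convex_connected)
 show "h z holomorphic_on V" "h z' holomorphic_on V" using rh(2) z by (auto simp: V_def intro: holomorphic_on_subset)
 show "h z y = h z' y" if "y : V \<inter> {y. 0 < Re y}" for y
 using rh(3)[of z y] rh(3)[of z' y] z that by (simp add: V_def Hplus_def)
 show "w : V" using w by (simp add: V_def)
 show "open V" unfolding V_def by (intro open_Int open_ball)
 qed (use op in auto)
 qed
 define F where "F w = (if w : Hplus then f w else h (SOME z. z : Hplus & w : ball z (r z)) w)" for w
 have Fh: "F w = h z w" if z: "z : Hplus" and w: "w : ball z (r z)" for z w
 proof (cases "w : Hplus")
 case True then show ?thesis using rh(3)[OF z w] by (simp add: F_def)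
 next
 case False
 define z' where "z' = (SOME z. z : Hplus & w : ball z (r z))"
 have "z' : Hplus & w : ball z' (r z')" unfolding z'_def by (rule someI[of _ z]) (use z w in blast)
 then have "h z w = h z' w" using agree[OF z _ w, of z'] by blast
 then show ?thesis unfolding F_def z'_def using False by simp
 qed
 have "F analytic_on Hplus"
 unfolding analytic_on_def
 proof
 fix z assume z: "z : Hplus"
 have "F holomorphic_on ball z (r z)"
 by (rule holomorphic_transform[OF rh(2)[OF z]]) (use Fh[OF z] in auto)
 then show "EX e>0. F holomorphic_on ball z e" using rh(1)[OF z] by blast
 qed
 then show ?thesis by (intro exI[of _ F]) (simp add: F_def)
qed

text \<open>Integrating the bound for the derivative from t to T and letting T tend to infinity
  compares the value at t with the limit.\<close>

lemma exp_tail_bound: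
 fixes y :: "real => 'a::euclidean_space"
 assumes d: "!!s. 0 <= s ==> (y hvd y' s) (at s)"
 and b: "!!s. 0 <= s ==> norm (y' s) <= C * exp (- al * s)" and al: "0 < al"
 and l: "(y ---> l) at_top" and t: "0 <= t"
 shows "norm (y t - l) <= C / al * exp (- al * t)"
proof -
 have C: "0 <= C" using order_trans[OF norm_ge_zero b[of 0]] by simp
 have "norm (y t - y T) <= C / al * exp (- al * t)" if T: "t < T" for T
 proof -
 let ?p = "%s. - (C / al) * exp (- al * s)"
 have "norm (y T - y t) <= ?p T - ?p t"
 proof (rule differentiable_bound_general[OF T, where f' = y' and \<phi>' = "%s. C * exp (- al * s)"])
 show "continuous_on {t..T} y"
 by (intro continuous_at_imp_continuous_on ballI has_vector_derivative_continuous[OF d]) (use t in auto)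
 show "continuous_on {t..T} ?p" by (intro continuous_intros)
 show "(y hvd y' s) (at s)" if "t < s" "s < T" for s using d t that by simp
 show "(?p hvd C * exp (- al * s)) (at s)" for s
 unfolding has_real_derivative_iff_has_vector_derivative[symmetric]
 using al by (auto intro!: derivative_eq_intros)
 show "norm (y' s) <= C * exp (- al * s)" if "t < s" "s < T" for s using b t that by simp
 qed
 moreover have "0 <= C / al * exp (- al * T)" using C al by simp
 ultimately show ?thesis by (simp add: norm_minus_commute)
 qed
 moreover have "((%T. norm (y t - y T)) ---> norm (y t - l)) at_top" by (intro tendsto_norm tendsto_diff tendsto_const l)
 note lim = this
 show ?thesis
 by (rule tendsto_upperbound[OF lim eventually_mono[OF eventually_gt_at_top[of t]]]) (use calculation in simp_all)
qed

context relaxation begin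

definition is_graph :: "complex => complex^'n^'n => bool" where
 "is_graph ka M \<longleftrightarrow> (ALL x. (EX xq. xq 0 = x & decays ka xq) \<longleftrightarrow> fst x = M *v snd x)"

lemma is_graph_unique:
 assumes "is_graph ka M" "is_graph ka M'"
 shows "M = M'"
proof -
 have "M *v b = M' *v b" for b
 proof -
 have "fst (M *v b, b) = M' *v snd (M *v b, b)"
 using assms[unfolded is_graph_def, THEN spec[of _ "(M *v b, b)"]] by simp
 then show ?thesis by simp
 qed
 then show ?thesis by (simp add: matrix_eq)
qed

definition local_graph :: "complex => real => (complex => complex^'n^'n) => bool" where
 "local_graph ka r R \<longleftrightarrow> 0 < r & (ALL i j. (%ka. R ka $ i $ j) holomorphic_on ball ka r) & (ALL ka':ball ka r. is_graph ka' (R ka'))"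

lemma is_graph_local: "ka : Hplus - {0} ==> EX r R. local_graph ka r R"
proof -
 assume "ka : Hplus - {0}"
 then have "0 <= Re ka" "ka ~= 0" by (simp_all add: Hplus_def)
 from graph_nonzero[OF this, folded is_graph_def] show ?thesis unfolding local_graph_def by blast
qed

lemma local_graphD:
 assumes "local_graph ka r R"
 shows "0 < r" "(%ka. R ka $ i $ j) holomorphic_on ball ka r" "ka' : ball ka r ==> is_graph ka' (R ka')" "is_graph ka (R ka)"
 using assms unfolding local_graph_def by simp_all

text \<open>On \<open>Hplus - {0}\<close> the graph matrix is unique, so the local holomorphic
  representatives are consistent there; at 0, where the decaying solutions may fail to form such a
  graph, the value of \<open>R0\<close> is imposed.\<close>

lemma global_graph:
 assumes r: "0 < r" and R0: "!!i j. (%ka. R0 ka $ i $ j) holomorphic_on ball 0 r"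
 and graph0: "!!ka. ka : ball 0 r ==> ka : Hplus - {0} ==> is_graph ka (R0 ka)"
 shows "EX R. R 0 = R0 0 & (ALL i j. (%ka. R ka $ i $ j) analytic_on Hplus) & (ALL ka:Hplus - {0}. is_graph ka (R ka))"
proof -
 define S where "S ka = (if ka = 0 then R0 0 else SOME M. is_graph ka M)" for ka
 have S: "is_graph ka (S ka)" if ka: "ka : Hplus - {0}" for ka
 proof -
 obtain r R where "local_graph ka r R" using is_graph_local[OF ka] by (elim exE)
 then have "is_graph ka (R ka)" by (rule local_graphD)
 then have "is_graph ka (SOME M. is_graph ka M)" by (rule someI)
 then show ?thesis using ka by (simp add: S_def)
 qed
 have "EX r>0. EX h. h holomorphic_on ball z r & (ALL w:ball z r \<inter> Hplus. h w = S w $ i $ j)" if z: "z : Hplus" for z i j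
 proof (cases "z = 0")
 case True
 have "R0 w $ i $ j = S w $ i $ j" if "w : ball 0 r \<inter> Hplus" for w
 proof (cases "w = 0")
 case False
 then have w: "w : Hplus - {0}" and w': "w : ball 0 r" using that by simp_all
 show ?thesis using is_graph_unique[OF graph0[OF w' w] S[OF w]] by simp
 qed (simp add: S_def)
 then show ?thesis using True r R0[of i j] by blast
 next
 case False
 have "z : Hplus - {0}" using z False by simp
 from is_graph_local[OF this] obtain ro R where lg: "local_graph z ro R" by (elim exE)
 note ro = local_graphD(1)[OF lg] and R = local_graphD(2,3)[OF lg]
 \<comment> \<open>The radius excludes 0 from the disc, so that uniqueness of the graph applies to
   all its points in \<open>Hplus\<close>.\<close>
 define r' where "r' = min ro (norm z)"
 have r': "0 < r'" using ro False by (simp add: r'_def)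
 have "(%ka. R ka $ i $ j) holomorphic_on ball z r'"
 by (rule holomorphic_on_subset[OF R(1)]) (simp add: r'_def subset_ball)
 moreover have "R w $ i $ j = S w $ i $ j" if "w : ball z r' \<inter> Hplus" for w
 proof -
 have "w : ball z ro" "norm (z - w) < norm z" using that by (simp_all add: r'_def dist_norm)
 moreover from this(2) have "w : Hplus - {0}" using that by auto
 ultimately show ?thesis using is_graph_unique[OF R(2) S] by simp
 qed
 ultimately show ?thesis using r' by blast
 qed
 note loc = this
 have "EX F. F analytic_on Hplus & (ALL w:Hplus. F w = S w $ i $ j)" for i j
 by (rule analytic_gluing) (rule loc)
 then have "ALL ij. EX F. F analytic_on Hplus & (ALL w:Hplus. F w = S w $ fst ij $ snd ij)" by simp
 from choice[OF this] obtain F' where F': "ALL ij. F' ij analytic_on Hplus & (ALL w:Hplus. F' ij w = S w $ fst ij $ snd ij)" ..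
 define F where "F i j = F' (i, j)" for i j
 have F: "F i j analytic_on Hplus" "w : Hplus ==> F i j w = S w $ i $ j" for i j w
 using F'[rule_format, of "(i, j)"] by (simp_all add: F_def)
 define R where "R w = (\<chi> i j. F i j w)" for w
 have RS: "R w = S w" if "w : Hplus" for w by (simp add: R_def vec_eq_iff F(2)[OF that])
 have "R 0 = R0 0" using RS[of 0] by (simp add: S_def Hplus_def)
 moreover have "ALL i j. (%ka. R ka $ i $ j) analytic_on Hplus" using F(1) by (simp add: R_def)
 moreover have "ALL ka:Hplus - {0}. is_graph ka (R ka)" using S RS by simp
 ultimately show ?thesis by blast
qed

text \<open>Two graphs over the same component that are nested in either direction coincide. At a
  fast end the graph is seen to consist of decaying solutions, at a slow end the decaying solutions
  are seen to lie in the graph.\<close>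

lemma is_graphI:
 assumes ka: "ka : Hplus - {0}"
 and sub: "(ALL b. EX xq. xq 0 = (M *v b, b) & decays ka xq) \<or> (ALL xq. decays ka xq --> fst (xq 0) = M *v snd (xq 0))"
 shows "is_graph ka M"
proof -
 obtain r R where "local_graph ka r R" using is_graph_local[OF ka] by (elim exE)
 then have isg: "is_graph ka (R ka)" by (rule local_graphD)
 note g = isg[unfolded is_graph_def, THEN spec]
 have "M *v b = R ka *v b" for b
 using sub
 proof
 assume "ALL b. EX xq. xq 0 = (M *v b, b) & decays ka xq"
 then have "EX xq. xq 0 = (M *v b, b) & decays ka xq" ..
 then show ?thesis unfolding g by simp
 next
 assume a: "ALL xq. decays ka xq --> fst (xq 0) = M *v snd (xq 0)"
 obtain xq where "xq 0 = (R ka *v b, b)" "decays ka xq" using g[of "(R ka *v b, b)"] by auto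
 then show ?thesis using a[rule_format, of xq] by simp
 qed
 then have "M = R ka" by (simp add: matrix_eq)
 then show ?thesis using isg by simp
qed

lemma B_zero_mid: "mid (B 0 t x) = (1/2) *R cm (A t - D t) (mid x)" and B_zero_if: "mid x = 0 ==> B 0 t x = 0"
 by (simp_all add: B_def mid_def cm.diff_left cm.scaleR_right algebra_simps prod_eq_iff cm.zero_right)

end

context relaxation_end begin

definition negative_at_0 :: "complex^'n^'n => bool" where
 "negative_at_0 M \<longleftrightarrow> (ALL b. (M *v b, b) #. L 0 0 (M *v b, b) <= 0 & ((M *v b, b) #. L 0 0 (M *v b, b) = 0 --> b = 0))"

definition zero_ex :: "real => complex => complex^'n^'n => bool" where
 "zero_ex et ka M \<longleftrightarrow> (ALL b. EX xq. xq 0 = (M *v b, b) & (ALL t. (xq hvd B ka t (xq t)) (at t)) &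
 (EX S. ALL t>=0. norm (Zt et ka t (xq t)) <= S) & xq 0 #. L 0 0 (xq 0) <= 0 & (xq 0 #. L 0 0 (xq 0) = 0 --> xq 0 = 0))"

definition zero_un :: "real => complex => complex^'n^'n => bool" where
 "zero_un et ka M \<longleftrightarrow> (ALL xq S. (ALL t. (xq hvd B ka t (xq t)) (at t)) --> (ALL t>=0. norm (Zt et ka t (xq t)) <= S) -->
 fst (xq 0) = M *v snd (xq 0))"

lemmas graph_zero' = graph_zero[folded zero_ex_def zero_un_def]

text \<open>All slow modes grow, so the whole space is weighted by \<open>exp (et * t)\<close> and
  the curves of the graph decay for every \<open>ka\<close> in the disc, including 0. The final
  clause makes the \<open>mid\<close> components of the graph at 0 independent, which is needed
  since the lift to the original system forgets \<open>dif\<close> at \<open>ka = 0\<close>.\<close>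

theorem fast_side:
 assumes id: "!!ka x. ka : ball 0 r0 ==> Pr ka x = x"
 shows "EX R. (ALL i j. (%ka. R ka $ i $ j) analytic_on Hplus) &
 (ALL ka:Hplus - {0}. is_graph ka (R ka)) &
 negative_at_0 (R 0) & (ALL b. mid (R 0 *v b, b) = 0 --> b = 0)"
proof -
 obtain et r R0 where et: "0 < et" "et <= 1" and r: "0 < r" "r <= r0" and R0: "ALL i j. (%ka. R0 ka $ i $ j) holomorphic_on ball 0 r"
 and Vu: "ALL ka:ball 0 r. zero_ex et ka (R0 ka) & zero_un et ka (R0 ka)"
 using graph_zero'[OF zero_less_one] by (elim exE conjE)
 note V = Vu[THEN bspec, THEN conjunct1, unfolded zero_ex_def, THEN spec]
 have dec: "EX xq. xq 0 = (R0 ka *v b, b) & decays ka xq & xq 0 #. L 0 0 (xq 0) <= 0 & (xq 0 #. L 0 0 (xq 0) = 0 --> xq 0 = 0)"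
 if ka: "ka : ball 0 r" for ka b
 proof -
 obtain xq S where xq: "xq 0 = (R0 ka *v b, b)" "ALL t. (xq hvd B ka t (xq t)) (at t)"
 "ALL t>=0. norm (Zt et ka t (xq t)) <= S" "xq 0 #. L 0 0 (xq 0) <= 0" "xq 0 #. L 0 0 (xq 0) = 0 --> xq 0 = 0"
 using V[OF ka] by blast
 have ka': "ka : ball 0 r0" using ka r by simp
 have Z: "Zt et ka t x = exp (et * t) *R x" for t x by (simp add: Zt_def Co_def id[OF ka'])
 have "(norm (xq t))^2 <= S^2 * exp (- (2 * et) * t)" if "0 <= t" for t
 proof -
 have "exp (et * t) * norm (xq t) <= S" using xq(3)[rule_format, OF that] by (simp add: Z)
 then have "exp (- (et * t)) * (exp (et * t) * norm (xq t)) <= exp (- (et * t)) * S" by (intro mult_left_mono) auto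
 then have "norm (xq t) <= exp (- (et * t)) * S" by (simp add: mult.assoc[symmetric] exp_add[symmetric])
 then have "(norm (xq t))^2 <= (exp (- (et * t)) * S)^2" by (intro power_mono) auto
 also have "... = S^2 * exp (- (2 * et) * t)" by (simp add: power_mult_distrib exp_double[symmetric] mult.commute)
 finally show ?thesis .
 qed
 moreover have "0 < 2 * et" using et(1) by simp
 ultimately have "(xq ---> 0) at_top" by (rule exp_bound_tendsto_0)
 then have "decays ka xq" unfolding decays_def using xq(2) by (intro conjI)
 then show ?thesis using xq(1,4,5) by (intro exI[of _ xq] conjI)
 qed
 have "EX R. R 0 = R0 0 & (ALL i j. (%ka. R ka $ i $ j) analytic_on Hplus) &
 (ALL ka:Hplus - {0}. is_graph ka (R ka))"
 proof (rule global_graph[OF r(1)])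
 show "(%ka. R0 ka $ i $ j) holomorphic_on ball 0 r" for i j using R0 by blast
 show "is_graph ka (R0 ka)" if "ka : ball 0 r" "ka : Hplus - {0}" for ka
 by (rule is_graphI[OF that(2)]) (use dec[OF that(1)] in blast)
 qed
 then obtain R where R: "R 0 = R0 0" "ALL i j. (%ka. R ka $ i $ j) analytic_on Hplus"
 "ALL ka:Hplus - {0}. is_graph ka (R ka)" by blast
 have 0: "(0::complex) : ball 0 r" using r by simp
 have "negative_at_0 (R 0)"
 unfolding negative_at_0_def R(1)
 proof
 fix b :: "complex^'n"
 obtain xq where xq: "xq 0 = (R0 0 *v b, b)" and "decays 0 xq" and xq2: "xq 0 #. L 0 0 (xq 0) <= 0" "xq 0 #. L 0 0 (xq 0) = 0 --> xq 0 = 0"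
 using dec[OF 0, of b] by (elim exE conjE)
 note xq = xq xq2
 then show "(R0 0 *v b, b) #. L 0 0 (R0 0 *v b, b) <= 0 & ((R0 0 *v b, b) #. L 0 0 (R0 0 *v b, b) = 0 --> b = 0)"
 by (simp add: zero_prod_def)
 qed
 moreover have "b = 0" if m: "mid (R 0 *v b, b) = 0" for b
 proof -
 obtain xq where xq0: "xq 0 = (R0 0 *v b, b)" and dc: "decays 0 xq" and "xq 0 #. L 0 0 (xq 0) <= 0" "xq 0 #. L 0 0 (xq 0) = 0 --> xq 0 = 0"
 using dec[OF 0, of b] by (elim exE conjE)
 note xq = xq0 dc[unfolded decays_def, THEN conjunct1, THEN spec] dc[unfolded decays_def, THEN conjunct2]
 have bl: "bounded_linear (mid :: 'n cpair => _)" using linear_mid linear_conv_bounded_linear by blast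
 \<comment> \<open>At \<open>ka = 0\<close> the component \<open>mid\<close> satisfies a closed
   linear equation, so it stays 0; then the curve is constant, and decay makes it vanish.\<close>
 have mz: "mid (xq t) = 0" if t: "0 <= t" for t
 proof (rule differential_inequality_zero[OF _ _ _ t, of "%t. mid (xq t)" "%t. mid (B 0 t (xq t))" "K0 + K0"])
 show "((%t. mid (xq t)) hvd mid (B 0 s (xq s))) (at s)" for s
 by (rule bounded_linear.has_vector_derivative[OF bl xq(2)])
 show "norm (mid (B 0 s (xq s))) <= (K0 + K0) * norm (mid (xq s))" if s: "0 <= s" for s
 proof -
 have "norm (A s - D s) <= K0 + K0" using norm_triangle_ineq4[of "A s" "D s"] bdA[OF s] bdD[OF s] by linarith
 then have "norm (cm (A s - D s) (mid (xq s))) <= (K0 + K0) * norm (mid (xq s))"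
 by (intro order_trans[OF norm_cm] mult_right_mono) auto
 moreover have "\<bar>1/2::real\<bar> * norm (cm (A s - D s) (mid (xq s))) <= 1 * norm (cm (A s - D s) (mid (xq s)))"
 by (intro mult_right_mono) auto
 ultimately show ?thesis unfolding B_zero_mid norm_scaleR by linarith
 qed
 show "mid (xq 0) = 0" using m by (simp add: xq(1) R(1))
 qed
 have "xq t - xq 0 = 0" if t: "0 <= t" for t
 proof (rule differential_inequality_zero[OF _ _ _ t, of "%t. xq t - xq 0" "%t. B 0 t (xq t) - 0" 0])
 show "((%t. xq t - xq 0) hvd B 0 s (xq s) - 0) (at s)" for s
 by (intro has_vector_derivative_diff xq(2) has_vector_derivative_const)
 show "norm (B 0 s (xq s) - 0) <= 0 * norm (xq s - xq 0)" if "0 <= s" for s using B_zero_if[OF mz[OF that]] by simp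
 qed simp
 then have "xq t = xq 0" if "0 <= t" for t using that eq_iff_diff_eq_0 by metis
 then have "\<forall>\<^sub>F t in at_top. xq t = xq 0" unfolding eventually_at_top_linorder by (intro exI[of _ 0] allI impI)
 then have "(xq ---> xq 0) at_top" by (rule tendsto_eventually)
 then have "xq 0 = 0" using tendsto_unique[OF trivial_limit_at_top_linorder _ xq(3)] by blast
 then show "b = 0" using xq(1) by (simp add: zero_prod_def)
 qed
 ultimately show ?thesis using R by blast
qed

text \<open>A decaying solution need not decay at a uniform rate, but its component along the
  growing slow mode is driven only by the exponentially small \<open>N\<close>, so it decays like
  \<open>exp (- tq * t)\<close>; the complement carries a decreasing weight. Hence the solution is
  admissible for \<open>graph_zero\<close>. At \<open>ka = 0\<close> the constants
  \<open>(u, - u)\<close> annihilated by \<open>Pr 0\<close> and the exponentially decaying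
  solutions are admissible for the same reason.\<close>

theorem slow_side:
 fixes ld :: "complex => 'n cpair => complex" and rv :: "complex => 'n cpair" and my :: "complex => complex"
 assumes Pr: "!!ka x. ka : ball 0 r0 ==> Pr ka x = sc (ld ka x) (rv ka)"
 and ld: "!!ka. ka : ball 0 r0 ==> bounded_linear (ld ka)"
 and eig: "!!ka x. ka : ball 0 r0 ==> ld ka (bop Ai Di ka x) = my ka * ld ka x"
 and my: "!!ka. ka : ball 0 r0 ==> ka : Hplus ==> 0 <= Re (my ka)"
 shows "EX R. (ALL i j. (%ka. R ka $ i $ j) analytic_on Hplus) &
 (ALL ka:Hplus - {0}. is_graph ka (R ka)) &
 negative_at_0 (R 0) & (ALL u. Pr 0 (u, - u) = 0 --> u = R 0 *v (- u)) &
 (ALL xq C. (ALL t. (xq hvd B 0 t (xq t)) (at t)) --> (ALL t>=0. norm (xq t) <= C * exp (- tq * t)) -->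
 fst (xq 0) = R 0 *v snd (xq 0))"
proof -
 obtain et r R0 where et: "0 < et" "et <= tq" and r: "0 < r" "r <= r0" and R0: "ALL i j. (%ka. R0 ka $ i $ j) holomorphic_on ball 0 r"
 and Vu: "ALL ka:ball 0 r. zero_ex et ka (R0 ka) & zero_un et ka (R0 ka)"
 using graph_zero'[OF tq] by (elim exE conjE)
 note V = Vu[THEN bspec, THEN conjunct1, unfolded zero_ex_def, THEN spec]
 have un: "fst (xq 0) = R0 ka *v snd (xq 0)" if "ka : ball 0 r" "!!t. (xq hvd B ka t (xq t)) (at t)"
 "!!t. 0 <= t ==> norm (Zt et ka t (xq t)) <= S" for ka xq S
 using Vu[THEN bspec, OF that(1), THEN conjunct2, unfolded zero_un_def, THEN spec, THEN spec, THEN mp, THEN mp, of xq S] that(2,3)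
 by blast
 obtain CP where CP: "1 <= CP" "!!ka x. ka : ball 0 r0 ==> norm (Pr ka x) <= CP * norm x"
 "!!ka x. ka : ball 0 r0 ==> norm (Co ka x) <= 2 * CP * norm x" by (rule norm_Pr_bound) blast
 \<comment> \<open>The choice \<open>et <= tq\<close> lets the decay of the projected part pay for
   its growing weight, while the other part only has to stay bounded.\<close>
 have Zb: "norm (Zt et ka t x) <= C + 2 * CP * S"
 if ka: "ka : ball 0 r0" and t: "0 <= t" and p: "norm (Pr ka x) <= C * exp (- tq * t)" and x: "norm x <= S" for ka t x C S
 proof -
 have C: "0 <= C" using order_trans[OF norm_ge_zero p] by (simp add: zero_le_mult_iff)
 have "norm (exp (et * t) *R Pr ka x) <= exp (et * t) * (C * exp (- tq * t))" using p by simp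
 also have "... = C * exp ((et - tq) * t)" by (simp add: exp_add[symmetric] algebra_simps flip: exp_minus)
 also have "... <= C * 1" using C et t by (intro mult_left_mono) (simp_all add: mult_nonpos_nonneg)
 finally have 1: "norm (exp (et * t) *R Pr ka x) <= C" by simp
 have "norm (exp (- (et * t)) *R Co ka x) <= 1 * norm (Co ka x)"
 unfolding norm_scaleR using et t by (intro mult_right_mono) auto
 also have "... <= 2 * CP * S" unfolding mult_1_left by (rule order_trans[OF CP(3)[OF ka]]) (use CP(1) x in \<open>simp add: mult_left_mono\<close>)
 finally have 2: "norm (exp (- (et * t)) *R Co ka x) <= 2 * CP * S" .
 show ?thesis unfolding Zt_def by (rule norm_triangle_mono[OF 1 2])
 qed
 have dec: "fst (xq 0) = R0 ka *v snd (xq 0)" if ka: "ka : ball 0 r" "ka : Hplus - {0}" and dc: "decays ka xq" for ka xq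
 proof -
 have ka': "ka : ball 0 r0" using ka r by simp
 note d = dc[unfolded decays_def, THEN conjunct1, rule_format] and lim = dc[unfolded decays_def, THEN conjunct2]
 obtain S where S: "ALL t>=0. norm (xq t) <= S" using bounded_on_half_line[OF d lim] by blast
 have S0: "0 <= S" using S norm_ge_zero order_trans by blast
 note bl = ld[OF ka']
 obtain Cl where Cl: "0 < Cl" "!!x. norm (ld ka x) <= norm x * Cl" using bounded_linear.pos_bounded[OF bl] by blast
 define m where "m = my ka"
 have m: "0 <= Re m" using my[OF ka'] ka(2) by (simp add: m_def)
 \<comment> \<open>The integrating factor removes the slow rate, leaving only \<open>N\<close> in
   the derivative. Because \<open>Re m >= 0\<close> the factor does not destroy decay, so y can be
   integrated from infinity.\<close>
 define y where "y t = exp (- (of_real t * m)) * ld ka (xq t)" for t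
 define y' where "y' t = exp (- (of_real t * m)) * ld ka (N t (xq t))" for t
 have dy: "(y hvd y' t) (at t)" for t
 proof -
 have de: "((%t. exp (- (of_real t * m))) hvd (- m * exp (- (of_real t * m)))) (at t)"
 proof -
 have "((%z. exp (- (z * m))) has_field_derivative (- m * exp (- (of_real t * m)))) (at (of_real t))"
 by (auto intro!: derivative_eq_intros)
 from has_vector_derivative_real_field[OF this] show ?thesis .
 qed
 have dl: "((%t. ld ka (xq t)) hvd ld ka (B ka t (xq t))) (at t)"
 by (rule bounded_linear.has_vector_derivative[OF bl d])
 have "ld ka (B ka t (xq t)) = m * ld ka (xq t) + ld ka (N t (xq t))"
 unfolding B_N linear_add[OF bounded_linear.linear[OF bl]] eig[OF ka'] m_def ..
 then show ?thesis using has_vector_derivative_mult[OF de dl] by (simp add: y_def[abs_def] y'_def algebra_simps)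
 qed
 have ne: "norm (exp (- (of_real t * m))) = exp (- (Re m) * t)" for t by (simp add: norm_exp_eq_Re mult.commute)
 define C where "C = 2 * K1 * S * Cl"
 have b: "norm (y' s) <= C * exp (- (tq + Re m) * s)" if s: "0 <= s" for s
 proof -
 have "norm (N s (xq s)) <= 2 * K1 * exp (- tq * s) * S"
 by (rule order_trans[OF norm_N[OF s]]) (use S s K1 in \<open>auto intro!: mult_left_mono\<close>)
 then have "norm (ld ka (N s (xq s))) <= 2 * K1 * exp (- tq * s) * S * Cl"
 using order_trans[OF Cl(2)] Cl(1) mult_right_mono less_imp_le by metis
 then have "norm (y' s) <= exp (- (Re m) * s) * (2 * K1 * exp (- tq * s) * S * Cl)"
 unfolding y'_def norm_mult ne by (intro mult_left_mono) auto
 also have "... = C * (exp (- (Re m) * s) * exp (- tq * s))" by (simp add: C_def)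
 also have "exp (- (Re m) * s) * exp (- tq * s) = exp (- (tq + Re m) * s)" by (simp add: exp_add[symmetric] algebra_simps)
 finally show ?thesis .
 qed
 have "(y ---> 0) at_top"
 proof (rule Lim_null_comparison)
 show "\<forall>\<^sub>F t in at_top. norm (y t) <= norm (ld ka (xq t))"
 unfolding eventually_at_top_linorder
 proof (intro exI[of _ 0] allI impI)
 fix t :: real assume "0 <= t"
 then have "exp (- (Re m) * t) <= 1" using m by simp
 then show "norm (y t) <= norm (ld ka (xq t))" unfolding y_def norm_mult ne by (intro mult_left_le_one_le) auto
 qed
 show "((%t. norm (ld ka (xq t))) ---> 0) at_top"
 using bounded_linear.tendsto[OF bl lim] linear_0[OF bounded_linear.linear[OF bl]] by (simp add: tendsto_norm_zero)
 qed
 from exp_tail_bound[OF dy b _ this]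
 have yb: "norm (y t) <= C / (tq + Re m) * exp (- (tq + Re m) * t)" if "0 <= t" for t using that m tq by simp
 have C0: "0 <= C" using K1 S0 Cl by (simp add: C_def)
 have db: "norm (ld ka (xq t)) <= C / tq * exp (- tq * t)" if t: "0 <= t" for t
 proof -
 have "norm (ld ka (xq t)) = exp (Re m * t) * norm (y t)" unfolding y_def norm_mult ne by (simp add: mult.assoc[symmetric] exp_add[symmetric])
 also have "... <= exp (Re m * t) * (C / (tq + Re m) * exp (- (tq + Re m) * t))" by (intro mult_left_mono yb t) auto
 also have "... = C / (tq + Re m) * (exp (Re m * t) * exp (- (tq + Re m) * t))" by simp
 also have "exp (Re m * t) * exp (- (tq + Re m) * t) = exp (- tq * t)" by (simp add: exp_add[symmetric] algebra_simps)
 also have "C / (tq + Re m) * exp (- tq * t) <= C / tq * exp (- tq * t)"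
 using C0 m tq by (intro mult_right_mono divide_left_mono) auto
 finally show ?thesis .
 qed
 have "norm (Pr ka (xq t)) <= (C / tq * norm (rv ka)) * exp (- tq * t)" if t: "0 <= t" for t
 unfolding Pr[OF ka'] norm_sc using mult_right_mono[OF db[OF t] norm_ge_zero[of "rv ka"]] by (simp add: mult_ac)
 from Zb[OF ka' _ this] S show ?thesis by (intro un[OF ka(1) d]) blast
 qed
 have "EX R. R 0 = R0 0 & (ALL i j. (%ka. R ka $ i $ j) analytic_on Hplus) &
 (ALL ka:Hplus - {0}. is_graph ka (R ka))"
 proof (rule global_graph[OF r(1)])
 show "(%ka. R0 ka $ i $ j) holomorphic_on ball 0 r" for i j using R0 by blast
 show "is_graph ka (R0 ka)" if "ka : ball 0 r" "ka : Hplus - {0}" for ka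
 by (rule is_graphI[OF that(2)]) (use dec[OF that] in blast)
 qed
 then obtain R where R: "R 0 = R0 0" "ALL i j. (%ka. R ka $ i $ j) analytic_on Hplus"
 "ALL ka:Hplus - {0}. is_graph ka (R ka)" by blast
 have 0: "(0::complex) : ball 0 r" "(0::complex) : ball 0 r0" using r by simp_all
 have "negative_at_0 (R 0)"
 unfolding negative_at_0_def R(1)
 proof
 fix b :: "complex^'n"
 obtain xq S where xq: "xq 0 = (R0 0 *v b, b)" and "ALL t. (xq hvd B 0 t (xq t)) (at t)"
 and "ALL t>=0. norm (Zt et 0 t (xq t)) <= S" and xq2: "xq 0 #. L 0 0 (xq 0) <= 0" "xq 0 #. L 0 0 (xq 0) = 0 --> xq 0 = 0"
 using V[OF 0(1), of b] by (elim exE conjE)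
 note xq = xq xq2
 then show "(R0 0 *v b, b) #. L 0 0 (R0 0 *v b, b) <= 0 & ((R0 0 *v b, b) #. L 0 0 (R0 0 *v b, b) = 0 --> b = 0)"
 by (simp add: zero_prod_def)
 qed
 moreover have "u = R 0 *v (- u)" if u: "Pr 0 (u, - u) = 0" for u
 proof -
 have m: "mid (u, - u) = 0" by (simp add: mid_def)
 have "fst ((%t::real. (u, - u)) 0) = R0 0 *v snd ((%t::real. (u, - u)) 0)"
 proof (rule un[OF 0(1)])
 show "((%t. (u, - u)) hvd B 0 t (u, - u)) (at t)" for t by (simp add: B_zero_if[OF m])
 show "norm (Zt et 0 t (u, - u)) <= 0 + 2 * CP * norm (u, - u)" if "0 <= t" for t
 by (rule Zb[OF 0(2) that]) (simp_all add: u)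
 qed
 then show ?thesis by (simp add: R(1))
 qed
 moreover have "fst (xq 0) = R 0 *v snd (xq 0)"
 if d: "ALL t. (xq hvd B 0 t (xq t)) (at t)" and C: "ALL t>=0. norm (xq t) <= C * exp (- tq * t)" for xq C
 unfolding R(1)
 proof (rule un[OF 0(1) d[rule_format]])
 fix t :: real assume t: "0 <= t"
 have "norm (Pr 0 (xq t)) <= CP * (C * exp (- tq * t))"
 by (rule order_trans[OF CP(2)[OF 0(2)]]) (use CP(1) C t in \<open>simp add: mult_left_mono\<close>)
 then have 1: "norm (Pr 0 (xq t)) <= (CP * C) * exp (- tq * t)" by (simp only: mult.assoc)
 have C0: "0 <= C" using order_trans[OF norm_ge_zero C[rule_format, OF order_refl]] by simp
 have "C * exp (- tq * t) <= C * 1" using C0 tq t by (intro mult_left_mono) auto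
 then have 2: "norm (xq t) <= C" using C t by force
 show "norm (Zt et 0 t (xq t)) <= CP * C + 2 * CP * C" by (rule Zb[OF 0(2) t 1 2])
 qed
 ultimately show ?thesis using R by blast
qed

end

section \<open>The growing slow mode of an end state\<close>

text \<open>The iterates from 0 are holomorphic and converge uniformly on the disc, so the fixed
  point is holomorphic. Assuming only that \<open>T\<close> preserves holomorphic curves avoids
  holomorphy in several variables.\<close>

lemma holomorphic_fixed_point:
 fixes T :: "complex => complex^'n::finite => complex^'n"
 assumes R: "0 < R"
 and contr: "!!ka c c'. ka : ball 0 r ==> norm c <= R ==> norm c' <= R ==> norm (T ka c - T ka c') <= 1/2 * norm (c - c')"
 and start: "!!ka. ka : ball 0 r ==> norm (T ka 0) <= R / 2"
 and hol: "!!c. (!!i. (%ka. c ka $ i) holomorphic_on ball 0 r) ==> (!!i. (%ka. T ka (c ka) $ i) holomorphic_on ball 0 r)"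
 shows "EX c. (ALL i. (%ka. c ka $ i) holomorphic_on ball 0 r) & (ALL ka:ball 0 r. norm (c ka) <= R & T ka (c ka) = c ka)"
proof -
 define cs where "cs n ka = (T ka ^^ n) 0" for n ka
 have cs0: "cs 0 ka = 0" and csS: "cs (Suc n) ka = T ka (cs n ka)" for n ka by (simp_all add: cs_def)
 have bd: "norm (cs n ka) <= R" if ka: "ka : ball 0 r" for n ka
 proof (induction n)
 case (Suc n)
 have "norm (T ka (cs n ka)) <= norm (T ka (cs n ka) - T ka 0) + norm (T ka 0)"
 using norm_triangle_ineq[of "T ka (cs n ka) - T ka 0" "T ka 0"] by simp
 moreover have "norm (T ka (cs n ka) - T ka 0) <= 1/2 * norm (cs n ka - 0)" by (rule contr[OF ka Suc]) (use R in simp)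
 ultimately show ?case using Suc start[OF ka] by (simp add: csS)
 qed (use R in \<open>simp add: cs0\<close>)
 have st: "norm (cs (Suc n) ka - cs n ka) <= R * (1/2)^n" if ka: "ka : ball 0 r" for n ka
 proof (induction n)
 case 0 show ?case using bd[OF ka, of 1] by (simp add: cs0)
 next
 case (Suc n)
 have "norm (T ka (cs (Suc n) ka) - T ka (cs n ka)) <= 1/2 * norm (cs (Suc n) ka - cs n ka)" by (intro contr ka bd)
 also have "... <= 1/2 * (R * (1/2)^n)" by (intro mult_left_mono Suc) simp
 finally show ?case by (simp add: csS)
 qed
 have tel: "(\<Sum>i<n. cs (Suc i) ka - cs i ka) = cs n ka" for n ka by (induction n) (simp_all add: cs0)
 define c where "c ka = (\<Sum>i. cs (Suc i) ka - cs i ka)" for ka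
 have "uniform_limit (ball 0 r) (%n ka. \<Sum>i<n. cs (Suc i) ka - cs i ka) (%ka. \<Sum>i. cs (Suc i) ka - cs i ka) sequentially"
 by (rule Weierstrass_m_test[where M = "%n. R * (1/2)^n"]) (use st in \<open>auto intro: summable_mult summable_geometric\<close>)
 then have ul: "uniform_limit (ball 0 r) cs c sequentially" by (simp add: tel c_def[abs_def] fun_eq_iff)
 have csh: "(%ka. cs n ka $ i) holomorphic_on ball 0 r" for n i
 proof (induction n arbitrary: i)
 case (Suc n) show ?case unfolding csS by (rule hol[OF Suc])
 qed (simp add: cs0)
 have "(%ka. c ka $ i) holomorphic_on ball 0 r" for i
 proof (rule holomorphic_uniform_sequence[OF open_ball csh])
 fix x :: complex assume "x : ball 0 r"
 then obtain d where d: "d > 0" "cball x d \<subseteq> ball 0 r" using open_contains_cball[of "ball 0 r"] open_ball by blast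
 have "uniform_limit (cball x d) (%n ka. cs n ka $ i) (%ka. c ka $ i) sequentially"
 by (rule bounded_linear.uniform_limit[OF bounded_linear_vec_nth uniform_limit_on_subset[OF ul d(2)]])
 then show "EX d>0. cball x d \<subseteq> ball 0 r & uniform_limit (cball x d) (%n ka. cs n ka $ i) (%ka. c ka $ i) sequentially"
 using d by blast
 qed
 moreover have "norm (c ka) <= R & T ka (c ka) = c ka" if ka: "ka : ball 0 r" for ka
 proof
 have l: "(%n. cs n ka) \<longlonglongrightarrow> c ka" by (rule tendsto_uniform_limitI[OF ul ka])
 show n: "norm (c ka) <= R" by (rule tendsto_upperbound[OF tendsto_norm[OF l]]) (use bd[OF ka] in auto)
 have "(%n. T ka (cs n ka) - T ka (c ka)) \<longlonglongrightarrow> 0"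
 proof (rule Lim_null_comparison[OF always_eventually])
 show "ALL i. norm (T ka (cs i ka) - T ka (c ka)) <= 1/2 * norm (cs i ka - c ka)" using contr[OF ka bd[OF ka] n] by blast
 show "(%i. 1/2 * norm (cs i ka - c ka)) \<longlonglongrightarrow> 0"
 using tendsto_mult_right_zero[OF tendsto_norm_zero[OF LIM_zero[OF l]], of "1/2"] by simp
 qed
 then have "(%n. cs (Suc n) ka) \<longlonglongrightarrow> T ka (c ka)" unfolding csS by (rule LIM_zero_cancel)
 moreover have "(%n. cs (Suc n) ka) \<longlonglongrightarrow> c ka" by (rule LIMSEQ_Suc[OF l])
 ultimately show "T ka (c ka) = c ka" by (rule LIMSEQ_unique)
 qed
 ultimately show ?thesis by (intro exI[of _ c]) simp
qed

lemma norm_le_sum_components: "norm x <= (SUM i:UNIV. norm (x $ i))"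
 by (simp add: norm_vec_def L2_set_le_sum)

text \<open>The vector \<open>c\<close> encodes an eigenpair at once: \<open>c $ k\<close> is the
  change of the rate from \<open>m0\<close>, the other entries are coordinates of the eigenvector,
  and its k-th coordinate is normalized to 1 by \<open>ct\<close>. After division by the nonzero
  numbers \<open>d i\<close> the equation is a contraction, since what remains is quadratic in
  \<open>c\<close> or carries the factor \<open>ka\<close>.\<close>

lemma small_eigen_fixed_point:
 fixes k :: "'n::finite" and q d :: "'n => complex" and s :: "'n => 'n => complex" and m0 :: complex
 defines "ct \<equiv> %c j. if j = k then 1 else (c :: complex^'n) $ j"
 assumes d: "!!i. d i ~= 0"
 shows "EX r c. 0 < r & (ALL i. (%ka. c ka $ i) holomorphic_on ball 0 r) & c 0 = 0 &
 (ALL ka:ball 0 r. ALL i. d i * c ka $ i + q i * (c ka $ k * c ka $ i)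
 + ka * ((1 - (m0 + c ka $ k)^2) * (SUM j:UNIV. s i j * ct (c ka) j)) = 0)"
proof -
 define b where "b c i = (SUM j:UNIV. s i j * ct c j)" for c i
 define p where "p c = 1 - (m0 + (c::complex^'n) $ k)^2" for c
 define T where "T ka c = (\<chi> i. - (q i * (c $ k * c $ i) + ka * (p c * b c i)) / d i)" for ka c
 define S where "S = (SUM i:UNIV. SUM j:UNIV. norm (s i j))"
 define D where "D = (SUM i:UNIV. 1 / norm (d i))"
 define Q where "Q = (SUM i:UNIV. norm (q i))"
 define M where "M = (norm m0 + 1)^2 + 1 + (2 * norm m0 + 2)"
 have M: "(norm m0 + 1)^2 + 1 <= M" "2 * norm m0 + 2 <= M" by (simp_all add: M_def)
 have S: "(SUM j:UNIV. norm (s i j)) <= S" for i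
 unfolding S_def by (rule member_le_sum[of i UNIV "%i. SUM j:UNIV. norm (s i j)"]) (auto intro: sum_nonneg)
 have Qi: "norm (q i) <= Q" and Di: "1 / norm (d i) <= D" for i
 unfolding Q_def D_def using member_le_sum[of i UNIV "%i. norm (q i)"] member_le_sum[of i UNIV "%i. 1 / norm (d i)"] by auto
 have nn: "0 <= S" "0 <= D" "0 <= Q" "0 <= M" unfolding S_def D_def Q_def M_def by (auto intro!: sum_nonneg)
 have ct1: "norm (ct c j) <= 1" if "norm c <= 1" for c j
 using order_trans[OF Finite_Cartesian_Product.norm_nth_le[of c j] that] by (simp add: ct_def)
 have ctd: "norm (ct c j - ct c' j) <= norm (c - c')" for c c' j
 using Finite_Cartesian_Product.norm_nth_le[of "c - c'" j] by (simp add: ct_def)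
 have b1: "norm (b c i) <= S" if c: "norm c <= 1" for c i
 proof -
 have "norm (b c i) <= (SUM j:UNIV. norm (s i j))"
 unfolding b_def by (rule order_trans[OF norm_sum sum_mono]) (use ct1[OF c] in \<open>simp add: norm_mult mult_left_le\<close>)
 then show ?thesis using S order_trans by blast
 qed
 have bdiff: "norm (b c i - b c' i) <= S * norm (c - c')" for c c' i
 proof -
 have "norm (b c i - b c' i) <= (SUM j:UNIV. norm (s i j) * norm (c - c'))"
 unfolding b_def sum_subtractf[symmetric] right_diff_distrib[symmetric]
 by (rule order_trans[OF norm_sum sum_mono]) (use ctd in \<open>simp add: norm_mult mult_left_mono\<close>)
 also have "... <= S * norm (c - c')" unfolding sum_distrib_right[symmetric] by (intro mult_right_mono S) simp
 finally show ?thesis .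
 qed
 have ck: "norm (c $ i) <= norm c" for c :: "complex^'n" and i by (rule Finite_Cartesian_Product.norm_nth_le)
 have p1: "norm (p c) <= M" if c: "norm c <= 1" for c
 proof -
 have "norm (m0 + c $ k) <= norm m0 + 1" using norm_triangle_ineq[of m0 "c $ k"] ck[of c k] c by linarith
 then have "norm ((m0 + c $ k)^2) <= (norm m0 + 1)^2" by (simp add: norm_power power_mono)
 then show ?thesis using norm_triangle_ineq4[of 1 "(m0 + c $ k)^2"] M(1) by (simp add: p_def)
 qed
 have pdiff: "norm (p c - p c') <= M * norm (c - c')" if c: "norm c <= 1" "norm c' <= 1" for c c'
 proof -
 have e: "p c - p c' = - ((2 * m0 + (c $ k + c' $ k)) * (c - c') $ k)" by (simp add: p_def power2_eq_square algebra_simps)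
 have "norm (2 * m0 + (c $ k + c' $ k)) <= norm (2 * m0) + (norm (c $ k) + norm (c' $ k))"
 by (rule order_trans[OF norm_triangle_ineq add_left_mono[OF norm_triangle_ineq]])
 also have "... <= M" using ck[of c k] ck[of c' k] c M(2) by (simp add: norm_mult)
 finally show ?thesis unfolding e norm_minus_cancel norm_mult by (intro mult_mono ck) (use nn in auto)
 qed
 \<comment> \<open>A bound for all Lipschitz constants summed over the entries. The radii below give
   \<open>K * (R + r) <= 1/2\<close>, the contraction, and \<open>K * r <= R / 2\<close>, the bound
   on the first iterate.\<close>
 define K where "K = real CARD('n) * D * (2 * Q + 2 * M * S + 1)"
 have K: "0 <= K" unfolding K_def using nn by simp
 define R where "R = min (1/2) (1 / (4 * (K + 1)))"
 have R: "0 < R" "R <= 1" "R <= 1/2" "K * R <= 1/4" using K by (auto simp: R_def min_def field_simps)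
 define r where "r = R / (2 * (K + 1))"
 have r: "0 < r" "K * r <= R / 2" using K R(1) by (auto simp: r_def field_simps)
 have r': "K * r <= 1/4" using r(2) R by linarith
 have DD: "norm (T ka c - T ka c') <= 1/2 * norm (c - c')" if ka: "ka : ball 0 r" and c: "norm c <= R" "norm c' <= R" for ka c c'
 proof -
 have c1: "norm c <= 1" "norm c' <= 1" using c R by linarith+
 let ?n = "norm (c - c')"
 have "norm ((T ka c - T ka c') $ i) <= D * ((2 * Q + 2 * M * S) * (R + r)) * ?n" for i
 proof -
 have "norm (c $ k * c $ i - c' $ k * c' $ i) <= norm (c $ k * (c - c') $ i) + norm ((c - c') $ k * c' $ i)"
 using norm_triangle_ineq[of "c $ k * (c - c') $ i" "(c - c') $ k * c' $ i"] by (simp add: algebra_simps)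
 also have "... <= R * ?n + ?n * R" unfolding norm_mult
 by (intro add_mono mult_mono ck order_trans[OF ck c(1)] order_trans[OF ck c(2)]) (use R in auto)
 finally have 1: "norm (q i * (c $ k * c $ i - c' $ k * c' $ i)) <= Q * (R * ?n + ?n * R)"
 unfolding norm_mult[of "q i"] by (intro mult_mono Qi) (use nn in auto)
 have "norm (p c * b c i - p c' * b c' i) <= norm ((p c - p c') * b c i) + norm (p c' * (b c i - b c' i))"
 using norm_triangle_ineq[of "(p c - p c') * b c i" "p c' * (b c i - b c' i)"] by (simp add: algebra_simps)
 also have "... <= (M * ?n) * S + M * (S * ?n)" unfolding norm_mult
 by (intro add_mono mult_mono pdiff p1 b1 bdiff c1) (use nn in auto)
 finally have 2: "norm (ka * (p c * b c i - p c' * b c' i)) <= r * ((M * ?n) * S + M * (S * ?n))"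
 unfolding norm_mult[of ka] using ka nn r by (intro mult_mono) auto
 have e: "(T ka c - T ka c') $ i = - (q i * (c $ k * c $ i - c' $ k * c' $ i) + ka * (p c * b c i - p c' * b c' i)) / d i"
 by (simp add: T_def diff_divide_distrib[symmetric] algebra_simps)
 have "norm (q i * (c $ k * c $ i - c' $ k * c' $ i) + ka * (p c * b c i - p c' * b c' i))
 <= Q * (R * ?n + ?n * R) + r * ((M * ?n) * S + M * (S * ?n))" using norm_triangle_ineq 1 2 by (rule order_trans[OF _ add_mono])
 also have "... = 2 * (Q * ?n) * R + 2 * (M * S * ?n) * r" by (simp add: algebra_simps)
 also have "... <= (2 * Q + 2 * M * S) * (R + r) * ?n"
 proof -
 have "0 <= 2 * (Q * ?n) * r" "0 <= 2 * (M * S * ?n) * R" using nn R r by simp_all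
 then show ?thesis by (simp add: algebra_simps)
 qed
 finally have "norm ((T ka c - T ka c') $ i) <= (1 / norm (d i)) * ((2 * Q + 2 * M * S) * (R + r) * ?n)"
 unfolding e norm_divide norm_minus_cancel by (simp add: divide_right_mono)
 also have "... <= D * ((2 * Q + 2 * M * S) * (R + r) * ?n)" by (intro mult_right_mono Di) (use nn R r in auto)
 finally show ?thesis by (simp add: mult.assoc)
 qed
 then have "norm (T ka c - T ka c') <= (\<Sum>i\<in>(UNIV::'n set). D * ((2 * Q + 2 * M * S) * (R + r)) * ?n)"
 by (intro order_trans[OF norm_le_sum_components sum_mono])
 also have "... = (real CARD('n) * D * (2 * Q + 2 * M * S)) * (R + r) * ?n" by simp
 also have "... <= K * (R + r) * ?n" unfolding K_def by (intro mult_right_mono mult_left_mono) (use nn R r in auto)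
 also have "... <= 1/2 * ?n" by (intro mult_right_mono) (use R(4) r' in \<open>auto simp: algebra_simps\<close>)
 finally show ?thesis .
 qed
 have st: "norm (T ka 0) <= R / 2" if ka: "ka : ball 0 r" for ka
 proof -
 have "norm (T ka 0 $ i) <= D * (2 * M * S) * r" for i
 proof -
 have "norm (ka * (p 0 * b 0 i)) <= r * (M * S)" unfolding norm_mult using ka nn r p1[of 0] b1[of 0 i] by (intro mult_mono) auto
 then have "norm (T ka 0 $ i) <= (1 / norm (d i)) * (r * (M * S))" by (simp add: T_def norm_divide divide_right_mono)
 also have "... <= D * (r * (M * S))" by (intro mult_right_mono Di) (use nn r in auto)
 also have "... <= D * (2 * M * S) * r" using nn r by (simp add: mult_ac)
 finally show ?thesis .
 qed
 then have "norm (T ka 0) <= (\<Sum>i\<in>(UNIV::'n set). D * (2 * M * S) * r)" by (intro order_trans[OF norm_le_sum_components sum_mono])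
 also have "... = (real CARD('n) * D * (2 * M * S)) * r" by simp
 also have "... <= K * r" unfolding K_def by (intro mult_right_mono mult_left_mono) (use nn r in auto)
 finally show ?thesis using r(2) by linarith
 qed
 have "EX c. (ALL i. (%ka. c ka $ i) holomorphic_on ball 0 r) & (ALL ka:ball 0 r. norm (c ka) <= R & T ka (c ka) = c ka)"
 proof (rule holomorphic_fixed_point[OF R(1) DD st])
 fix c :: "complex => complex^'n" and i
 assume h: "!!i. (%ka. c ka $ i) holomorphic_on ball 0 r"
 have cth: "(%ka. ct (c ka) j) holomorphic_on ball 0 r" for j using h by (cases "j = k") (simp_all add: ct_def)
 show "(%ka. T ka (c ka) $ i) holomorphic_on ball 0 r"
 unfolding T_def p_def b_def vec_lambda_beta by (intro holomorphic_intros h cth d)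
 qed
 then obtain c where c: "ALL i. (%ka. c ka $ i) holomorphic_on ball 0 r" and fp: "ALL ka:ball 0 r. norm (c ka) <= R & T ka (c ka) = c ka"
 by (elim exE conjE)
 have "T 0 0 = 0" by (simp add: T_def vec_eq_iff)
 moreover have "(0::complex) : ball 0 r" using r by simp
 ultimately have "norm (c 0) <= 1/2 * norm (c 0)" using DD[of 0 "c 0" 0] fp R by simp
 then have c0: "c 0 = 0" by simp
 have "d i * c ka $ i + q i * (c ka $ k * c ka $ i) + ka * ((1 - (m0 + c ka $ k)^2) * (SUM j:UNIV. s i j * ct (c ka) j)) = 0"
 if ka: "ka : ball 0 r" for ka i
 proof -
 have "c ka $ i = T ka (c ka) $ i" using fp ka by simp
 also have "... = - (q i * (c ka $ k * c ka $ i) + ka * (p (c ka) * b (c ka) i)) / d i" by (simp add: T_def)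
 finally have e: "c ka $ i = - (q i * (c ka $ k * c ka $ i) + ka * (p (c ka) * b (c ka) i)) / d i" .
 have "d i * c ka $ i = - (q i * (c ka $ k * c ka $ i) + ka * (p (c ka) * b (c ka) i))"
 using arg_cong[OF e, of "%x. d i * x"] d[of i] by simp
 then show ?thesis by (simp add: p_def b_def algebra_simps)
 qed
 then show ?thesis using r(1) c c0 by (intro exI[of _ r] exI[of _ c]) simp
qed

section \<open>Projections of rank one and the spectrum at an end state\<close>

definition co :: "bool \<times> 'n => 'n::finite cpair => complex" where "co d x = (if fst d then fst x else snd x) $ snd d"
definition eb :: "bool \<times> 'n => 'n::finite cpair" where
 "eb d = (if fst d then axis (snd d) 1 else 0, if fst d then 0 else axis (snd d) 1)"

lemma sum_axis: "(SUM j:UNIV. x $ j *s axis j 1) = (x :: complex^'n::finite)"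
 by (simp add: vec_eq_iff axis_def if_distrib[of "%z. _ * z"] sum.delta cong: if_cong)

lemma co_expand:
 fixes x :: "'n::finite cpair"
 shows "x = (SUM d:UNIV. sc (co d x) (eb d))"
proof -
 have e: "(SUM d:UNIV. f d) = (SUM p:UNIV. SUM q:UNIV. f (p, q))" for f :: "bool \<times> 'n => 'n cpair"
 by (simp add: sum.cartesian_product)
 show ?thesis
 unfolding e UNIV_bool by (simp add: prod_eq_iff fst_sum snd_sum co_def eb_def sum_axis)
qed

lemma uhol_sum:
 assumes "finite I" "!!i. i : I ==> uhol U (S i)"
 shows "uhol U (%ka t x. \<Sum>i\<in>I. S i ka t x)"
 using assms
proof (induction I rule: finite_induct)
 case empty
 have "uhol U (%ka t x. 0)" by (rule uhol_const[where K = 0]) (simp_all add: linear_zero sc_def prod_eq_iff)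
 then show ?case by simp
next
 case (insert i I) then show ?case by (simp add: uhol_add)
qed

lemma linear_co: "linear (co d)" by (rule linearI) (simp_all add: co_def)
lemma co_sc: "co d (sc h x) = h * co d x" by (simp add: co_def)

text \<open>In coordinates the family is a finite sum of constant maps of rank one multiplied by
  holomorphic scalars.\<close>

lemma uhol_rank_one:
 fixes ld :: "complex => 'n::finite cpair => complex" and rv :: "complex => 'n cpair"
 assumes r: "0 < r" "r <= 1"
 and lin: "!!ka. linear (ld ka)" and ldsc: "!!ka h x. ld ka (sc h x) = h * ld ka x"
 and hl: "!!d. (%ka. ld ka (eb d)) holomorphic_on ball 0 r" and hr: "!!d. (%ka. co d (rv ka)) holomorphic_on ball 0 r"
 shows "uhol (ball 0 (r/2)) (%ka t x. sc (ld ka x) (rv ka))"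
proof -
 have e: "sc (ld ka x) (rv ka) = (SUM d:UNIV. SUM c:UNIV. sc (ld ka (eb d) * co c (rv ka)) (sc (co d x) (eb c)))" for ka x
 proof -
 have "ld ka x = (SUM d:UNIV. co d x * ld ka (eb d))"
 by (subst (1) co_expand[of x]) (simp add: linear_sum[OF lin] ldsc)
 moreover have "sc h (rv ka) = (SUM c:UNIV. sc (h * co c (rv ka)) (eb c))" for h
 by (subst (1) co_expand[of "rv ka"]) (simp add: linear_sum[OF bounded_linear.linear[OF bounded_linear_sc]])
 ultimately have "sc (ld ka x) (rv ka) = (SUM c:UNIV. sc ((SUM d:UNIV. co d x * ld ka (eb d)) * co c (rv ka)) (eb c))" by simp
 also have "... = (SUM c:UNIV. SUM d:UNIV. sc (ld ka (eb d) * co c (rv ka)) (sc (co d x) (eb c)))"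
 by (intro sum.cong refl) (simp add: sc_def sum_distrib_left sum_distrib_right prod_eq_iff vec_eq_iff fst_sum snd_sum mult_ac)
 also have "... = (SUM d:UNIV. SUM c:UNIV. sc (ld ka (eb d) * co c (rv ka)) (sc (co d x) (eb c)))" by (rule sum.swap)
 finally show ?thesis .
 qed
 have small: "norm (w - z) <= 1" if "z : ball 0 (r/2)" "w : ball 0 (r/2)" for z w :: complex
 using that r norm_triangle_ineq4[of w z] by simp
 show ?thesis
 unfolding e
 proof (intro uhol_sum finite)
 fix d c :: "bool \<times> 'n"
 have h: "(%ka. ld ka (eb d) * co c (rv ka)) holomorphic_on ball 0 r" by (intro holomorphic_intros hl hr)
 have n: "uhol (ball 0 (r/2)) (%ka t x. sc (co d x) (eb c :: 'n cpair))"
 proof (rule uhol_const[where K = "norm (eb c :: 'n cpair)"])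
 show "linear (%x. sc (co d x) (eb c :: 'n cpair))"
 by (rule linearI) (simp_all add: linear_add[OF linear_co] linear_cmul[OF linear_co] sc_add_left sc_def prod_eq_iff vec_eq_iff)
 have "norm (co d x) <= norm x" for x :: "'n cpair"
 using norm_fst_le[of "fst x" "snd x"] norm_snd_le[of "snd x" "fst x"]
 Finite_Cartesian_Product.norm_nth_le[of "fst x" "snd d"] Finite_Cartesian_Product.norm_nth_le[of "snd x" "snd d"]
 unfolding co_def prod.collapse by (cases "fst d") (simp_all del: prod.collapse)
 then show "norm (sc (co d x) (eb c :: 'n cpair)) <= norm (eb c :: 'n cpair) * norm x" for x
 unfolding norm_sc by (subst mult.commute) (rule mult_left_mono[OF _ norm_ge_zero])
 qed (simp_all add: co_sc)
 show "uhol (ball 0 (r/2)) (%ka t x. sc (ld ka (eb d) * co c (rv ka)) (sc (co d x) (eb c)))"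
 by (rule uhol_comp[OF uhol_sc[OF h r(1)] n small])
 qed
qed

definition cv :: "real^'n => complex^'n" where "cv r = (\<chi> i. complex_of_real (r $ i))"
text \<open>Bilinear, not Hermitian, so that pairings of holomorphic vectors stay holomorphic; for a
  real symmetric matrix it still allows the matrix to be moved across.\<close>

definition bil :: "complex^'n::finite => complex^'n => complex" where "bil x y = (SUM l:UNIV. x $ l * y $ l)"

lemma bil_add: "bil x (y + z) = bil x y + bil x z" and bil_smult: "bil x (h *s y) = h * bil x y"
 and bil_comm: "bil x y = bil y x"
 by (simp_all add: bil_def algebra_simps sum.distrib sum_distrib_left)

lemma bil_sum: "bil x (\<Sum>i\<in>I. y i) = (\<Sum>i\<in>I. bil x (y i))"
 by (simp add: bil_def sum_distrib_left sum.swap[of _ I])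

lemma bil_scaleR: "bil x (a *R y) = a *R bil x y"
 by (simp add: bil_def scaleR_sum_right)

lemma bil_cm: "sym_mat M ==> bil x (cm M y) = bil (cm M x) y"
proof -
 assume M: "sym_mat M"
 have s: "M $ j $ i = M $ i $ j" for i j using M unfolding sym_mat_def by (metis transpose_def vec_lambda_beta)
 have "bil x (cm M y) = (SUM i:UNIV. SUM j:UNIV. x $ i * (M $ i $ j *R y $ j))" by (simp add: bil_def cm_def sum_distrib_left)
 also have "... = (SUM j:UNIV. SUM i:UNIV. x $ i * (M $ i $ j *R y $ j))" by (rule sum.swap)
 also have "... = bil (cm M x) y" by (simp add: bil_def cm_def sum_distrib_right s)
 finally show ?thesis .
qed

lemma cm_cv: "cm M (cv r) = cv (M *v r)"
 by (simp add: cm_def cv_def vec_eq_iff matrix_vector_mult_def scaleR_conv_of_real)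

lemma bil_cv: "bil (cv r) (cv r') = complex_of_real (r #. r')"
 by (simp add: bil_def cv_def inner_vec_def)

lemma inner_smult_cv: "(h *s cv a) #. (h' *s cv b) = Re (cnj h * h') * (a #. b)"
 by (simp add: inner_vec_def inner_complex_def cv_def sum_distrib_left algebra_simps sum.distrib[symmetric])

lemma cv_scaleR: "cv (a *R r) = complex_of_real a *s cv r" by (simp add: cv_def vec_eq_iff)

lemma cm_sum: "cm M (\<Sum>i\<in>I. y i) = (\<Sum>i\<in>I. cm M (y i))" by (rule cm.sum_right)

definition pr :: "complex^'n::finite => complex^'n => 'n cpair" where "pr v u = (v + u, v - u)"

lemma mid_pr [simp]: "mid (pr v u) = v" and dif_pr [simp]: "dif (pr v u) = u"
 by (simp_all add: pr_def mid_def dif_def scaleR_2[symmetric])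

lemma pair_eqI: "mid x = mid y ==> dif x = dif y ==> x = y"
 by (rule prod_eqI) (simp_all add: fst_mid_dif snd_mid_dif)

lemma mid_bop: "mid (bop (G + F) (G - F) ka x) = ka *s dif x + cm F (mid x)"
 and dif_bop: "dif (bop (G + F) (G - F) ka x) = ka *s mid x + cm G (mid x)"
proof -
 have f: "cm (G + F) y = cm G y + cm F y" "cm (G - F) y = cm G y - cm F y" for y by (simp_all add: cm.add_left cm.diff_left)
 have x: "fst x = mid x + dif x" "snd x = mid x - dif x" by (rule fst_mid_dif snd_mid_dif)+
 show "mid (bop (G + F) (G - F) ka x) = ka *s dif x + cm F (mid x)"
 unfolding bop_def mid_def[of "(a, b)" for a b] fst_conv snd_conv f x by (simp add: vec_eq_iff scaleR_conv_of_real[where 'a = complex] field_simps)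
 show "dif (bop (G + F) (G - F) ka x) = ka *s mid x + cm G (mid x)"
 unfolding bop_def dif_def[of "(a, b)" for a b] fst_conv snd_conv f x by (simp add: vec_eq_iff scaleR_conv_of_real[where 'a = complex] field_simps)
qed

lemma mid_anti: "mid (u, - u) = 0" and dif_anti: "dif (u, - u) = u"
 by (simp_all add: mid_def dif_def scaleR_2[symmetric])

text \<open>\<open>F\<close> and \<open>G\<close> are diagonal relative to the metric
  \<open>W\<close> in the basis \<open>rr\<close>, with entries \<open>ff\<close> and
  \<open>gg\<close>; \<open>dom\<close> expresses that \<open>G + F\<close> and \<open>G - F\<close>
  are positive. The slow rates are to first order \<open>- ka * gg j / ff j\<close>, so the sign of
  \<open>ff j\<close> tells whether the j-th slow mode grows or decays. \<open>Pi\<close> and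
  \<open>Qi\<close> are \<open>om\<close> times the inverses of \<open>G + F\<close> and
  \<open>G - F\<close>.\<close>

locale end_spectrum =
 fixes F G W Pi Qi :: "real^'n::finite^'n" and rr :: "'n => real^'n" and ff gg :: "'n => real" and k :: 'n and om :: real
 assumes symF: "sym_mat F" and symG: "sym_mat G"
 and orth: "rr i #. (W *v rr j) = (if i = j then 1 else 0)"
 and eigF: "F *v rr j = ff j *R (W *v rr j)" and eigG: "G *v rr j = gg j *R (W *v rr j)"
 and dom: "\<bar>ff j\<bar> < gg j" and fk: "ff k < 0" and om: "0 < om"
 and invP: "Pi *v ((G + F) *v x) = om *R x" and invQ: "Qi *v ((G - F) *v x) = om *R x"
begin

definition crd :: "'n => complex^'n => complex" where "crd j u = bil (cv (rr j)) u"

text \<open>Orthonormality with respect to \<open>W\<close> is a left inverse identity for square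
  matrices; read as a right inverse it is the expansion in the dual basis
  \<open>W *v rr j\<close>.\<close>

lemma complete: "u = (SUM j:UNIV. crd j u *s cv (W *v rr j))"
proof -
 define M where "M = (\<chi> i j. rr j $ i)"
 have WM: "(W ** M) $ l $ j = (W *v rr j) $ l" for l j by (simp add: matrix_matrix_mult_def matrix_vector_mult_def M_def)
 have Mi: "M $ l $ j = rr j $ l" for l j by (simp add: M_def)
 have "transpose M ** (W ** M) = mat 1"
 proof -
 have "(transpose M ** (W ** M)) $ i $ j = rr i #. (W *v rr j)" for i j
 unfolding matrix_matrix_mult_def[of "transpose M"] by (simp add: WM transpose_def Mi inner_vec_def)
 then show ?thesis by (simp add: vec_eq_iff mat_def orth)
 qed
 then have "(W ** M) ** transpose M = mat 1" by (simp add: matrix_left_right_inverse)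
 then have e: "(SUM j:UNIV. (W *v rr j) $ i * rr j $ l) = (if i = l then 1 else 0)" for i l
 unfolding vec_eq_iff matrix_matrix_mult_def[of "W ** M"] by (simp add: WM transpose_def Mi mat_def)
 have "(SUM j:UNIV. crd j u *s cv (W *v rr j)) $ i = u $ i" for i
 proof -
 have "(SUM j:UNIV. crd j u *s cv (W *v rr j)) $ i = (SUM j:UNIV. SUM l:UNIV. complex_of_real ((W *v rr j) $ i * rr j $ l) * u $ l)"
 by (simp add: crd_def bil_def cv_def sum_distrib_left sum_distrib_right mult_ac)
 also have "... = (SUM l:UNIV. SUM j:UNIV. complex_of_real ((W *v rr j) $ i * rr j $ l) * u $ l)" by (rule sum.swap)
 also have "... = (SUM l:UNIV. complex_of_real (if i = l then 1 else 0) * u $ l)"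
 unfolding sum_distrib_right[symmetric] of_real_sum[symmetric] e ..
 also have "... = u $ i" by (simp add: if_distrib[of complex_of_real] if_distrib[of "%z. z * _"] sum.delta cong: if_cong)
 finally show ?thesis .
 qed
 then show ?thesis by (simp add: vec_eq_iff)
qed

lemma crd_zero: "(!!j. crd j u = 0) ==> u = 0"
 by (subst complete) simp

text \<open>The j-th diagonal entry of \<open>Pi - Qi\<close> in the dual basis; its sign is
  opposite to that of \<open>ff j\<close>.\<close>

definition xx :: "'n => real" where "xx j = om / (gg j + ff j) - om / (gg j - ff j)"

lemma xx_sign: "ff j < 0 ==> 0 < xx j" "0 < ff j ==> xx j < 0"
 using dom[of j] om unfolding xx_def by (simp_all add: frac_less2 abs_less_iff divide_strict_left_mono)

text \<open>A diagonal map in the dual basis. With all signs 1 it is the identity; with 1 at k and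
  -1 elsewhere it is \<open>2 Pr - 1\<close> for the projection onto the k-th direction.\<close>

definition flip :: "('n => real) => complex^'n => complex^'n" where
 "flip si u = (SUM j:UNIV. (complex_of_real (si j) * crd j u) *s cv (W *v rr j))"

lemma inv_rr: "Pi *v (W *v rr j) = (om / (gg j + ff j)) *R rr j" "Qi *v (W *v rr j) = (om / (gg j - ff j)) *R rr j"
proof -
 have nz: "gg j + ff j ~= 0" "gg j - ff j ~= 0" using dom[of j] by (auto simp: abs_less_iff)
 have "Pi *v ((gg j + ff j) *R (W *v rr j)) = om *R rr j"
 using invP[of "rr j"] by (simp add: matrix_vector_mult_add_rdistrib eigF eigG scaleR_left_distrib)
 then have "(gg j + ff j) *R (Pi *v (W *v rr j)) = om *R rr j" by (simp add: matrix_vector_mult_scaleR)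
 then have "(1 / (gg j + ff j)) *R (gg j + ff j) *R (Pi *v (W *v rr j)) = (1 / (gg j + ff j)) *R om *R rr j" by simp
 then show "Pi *v (W *v rr j) = (om / (gg j + ff j)) *R rr j" using nz by simp
 have "Qi *v ((gg j - ff j) *R (W *v rr j)) = om *R rr j"
 using invQ[of "rr j"] by (simp add: matrix_vector_mult_diff_rdistrib eigF eigG scaleR_left_diff_distrib)
 then have "(gg j - ff j) *R (Qi *v (W *v rr j)) = om *R rr j" by (simp add: matrix_vector_mult_scaleR)
 then have "(1 / (gg j - ff j)) *R (gg j - ff j) *R (Qi *v (W *v rr j)) = (1 / (gg j - ff j)) *R om *R rr j" by simp
 then show "Qi *v (W *v rr j) = (om / (gg j - ff j)) *R rr j" using nz by simp
qed

lemma flip_form: "(flip si u, - flip si u) #. diagop Pi Qi (u, - u) = (SUM j:UNIV. si j * xx j * (norm (crd j u))^2)"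
proof -
 have cp: "cm Pi u = (SUM j:UNIV. (crd j u * complex_of_real (om / (gg j + ff j))) *s cv (rr j))"
 by (subst (1) complete) (simp add: cm_sum cm_smult cm_cv inv_rr cv_scaleR)
 have cq: "cm Qi u = (SUM j:UNIV. (crd j u * complex_of_real (om / (gg j - ff j))) *s cv (rr j))"
 by (subst (1) complete) (simp add: cm_sum cm_smult cm_cv inv_rr cv_scaleR)
 have pair: "flip si u #. (SUM j:UNIV. (crd j u * complex_of_real (y j)) *s cv (rr j)) = (SUM j:UNIV. si j * y j * (norm (crd j u))^2)" for y
 proof -
 have "flip si u #. (SUM j:UNIV. (crd j u * complex_of_real (y j)) *s cv (rr j)) =
 (SUM i:UNIV. SUM j:UNIV. Re (cnj (complex_of_real (si i) * crd i u) * (crd j u * complex_of_real (y j))) * ((W *v rr i) #. rr j))"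
 unfolding flip_def inner_sum_left inner_sum_right inner_smult_cv by (rule sum.swap)
 also have "... = (SUM i:UNIV. Re (cnj (complex_of_real (si i) * crd i u) * (crd i u * complex_of_real (y i))))"
 by (simp add: inner_commute[of "W *v _"] orth if_distrib[of "%z. _ * z"] sum.delta' cong: if_cong)
 also have "... = (SUM i:UNIV. si i * y i * (norm (crd i u))^2)"
 proof (rule sum.cong[OF refl])
 fix i
 have "cnj (complex_of_real (si i) * crd i u) * (crd i u * complex_of_real (y i)) = complex_of_real (si i * y i) * (crd i u * cnj (crd i u))"
 by simp
 also have "... = complex_of_real (si i * y i * (norm (crd i u))^2)" unfolding complex_norm_square[symmetric] by simp
 finally show "Re (cnj (complex_of_real (si i) * crd i u) * (crd i u * complex_of_real (y i))) = si i * y i * (norm (crd i u))^2" by (metis Re_complex_of_real)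
 qed
 finally show ?thesis .
 qed
 have "(flip si u, - flip si u) #. diagop Pi Qi (u, - u) = flip si u #. cm Pi u - flip si u #. cm Qi u"
 by (simp add: diagop_def cm.minus_right)
 also have "... = (SUM j:UNIV. si j * xx j * (norm (crd j u))^2)"
 unfolding cp cq pair by (simp add: xx_def sum_subtractf[symmetric] algebra_simps)
 finally show ?thesis .
qed

lemma flip_positive:
 assumes "!!j. 0 < si j * xx j"
 shows "EX c>0. ALL u. c * (norm u)^2 <= (flip si u, - flip si u) #. diagop Pi Qi (u, - u)"
proof -
 define K where "K = (SUM j:UNIV. (norm (cv (W *v rr j)))^2) + 1"
 define m where "m = Min (range (%j. si j * xx j))"
 have m: "0 < m" "m <= si j * xx j" for j using assms by (auto simp: m_def)
 have K: "0 < K" unfolding K_def by (intro add_nonneg_pos sum_nonneg) auto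
 have "m / K * (norm u)^2 <= (flip si u, - flip si u) #. diagop Pi Qi (u, - u)" for u
 proof -
 have "norm u <= (SUM j:UNIV. norm (crd j u) * norm (cv (W *v rr j)))"
 by (subst (1) complete) (rule order_trans[OF norm_sum], simp)
 then have "(norm u)^2 <= (SUM j:UNIV. norm (crd j u) * norm (cv (W *v rr j)))^2" by (intro power_mono) auto
 also have "... <= (SUM j:UNIV. (norm (crd j u))^2) * (SUM j:UNIV. (norm (cv (W *v rr j)))^2)" by (rule Cauchy_Schwarz_ineq_sum)
 also have "... <= (SUM j:UNIV. (norm (crd j u))^2) * K" unfolding K_def by (intro mult_left_mono sum_nonneg) auto
 finally have "m / K * (norm u)^2 <= m / K * ((SUM j:UNIV. (norm (crd j u))^2) * K)" using m K by (intro mult_left_mono) auto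
 also have "... = (SUM j:UNIV. m * (norm (crd j u))^2)" using K by (simp add: sum_distrib_left)
 also have "... <= (SUM j:UNIV. si j * xx j * (norm (crd j u))^2)" by (intro sum_mono mult_right_mono m) auto
 finally show ?thesis unfolding flip_form .
 qed
 then show ?thesis using m K by (intro exI[of _ "m / K"]) simp
qed

lemma crd_cm: "crd i (cm F (SUM j:UNIV. h j *s cv (rr j))) = complex_of_real (ff i) * h i"
 "crd i (cm G (SUM j:UNIV. h j *s cv (rr j))) = complex_of_real (gg i) * h i"
 by (simp_all add: crd_def cm_sum cm_smult cm_cv eigF eigG bil_sum bil_smult bil_cv orth
 if_distrib[of "%z. _ * z"] if_distrib[of complex_of_real] mult.commute sum.delta cong: if_cong)

text \<open>Seeking an eigenvalue \<open>ka * m\<close> of the generator and eliminating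
  \<open>dif\<close> leaves \<open>m F nu + G nu + ka (1 - m^2) nu = 0\<close> for the
  \<open>mid\<close> component. This pencil is regular at \<open>ka = 0\<close>, although 0 is there
  an eigenvalue of multiplicity at least n of the generator itself, and it is solved by
  \<open>m = - gg k / ff k\<close>, \<open>nu = rr k\<close>.\<close>

lemma slow_eigenpair:
 assumes fj: "!!j. j ~= k ==> 0 < ff j"
 shows "EX r m nu. 0 < r & m holomorphic_on ball 0 r & (ALL i. (%ka. nu ka $ i) holomorphic_on ball 0 r) &
 m 0 = complex_of_real (- (gg k / ff k)) & nu 0 = cv (rr k) &
 (ALL ka:ball 0 r. m ka *s cm F (nu ka) + cm G (nu ka) + (ka * (1 - (m ka)^2)) *s nu ka = 0)"
proof -
 define m0 where "m0 = - (gg k / ff k)"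
 have m0: "0 < m0" using fk dom[of k] by (simp add: m0_def divide_pos_neg)
 define d where "d i = (if i = k then complex_of_real (ff k) else complex_of_real (m0 * ff i + gg i))" for i
 define q where "q i = (if i = k then 0 else complex_of_real (ff i))" for i
 \<comment> \<open>In direction k the linear part vanishes, so there the derivative with respect to
   \<open>m\<close>, which is \<open>ff k\<close>, serves as the nonzero coefficient; in the other
   directions \<open>m0 * ff i + gg i\<close> is positive.\<close>
 have mk: "m0 * ff k + gg k = 0" using fk by (simp add: m0_def)
 have d0: "d i ~= 0" for i
 proof (cases "i = k")
 case False
 have "0 < m0 * ff i" using m0 fj[OF False] by simp
 then have "m0 * ff i + gg i ~= 0" using dom[of i] by linarith
 then show ?thesis unfolding d_def using False of_real_eq_0_iff by metis
 qed (use fk in \<open>simp add: d_def\<close>)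
 obtain r c where r: "0 < r" and c: "ALL i. (%ka. c ka $ i) holomorphic_on ball 0 r" and c0: "c 0 = 0"
 and eq: "ALL ka:ball 0 r. ALL i. d i * c ka $ i + q i * (c ka $ k * c ka $ i) + ka * ((1 - (complex_of_real m0 + c ka $ k)^2) *
 (SUM j:UNIV. complex_of_real (rr i #. rr j) * (if j = k then 1 else c ka $ j))) = 0"
 using small_eigen_fixed_point[where d = d and q = q and k = k and s = "%i j. complex_of_real (rr i #. rr j)" and ?m0.0 = "complex_of_real m0", OF d0]
 by (elim exE conjE)
 define ct where "ct ka j = (if j = k then 1 else c ka $ j)" for ka j
 define m where "m ka = complex_of_real m0 + c ka $ k" for ka
 define nu where "nu ka = (SUM j:UNIV. ct ka j *s cv (rr j))" for ka
 have cth: "(%ka. ct ka j) holomorphic_on ball 0 r" for j using c by (cases "j = k") (simp_all add: ct_def)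
 have nui: "nu ka $ i = (SUM j:UNIV. ct ka j * complex_of_real (rr j $ i))" for ka i by (simp add: nu_def cv_def)
 have 1: "m holomorphic_on ball 0 r" unfolding m_def by (intro holomorphic_intros c[rule_format])
 have 2: "(%ka. nu ka $ i) holomorphic_on ball 0 r" for i unfolding nui by (intro holomorphic_intros cth)
 have 3: "m 0 = complex_of_real m0" by (simp add: m_def c0)
 have 4: "nu 0 = cv (rr k)" by (simp add: vec_eq_iff nui ct_def c0 cv_def if_distrib[of "%z. z * _"] sum.delta cong: if_cong)
 have 5: "m ka *s cm F (nu ka) + cm G (nu ka) + (ka * (1 - (m ka)^2)) *s nu ka = 0" if ka: "ka : ball 0 r" for ka
 proof (rule crd_zero)
 fix i
 have "crd i (nu ka) = (SUM j:UNIV. complex_of_real (rr i #. rr j) * ct ka j)"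
 by (simp add: crd_def nu_def bil_sum bil_smult bil_cv mult.commute)
 then have "crd i (m ka *s cm F (nu ka) + cm G (nu ka) + (ka * (1 - (m ka)^2)) *s nu ka)
 = (m ka * complex_of_real (ff i) + complex_of_real (gg i)) * ct ka i + ka * ((1 - (m ka)^2) * (SUM j:UNIV. complex_of_real (rr i #. rr j) * ct ka j))"
 using crd_cm[of i "ct ka", folded nu_def] by (simp only: crd_def bil_add bil_smult distrib_right mult.assoc)
 also have "(m ka * complex_of_real (ff i) + complex_of_real (gg i)) * ct ka i = d i * c ka $ i + q i * (c ka $ k * c ka $ i)"
 proof (cases "i = k")
 case True
 have "complex_of_real m0 * complex_of_real (ff k) + complex_of_real (gg k) = 0"
 using arg_cong[OF mk, of complex_of_real] by simp
 then show ?thesis using True by (simp add: m_def ct_def d_def q_def algebra_simps)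
 qed (simp add: m_def ct_def d_def q_def algebra_simps)
 finally show "crd i (m ka *s cm F (nu ka) + cm G (nu ka) + (ka * (1 - (m ka)^2)) *s nu ka) = 0"
 using eq[rule_format, OF ka, of i] by (simp only: m_def ct_def)
 qed
 show ?thesis using r 1 2 3 4 5 unfolding m0_def by (intro exI[of _ r] exI[of _ m] exI[of _ nu] conjI allI ballI) simp_all
qed

end

lemma eventually_nhds_holomorphic:
 fixes h :: "complex => 'a::topological_space"
 assumes "continuous_on (ball 0 r) h" "0 < r" "open V" "h 0 : V"
 shows "\<forall>\<^sub>F ka in nhds 0. h ka : V"
proof -
 have "isCont h 0" using assms(1,2) by (simp add: continuous_on_eq_continuous_at)
 then have "(h ---> h 0) (nhds 0)" unfolding continuous_at tendsto_at_iff_tendsto_nhds .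
 then show ?thesis by (rule topological_tendstoD[OF _ assms(3,4)])
qed

lemma crd_inner: "cv r #. cm M (cv r) = r #. (M *v r)"
 unfolding cm_cv by (simp add: cv_def inner_vec_def inner_complex_def)

context end_spectrum begin

text \<open>Multiply the pencil by \<open>ka\<close> and pair it with \<open>nu\<close>. If
  \<open>Re (ka * m)\<close> were negative, the term with \<open>F\<close> would be strictly
  positive, while the two remaining terms are nonnegative, so the sum could not vanish. The argument
  works for all small \<open>ka\<close>, where an expansion in \<open>ka\<close> would lose control
  along the imaginary axis.\<close>

lemma slow_rate_nonneg:
 assumes eq: "m *s cm F nu + cm G nu + (ka * (1 - m^2)) *s nu = 0"
 and f: "nu #. cm F nu < 0" and g: "0 <= nu #. cm G nu" and m: "1 <= Re (m^2)" and rm: "0 <= Re m" and ka: "0 <= Re ka"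
 shows "0 <= Re (ka * m)"
proof (rule ccontr)
 assume neg: "\<not> 0 <= Re (ka * m)"
 have "(ka * m) *s cm F nu + ka *s cm G nu + (ka^2 * (1 - m^2)) *s nu = ka *s (m *s cm F nu + cm G nu + (ka * (1 - m^2)) *s nu)"
 by (simp add: vec_eq_iff algebra_simps power2_eq_square)
 also have "... = 0" by (simp add: eq)
 finally have "nu #. ((ka * m) *s cm F nu + ka *s cm G nu + (ka^2 * (1 - m^2)) *s nu) = 0" by simp
 moreover have s: "nu #. (h *s cm M nu) = Re h * (nu #. cm M nu)" if "sym_mat M" for h M
 using inner_smult_cm[OF that, of h nu] cm_sym[OF that, of nu "h *s nu"] by (simp add: cm_smult inner_commute)
 have "sym_mat (mat 1 :: real^'n^'n)" by (simp add: sym_mat_def transpose_mat)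
 from s[OF this] have "nu #. (h *s nu) = Re h * (norm nu)^2" for h by (simp add: power2_norm_eq_inner)
 ultimately have e: "Re (ka * m) * (nu #. cm F nu) + Re ka * (nu #. cm G nu) + Re (ka^2 * (1 - m^2)) * (norm nu)^2 = 0"
 by (simp add: inner_add_right s symF symG)
 define x y a b where "x = Re ka" "y = Im ka" "a = Re m" "b = Im m"
 have n: "x * a - y * b < 0" using neg by (simp add: x_y_a_b_def)
 have ab: "1 <= a^2 - b^2" using m by (simp add: x_y_a_b_def power2_eq_square)
 have a: "0 <= a" using rm by (simp add: x_y_a_b_def)
 have x: "0 <= x" using ka by (simp add: x_y_a_b_def)
 have "0 <= Re (ka^2 * (1 - m^2))"
 proof -
 \<comment> \<open>The subtracted square is that of \<open>Re (ka * m)\<close>; under the assumption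
   of negativity it is at most \<open>(y * b)^2\<close>, which the second term covers because
   \<open>Re (m^2) >= 1\<close>.\<close>
 have id: "Re (ka^2 * (1 - m^2)) = x^2 * (1 + a^2 + b^2) + y^2 * (a^2 + b^2 - 1) - 2 * (x * a - y * b)^2"
 by (simp add: x_y_a_b_def power2_eq_square algebra_simps)
 have "0 <= x * a" using x a by simp
 then have "\<bar>x * a - y * b\<bar> <= \<bar>y * b\<bar>" using n by linarith
 then have "(x * a - y * b)^2 <= (y * b)^2" by (simp only: abs_le_square_iff)
 moreover have "2 * (y * b)^2 <= y^2 * (a^2 + b^2 - 1)"
 using mult_left_mono[OF ab, of "y^2"] by (simp add: power_mult_distrib algebra_simps)
 moreover have "0 <= x^2 * (1 + a^2 + b^2)" by simp
 ultimately show ?thesis unfolding id by linarith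
 qed
 then have "0 <= Re (ka^2 * (1 - m^2)) * (norm nu)^2" by simp
 moreover have "0 <= Re ka * (nu #. cm G nu)" using ka g by simp
 moreover have "0 < Re (ka * m) * (nu #. cm F nu)" using neg f by (intro mult_neg_neg) auto
 ultimately show False using e by linarith
qed

text \<open>The spectral projection is built from a left and a right eigenvector, both scaled to
  stay regular at \<open>ka = 0\<close>: the right one has \<open>mid = ka nu\<close> and
  \<open>dif = ka m nu - F nu\<close>, so it becomes a pair \<open>(u, - u)\<close> in the limit.
  The sign conditions needed for \<open>slow_rate_nonneg\<close> hold strictly at 0 and hence on a
  small disc.\<close>

theorem slow_projection:
 assumes fj: "!!j. j ~= k ==> 0 < ff j"
 shows "EX r0 c1 ld rv mu. 0 < r0 & r0 <= 1/2 & 0 < c1 & (ALL ka. linear (ld ka)) & (ALL ka h x. ld ka (sc h x) = h * ld ka x) &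
 uhol (ball 0 r0) (%ka t x. sc (ld ka x) (rv ka)) &
 (ALL ka:ball 0 r0. (ALL x. ld ka (bop (G + F) (G - F) ka x) = mu ka * ld ka x) & ld ka (rv ka) = 1 &
 bop (G + F) (G - F) ka (rv ka) = sc (mu ka) (rv ka) & (ka : Hplus --> 0 <= Re (mu ka))) &
 (ALL u. c1 * (norm u)^2 <= (2 *R sc (ld 0 (u, - u)) (rv 0) - (u, - u)) #. diagop Pi Qi (u, - u)) &
 (ALL u. crd k u = 0 --> sc (ld 0 (u, - u)) (rv 0) = 0)"
proof -
 obtain r m nu where r: "0 < r" and hm: "m holomorphic_on ball 0 r" and hnu: "ALL i. (%ka. nu ka $ i) holomorphic_on ball 0 r"
 and m0: "m 0 = complex_of_real (- (gg k / ff k))" and nu0: "nu 0 = cv (rr k)"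
 and eq: "ALL ka:ball 0 r. m ka *s cm F (nu ka) + cm G (nu ka) + (ka * (1 - (m ka)^2)) *s nu ka = 0"
 by atomize_elim (rule slow_eigenpair, rule fj)
 \<comment> \<open>The pairing of the unnormalized left and right eigenvectors; at 0 it equals
   \<open>- ff k\<close>, so it can be divided by on a small disc.\<close>
 define cc where "cc ka = 2 * (ka * m ka) * bil (nu ka) (nu ka) - bil (nu ka) (cm F (nu ka))" for ka
 have hF: "(%ka. cm M (nu ka) $ i) holomorphic_on ball 0 r" for M :: "real^'n^'n" and i
 by (simp add: cm_def scaleR_conv_of_real) (intro holomorphic_intros hnu[rule_format])
 have hcc: "cc holomorphic_on ball 0 r" unfolding cc_def bil_def by (intro holomorphic_intros hm hnu[rule_format] hF)
 have kk: "rr k #. (F *v rr k) = ff k" "rr k #. (G *v rr k) = gg k" using orth[of k k] by (simp_all add: eigF eigG)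
 have cc0: "cc 0 = - complex_of_real (ff k)" by (simp add: cc_def nu0 cm_cv bil_cv kk)
 have cnu: "continuous_on (ball 0 r) nu"
 proof -
 have "continuous_on (ball 0 r) (%ka. \<chi> i. nu ka $ i)"
 by (intro continuous_on_vec_lambda holomorphic_on_imp_continuous_on hnu[rule_format])
 then show ?thesis by simp
 qed
 note cm = holomorphic_on_imp_continuous_on[OF hm]
 note ev = eventually_nhds_holomorphic[OF _ r]
 have e1: "\<forall>\<^sub>F ka in nhds 0. cc ka \<in> - {0}"
 by (rule ev[OF holomorphic_on_imp_continuous_on[OF hcc]]) (use cc0 fk in auto)
 have e2: "\<forall>\<^sub>F ka in nhds 0. nu ka #. cm F (nu ka) : {..<0}"
 by (rule ev) (use fk in \<open>auto simp: nu0 crd_inner kk intro!: continuous_intros cnu cm.continuous_on\<close>)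
 have e3: "\<forall>\<^sub>F ka in nhds 0. nu ka #. cm G (nu ka) : {0<..}"
 by (rule ev) (use dom[of k] in \<open>auto simp: nu0 crd_inner kk intro!: continuous_intros cnu cm.continuous_on\<close>)
 have g1: "1 < - (gg k / ff k)" using dom[of k] fk by (simp add: field_simps)
 have e4: "\<forall>\<^sub>F ka in nhds 0. Re ((m ka)^2) : {1<..}"
 proof (rule ev)
 have "1 < (gg k / ff k)^2" using one_less_power[OF g1, of 2] by simp
 then show "Re ((m 0)^2) : {1<..}" unfolding m0 by (simp flip: of_real_power of_real_minus of_real_divide)
 qed (auto intro!: continuous_intros cm)
 have e5: "\<forall>\<^sub>F ka in nhds 0. Re (m ka) : {0<..}"
 proof (rule ev)
 show "Re (m 0) : {0<..}" unfolding m0 using g1 by (simp del: of_real_minus of_real_divide)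
 qed (auto intro!: continuous_intros cm)
 have "\<forall>\<^sub>F ka in nhds 0. cc ka ~= 0 & nu ka #. cm F (nu ka) < 0 & 0 <= nu ka #. cm G (nu ka) & 1 <= Re ((m ka)^2) & 0 <= Re (m ka)"
 using e1 e2 e3 e4 e5 by eventually_elim auto
 then obtain r1 where r1: "0 < r1" and
 g: "ALL ka. dist ka 0 < r1 --> cc ka ~= 0 & nu ka #. cm F (nu ka) < 0 & 0 <= nu ka #. cm G (nu ka) & 1 <= Re ((m ka)^2) & 0 <= Re (m ka)"
 unfolding eventually_nhds_metric by blast
 define r2 where "r2 = min (min r r1) 1"
 have r2: "0 < r2" "r2 <= 1" "ball 0 r2 \<subseteq> ball 0 r" using r r1 by (auto simp: r2_def)
 have good: "cc ka ~= 0" "nu ka #. cm F (nu ka) < 0" "0 <= nu ka #. cm G (nu ka)" "1 <= Re ((m ka)^2)" "0 <= Re (m ka)"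
 "m ka *s cm F (nu ka) + cm G (nu ka) + (ka * (1 - (m ka)^2)) *s nu ka = 0" if "ka : ball 0 r2" for ka
 using g[rule_format, of ka] eq[rule_format, of ka] that by (auto simp: r2_def)
 define ld where "ld ka x = bil (nu ka) (m ka *s mid x + dif x) / cc ka" for ka x
 define rv where "rv ka = pr (ka *s nu ka) ((ka * m ka) *s nu ka - cm F (nu ka))" for ka
 have lin: "linear (ld ka)" for ka
 by (rule linearI) (simp_all add: ld_def linear_add[OF linear_mid] linear_add[OF linear_dif] linear_cmul[OF linear_mid]
 linear_cmul[OF linear_dif] bil_add bil_smult bil_scaleR scaleR_conv_of_real[where 'a = complex] algebra_simps add_divide_distrib)
 have ldsc: "ld ka (sc h x) = h * ld ka x" for ka h x
 by (simp add: ld_def mid_sc dif_sc bil_add bil_smult algebra_simps)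
 have m2: "m holomorphic_on ball 0 r2" and n2: "(%ka. nu ka $ i) holomorphic_on ball 0 r2" and c2: "cc holomorphic_on ball 0 r2"
 and f2: "(%ka. cm F (nu ka) $ i) holomorphic_on ball 0 r2" for i
 using holomorphic_on_subset[OF _ r2(3)] hm hnu hcc hF by blast+
 have uh: "uhol (ball 0 (r2/2)) (%ka t x. sc (ld ka x) (rv ka))"
 proof (rule uhol_rank_one[OF r2(1,2) lin ldsc])
 show "(%ka. ld ka (eb d)) holomorphic_on ball 0 r2" for d
 unfolding ld_def bil_def vector_add_component vector_smult_component
 by (intro holomorphic_intros m2 n2 c2) (use good(1) in auto)
 show "(%ka. co d (rv ka)) holomorphic_on ball 0 r2" for d
 unfolding co_def rv_def pr_def fst_conv snd_conv
 by (cases "fst d") (simp_all, (intro holomorphic_intros m2 n2 f2)+)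
 qed
 have eqF: "m ka *s cm F (nu ka) + cm G (nu ka) + ka *s nu ka = (ka * (m ka)^2) *s nu ka" if "ka : ball 0 r2" for ka
 using good(6)[OF that] by (simp add: vec_eq_iff algebra_simps)
 have lb: "ld ka (bop (G + F) (G - F) ka x) = ka * m ka * ld ka x" if ka: "ka : ball 0 r2" for ka x
 proof -
 have "bil (nu ka) (m ka *s (ka *s dif x + cm F (mid x)) + (ka *s mid x + cm G (mid x)))
 = ka * m ka * bil (nu ka) (dif x) + bil (m ka *s cm F (nu ka) + cm G (nu ka) + ka *s nu ka) (mid x)"
 by (simp add: bil_add bil_smult bil_cm[OF symF] bil_cm[OF symG] bil_comm[of _ "mid x"] algebra_simps)
 also have "... = ka * m ka * bil (nu ka) (m ka *s mid x + dif x)"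
 unfolding eqF[OF ka] by (simp add: bil_add bil_smult bil_comm[of _ "mid x"] algebra_simps power2_eq_square)
 finally show ?thesis by (simp add: ld_def mid_bop dif_bop)
 qed
 have lr: "ld ka (rv ka) = 1" if ka: "ka : ball 0 r2" for ka
 proof -
 have "m ka *s mid (rv ka) + dif (rv ka) = (2 * (ka * m ka)) *s nu ka + (-1) *s cm F (nu ka)"
 by (simp add: rv_def vec_eq_iff algebra_simps)
 then have "bil (nu ka) (m ka *s mid (rv ka) + dif (rv ka)) = cc ka" by (simp only: bil_add bil_smult cc_def) simp
 then show ?thesis using good(1)[OF ka] by (simp add: ld_def)
 qed
 have br: "bop (G + F) (G - F) ka (rv ka) = sc (ka * m ka) (rv ka)" if ka: "ka : ball 0 r2" for ka
 proof (rule pair_eqI)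
 show "mid (bop (G + F) (G - F) ka (rv ka)) = mid (sc (ka * m ka) (rv ka))"
 unfolding mid_bop mid_sc rv_def mid_pr dif_pr by (simp add: cm_smult vec_eq_iff algebra_simps)
 have "ka *s (m ka *s cm F (nu ka) + cm G (nu ka) + ka *s nu ka) = ka *s ((ka * (m ka)^2) *s nu ka)" using eqF[OF ka] by simp
 then show "dif (bop (G + F) (G - F) ka (rv ka)) = dif (sc (ka * m ka) (rv ka))"
 unfolding dif_bop dif_sc rv_def mid_pr dif_pr by (simp add: cm_smult vec_eq_iff algebra_simps power2_eq_square)
 qed
 have re: "0 <= Re (ka * m ka)" if ka: "ka : ball 0 r2" "ka : Hplus" for ka
 by (rule slow_rate_nonneg[OF good(6,2,3,4,5)[OF ka(1)]]) (use ka(2) in \<open>simp add: Hplus_def\<close>)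
 \<comment> \<open>These signs turn \<open>2 Pr 0 - 1\<close> on pairs \<open>(u, - u)\<close> into
   \<open>flip\<close>, and they match the signs of \<open>xx\<close> because only
   \<open>ff k\<close> is negative.\<close>
 define si where "si j = (if j = k then 1 else - 1 :: real)" for j
 have "0 < si j * xx j" for j using xx_sign[of j] fj[of j] fk by (cases "j = k") (auto simp: si_def)
 from flip_positive[OF this] obtain c1 where c1: "0 < c1" "ALL u. c1 * (norm u)^2 <= (flip si u, - flip si u) #. diagop Pi Qi (u, - u)" by blast
 have P0: "sc (ld 0 (u, - u)) (rv 0) = (crd k u *s cv (W *v rr k), - (crd k u *s cv (W *v rr k)))" for u
 proof -
 have "ld 0 (u, - u) = - (crd k u / complex_of_real (ff k))" by (simp add: ld_def mid_anti dif_anti nu0 cc0 crd_def)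
 moreover have "rv 0 = pr 0 (- (complex_of_real (ff k) *s cv (W *v rr k)))"
 by (simp add: rv_def nu0 cm_cv eigF cv_scaleR)
 ultimately show ?thesis using fk by (simp add: sc_def pr_def prod_eq_iff vec_eq_iff)
 qed
 have fl: "2 *R sc (ld 0 (u, - u)) (rv 0) - (u, - u) = (flip si u, - flip si u)" for u
 proof -
 have "2 *R (crd k u *s cv (W *v rr k)) - u = flip si u"
 proof -
 have "flip si u + u = (SUM j:UNIV. (complex_of_real (si j) * crd j u + crd j u) *s cv (W *v rr j))"
 by (subst (2) complete) (simp add: flip_def sum.distrib[symmetric])
 also have "... = (SUM j:UNIV. if j = k then (crd k u + crd k u) *s cv (W *v rr k) else 0)"
 by (intro sum.cong refl) (auto simp: si_def vec_eq_iff)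
 also have "... = 2 *R (crd k u *s cv (W *v rr k))"
 by (simp add: vec_eq_iff scaleR_conv_of_real[where 'a = complex])
 finally show ?thesis by (simp add: algebra_simps)
 qed
 then show ?thesis unfolding P0 by (simp add: prod_eq_iff) (metis minus_diff_eq)
 qed
 have sub: "ball 0 (r2/2) \<subseteq> ball (0::complex) r2" using r2 by auto
 have pos: "c1 * (norm u)^2 <= (2 *R sc (ld 0 (u, - u)) (rv 0) - (u, - u)) #. diagop Pi Qi (u, - u)" for u
 unfolding fl using c1(2) by blast
 have z: "sc (ld 0 (u, - u)) (rv 0) = 0" if "crd k u = 0" for u unfolding P0 that by (simp add: zero_prod_def)
 show ?thesis
 by (rule exI[of _ "r2/2"], rule exI[of _ c1], rule exI[of _ ld], rule exI[of _ rv], rule exI[of _ "%ka. ka * m ka"])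
 (intro conjI allI ballI impI c1(1) lin ldsc uh pos z lb lr br re, use r2 sub in auto)
qed

end

section \<open>The Evans bundles at a fast and at a slow end\<close>

context relaxation begin

definition graph_form :: "complex^'n^'n => complex^'n => real" where
 "graph_form M b = (M *v b) #. cm (P 0) (M *v b) - b #. cm (Q 0) b"

lemma graph_form_L: "(M *v b, b) #. L 0 0 (M *v b, b) = graph_form M b"
 by (simp add: L_def graph_form_def)

text \<open>With all \<open>ff j\<close> negative every slow mode grows, the projection is the
  identity, and positivity of the limit form is the positivity of all \<open>xx j\<close>.\<close>

theorem fast_end:
 assumes es: "end_spectrum F G W Pl Ql rr ff gg k om" and neg: "!!j. ff j < 0"
 and tq: "0 < tq" and K1: "0 <= K1"
 and convA: "!!t. 0 <= t ==> norm (A t - (G + F)) <= K1 * exp (- tq * t)"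
 and convD: "!!t. 0 <= t ==> norm (D t - (G - F)) <= K1 * exp (- tq * t)"
 and convP: "(P ---> Pl) at_top" and convQ: "(Q ---> Ql) at_top"
 shows "EX R. (ALL i j. (%ka. R ka $ i $ j) analytic_on Hplus) &
 (ALL ka:Hplus - {0}. is_graph ka (R ka)) &
 (ALL b. graph_form (R 0) b <= 0 & (graph_form (R 0) b = 0 --> b = 0)) & (ALL b. mid (R 0 *v b, b) = 0 --> b = 0)"
proof -
 interpret es: end_spectrum F G W Pl Ql rr ff gg k om by (rule es)
 have "0 < 1 * es.xx j" for j using es.xx_sign(1)[OF neg] by simp
 from es.flip_positive[of "%_. 1", OF this] obtain c1 where c1: "0 < c1"
 "ALL u. c1 * (norm u)^2 <= (es.flip (%_. 1) u, - es.flip (%_. 1) u) #. diagop Pl Ql (u, - u)" by blast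
 have fl: "es.flip (%_. 1) u = u" for u unfolding es.flip_def by (subst (2) es.complete) simp
 interpret re: relaxation_end A D P Q P' Q' py c0 K0 "G + F" "G - F" Pl Ql tq K1 "1/2" c1 "%ka x. x"
 proof (rule relaxation_end.intro[OF relaxation_axioms relaxation_end_axioms.intro])
 show "uhol (ball 0 (1/2)) (%ka t x. x :: 'n cpair)" by (rule uhol_const[where K = 1]) (simp_all add: linear_id[unfolded id_def])
 show "c1 * (norm u)^2 <= (2 *R (u, - u) - (u, - u)) #. diagop Pl Ql (u, - u)" for u
 using c1(2)[rule_format, of u] by (simp add: fl scaleR_2)
 qed (use tq K1 convA convD convP convQ c1(1) in auto)
 show ?thesis using re.fast_side[unfolded re.negative_at_0_def graph_form_L] by simp
qed

text \<open>Only the k-th slow mode grows. The graph at \<open>ka = 0\<close> then contains the n -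
  1 constants orthogonal to \<open>rr k\<close> and, by the last clause, every exponentially
  decaying solution; together these will furnish its basis.\<close>

theorem slow_end:
 assumes es: "end_spectrum F G W Pl Ql rr ff gg k om" and pos: "!!j. j ~= k ==> 0 < ff j"
 and tq: "0 < tq" and K1: "0 <= K1"
 and convA: "!!t. 0 <= t ==> norm (A t - (G + F)) <= K1 * exp (- tq * t)"
 and convD: "!!t. 0 <= t ==> norm (D t - (G - F)) <= K1 * exp (- tq * t)"
 and convP: "(P ---> Pl) at_top" and convQ: "(Q ---> Ql) at_top"
 shows "EX R. (ALL i j. (%ka. R ka $ i $ j) analytic_on Hplus) &
 (ALL ka:Hplus - {0}. is_graph ka (R ka)) &
 (ALL b. graph_form (R 0) b <= 0 & (graph_form (R 0) b = 0 --> b = 0)) &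
 (ALL u. bil (cv (rr k)) u = 0 --> u = R 0 *v (- u)) &
 (ALL xq C. (ALL t. (xq hvd B 0 t (xq t)) (at t)) --> (ALL t>=0. norm (xq t) <= C * exp (- tq * t)) -->
 fst (xq 0) = R 0 *v snd (xq 0))"
proof -
 interpret es: end_spectrum F G W Pl Ql rr ff gg k om by (rule es)
 obtain r0 c1 ld rv mu where r0: "0 < r0" "r0 <= 1/2" and c1: "0 < c1" and lin: "ALL ka. linear (ld ka)"
 and ldsc: "ALL ka h x. ld ka (sc h x) = h * ld ka x" and uh: "uhol (ball 0 r0) (%ka t x. sc (ld ka x) (rv ka))"
 and sp: "ALL ka:ball 0 r0. (ALL x. ld ka (bop (G + F) (G - F) ka x) = mu ka * ld ka x) & ld ka (rv ka) = 1 &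
 bop (G + F) (G - F) ka (rv ka) = sc (mu ka) (rv ka) & (ka : Hplus --> 0 <= Re (mu ka))"
 and c1': "ALL u. c1 * (norm u)^2 <= (2 *R sc (ld 0 (u, - u)) (rv 0) - (u, - u)) #. diagop Pl Ql (u, - u)"
 and z: "ALL u. es.crd k u = 0 --> sc (ld 0 (u, - u)) (rv 0) = 0"
 by atomize_elim (rule es.slow_projection, rule pos)
 have bsc: "bop (G + F) (G - F) ka (sc h x) = sc h (bop (G + F) (G - F) ka x)" for ka h x
 by (rule pair_eqI) (simp_all only: mid_bop dif_bop mid_sc dif_sc cm_smult vector_smult_assoc vector_add_ldistrib mult.commute)
 interpret re: relaxation_end A D P Q P' Q' py c0 K0 "G + F" "G - F" Pl Ql tq K1 r0 c1 "%ka x. sc (ld ka x) (rv ka)"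
 proof (rule relaxation_end.intro[OF relaxation_axioms relaxation_end_axioms.intro])
 show "sc (ld ka (sc (ld ka x) (rv ka))) (rv ka) = sc (ld ka x) (rv ka)" if "ka : ball 0 r0" for ka x
 unfolding ldsc[THEN spec, THEN spec, THEN spec] sp[THEN bspec, OF that, THEN conjunct2, THEN conjunct1] by simp
 show "sc (ld ka (bop (G + F) (G - F) ka x)) (rv ka) = bop (G + F) (G - F) ka (sc (ld ka x) (rv ka))" if "ka : ball 0 r0" for ka x
 unfolding bsc sp[THEN bspec, OF that, THEN conjunct1, THEN spec] sp[THEN bspec, OF that, THEN conjunct2, THEN conjunct2, THEN conjunct1]
 by (simp add: mult.commute)
 show "c1 * (norm u)^2 <= (2 *R sc (ld 0 (u, - u)) (rv 0) - (u, - u)) #. diagop Pl Ql (u, - u)" for u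
 using c1' by blast
 qed (use tq K1 convA convD convP convQ c1 r0 uh in auto)
 have "EX R. (ALL i j. (%ka. R ka $ i $ j) analytic_on Hplus) &
 (ALL ka:Hplus - {0}. is_graph ka (R ka)) &
 re.negative_at_0 (R 0) & (ALL u. sc (ld 0 (u, - u)) (rv 0) = 0 --> u = R 0 *v (- u)) &
 (ALL xq C. (ALL t. (xq hvd B 0 t (xq t)) (at t)) --> (ALL t>=0. norm (xq t) <= C * exp (- tq * t)) -->
 fst (xq 0) = R 0 *v snd (xq 0))"
 by (rule re.slow_side[where my = mu]) (use sp lin linear_conv_bounded_linear in \<open>blast+\<close>)
 then obtain R where R: "ALL i j. (%ka. R ka $ i $ j) analytic_on Hplus" "ALL ka:Hplus - {0}. is_graph ka (R ka)"
 "re.negative_at_0 (R 0)" "ALL u. sc (ld 0 (u, - u)) (rv 0) = 0 --> u = R 0 *v (- u)"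
 "ALL xq C. (ALL t. (xq hvd B 0 t (xq t)) (at t)) --> (ALL t>=0. norm (xq t) <= C * exp (- tq * t)) -->
 fst (xq 0) = R 0 *v snd (xq 0)" by (elim exE conjE)
 have "u = R 0 *v (- u)" if "bil (cv (rr k)) u = 0" for u
 using R(4) z that unfolding es.crd_def by blast
 then show ?thesis using R(1,2,5) R(3)[unfolded re.negative_at_0_def graph_form_L] by (intro exI[of _ R] conjI allI) blast+
qed

end

section \<open>Evans functions under a change of analytic bases\<close>

definition colm :: "('n::finite => complex^'m) => complex^'n^'m" where "colm h = (\<chi> r c. h c $ r)"

lemma colm_mult: "colm h *v c = (SUM j:UNIV. c $ j *s h j)"
 by (simp add: colm_def matrix_vector_mult_def vec_eq_iff mult.commute)

lemma cindep_colm: "cindep h \<longleftrightarrow> (ALL c. colm h *v c = 0 --> c = 0)"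
proof
 assume h: "cindep h"
 show "ALL c. colm h *v c = 0 --> c = 0"
 using h unfolding cindep_def colm_mult by (simp add: vec_eq_iff)
next
 assume h: "ALL c. colm h *v c = 0 --> c = 0"
 show "cindep h" unfolding cindep_def
 proof (intro allI impI)
 fix c j assume "(SUM j:UNIV. c j *s h j) = 0"
 then have "colm h *v (\<chi> j. c j) = 0" by (simp add: colm_mult)
 then have "(\<chi> j. c j) = 0" using h by blast
 then show "c j = 0" by (metis vec_lambda_beta zero_index)
 qed
qed

lemma det_colm_nz: "det (colm h) ~= 0 \<longleftrightarrow> cindep h" for h :: "'n::finite => complex^'n"
 unfolding cindep_colm matrix_left_invertible_ker[symmetric] invertible_det_nz[symmetric] invertible_def
 using matrix_left_right_inverse by blast

lemma evans_fun_colm: "evans_fun hm hp ka = det (colm (case_sum (%j. hm j ka) (%j. hp j ka)))"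
proof -
 have "(\<chi> r c. case c of Inl j => hm j ka $ r | Inr j => hp j ka $ r) = colm (case_sum (%j. hm j ka) (%j. hp j ka))"
 by (simp add: colm_def vec_eq_iff split: sum.split)
 then show ?thesis by (simp add: evans_fun_def)
qed

lemma tendsto_det:
 fixes A :: "'a => complex^'n::finite^'n"
 assumes "!!i j. ((%x. A x $ i $ j) ---> A0 $ i $ j) Fl"
 shows "((%x. det (A x)) ---> det A0) Fl"
 unfolding det_def by (intro tendsto_intros assms)

text \<open>The transition matrix \<open>C\<close> is known only off the limit point. Multiplying by
  constant left inverses of the limits of \<open>X\<close> and \<open>X'\<close> makes its
  determinant a quotient of convergent determinants; exchanging the roles of the two bases shows
  that the limit is not 0.\<close>

lemma basis_change_det:
 fixes X X' :: "complex => complex^'n::finite^'m::finite"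
 assumes X: "!!i j. ((%ka. X ka $ i $ j) ---> X0 $ i $ j) Fl" and X': "!!i j. ((%ka. X' ka $ i $ j) ---> X0' $ i $ j) Fl"
 and i: "ALL c. X0 *v c = 0 --> c = 0" "ALL c. X0' *v c = 0 --> c = 0"
 and C: "\<forall>\<^sub>F ka in Fl. X' ka = X ka ** C ka" and Fl: "Fl ~= bot"
 shows "EX d. d ~= 0 & ((%ka. det (C ka)) ---> d) Fl"
proof -
 obtain M where M: "M ** X0 = mat 1" using i(1) unfolding matrix_left_invertible_ker[symmetric] by blast
 obtain M' where M': "M' ** X0' = mat 1" using i(2) unfolding matrix_left_invertible_ker[symmetric] by blast
 have l: "((%ka. det (K ** Y ka)) ---> det (K ** Y0)) Fl" if "!!i j. ((%ka. Y ka $ i $ j) ---> Y0 $ i $ j) Fl"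
 for K :: "complex^'m^'n" and Y Y0
 by (rule tendsto_det) (simp add: matrix_matrix_mult_def, intro tendsto_intros that)
 have 1: "((%ka. det (M ** X ka)) ---> 1) Fl" using l[OF X, of M] by (simp add: M)
 have 2: "((%ka. det (M' ** X' ka)) ---> 1) Fl" using l[OF X', of M'] by (simp add: M')
 have C': "\<forall>\<^sub>F ka in Fl. det (K ** X' ka) = det (K ** X ka) * det (C ka)" for K :: "complex^'m^'n"
 using C by eventually_elim (simp add: matrix_mul_assoc det_mul)
 define d where "d = det (M ** X0')"
 have "\<forall>\<^sub>F ka in Fl. det (M ** X ka) \<in> - {0}" by (rule topological_tendstoD[OF 1]) auto
 then have "\<forall>\<^sub>F ka in Fl. det (M ** X' ka) / det (M ** X ka) = det (C ka)" using C'[of M] by eventually_elim auto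
 moreover have "((%ka. det (M ** X' ka) / det (M ** X ka)) ---> d / 1) Fl"
 unfolding d_def by (intro tendsto_divide l X' 1) simp
 ultimately have dC: "((%ka. det (C ka)) ---> d) Fl" using Lim_transform_eventually by fastforce
 have "((%ka. det (M' ** X ka) * det (C ka)) ---> det (M' ** X0) * d) Fl" by (intro tendsto_mult l X dC)
 moreover have "((%ka. det (M' ** X ka) * det (C ka)) ---> 1) Fl" by (rule Lim_transform_eventually[OF 2 C'])
 ultimately have "det (M' ** X0) * d = 1" using Fl tendsto_unique by blast
 then show ?thesis using dC by (intro exI[of _ d]) auto
qed

lemma at_0_Hplus: "at 0 within Hplus ~= (bot :: complex filter)"
proof -
 have "(0::complex) islimpt Hplus"
 unfolding islimpt_approachable
 proof (intro allI impI)
 fix e :: real assume "e > 0"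
 then show "EX x':Hplus. x' ~= 0 & dist x' 0 < e"
 by (intro bexI[of _ "complex_of_real (e/2)"]) (auto simp: Hplus_def simp del: of_real_divide)
 qed
 then show ?thesis using trivial_limit_within by blast
qed

lemma analytic_tendsto_0:
 assumes "f analytic_on Hplus"
 shows "(f ---> f 0) (at 0 within Hplus)"
proof -
 have "f field_differentiable at 0" using analytic_on_imp_differentiable_at[OF assms] by (simp add: Hplus_def)
 then have "isCont f 0" by (rule field_differentiable_imp_continuous_at)
 then have "(f ---> f 0) (at 0)" by (simp add: isCont_def)
 then show ?thesis by (rule tendsto_within_subset) simp
qed

lemma cspan_colm: "x : cspan h \<longleftrightarrow> (EX c. x = colm h *v c)"
 unfolding cspan_def colm_mult mem_Collect_eq by (metis (no_types, lifting) sum.cong vec_lambda_beta)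

lemma span_factor:
 assumes "!!j. h' j : cspan h"
 shows "EX C. colm h' = colm h ** C"
proof -
 have "ALL j. EX c. h' j = colm h *v c" using assms cspan_colm by blast
 then obtain c where c: "!!j. h' j = colm h *v c j" by metis
 have "colm h' = colm h ** colm c"
 by (simp add: vec_eq_iff matrix_matrix_mult_def colm_def[of h'] colm_def[of c] c matrix_vector_mult_def)
 then show ?thesis by blast
qed

lemma mem_cspan: "h j : cspan h"
proof -
 have "colm h *v axis j 1 = h j" by (simp add: colm_mult axis_def if_distrib[of "%z. z *s _"] sum.delta cong: if_cong)
 then show ?thesis unfolding cspan_colm by metis
qed

text \<open>Another choice of bases multiplies the Evans function by \<open>det (C ka)\<close>,
  which has a nonzero limit at 0. Hence the factorization into \<open>ka\<close> and a zero-free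
  factor for one choice determines the zeros and the derivative at 0 for all choices.\<close>

theorem evans_any_basis:
 fixes hm hp hm' hp' :: "'n::finite => complex => complex^('n + 'n)"
 assumes b: "analytic_basis Hm hm" "analytic_basis Hp hp" and b': "analytic_basis Hm hm'" "analytic_basis Hp hp'"
 and E: "!!ka. ka : Hplus - {0} ==> evans_fun hm hp ka = ka * Et ka"
 and Et: "!!ka. ka : Hplus ==> Et ka ~= 0" "(Et ---> Et 0) (at 0 within Hplus)"
 shows "(ALL ka:Hplus. evans_fun hm' hp' ka = 0 \<longleftrightarrow> ka = 0) & deriv (evans_fun hm' hp') 0 ~= 0"
proof -
 \<comment> \<open>At 0 the columns of both bases together are dependent, so they are placed in two
   separate copies of the space. The resulting matrix with 4n rows has independent columns also at
   0, and its transition matrix is the same \<open>C\<close>.\<close>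
 define W :: "('n => complex => complex^('n + 'n)) => ('n => complex => complex^('n + 'n)) => complex => ('n + 'n) => complex^(('n + 'n) + ('n + 'n))"
 where "W m p ka c = (\<chi> r. case c of Inl j => (case r of Inl q => m j ka $ q | Inr q => 0)
 | Inr j => (case r of Inl q => 0 | Inr q => p j ka $ q))" for m p ka c
 note ab = b[unfolded analytic_basis_def] b'[unfolded analytic_basis_def]
 have U: "(UNIV :: ('n + 'n) set) = UNIV <+> UNIV" by simp
 have ex: "EX C. colm (W m' p' ka) = colm (W m p ka) ** C &
 colm (case_sum (%j. m' j ka) (%j. p' j ka)) = colm (case_sum (%j. m j ka) (%j. p j ka)) ** C"
 if a: "analytic_basis Hm m" "analytic_basis Hp p" "analytic_basis Hm m'" "analytic_basis Hp p'" and ka: "ka : Hplus - {0}"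
 for m p m' p' :: "'n => complex => complex^('n + 'n)" and ka
 proof -
 have "m' j ka : cspan (%j. m j ka)" "p' j ka : cspan (%j. p j ka)" for j
 using a ka mem_cspan[of "%j. m' j ka" j] mem_cspan[of "%j. p' j ka" j] unfolding analytic_basis_def by auto
 then obtain A B where A: "colm (%j. m' j ka) = colm (%j. m j ka) ** A" and B: "colm (%j. p' j ka) = colm (%j. p j ka) ** B"
 using span_factor[of "%j. m' j ka"] span_factor[of "%j. p' j ka"] by metis
 have A': "m' j ka $ r = (SUM i:UNIV. m i ka $ r * A $ i $ j)" and B': "p' j ka $ r = (SUM i:UNIV. p i ka $ r * B $ i $ j)" for r j
 using arg_cong[OF A, of "%M. M $ r $ j"] arg_cong[OF B, of "%M. M $ r $ j"] by (simp_all add: colm_def matrix_matrix_mult_def)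
 define C where "C = (\<chi> r c. case c of Inl j => (case r of Inl i => A $ i $ j | Inr i => 0)
 | Inr j => (case r of Inl i => 0 | Inr i => B $ i $ j))"
 show ?thesis
 by (rule exI[of _ C]) (simp add: vec_eq_iff matrix_matrix_mult_def colm_def W_def C_def U sum.Plus A' B' del: UNIV_Plus_UNIV split: sum.split)
 qed
 have "EX C. ALL ka:Hplus - {0}. colm (W hm' hp' ka) = colm (W hm hp ka) ** C ka &
 colm (case_sum (%j. hm' j ka) (%j. hp' j ka)) = colm (case_sum (%j. hm j ka) (%j. hp j ka)) ** C ka"
 by (rule bchoice) (use ex[OF b b'] in blast)
 then obtain C where C: "!!ka. ka : Hplus - {0} ==> colm (W hm' hp' ka) = colm (W hm hp ka) ** C ka"
 "!!ka. ka : Hplus - {0} ==> colm (case_sum (%j. hm' j ka) (%j. hp' j ka)) = colm (case_sum (%j. hm j ka) (%j. hp j ka)) ** C ka"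
 by blast
 let ?F = "at 0 within Hplus :: complex filter"
 have evF: "\<forall>\<^sub>F ka in ?F. ka : Hplus - {0}" by (auto simp: eventually_at_filter)
 have W0: "ALL c. colm (W m p 0) *v c = 0 --> c = 0" and Wl: "!!i j. ((%ka. colm (W m p ka) $ i $ j) ---> colm (W m p 0) $ i $ j) ?F"
 if a: "analytic_basis Hm m" "analytic_basis Hp p" for m p
 proof -
 have H0: "(0::complex) : Hplus" by (simp add: Hplus_def)
 note aa = a[unfolded analytic_basis_def]
 have ci: "cindep (%j. m j 0)" "cindep (%j. p j 0)" using aa H0 by blast+
 show "ALL c. colm (W m p 0) *v c = 0 --> c = 0"
 proof (intro allI impI)
 fix c assume c0: "colm (W m p 0) *v c = 0"
 have "colm (%j. m j 0) *v (\<chi> j. c $ Inl j) = 0"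
 unfolding vec_eq_iff
 proof
 fix r show "(colm (%j. m j 0) *v (\<chi> j. c $ Inl j)) $ r = 0 $ r"
 using arg_cong[OF c0, of "%v. v $ Inl r"] by (simp add: colm_def matrix_vector_mult_def W_def U sum.Plus del: UNIV_Plus_UNIV)
 qed
 then have "(\<chi> j. c $ Inl j) = 0" using ci(1)[unfolded cindep_colm] by blast
 then have 1: "c $ Inl j = 0" for j by (metis vec_lambda_beta zero_index)
 have "colm (%j. p j 0) *v (\<chi> j. c $ Inr j) = 0"
 unfolding vec_eq_iff
 proof
 fix r show "(colm (%j. p j 0) *v (\<chi> j. c $ Inr j)) $ r = 0 $ r"
 using arg_cong[OF c0, of "%v. v $ Inr r"] by (simp add: colm_def matrix_vector_mult_def W_def U sum.Plus del: UNIV_Plus_UNIV)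
 qed
 then have "(\<chi> j. c $ Inr j) = 0" using ci(2)[unfolded cindep_colm] by blast
 then have 2: "c $ Inr j = 0" for j by (metis vec_lambda_beta zero_index)
 show "c = 0" unfolding vec_eq_iff using 1 2 by (metis old.sum.exhaust zero_index)
 qed
 show "((%ka. colm (W m p ka) $ i $ j) ---> colm (W m p 0) $ i $ j) ?F" for i j
 using aa by (cases i; cases j) (auto simp: colm_def W_def intro: analytic_tendsto_0)
 qed
 obtain d where d: "d ~= 0" "((%ka. det (C ka)) ---> d) ?F"
 by atomize_elim (rule basis_change_det[OF Wl[OF b] Wl[OF b'] W0[OF b] W0[OF b'] _ at_0_Hplus], rule eventually_mono[OF evF C(1)])
 have E': "evans_fun hm' hp' ka = ka * (Et ka * det (C ka))" if "ka : Hplus - {0}" for ka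
 using C(2)[OF that] E[OF that] unfolding evans_fun_colm by (simp add: det_mul)
 have nz: "evans_fun hm' hp' ka ~= 0" if ka: "ka : Hplus - {0}" for ka
 proof -
 obtain C' where "colm (case_sum (%j. hm j ka) (%j. hp j ka)) = colm (case_sum (%j. hm' j ka) (%j. hp' j ka)) ** C'"
 using ex[OF b' b ka] by blast
 then have "evans_fun hm hp ka = evans_fun hm' hp' ka * det C'" unfolding evans_fun_colm by (simp add: det_mul)
 then show ?thesis using E[OF ka] Et(1)[of ka] ka by auto
 qed
 have an: "evans_fun hm' hp' analytic_on Hplus"
 proof -
 have e: "(%ka. (case c of Inl j => hm' j ka $ r | Inr j => hp' j ka $ r)) analytic_on Hplus" for r c
 using ab by (cases c) auto
 show ?thesis unfolding evans_fun_def[abs_def] det_def vec_lambda_beta by (intro analytic_intros e)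
 qed
 have lim: "((%ka. Et ka * det (C ka)) ---> Et 0 * d) ?F" by (intro tendsto_mult Et(2) d(2))
 have "((%ka. ka * (Et ka * det (C ka))) ---> 0 * (Et 0 * d)) ?F" by (intro tendsto_mult lim tendsto_ident_at)
 moreover have "\<forall>\<^sub>F ka in ?F. ka * (Et ka * det (C ka)) = evans_fun hm' hp' ka" using evF by eventually_elim (rule E'[symmetric])
 ultimately have "(evans_fun hm' hp' ---> 0) ?F" using Lim_transform_eventually by fastforce
 then have E0: "evans_fun hm' hp' 0 = 0" using tendsto_unique[OF at_0_Hplus analytic_tendsto_0[OF an]] by blast
 have fd: "evans_fun hm' hp' field_differentiable at 0"
 by (rule analytic_on_imp_differentiable_at[OF an]) (simp add: Hplus_def)
 have "(evans_fun hm' hp' has_field_derivative deriv (evans_fun hm' hp') 0) (at 0 within Hplus)"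
 by (rule has_field_derivative_at_within[OF field_differentiable_derivI[OF fd]])
 then have q: "((%ka. evans_fun hm' hp' ka / ka) ---> deriv (evans_fun hm' hp') 0) ?F" by (simp add: has_field_derivative_iff E0)
 have "\<forall>\<^sub>F ka in ?F. Et ka * det (C ka) = evans_fun hm' hp' ka / ka" using evF by eventually_elim (simp add: E')
 from tendsto_unique[OF at_0_Hplus q Lim_transform_eventually[OF lim this]] have "deriv (evans_fun hm' hp') 0 = Et 0 * d" .
 then show ?thesis using nz E0 d(1) Et(1)[of 0] by (auto simp: Hplus_def)
qed

section \<open>The first-order system, its relaxation variables and reflection\<close>

text \<open>The bundle is expressed through coefficient curves in place of fluxes and profile, so
  that reflection of the line acts on the coefficients alone.\<close>

definition ev_plus :: "(real => real^'n::finite^'n) => (real => real^'n^'n) => complex => (complex^('n + 'n)) set" where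
 "ev_plus F G ka = {xq0. EX xq. xq 0 = xq0 & (ALL x. (xq hvd (evans_mat (F x) (G x) ka *v xq x)) (at x)) & (xq ---> 0) at_top}"
definition ev_minus :: "(real => real^'n::finite^'n) => (real => real^'n^'n) => complex => (complex^('n + 'n)) set" where
 "ev_minus F G ka = {xq0. EX xq. xq 0 = xq0 & (ALL x. (xq hvd (evans_mat (F x) (G x) ka *v xq x)) (at x)) & (xq ---> 0) at_bot}"

definition jn :: "complex^'n::finite => complex^'n => complex^('n + 'n)" where
 "jn v w = (\<chi> c. case c of Inl i => v $ i | Inr i => w $ i)"
definition lf :: "complex^('n + 'n) => complex^'n::finite" where "lf xq = (\<chi> i. xq $ Inl i)"
definition rt :: "complex^('n + 'n) => complex^'n::finite" where "rt xq = (\<chi> i. xq $ Inr i)"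

lemma jn_simps [simp]: "lf (jn v w) = v" "rt (jn v w) = w" "jn (lf xq) (rt xq) = xq" "jn v w $ Inl i = v $ i" "jn v w $ Inr i = w $ i"
 by (simp_all add: jn_def lf_def rt_def vec_eq_iff split: sum.split)

lemma jn_add: "jn (v + v') (w + w') = jn v w + jn v' w'" and jn_smult: "jn (h *s v) (h *s w) = h *s jn v w"
 and jn_scaleR: "jn (a *R v) (a *R w) = a *R jn v w"
 by (simp_all add: jn_def vec_eq_iff split: sum.split)

lemma lf_add: "lf (x + y) = lf x + lf y" "rt (x + y) = rt x + rt y" "lf (a *R x) = a *R lf x" "rt (a *R x) = a *R rt x"
 by (simp_all add: lf_def rt_def vec_eq_iff)

lemma evans_mat_jn:
 fixes F G :: "real^'n::finite^'n"
 shows "evans_mat F G ka *v jn v w = jn (cm F v + w) (ka^2 *s v + ka *s cm G v)"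
proof -
 have U: "(UNIV :: ('n + 'n) set) = UNIV <+> UNIV" by simp
 show ?thesis
 unfolding vec_eq_iff
 proof
 fix c :: "'n + 'n"
 have d: "(SUM j:UNIV. (if i = j then 1 else 0) * x $ j) = x $ i" for i and x :: "complex^'n"
 by (simp add: if_distrib[of "%z. z * _"] sum.delta cong: if_cong)
 have d': "(SUM j:UNIV. (ka^2 * (if i = j then 1 else 0) + ka * complex_of_real (G $ i $ j)) * v $ j) = ka^2 * v $ i + ka * cm G v $ i" for i
 unfolding distrib_right sum.distrib mult.assoc sum_distrib_left[symmetric] d by (simp add: cm_def scaleR_conv_of_real)
 show "(evans_mat F G ka *v jn v w) $ c = jn (cm F v + w) (ka^2 *s v + ka *s cm G v) $ c"
 proof (cases c)
 case (Inl i) then show ?thesis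
 by (simp add: matrix_vector_mult_def evans_mat_def U sum.Plus d cm_def scaleR_conv_of_real del: UNIV_Plus_UNIV)
 next
 case (Inr i) then show ?thesis
 by (simp add: matrix_vector_mult_def evans_mat_def U sum.Plus d' del: UNIV_Plus_UNIV)
 qed
 qed
qed

text \<open>The map from \<open>(v + u, v - u)\<close> to \<open>(v, ka u)\<close>. It is invertible
  exactly for \<open>ka ~= 0\<close>; its degeneration at 0 is the origin of the zero of the Evans
  function.\<close>

definition lift :: "complex => 'n::finite cpair => complex^('n + 'n)" where "lift ka x = jn (mid x) (ka *s dif x)"
definition unlift :: "complex => complex^('n + 'n) => 'n::finite cpair" where "unlift ka xq = pr (lf xq) (inverse ka *s rt xq)"

lemma unlift_lift: "ka ~= 0 ==> unlift ka (lift ka x) = x" and lift_unlift: "ka ~= 0 ==> lift ka (unlift ka xq) = xq"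
 by (rule pair_eqI, simp_all add: unlift_def lift_def vector_smult_assoc)

lemma linear_lift: "linear (lift ka)" and linear_unlift: "linear (unlift ka)"
proof -
 show "linear (lift ka)"
 by (rule linearI) (simp_all add: lift_def linear_add[OF linear_mid] linear_add[OF linear_dif] linear_cmul[OF linear_mid]
 linear_cmul[OF linear_dif] jn_add[symmetric] jn_scaleR[symmetric] vector_add_ldistrib linear_cmul[OF bounded_linear.linear[OF bounded_linear_smult]])
 show "linear (unlift ka)"
 by (rule linearI; rule pair_eqI) (simp_all add: unlift_def lf_add linear_add[OF linear_mid] linear_add[OF linear_dif] linear_cmul[OF linear_mid]
 linear_cmul[OF linear_dif] vector_add_ldistrib linear_cmul[OF bounded_linear.linear[OF bounded_linear_smult]])
qed

lemma evans_lift: "evans_mat F G ka *v lift ka x = lift ka (bop (G + F) (G - F) ka x)"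
 unfolding lift_def evans_mat_jn mid_bop dif_bop by (simp add: vector_add_ldistrib vector_smult_assoc power2_eq_square add.commute)

text \<open>For \<open>ka ~= 0\<close> the linear maps \<open>lift ka\<close> and
  \<open>unlift ka\<close> conjugate the two systems, and they preserve decay.\<close>

lemma ev_plus_lift:
 assumes ka: "ka ~= 0"
 shows "ev_plus F G ka = lift ka ` {x. EX xq. xq 0 = x & (ALL t. (xq hvd bop (G t + F t) (G t - F t) ka (xq t)) (at t)) & (xq ---> 0) at_top}"
 (is "_ = _ ` ?S")
proof (intro equalityI)
 show "ev_plus F G ka \<subseteq> lift ka ` ?S"
 proof
 fix y assume "y : ev_plus F G ka"
 then obtain xq where x0: "xq 0 = y" and x1: "ALL x. (xq hvd (evans_mat (F x) (G x) ka *v xq x)) (at x)" and x2: "(xq ---> 0) at_top"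
 unfolding ev_plus_def mem_Collect_eq by (elim exE conjE)
 have bl: "bounded_linear (unlift ka :: _ => 'a cpair)" using linear_unlift linear_conv_bounded_linear by blast
 have "((%t. unlift ka (xq t)) hvd bop (G t + F t) (G t - F t) ka (unlift ka (xq t))) (at t)" for t
 proof -
 have "unlift ka (evans_mat (F t) (G t) ka *v xq t) = bop (G t + F t) (G t - F t) ka (unlift ka (xq t))"
 using evans_lift[of "F t" "G t" ka "unlift ka (xq t)"] unlift_lift[OF ka] by (simp add: lift_unlift[OF ka])
 then show ?thesis using bounded_linear.has_vector_derivative[OF bl x1[THEN spec, of t]] by simp
 qed
 moreover have "((%t. unlift ka (xq t)) ---> 0) at_top" using bounded_linear.tendsto[OF bl x2] by (simp add: linear_0[OF linear_unlift])
 ultimately have mem: "unlift ka y \<in> ?S" unfolding mem_Collect_eq by (intro exI[of _ "%t. unlift ka (xq t)"] conjI allI) (simp_all only: x0)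
 show "y : lift ka ` ?S" by (rule image_eqI[where f = "lift ka" and x = "unlift ka y", OF lift_unlift[OF ka, symmetric] mem])
 qed
 show "lift ka ` ?S \<subseteq> ev_plus F G ka"
 proof
 fix y assume "y : lift ka ` ?S"
 then obtain x where y: "y = lift ka x" and "x \<in> ?S" by (elim imageE)
 from this(2) obtain xq where x0: "xq 0 = x" and x1: "ALL t. (xq hvd bop (G t + F t) (G t - F t) ka (xq t)) (at t)" and x2: "(xq ---> 0) at_top"
 unfolding mem_Collect_eq by (elim exE conjE)
 have bl: "bounded_linear (lift ka :: 'a cpair => _)" using linear_lift linear_conv_bounded_linear by blast
 have "((%t. lift ka (xq t)) hvd evans_mat (F t) (G t) ka *v lift ka (xq t)) (at t)" for t
 unfolding evans_lift by (rule bounded_linear.has_vector_derivative[OF bl x1[THEN spec]])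
 moreover have "((%t. lift ka (xq t)) ---> 0) at_top" using bounded_linear.tendsto[OF bl x2] by (simp add: linear_0[OF linear_lift])
 ultimately show "y : ev_plus F G ka" unfolding ev_plus_def mem_Collect_eq
 by (intro exI[of _ "%t. lift ka (xq t)"] conjI allI) (simp_all only: x0 y)
 qed
qed

text \<open>Reversing the line turns the coefficients \<open>(F, G)\<close> into
  \<open>(- F, G)\<close>, provided the second half of the vector changes sign; this is that sign
  change.\<close>

definition TM :: "complex^('n::finite + 'n)^('n + 'n)" where
 "TM = (\<chi> r c. if r = c then (case r of Inl _ => 1 | Inr _ => - 1) else 0)"

lemma TM_mult: "TM *v xq = jn (lf xq) (- rt xq)"
proof -
 have "(TM *v xq) $ r = (case r of Inl _ => 1 | Inr _ => - 1) * xq $ r" for r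
 by (simp add: TM_def matrix_vector_mult_def if_distrib[of "%z. z * _"] sum.delta cong: if_cong)
 then show ?thesis unfolding vec_eq_iff by (simp add: jn_def lf_def rt_def split: sum.split)
qed

lemma TM_TM [simp]: "TM *v (TM *v xq) = xq"
 unfolding TM_mult jn_simps minus_minus ..

lemma TM_lift: "TM *v lift ka x = jn (mid x) (- (ka *s dif x))"
 by (simp add: TM_mult lift_def)

lemma evans_mat_TM: "evans_mat (- F) G ka *v (TM *v xq) = - (TM *v (evans_mat F G ka *v xq))"
proof -
 have 1: "evans_mat (- F) G ka *v jn v (- w) = - jn (cm F v + w) (- (ka^2 *s v + ka *s cm G v))" for v w
 unfolding evans_mat_jn by (simp add: vec_eq_iff jn_def cm.minus_left split: sum.split)
 have "evans_mat F G ka *v xq = jn (cm F (lf xq) + rt xq) (ka^2 *s lf xq + ka *s cm G (lf xq))"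
 using evans_mat_jn[of F G ka "lf xq" "rt xq"] by simp
 then show ?thesis by (simp add: TM_mult 1)
qed

lemma ev_minus_reflect: "ev_minus F G ka = (%xq. TM *v xq) ` ev_plus (%x. - F (- x)) (%x. G (- x)) ka"
proof -
 have bl: "bounded_linear (%xq. TM *v xq :: complex^('a + 'a))"
 unfolding linear_conv_bounded_linear[symmetric] by (rule linearI) (simp_all add: matrix_vector_right_distrib vec_eq_iff TM_mult jn_def lf_def rt_def split: sum.split)
 have d: "((%t. TM *v xq (- t)) hvd evans_mat (- F (- t)) (G (- t)) ka *v (TM *v xq (- t))) (at t)"
 if "ALL x. (xq hvd (evans_mat (F x) (G x) ka *v xq x)) (at x)" for F G :: "real => real^'a^'a" and xq t
 proof -
 have "((%t. xq (- t)) hvd - (evans_mat (F (- t)) (G (- t)) ka *v xq (- t))) (at t)"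
 by (rule has_vector_derivative_reflect) (use that in blast)
 from bounded_linear.has_vector_derivative[OF bl this] show ?thesis
 unfolding evans_mat_TM by (simp add: linear_neg[OF bounded_linear.linear[OF bl]])
 qed
 have z: "TM *v 0 = 0" by simp
 show ?thesis
 proof (intro equalityI subsetI)
 fix y assume "y : ev_minus F G ka"
 then obtain xq where xq: "xq 0 = y" "ALL x. (xq hvd (evans_mat (F x) (G x) ka *v xq x)) (at x)" "(xq ---> 0) at_bot"
 unfolding ev_minus_def by blast
 have "((%t. TM *v xq (- t)) ---> 0) at_top"
 using bounded_linear.tendsto[OF bl filterlim_compose[OF xq(3) filterlim_uminus_at_bot_at_top]] by simp
 then have "TM *v y : ev_plus (%x. - F (- x)) (%x. G (- x)) ka"
 unfolding ev_plus_def mem_Collect_eq using d[OF xq(2)] xq(1) by (intro exI[of _ "%t. TM *v xq (- t)"]) auto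
 then show "y : (%xq. TM *v xq) ` ev_plus (%x. - F (- x)) (%x. G (- x)) ka" by (intro image_eqI[of _ _ "TM *v y"]) simp_all
 next
 fix y assume "y : (%xq. TM *v xq) ` ev_plus (%x. - F (- x)) (%x. G (- x)) ka"
 then obtain xq where xq: "y = TM *v xq 0" "ALL x. (xq hvd (evans_mat (- F (- x)) (G (- x)) ka *v xq x)) (at x)" "(xq ---> 0) at_top"
 unfolding ev_plus_def by blast
 have "((%t. TM *v xq (- t)) ---> 0) at_bot"
 using bounded_linear.tendsto[OF bl filterlim_compose[OF xq(3) filterlim_uminus_at_top_at_bot]] by simp
 then show "y : ev_minus F G ka"
 unfolding ev_minus_def mem_Collect_eq using d[OF xq(2)] xq(1) by (intro exI[of _ "%t. TM *v xq (- t)"]) auto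
 qed
qed

lemma ev_plus_reflect: "ev_plus F G ka = (%xq. TM *v xq) ` ev_minus (%x. - F (- x)) (%x. G (- x)) ka"
 unfolding ev_minus_reflect by (simp add: image_image)

lemma evans_fun_analytic:
 assumes "analytic_basis Hm hm" "analytic_basis Hp hp"
 shows "evans_fun hm hp analytic_on Hplus"
proof -
 have e: "(%ka. (case c of Inl j => hm j ka $ r | Inr j => hp j ka $ r)) analytic_on Hplus" for r c
 using assms[unfolded analytic_basis_def] by (cases c) auto
 show ?thesis unfolding evans_fun_def[abs_def] det_def vec_lambda_beta by (intro analytic_intros e)
qed

text \<open>Spectral stability formulated for two families of subspaces, so that it can be carried
  through the reflection, where the two bundles trade places.\<close>

definition stable_pair :: "(complex => (complex^('n::finite + 'n)) set) => (complex => (complex^('n + 'n)) set) => bool" where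
 "stable_pair Hm Hp \<longleftrightarrow>
 (\<exists>(hm :: 'n => complex => complex^('n + 'n)) (hp :: 'n => complex => complex^('n + 'n)). analytic_basis Hm hm & analytic_basis Hp hp) &
 (\<forall>(hm :: 'n => complex => complex^('n + 'n)) (hp :: 'n => complex => complex^('n + 'n)). analytic_basis Hm hm & analytic_basis Hp hp -->
 (ALL ka:Hplus. evans_fun hm hp ka = 0 \<longleftrightarrow> ka = 0) & deriv (evans_fun hm hp) 0 ~= 0)"

lemma colm_matrix: "colm (%j. M *v h j) = M ** colm h"
 by (simp add: colm_def vec_eq_iff matrix_matrix_mult_def matrix_vector_mult_def)

lemma TM_square: "TM ** TM = mat 1"
 unfolding matrix_eq matrix_vector_mul_assoc[symmetric] by simp

lemma analytic_basis_TM: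
 assumes "analytic_basis H h"
 shows "analytic_basis (%ka. (%xq. TM *v xq) ` H ka) (%j ka. TM *v h j ka)"
 unfolding analytic_basis_def
proof (intro conjI allI ballI)
 note h = assms[unfolded analytic_basis_def]
 show "(%ka. (TM *v h j ka) $ r) analytic_on Hplus" for j r
 using h by (cases r) (auto simp: TM_mult lf_def rt_def intro: analytic_on_neg)
 fix ka
 show "cindep (%j. TM *v h j ka)" if "ka : Hplus"
 proof -
 have "cindep (%j. h j ka)" using h that by blast
 moreover have "colm (%j. h j ka) *v c = TM *v (colm (%j. TM *v h j ka) *v c)" for c
 by (simp add: colm_matrix matrix_vector_mul_assoc[symmetric])
 ultimately show ?thesis unfolding cindep_colm by simp
 qed
 show "cspan (%j. TM *v h j ka) = (%xq. TM *v xq) ` H ka" if "ka : Hplus - {0}"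
 proof -
 have "H ka = cspan (%j. h j ka)" using h that by blast
 then show ?thesis by (auto simp: set_eq_iff cspan_colm colm_matrix matrix_vector_mul_assoc[symmetric] image_iff)
 qed
qed

text \<open>Reflection multiplies the matrix by \<open>TM\<close> on the left and permutes the two
  blocks of columns. Only the nonvanishing of the factor matters, and it follows because both
  matrices are involutions.\<close>

lemma evans_fun_swap: "EX e. e ~= 0 & (\<forall>(hm :: 'n::finite => complex => complex^('n + 'n)) hp ka.
 evans_fun (%j ka. TM *v hp j ka) (%j ka. TM *v hm j ka) ka = e * evans_fun hm hp ka)"
proof -
 define sw where "sw = case_sum (Inr :: 'n => 'n + 'n) Inl"
 define S :: "complex^('n + 'n)^('n + 'n)" where "S = (\<chi> r c. if r = sw c then 1 else 0)"
 have sw: "sw (sw c) = c" for c by (cases c) (simp_all add: sw_def)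
 have ci: "(r = sw c) = (sw r = c)" for r c using sw by metis
 have cS: "colm h ** S = colm (h \<circ> sw)" for h :: "'n + 'n => complex^('n + 'n)"
 by (simp add: colm_def S_def vec_eq_iff matrix_matrix_mult_def if_distrib[of "%z. _ * z"] sum.delta' cong: if_cong)
 have "S ** S = mat 1"
 by (simp add: S_def vec_eq_iff matrix_matrix_mult_def mat_def if_distrib[of "%z. _ * z"] sum.delta' sw cong: if_cong)
 then have "det S * det S = 1" by (metis det_mul det_I)
 then have "det S ~= 0" by auto
 moreover have "det (TM :: complex^('n + 'n)^('n + 'n)) ~= 0" by (metis det_mul det_I TM_square mult_zero_left zero_neq_one)
 moreover have "evans_fun (%j ka. TM *v hp j ka) (%j ka. TM *v hm j ka) ka = det (TM :: complex^('n + 'n)^('n + 'n)) * det S * evans_fun hm hp ka"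
 for hm hp :: "'n => complex => complex^('n + 'n)" and ka
 proof -
 have cs: "case_sum (%j. TM *v hp j ka) (%j. TM *v hm j ka) = (%c. TM *v ((case_sum (%j. hm j ka) (%j. hp j ka)) \<circ> sw) c)"
 by (auto simp: fun_eq_iff sw_def split: sum.split)
 show ?thesis unfolding evans_fun_colm cs colm_matrix cS[symmetric] det_mul by (simp only: mult_ac)
 qed
 ultimately show ?thesis by (intro exI[of _ "det (TM :: complex^('n + 'n)^('n + 'n)) * det S"]) auto
qed

lemma stable_pair_reflect:
 assumes "stable_pair A B"
 shows "stable_pair (%ka. (%xq. TM *v xq) ` B ka) (%ka. (%xq. TM *v xq) ` A ka)"
 unfolding stable_pair_def
proof (intro conjI allI impI)
 note a = assms[unfolded stable_pair_def]
 obtain hm hp :: "'a => complex => complex^('a + 'a)" where hA: "analytic_basis A hm" and hB: "analytic_basis B hp" using a by blast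
 show "\<exists>(hm :: 'a => complex => complex^('a + 'a)) (hp :: 'a => complex => complex^('a + 'a)). analytic_basis (%ka. (%xq. TM *v xq) ` B ka) hm & analytic_basis (%ka. (%xq. TM *v xq) ` A ka) hp"
 by (intro exI conjI) (rule analytic_basis_TM[OF hB], rule analytic_basis_TM[OF hA])
 fix hm hp :: "'a => complex => complex^('a + 'a)"
 assume h: "analytic_basis (%ka. (%xq. TM *v xq) ` B ka) hm & analytic_basis (%ka. (%xq. TM *v xq) ` A ka) hp"
 define m p where "m = (%j ka. TM *v hp j ka)" "p = (%j ka. TM *v hm j ka)"
 have mA: "analytic_basis A m" using analytic_basis_TM[OF h[THEN conjunct2]] by (simp only: m_p_def image_image TM_TM image_ident)
 have pB: "analytic_basis B p" using analytic_basis_TM[OF h[THEN conjunct1]] by (simp only: m_p_def image_image TM_TM image_ident)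
 note s = a[THEN conjunct2, THEN spec, THEN spec, THEN mp, OF conjI[OF mA pB]]
 obtain e where e: "e ~= 0" and e2: "\<forall>(hm :: 'a => complex => complex^('a + 'a)) hp ka. evans_fun (%j ka. TM *v hp j ka) (%j ka. TM *v hm j ka) ka = e * evans_fun hm hp ka"
 using evans_fun_swap[where 'n = 'a] by (elim exE conjE)
 have "evans_fun m p = (%ka. e * evans_fun hm hp ka)" unfolding m_p_def using e2[THEN spec, of hm, THEN spec, of hp] by (simp add: fun_eq_iff)
 then have eq: "evans_fun hm hp = (%ka. evans_fun m p ka / e)" using e by (simp add: fun_eq_iff)
 show "ALL ka:Hplus. evans_fun hm hp ka = 0 \<longleftrightarrow> ka = 0" using s[THEN conjunct1] e by (simp add: eq)
 have fd: "evans_fun m p field_differentiable at 0"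
 by (rule analytic_on_imp_differentiable_at[OF evans_fun_analytic[OF mA pB]]) (simp add: Hplus_def)
 show "deriv (evans_fun hm hp) 0 ~= 0" using s[THEN conjunct2] e unfolding eq deriv_cdivide_right[OF fd] by simp
qed

section \<open>Transversality and the simple zero\<close>

context relaxation begin

text \<open>With \<open>ro = 0\<close> the form is nondecreasing along solutions for all
  \<open>ka\<close> with \<open>Re ka >= 0\<close>, and it tends to 0 along decaying ones. The forms
  used to construct the graphs depend on \<open>ka\<close>; comparing the two ends needs this common
  one, for which only strictness at the initial point is required.\<close>

lemma decays_negative:
 assumes d: "decays ka xq" and ka: "0 <= Re ka"
 shows "xq 0 #. L 0 0 (xq 0) <= 0" "xq 0 #. L 0 0 (xq 0) = 0 --> xq 0 = 0"
proof -
 note xq = d[unfolded decays_def, THEN conjunct1, THEN spec] d[unfolded decays_def, THEN conjunct2]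
 define h where "h t = xq t #. L 0 t (xq t)" for t
 define h' where "h' t = dL t (xq t) + 2 * (B ka t (xq t) #. L 0 t (xq t))" for t
 have dh: "(h has_real_derivative h' t) (at t)" if "0 <= t" for t unfolding h_def h'_def by (rule deriv_form[OF that xq(1)])
 have h'1: "c0 * ((norm (mid (xq t)))^2 + py t * (norm (dif (xq t)))^2) <= h' t" if "0 <= t" for t
 proof -
 have "0 <= 4 * Re ka * c0 * ((norm (mid (xq t)))^2 + (norm (dif (xq t)))^2)" using ka c0 by simp
 then show ?thesis using generator_form[OF that ka, of "xq t" 0] unfolding h'_def abs_zero mult_zero_left by linarith
 qed
 have h'0: "0 <= h' t" if "0 <= t" for t
 using order_trans[OF _ h'1[OF that]] c0 pypos[OF that] by (simp add: less_imp_le)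
 have mono: "h t <= h T" if "0 <= t" "t <= T" for t T
 by (rule DERIV_nonneg_imp_nondecreasing[OF that(2)]) (use dh h'0 that(1) in \<open>meson order_trans\<close>)
 have L0: "x #. L 0 t x = fst x #. cm (P t) (fst x) - snd x #. cm (Q t) (snd x)" for t x
 by (simp add: L_def inner_prod_def)
 have "\<bar>h t\<bar> <= K0 * (norm (xq t))^2" if t: "0 <= t" for t
 proof -
 have "\<bar>a #. cm M a\<bar> <= K0 * (norm a)^2" if "norm M <= K0" for M and a :: "complex^'n"
 proof -
 have "\<bar>a #. cm M a\<bar> <= norm a * (K0 * norm a)"
 by (rule order_trans[OF Cauchy_Schwarz_ineq2]) (intro mult_left_mono order_trans[OF norm_cm] mult_right_mono that, auto)
 then show ?thesis by (simp add: power2_eq_square mult_ac)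
 qed
 from this[OF bdP[OF t], of "fst (xq t)"] this[OF bdQ[OF t], of "snd (xq t)"] show ?thesis
 unfolding h_def L0 norm_fst_snd[of "xq t"] distrib_left by linarith
 qed
 then have b: "\<forall>\<^sub>F t in at_top. norm (h t) <= K0 * (norm (xq t))^2" unfolding eventually_at_top_linorder by (intro exI[of _ 0]) simp
 have "((%t. K0 * (norm (xq t))^2) ---> K0 * 0^2) at_top" by (intro tendsto_intros tendsto_norm_zero xq(2))
 then have h0: "(h ---> 0) at_top" using Lim_null_comparison[OF b] by simp
 have le: "h t <= 0" if "0 <= t" for t
 by (rule tendsto_lowerbound[OF h0 eventually_mono[OF eventually_ge_at_top[of t]]]) (use mono that in auto)
 then show "xq 0 #. L 0 0 (xq 0) <= 0" unfolding h_def[symmetric] by simp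
 show "xq 0 #. L 0 0 (xq 0) = 0 --> xq 0 = 0"
 proof (rule impI, rule ccontr)
 assume z: "xq 0 #. L 0 0 (xq 0) = 0" and nz: "xq 0 ~= 0"
 have "0 < (norm (mid (xq 0)))^2 + py 0 * (norm (dif (xq 0)))^2"
 proof (rule ccontr)
 assume "\<not> ?thesis"
 moreover have "0 <= py 0 * (norm (dif (xq 0)))^2" using pypos[of 0] by simp
 moreover have "0 <= (norm (mid (xq 0)))^2" by simp
 ultimately have "(norm (mid (xq 0)))^2 = 0" "py 0 * (norm (dif (xq 0)))^2 = 0" by linarith+
 then have "norm (xq 0) = 0" using norm_mid_dif[of "xq 0"] pypos[of 0] by simp
 then show False using nz by simp
 qed
 then have "0 < h' 0" using h'1[of 0] c0 by (smt (verit) mult_pos_pos)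
 then obtain e where "0 < e" "ALL y>0. y < e --> h 0 < h (0 + y)" using DERIV_pos_inc_right[OF dh[of 0]] by auto
 then have "h 0 < h (e / 2)" by simp
 then show False using le[of "e/2"] z \<open>0 < e\<close> unfolding h_def[symmetric] by simp
 qed
qed

end

definition gr :: "complex^'n::finite^'n => complex^'n => 'n cpair" where "gr R b = (R *v b, b)"

lemma mid_gr_add: "mid (gr R (b + c)) = mid (gr R b) + mid (gr R c)" "mid (gr R (h *s b)) = h *s mid (gr R b)"
 "dif (gr R (b + c)) = dif (gr R b) + dif (gr R c)" "dif (gr R (h *s b)) = h *s dif (gr R b)"
 by (simp_all add: gr_def mid_def dif_def matrix_vector_right_distrib vector_scalar_commute vec_eq_iff algebra_simps scaleR_conv_of_real[where 'a = complex])

lemma mid_gr_sum: "mid (gr R (\<Sum>j\<in>S. c j *s b j)) = (\<Sum>j\<in>S. c j *s mid (gr R (b j)))"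
 "dif (gr R (\<Sum>j\<in>S. c j *s b j)) = (\<Sum>j\<in>S. c j *s dif (gr R (b j)))"
proof -
 have 0: "mid (gr R 0) = 0" "dif (gr R 0) = 0" by (simp_all add: gr_def mid_def dif_def)
 show "mid (gr R (\<Sum>j\<in>S. c j *s b j)) = (\<Sum>j\<in>S. c j *s mid (gr R (b j)))"
 by (induction S rule: infinite_finite_induct) (simp_all add: 0 mid_gr_add)
 show "dif (gr R (\<Sum>j\<in>S. c j *s b j)) = (\<Sum>j\<in>S. c j *s dif (gr R (b j)))"
 by (induction S rule: infinite_finite_induct) (simp_all add: 0 mid_gr_add)
qed

lemma jn_sum: "(\<Sum>j\<in>S. c j *s jn (v j) (w j)) = jn (\<Sum>j\<in>S. c j *s v j) (\<Sum>j\<in>S. c j *s w j)"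
proof -
 have "jn 0 0 = 0" by (simp add: jn_def vec_eq_iff split: sum.split)
 then show ?thesis by (induction S rule: infinite_finite_induct) (simp_all add: jn_smult[symmetric] jn_add)
qed

lemma jn_0: "jn v w = 0 \<longleftrightarrow> v = 0 & w = 0"
proof
 assume "jn v w = 0"
 then have "lf (jn v w) = lf 0" "rt (jn v w) = rt 0" by simp_all
 then show "v = 0 & w = 0" unfolding jn_simps by (simp add: lf_def rt_def vec_eq_iff)
qed (simp add: jn_def vec_eq_iff split: sum.split)

lemma cspan_basis:
 fixes be :: "'n::finite => complex^'n" and f :: "complex^'n => complex^'m"
 assumes be: "cindep be" and f: "!!c (b :: 'n => complex^'n). f (SUM j:UNIV. c j *s b j) = (SUM j:UNIV. c j *s f (b j))" and a: "!!j. a j ~= 0"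
 shows "cspan (%j. a j *s f (be j)) = range f"
proof -
 have e: "(SUM j:UNIV. c j *s (a j *s f (be j))) = f (colm be *v (\<chi> j. c j * a j))" for c
 unfolding colm_mult vec_lambda_beta f by (simp add: vector_smult_assoc)
 show ?thesis
 proof (intro equalityI subsetI)
 fix x assume "x : cspan (%j. a j *s f (be j))"
 then show "x : range f" unfolding cspan_def e by auto
 next
 fix x assume "x : range f"
 then obtain b where b: "x = f b" by blast
 obtain M where M: "M ** colm be = mat 1"
 using be unfolding cindep_colm matrix_left_invertible_ker[symmetric] by (elim exE)
 then have "colm be ** M = mat 1" by (simp add: matrix_left_right_inverse)
 then have "colm be *v (M *v b) = b" by (simp add: matrix_vector_mul_assoc)
 moreover have "(\<chi> j. (M *v b) $ j / a j * a j) = M *v b" using a by (simp add: vec_eq_iff)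
 ultimately have "x = (SUM j:UNIV. ((M *v b) $ j / a j) *s (a j *s f (be j)))" unfolding e b by simp
 then show "x : cspan (%j. a j *s f (be j))" unfolding cspan_def by (intro CollectI exI conjI TrueI)
 qed
qed

lemma cindep_basis:
 fixes be :: "'n::finite => complex^'n" and f :: "complex^'n => complex^'m"
 assumes be: "cindep be" and f: "!!c (b :: 'n => complex^'n). f (SUM j:UNIV. c j *s b j) = (SUM j:UNIV. c j *s f (b j))" and a: "!!j. a j ~= 0"
 and inj: "!!b. f b = 0 ==> b = 0"
 shows "cindep (%j. a j *s f (be j))"
 unfolding cindep_def
proof (intro allI impI)
 fix c j assume "(SUM j:UNIV. c j *s (a j *s f (be j))) = 0"
 then have "f (SUM j:UNIV. (c j * a j) *s be j) = 0" unfolding f by (simp add: vector_smult_assoc)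
 then have "c j * a j = 0" using be[unfolded cindep_def, rule_format, of "%j. c j * a j"] inj by blast
 then show "c j = 0" using a by simp
qed

lemma cindep_axis: "cindep (%j. axis j 1 :: complex^'n::finite)"
proof -
 have "(SUM j:UNIV. c j *s axis j 1) = (\<chi> j. c j)" for c :: "'n => complex" using sum_axis[of "\<chi> j. c j"] by simp
 then show ?thesis unfolding cindep_def by (simp add: vec_eq_iff)
qed

lemma analytic_gr:
 assumes "!!i j. (%ka. R ka $ i $ j) analytic_on Hplus"
 shows "(%ka. mid (gr (R ka) b) $ i) analytic_on Hplus" "(%ka. dif (gr (R ka) b) $ i) analytic_on Hplus"
proof -
 have e: "mid (gr M b) $ i = 1/2 * ((SUM j:UNIV. M $ i $ j * b $ j) + b $ i)"
 "dif (gr M b) $ i = 1/2 * ((SUM j:UNIV. M $ i $ j * b $ j) - b $ i)" for M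
 by (simp_all add: gr_def mid_def dif_def matrix_vector_mult_def scaleR_conv_of_real[where 'a = complex])
 show "(%ka. mid (gr (R ka) b) $ i) analytic_on Hplus" "(%ka. dif (gr (R ka) b) $ i) analytic_on Hplus"
 unfolding e by (intro analytic_intros assms)+
qed

text \<open>The Evans determinant is compared with the determinant \<open>Et\<close> of the same
  graphs in the variables \<open>(v, u)\<close>. The latter has no zero on \<open>Hplus\<close>,
  because the form at 0 is negative on the plus graph and, after reflection, positive on the minus
  graph. The difference between the two determinants is the single factor \<open>ka\<close>.\<close>

theorem stable_pair_graphs:
 fixes F G :: "real => real^'n::finite^'n" and wv :: "'n => complex^'n"
 assumes p: "relaxation (%t. G t + F t) (%t. G t - F t) P Q P' Q' py c0 K0"
 and m: "relaxation (%t. G (- t) - F (- t)) (%t. G (- t) + F (- t)) P2 Q2 P2' Q2' py2 c0 K0"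
 and PQ: "P2 0 = Q 0" "Q2 0 = P 0"
 and R1: "!!i j. (%ka. R1 ka $ i $ j) analytic_on Hplus"
 "!!ka. ka : Hplus - {0} ==> relaxation.is_graph (%t. G t + F t) (%t. G t - F t) ka (R1 ka)"
 "ALL b. relaxation.graph_form P Q (R1 0) b <= 0 & (relaxation.graph_form P Q (R1 0) b = 0 --> b = 0)"
 "!!b. mid (R1 0 *v b, b) = 0 ==> b = 0"
 and R2: "!!i j. (%ka. R2 ka $ i $ j) analytic_on Hplus"
 "!!ka. ka : Hplus - {0} ==> relaxation.is_graph (%t. G (- t) - F (- t)) (%t. G (- t) + F (- t)) ka (R2 ka)"
 "ALL b. relaxation.graph_form P2 Q2 (R2 0) b <= 0 & (relaxation.graph_form P2 Q2 (R2 0) b = 0 --> b = 0)"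
 and wv: "cindep wv" "!!j. j ~= k ==> wv j = R2 0 *v (- wv j)"
 and x0: "R2 0 *v b0 = a0" "mid (a0, b0) ~= 0"
 shows "stable_pair (ev_minus F G) (ev_plus F G)"
proof -
 interpret p: relaxation "%t. G t + F t" "%t. G t - F t" P Q P' Q' py c0 K0 by (rule p)
 interpret m: relaxation "%t. G (- t) - F (- t)" "%t. G (- t) + F (- t)" P2 Q2 P2' Q2' py2 c0 K0 by (rule m)
 \<comment> \<open>Second components adapted to \<open>ka = 0\<close>: index k stands for the
   solution \<open>(a0, b0)\<close> with nonzero \<open>mid\<close>, the other indices for constants
   \<open>(u, - u)\<close>, whose \<open>mid\<close> vanishes.\<close>
 define be where "be j = (if j = k then b0 else - wv j)" for j
 have midbe: "mid (gr (R2 0) (be j)) = (if j = k then mid (a0, b0) else 0)" for j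
 using wv(2)[of j] x0(1) by (simp add: gr_def be_def mid_def)
 have be: "cindep be"
 unfolding cindep_def
 proof (intro allI impI)
 fix c j assume z: "(SUM j:UNIV. c j *s be j) = 0"
 have m0: "mid (gr (R2 0) 0) = 0" by (simp add: gr_def mid_def)
 have "(SUM j:UNIV. c j *s mid (gr (R2 0) (be j))) = mid (gr (R2 0) 0)" unfolding mid_gr_sum[symmetric] z ..
 then have "c k *s mid (a0, b0) = 0"
 unfolding midbe by (simp add: if_distrib[of "%z. _ *s z"] sum.delta m0 cong: if_cong)
 then have ck: "c k = 0" using x0(2) by (simp add: vec_eq_iff) (metis mult_eq_0_iff)
 have "(SUM j:UNIV. (- c j) *s wv j) = (SUM j:UNIV. c j *s be j)" by (intro sum.cong refl) (simp add: be_def ck vec_eq_iff)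
 then have "- c j = 0" using wv(1)[unfolded cindep_def, rule_format, of "%j. - c j" j] z by simp
 then show "c j = 0" by simp
 qed
 define f1 where "f1 ka b = lift ka (gr (R1 ka) b)" for ka b
 define f2 where "f2 ka b = TM *v lift ka (gr (R2 ka) b)" for ka b
 have f1s: "f1 ka (SUM j:UNIV. c j *s b j) = (SUM j:UNIV. c j *s f1 ka (b j))" for ka c and b :: "'n => complex^'n"
 by (simp add: f1_def lift_def mid_gr_sum jn_sum vec.scale_sum_right vector_smult_assoc mult.commute)
 have f2s: "f2 ka (SUM j:UNIV. c j *s b j) = (SUM j:UNIV. c j *s f2 ka (b j))" for ka c and b :: "'n => complex^'n"
 using arg_cong[OF jn_sum, of "%x. x"] by (simp add: f2_def TM_lift mid_gr_sum jn_sum vec.scale_sum_right vector_smult_assoc mult.commute sum_negf[symmetric])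
 have g0: "mid (gr R b) = 0 ==> dif (gr R b) = 0 ==> b = 0" for R :: "complex^'n^'n" and b
 using snd_mid_dif[of "gr R b"] by (simp add: gr_def)
 have f1i: "b = 0" if "f1 ka b = 0" "ka ~= 0" for ka b
 using that g0[of "R1 ka" b] by (simp add: f1_def lift_def jn_0)
 have f2i: "b = 0" if "f2 ka b = 0" "ka ~= 0" for ka b
 using that g0[of "R2 ka" b] by (simp add: f2_def TM_lift jn_0)
 have evp: "ev_plus F G ka = range (f1 ka)" if ka: "ka : Hplus - {0}" for ka
 proof -
 have "ev_plus F G ka = lift ka ` {x. EX xq. xq 0 = x & p.decays ka xq}"
 using ev_plus_lift[of ka F G] ka unfolding p.decays_def p.B_def[abs_def] bop_def by simp
 also have "{x. EX xq. xq 0 = x & p.decays ka xq} = range (gr (R1 ka))"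
 using R1(2)[OF ka] unfolding p.is_graph_def gr_def[abs_def] by (auto simp: image_iff prod_eq_iff)
 finally show ?thesis by (simp add: image_image f1_def)
 qed
 have evm: "ev_minus F G ka = range (f2 ka)" if ka: "ka : Hplus - {0}" for ka
 proof -
 have "ev_plus (%x. - F (- x)) (%x. G (- x)) ka = lift ka ` {x. EX xq. xq 0 = x & m.decays ka xq}"
 using ev_plus_lift[of ka "%x. - F (- x)" "%x. G (- x)"] ka unfolding m.decays_def m.B_def[abs_def] bop_def by simp
 also have "{x. EX xq. xq 0 = x & m.decays ka xq} = range (gr (R2 ka))"
 using R2(2)[OF ka] unfolding m.is_graph_def gr_def[abs_def] by (auto simp: image_iff prod_eq_iff)
 finally show ?thesis unfolding ev_minus_reflect by (simp add: image_image f2_def)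
 qed
 have neg1: "p.graph_form (R1 ka) b <= 0 & (p.graph_form (R1 ka) b = 0 --> b = 0)" if ka: "ka : Hplus" for ka b
 proof (cases "ka = 0")
 case False
 then have k: "ka : Hplus - {0}" "0 <= Re ka" using ka by (auto simp: Hplus_def)
 have "EX xq. xq 0 = gr (R1 ka) b & p.decays ka xq" using R1(2)[OF k(1)] unfolding p.is_graph_def by (simp add: gr_def)
 then obtain xq where x: "xq 0 = gr (R1 ka) b" and d: "p.decays ka xq" by (elim exE conjE)
 show ?thesis using p.decays_negative[OF d k(2)] unfolding x by (simp add: gr_def p.graph_form_L zero_prod_def)
 qed (use R1(3) in simp)
 have neg2: "m.graph_form (R2 ka) b <= 0 & (m.graph_form (R2 ka) b = 0 --> b = 0)" if ka: "ka : Hplus" for ka b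
 proof (cases "ka = 0")
 case False
 then have k: "ka : Hplus - {0}" "0 <= Re ka" using ka by (auto simp: Hplus_def)
 have "EX xq. xq 0 = gr (R2 ka) b & m.decays ka xq" using R2(2)[OF k(1)] unfolding m.is_graph_def by (simp add: gr_def)
 then obtain xq where x: "xq 0 = gr (R2 ka) b" and d: "m.decays ka xq" by (elim exE conjE)
 show ?thesis using m.decays_negative[OF d k(2)] unfolding x by (simp add: gr_def m.graph_form_L zero_prod_def)
 qed (use R2(3) in simp)
 \<comment> \<open>A common vector means \<open>R2 b2 = - b1\<close> and
   \<open>b2 = - R1 b1\<close>, since reflection exchanges the two components up to sign. With
   \<open>P\<close> and \<open>Q\<close> exchanged as well, the two graph forms are opposite
   numbers, both nonpositive, so both vanish.\<close>
 have transversal: "b1 = 0 & b2 = 0" if ka: "ka : Hplus" and z: "mid (gr (R2 ka) b2) + mid (gr (R1 ka) b1) = 0" "dif (gr (R1 ka) b1) = dif (gr (R2 ka) b2)" for ka b1 b2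
 proof -
 have m: "mid (gr (R2 ka) b2) = - mid (gr (R1 ka) b1)" using z(1) by (simp add: eq_neg_iff_add_eq_0)
 define g1 g2 where "g1 = gr (R1 ka) b1" "g2 = gr (R2 ka) b2"
 have g: "R1 ka *v b1 = mid g1 + dif g1" "b1 = mid g1 - dif g1" "R2 ka *v b2 = mid g2 + dif g2" "b2 = mid g2 - dif g2"
 using fst_mid_dif[of g1] snd_mid_dif[of g1] fst_mid_dif[of g2] snd_mid_dif[of g2] by (simp_all add: g1_g2_def gr_def)
 have "mid g2 + dif g2 = - (mid g1 - dif g1)" "mid g2 - dif g2 = - (mid g1 + dif g1)"
 unfolding g1_g2_def m z(2) by simp_all
 then have 1: "R2 ka *v b2 = - b1" and 2: "b2 = - (R1 ka *v b1)" unfolding g[symmetric] .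
 have "m.graph_form (R2 ka) b2 = - p.graph_form (R1 ka) b1"
 unfolding m.graph_form_def p.graph_form_def 1 PQ unfolding 2 by (simp add: cm.minus_right)
 then show ?thesis using neg1[OF ka, of b1] neg2[OF ka, of b2] by auto
 qed
 define hp where "hp j ka = f1 ka (axis j 1)" for j :: 'n and ka
 \<comment> \<open>The quotient by \<open>ka\<close> of a function vanishing at 0, completed by its
   derivative there; for \<open>j ~= k\<close> the singularity is removable.\<close>
 define mq where "mq j i ka = (if ka = 0 then deriv (%ka. mid (gr (R2 ka) (be j)) $ i) 0 else mid (gr (R2 ka) (be j)) $ i / ka)" for j i ka
 define hm where "hm j ka = (if j = k then f2 ka (be k) else jn (\<chi> i. mq j i ka) (- dif (gr (R2 ka) (be j))))" for j ka
 define aa where "aa ka j = (if j = k then 1 else inverse ka)" for ka :: complex and j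
 have hmk: "hm j ka = aa ka j *s f2 ka (be j)" if "ka ~= 0" for j ka
 using that by (simp add: hm_def aa_def f2_def TM_lift mq_def jn_smult[symmetric] vector_smult_assoc vec_eq_iff jn_def divide_inverse mult.commute split: sum.split)
 have aanz: "aa ka j ~= 0" if "ka ~= 0" for ka j using that by (simp add: aa_def)
 have bp: "analytic_basis (ev_plus F G) hp"
 unfolding analytic_basis_def
 proof (intro conjI allI ballI)
 show "(%ka. hp j ka $ r) analytic_on Hplus" for j r
 by (cases r) (auto simp: hp_def f1_def lift_def intro!: analytic_intros analytic_gr R1(1))
 fix ka :: complex
 show "cindep (%j. hp j ka)" if "ka : Hplus"
 proof (cases "ka = 0")
 case True
 have "b = 0" if "f1 0 b = 0" for b using that R1(4)[of b] by (simp add: f1_def lift_def jn_0 gr_def)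
 from cindep_basis[OF cindep_axis f1s[of 0], where a = "%_. 1", OF _ this] show ?thesis by (simp add: hp_def True)
 next
 case False
 from cindep_basis[OF cindep_axis f1s[of ka], where a = "%_. 1", OF _ f1i] False show ?thesis by (simp add: hp_def)
 qed
 show "cspan (%j. hp j ka) = ev_plus F G ka" if "ka : Hplus - {0}"
 using cspan_basis[OF cindep_axis f1s[of ka], where a = "%_. 1"] by (simp add: hp_def evp[OF that])
 qed
 have bm: "analytic_basis (ev_minus F G) hm"
 unfolding analytic_basis_def
 proof (intro conjI allI ballI)
 have an: "mq j i analytic_on Hplus" if "j ~= k" for j i
 proof (rule pole_theorem_analytic_0[where a = 0])
 show "(%ka. mid (gr (R2 ka) (be j)) $ i) analytic_on Hplus" by (rule analytic_gr[OF R2(1)])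
 show "EX d>0. ALL w:ball z d - {0}. mid (gr (R2 w) (be j)) $ i = (w - 0) * mq j i w" for z
 by (rule exI[of _ 1]) (simp add: mq_def)
 qed (use that in \<open>simp_all add: mq_def midbe\<close>)
 show "(%ka. hm j ka $ r) analytic_on Hplus" for j r
 using an[of j] by (cases r; cases "j = k")
 (auto simp: hm_def f2_def TM_lift simp del: mult_minus_left mult_minus_right intro!: analytic_intros analytic_gr R2(1))
 fix ka :: complex
 show "cindep (%j. hm j ka)" if "ka : Hplus"
 proof (cases "ka = 0")
 case True
 show ?thesis unfolding cindep_def
 proof (intro allI impI)
 fix c j assume z: "(SUM j:UNIV. c j *s hm j ka) = 0"
 have "hm j 0 = jn (if j = k then mid (a0, b0) else (\<chi> i. mq j i 0)) (if j = k then 0 else - (- be j))" for j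
 proof (cases "j = k")
 case False
 have "dif (gr (R2 0) (be j)) = mid (gr (R2 0) (be j)) - snd (gr (R2 0) (be j))" unfolding snd_mid_dif[of "gr (R2 0) (be j)"] by simp
 moreover have "snd (gr (R2 0) (be j)) = be j" by (simp add: gr_def)
 ultimately have "dif (gr (R2 0) (be j)) = - be j" using False by (simp only: midbe if_False diff_0)
 then show ?thesis using False by (simp add: hm_def)
 qed (simp add: hm_def f2_def TM_lift midbe)
 then have h: "hm j 0 = jn (if j = k then mid (a0, b0) else (\<chi> i. mq j i 0)) (if j = k then 0 else be j)" for j by simp
 have z0: "(SUM j:UNIV. c j *s (if j = k then mid (a0, b0) else (\<chi> i. mq j i 0))) = 0" "(SUM j:UNIV. c j *s (if j = k then 0 else be j)) = 0"
 using z unfolding True h jn_sum jn_0 by blast+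
 have "(SUM j:UNIV. (if j = k then 0 else c j) *s be j) = (SUM j:UNIV. c j *s (if j = k then 0 else be j))" by (intro sum.cong refl) simp
 then have cj: "j ~= k ==> c j = 0" for j
 using be[unfolded cindep_def, rule_format, of "%j. if j = k then 0 else c j" j] z0(2) by simp
 have "(SUM j:UNIV. c j *s (if j = k then mid (a0, b0) else (\<chi> i. mq j i 0))) = (SUM j:UNIV. if j = k then c k *s mid (a0, b0) else 0)"
 by (intro sum.cong refl) (simp add: cj)
 then have "c k *s mid (a0, b0) = 0" using z0(1) by simp
 then have "c k = 0" using x0(2) by (simp add: vec_eq_iff) (metis mult_eq_0_iff)
 then show "c j = 0" using cj by (cases "j = k") auto
 qed
 next
 case False
 from cindep_basis[OF be f2s[of ka], OF aanz[OF False] f2i[OF _ False]] show ?thesis by (simp add: hmk[OF False])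
 qed
 show "cspan (%j. hm j ka) = ev_minus F G ka" if k: "ka : Hplus - {0}"
 proof -
 have nz: "ka ~= 0" using k by simp
 show ?thesis using cspan_basis[OF be f2s[of ka], OF aanz[OF nz]] by (simp add: hmk[OF nz] evm[OF k])
 qed
 qed
 \<comment> \<open>With \<open>lift 1\<close> the columns are \<open>(v, u)\<close> in place of
   \<open>(v, ka u)\<close>, so they do not degenerate at 0.\<close>
 define n1 where "n1 j ka = lift 1 (gr (R1 ka) (axis j 1))" for j :: 'n and ka
 define n2 where "n2 j ka = TM *v lift 1 (gr (R2 ka) (be j))" for j ka
 have n2e: "n2 j ka = jn (mid (gr (R2 ka) (be j))) (- dif (gr (R2 ka) (be j)))"
 and f2e: "f2 ka b = jn (mid (gr (R2 ka) b)) (- (ka *s dif (gr (R2 ka) b)))" for j ka b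
 by (simp_all add: n2_def f2_def TM_lift)
 define Et where "Et = evans_fun n2 n1"
 have Enz: "Et ka ~= 0" if ka: "ka : Hplus" for ka
 unfolding Et_def evans_fun_colm det_colm_nz cindep_def
 proof (intro allI impI)
 fix c j assume z: "(SUM j:UNIV. c j *s case_sum (%j. n2 j ka) (%j. n1 j ka) j) = 0"
 have U: "(UNIV :: ('n + 'n) set) = UNIV <+> UNIV" by simp
 define b2 where "b2 = (SUM j:UNIV. c (Inl j) *s be j)"
 define b1 where "b1 = (SUM j:UNIV. c (Inr j) *s (axis j 1 :: complex^'n))"
 have "jn (mid (gr (R2 ka) b2)) (- dif (gr (R2 ka) b2)) + jn (mid (gr (R1 ka) b1)) (dif (gr (R1 ka) b1)) = 0"
 proof -
 have neg: "(SUM j:UNIV. h j *s (- y j)) = - (SUM j:UNIV. h j *s y j)" for h and y :: "'n => complex^'n"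
 by (simp add: sum_negf[symmetric] vec_eq_iff)
 have e2: "(SUM j:UNIV. c (Inl j) *s n2 j ka) = jn (mid (gr (R2 ka) b2)) (- dif (gr (R2 ka) b2))"
 unfolding n2e jn_sum b2_def mid_gr_sum neg ..
 have n1e: "n1 j ka = jn (mid (gr (R1 ka) (axis j 1))) (dif (gr (R1 ka) (axis j 1)))" for j by (simp add: n1_def lift_def)
 have e1: "(SUM j:UNIV. c (Inr j) *s n1 j ka) = jn (mid (gr (R1 ka) b1)) (dif (gr (R1 ka) b1))"
 unfolding n1e jn_sum b1_def mid_gr_sum ..
 show ?thesis using z unfolding U sum.Plus[OF finite finite] comp_def sum.case e1 e2 .
 qed
 then have "mid (gr (R2 ka) b2) + mid (gr (R1 ka) b1) = 0" "- dif (gr (R2 ka) b2) + dif (gr (R1 ka) b1) = 0"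
 unfolding jn_add[symmetric] jn_0 by blast+
 from transversal[OF ka this(1)] this(2) have "b1 = 0" "b2 = 0" by simp_all
 then have "c (Inl j) = 0" "c (Inr j) = 0" for j
 using be[unfolded cindep_def, rule_format, of "%j. c (Inl j)"] cindep_axis[unfolded cindep_def, rule_format, of "%j. c (Inr j)"]
 unfolding b1_def b2_def by blast+
 then show "c j = 0" by (cases j) auto
 qed
 have Ean: "Et analytic_on Hplus"
 proof -
 have "(%ka. (case c of Inl j => n2 j ka $ r | Inr j => n1 j ka $ r)) analytic_on Hplus" for r c
 by (cases c; cases r) (auto simp: n1_def n2e lift_def intro!: analytic_intros analytic_gr R1(1) R2(1))
 then show ?thesis unfolding Et_def evans_fun_def[abs_def] det_def vec_lambda_beta by (intro analytic_intros)
 qed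
 have EE: "evans_fun hm hp ka = ka * Et ka" if k: "ka : Hplus - {0}" for ka
 proof -
 have nz: "ka ~= 0" using k by simp
 have U: "(UNIV :: ('n + 'n) set) = UNIV <+> UNIV" by simp
 \<comment> \<open>\<open>D\<close> multiplies the n lower rows by \<open>ka\<close>, and
   \<open>A\<close> divides the n - 1 minus columns with \<open>j ~= k\<close> by \<open>ka\<close>.
   Their determinants combine to exactly one factor \<open>ka\<close>.\<close>
 define D :: "complex^('n + 'n)^('n + 'n)" where "D = (\<chi> r c. if r = c then (case r of Inl _ => 1 | Inr _ => ka) else 0)"
 define A :: "complex^('n + 'n)^('n + 'n)" where "A = (\<chi> r c. if r = c then (case r of Inl j => aa ka j | Inr _ => 1) else 0)"
 have "prod (aa ka) UNIV * ka ^ CARD('n) = ka"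
 proof -
 have "prod (aa ka) UNIV * ka ^ CARD('n) = (\<Prod>j\<in>UNIV. aa ka j * ka)" by (simp add: prod.distrib)
 also have "... = (\<Prod>j\<in>UNIV. if j = k then ka else 1)" by (intro prod.cong refl) (simp add: aa_def nz)
 finally show ?thesis by simp
 qed
 moreover have "det D = ka ^ CARD('n)" by (subst det_diagonal) (simp_all add: D_def U prod.Plus del: UNIV_Plus_UNIV)
 moreover have "det A = prod (aa ka) UNIV" by (subst det_diagonal) (simp_all add: A_def U prod.Plus comp_def del: UNIV_Plus_UNIV)
 ultimately have dd: "det D * det A = ka" by (simp add: mult.commute)
 have "colm (case_sum (%j. hm j ka) (%j. hp j ka)) = D ** colm (case_sum (%j. n2 j ka) (%j. n1 j ka)) ** A"
 proof -
 have "(D ** M) $ r $ c = (case r of Inl _ => 1 | Inr _ => ka) * M $ r $ c" for M :: "complex^('n + 'n)^('n + 'n)" and r c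
 by (simp add: D_def matrix_matrix_mult_def if_distrib[of "%z. z * _"] sum.delta cong: if_cong)
 moreover have "(M ** A) $ r $ c = M $ r $ c * (case c of Inl j => aa ka j | Inr _ => 1)" for M :: "complex^('n + 'n)^('n + 'n)" and r c
 by (simp add: A_def matrix_matrix_mult_def if_distrib[of "%z. _ * z"] sum.delta' cong: if_cong)
 ultimately show ?thesis
 unfolding vec_eq_iff by (auto simp: colm_def hp_def f1_def n1_def n2e hmk[OF nz] f2e lift_def jn_def split: sum.split)
 qed
 then show ?thesis unfolding evans_fun_colm Et_def by (simp add: det_mul dd[symmetric])
 qed
 show ?thesis
 unfolding stable_pair_def
 proof (intro conjI allI impI)
 show "\<exists>(hm :: 'n => complex => complex^('n + 'n)) (hp :: 'n => complex => complex^('n + 'n)). analytic_basis (ev_minus F G) hm & analytic_basis (ev_plus F G) hp"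
 by (intro exI conjI) (rule bm, rule bp)
 fix hm' hp' :: "'n => complex => complex^('n + 'n)"
 assume b: "analytic_basis (ev_minus F G) hm' & analytic_basis (ev_plus F G) hp'"
 note r = evans_any_basis[OF bm bp b[THEN conjunct1] b[THEN conjunct2] EE Enz analytic_tendsto_0[OF Ean]]
 show "ALL ka:Hplus. evans_fun hm' hp' ka = 0 \<longleftrightarrow> ka = 0" "deriv (evans_fun hm' hp') 0 ~= 0" using r by blast+
 qed
qed

section \<open>Inverses of positive definite matrices along a curve\<close>

lemma bounded_bilinear_mm: "bounded_bilinear ((**) :: real^'n::finite^'n => real^'n^'n => real^'n^'n)"
 unfolding bilinear_conv_bounded_bilinear[symmetric] bilinear_def
 by (auto intro!: linearI simp: matrix_matrix_mult_def vec_eq_iff sum.distrib[symmetric] sum_distrib_left algebra_simps)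

interpretation mm: bounded_bilinear "(**) :: real^'n::finite^'n => real^'n^'n => real^'n^'n" by (rule bounded_bilinear_mm)

lemma has_vector_derivative_quotient:
 fixes f :: "real => 'a::real_normed_vector"
 shows "(f hvd D) (at x) \<longleftrightarrow> ((%y. (1 / (y - x)) *R (f y - f x)) ---> D) (at x)"
proof -
 have "norm ((1 / norm (y - x)) *R (f y - (f x + (y - x) *R D))) = norm ((1 / (y - x)) *R (f y - f x) - D)" if "y ~= x" for y
 proof -
 have "(1 / (y - x)) *R (f y - f x) - D = (1 / (y - x)) *R (f y - (f x + (y - x) *R D))"
 using that by (simp add: scaleR_diff_right scaleR_add_right)
 then show ?thesis by simp
 qed
 then have "\<forall>\<^sub>F y in at x. norm ((1 / norm (y - x)) *R (f y - (f x + (y - x) *R D))) = norm ((1 / (y - x)) *R (f y - f x) - D)"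
 by (auto simp: eventually_at_filter)
 from tendsto_cong[OF this, of 0] show ?thesis
 unfolding has_vector_derivative_def has_derivative_within tendsto_norm_zero_iff LIM_zero_iff
 using bounded_linear_scaleR_left[of D] by blast
qed

lemma cm_pos:
 assumes "!!x. c * (norm x)^2 <= x #. (A *v x)"
 shows "c * (norm v)^2 <= v #. cm A (v :: complex^'n::finite)"
proof -
 define x y where "x = (\<chi> i. Re (v $ i))" "y = (\<chi> i. Im (v $ i))"
 have "v #. cm A v = x #. (A *v x) + y #. (A *v y)"
 by (simp add: inner_vec_def inner_complex_def cm_def x_y_def matrix_vector_mult_def sum.distrib)
 moreover have "(norm v)^2 = (norm x)^2 + (norm y)^2"
 by (simp add: power2_norm_eq_inner inner_vec_def inner_complex_def x_y_def sum.distrib)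
 ultimately show ?thesis using assms[of x] assms[of y] by (simp add: distrib_left)
qed

lemma norm_matrix_le:
 fixes M :: "real^'n::finite^'n"
 assumes "!!x. norm (M *v x) <= b * norm x"
 shows "norm M <= (real CARD('n))^2 * b"
proof -
 have e: "norm (M $ i $ j) <= b" for i j
 proof -
 have "M $ i $ j = (M *v axis j 1) $ i"
 by (simp add: matrix_vector_mult_def axis_def if_distrib[of "%z. _ * z"] sum.delta' cong: if_cong)
 then show ?thesis using order_trans[OF Finite_Cartesian_Product.norm_nth_le assms[of "axis j 1"]] by (simp add: norm_axis_1)
 qed
 have r: "norm (M $ i) <= (\<Sum>j\<in>(UNIV::'n set). b)" for i by (intro order_trans[OF norm_le_sum_components sum_mono] e)
 have "norm M <= (\<Sum>i\<in>(UNIV::'n set). \<Sum>j\<in>(UNIV::'n set). b)" by (intro order_trans[OF norm_le_sum_components sum_mono] r)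
 then show ?thesis by (simp add: power2_eq_square)
qed

text \<open>Coercivity bounds \<open>A\<close> from below, hence the inverse as an operator; the
  factor \<open>(real CARD('n))^2\<close> converts the operator bound into one for the Euclidean
  norm of the entries.\<close>

lemma positive_inverse:
 fixes A :: "real^'n::finite^'n"
 assumes c: "0 < c" and A: "!!x. c * (norm x)^2 <= x #. (A *v x)" and s: "sym_mat A"
 shows "EX P. P ** A = mat 1 & A ** P = mat 1 & sym_mat P & norm P <= (real CARD('n))^2 / c"
proof -
 have b: "c * norm x <= norm (A *v x)" for x
 proof (cases "x = 0")
 case False
 have "c * norm x * norm x <= norm (A *v x) * norm x"
 using order_trans[OF A[of x] norm_cauchy_schwarz[of x "A *v x"]] by (simp add: power2_eq_square mult_ac)
 then show ?thesis using False by simp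
 qed simp
 have "A *v x = 0 ==> x = 0" for x using b[of x] c by (simp add: mult_le_0_iff)
 then obtain P where P: "P ** A = mat 1" using matrix_left_invertible_ker by blast
 then have P': "A ** P = mat 1" by (simp add: matrix_left_right_inverse)
 have "norm (P *v x) <= (1/c) * norm x" for x
 using b[of "P *v x"] c by (simp add: matrix_vector_mul_assoc P' field_simps)
 then have "norm P <= (real CARD('n))^2 * (1/c)" by (rule norm_matrix_le)
 moreover have "transpose P = P"
 proof -
 have "transpose P ** A = mat 1" using arg_cong[OF P', of transpose] s by (simp add: matrix_transpose_mul sym_mat_def transpose_mat)
 then have "transpose P ** A ** P = P" by simp
 then show ?thesis by (simp add: matrix_mul_assoc[symmetric] P')
 qed
 ultimately show ?thesis using P P' by (intro exI[of _ P]) (simp add: sym_mat_def)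
qed

lemma inverse_tendsto:
 fixes A P :: "'a => real^'n::finite^'n"
 assumes A: "(A ---> A0) Fl" and P: "!!t. P t ** A t = mat 1" and P0: "A0 ** P0 = mat 1" and b: "!!t. norm (P t) <= K"
 shows "(P ---> P0) Fl"
proof -
 obtain C where C0: "0 < C" and C: "!!(a :: real^'n^'n) (b :: real^'n^'n). norm (a ** b) <= norm a * norm b * C" using mm.pos_bounded by blast
 have K0: "0 <= K" using order_trans[OF norm_ge_zero b] .
 have "P t - P0 = P t ** ((A0 - A t) ** P0)" for t
 by (simp add: mm.diff_left mm.diff_right matrix_mul_assoc P P0)
 then have bnd: "norm (P t - P0) <= K * (norm (A t - A0) * norm P0 * C) * C" for t
 using order_trans[OF C[of "P t" "(A0 - A t) ** P0"] mult_right_mono[OF mult_mono[OF b[of t] C[of "A0 - A t" P0] K0] less_imp_le[OF C0]]]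
 by (simp add: norm_minus_commute)
 have "((%t. K * (norm (A t - A0) * norm P0 * C) * C) ---> K * (0 * norm P0 * C) * C) Fl"
 by (intro tendsto_intros tendsto_norm_zero LIM_zero A)
 then have lim: "((%t. K * (norm (A t - A0) * norm P0 * C) * C) ---> 0) Fl" by simp
 have "((%t. P t - P0) ---> 0) Fl" by (rule Lim_null_comparison[OF always_eventually lim]) (intro allI bnd)
 then show ?thesis by (rule LIM_zero_cancel)
qed

text \<open>\<open>P y - P x = - P y ** (A y - A x) ** P x\<close>, and \<open>P\<close> is
  continuous because of the uniform bound on inverses.\<close>

lemma inverse_derivative:
 fixes A P :: "real => real^'n::finite^'n"
 assumes A: "(A hvd A') (at x)" and P: "!!t. P t ** A t = mat 1" "!!t. A t ** P t = mat 1" and b: "!!t. norm (P t) <= K"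
 shows "(P hvd - (P x ** A' ** P x)) (at x)"
 unfolding has_vector_derivative_quotient
proof -
 have "(A ---> A x) (at x)" using has_vector_derivative_continuous[OF A] by (simp add: continuous_at)
 then have "(P ---> P x) (at x)" by (rule inverse_tendsto[OF _ P(1) P(2) b])
 moreover have "((%y. (1 / (y - x)) *R (A y - A x)) ---> A') (at x)" using A unfolding has_vector_derivative_quotient .
 ultimately have "((%y. - (P y ** ((1 / (y - x)) *R (A y - A x)) ** P x)) ---> - (P x ** A' ** P x)) (at x)"
 by (intro tendsto_minus mm.tendsto tendsto_const)
 moreover have "- (P y ** ((1 / (y - x)) *R (A y - A x)) ** P x) = (1 / (y - x)) *R (P y - P x)" for y
 proof -
 have "P y ** (A y - A x) ** P x = P x - P y"
 by (simp add: mm.diff_left mm.diff_right P) (simp add: matrix_mul_assoc[symmetric] P)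
 then show ?thesis by (simp add: mm.scaleR_left mm.scaleR_right scaleR_minus_right[symmetric] del: scaleR_minus_right)
 qed
 ultimately show "((%y. (1 / (y - x)) *R (P y - P x)) ---> - (P x ** A' ** P x)) (at x)" by simp
qed

lemma inner_cm_bound: "\<bar>v #. cm M w\<bar> <= norm M * norm v * norm (w :: complex^'n::finite)"
 using order_trans[OF Cauchy_Schwarz_ineq2 mult_left_mono[OF norm_cm norm_ge_zero], of v M w] by (simp add: mult_ac)

lemma cm_le: "norm M <= b ==> norm (cm M v) <= b * norm (v :: complex^'n::finite)"
 by (rule order_trans[OF norm_cm mult_right_mono]) auto

section \<open>The weighted energy estimate with explicit constants\<close>

text \<open>The scalar core: \<open>al\<close> and \<open>be\<close> are the sizes of the components
  along and across the shock direction, \<open>N\<close> and \<open>V\<close> the norms of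
  \<open>y\<close> and of the mode \<open>v\<close>. Compressivity yields
  \<open>2 * e0 * al^2\<close>, the weight yields \<open>2 * l * be^2\<close>; all other terms are
  losses. The weight constant \<open>C\<close> is fixed first, to pay for the losses in
  \<open>be\<close>, and the smallness \<open>si\<close> afterwards, depending on
  \<open>C\<close>.\<close>

lemma lyapunov_scalar:
 fixes e0 l M :: real
 assumes e0: "0 < e0" and l: "0 < l" and M: "1 <= M"
 shows "EX C si. 0 < C & 0 < si & si <= 1 & (ALL py N V al be. 0 < py --> py <= si --> 0 <= al --> 0 <= be --> 0 <= N --> 0 <= V --> N^2 = al^2 + be^2 -->
 3 * V^2 + py * (e0 * N^2) <= 4 * V^2 + py * (2 * e0 * al^2 - M * (al * be + be^2 + be * N) - M * (si * N^2) - M * (V^2 + V * N)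
 + C * (2 * l * be^2 - M * (si * N^2) - M * (V^2 + V * N))))"
proof -
 \<comment> \<open>Chosen so that \<open>2 * l * C * be^2\<close> pays the Young terms
   \<open>2 * M + 2 * M^2 / e0\<close> and still leaves \<open>3/2 * e0 * be^2\<close>.\<close>
 define C where "C = (2 * M + 2 * M^2 / e0 + 3/2 * e0) / (2 * l)"
 have C: "0 < C" "2 * l * C = 2 * M + 2 * M^2 / e0 + 3/2 * e0"
 using assms by (simp_all add: C_def add_pos_pos)
 define T where "T = M * (1 + C)"
 have T: "0 < T" using M C by (simp add: T_def)
 define S where "S = T + T^2 / e0"
 have S: "0 < S" using T e0 by (simp add: S_def add_pos_nonneg)
 define si where "si = min 1 (min (e0 / (4 * T)) (1 / S))"
 have si: "0 < si" "si <= 1" "T * si <= e0 / 4" "S * si <= 1"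
 proof -
 show "0 < si" "si <= 1" using T S e0 by (simp_all add: si_def)
 have "si <= e0 / (4 * T)" "si <= 1 / S" by (simp_all add: si_def)
 then show "T * si <= e0 / 4" "S * si <= 1" using T S by (simp_all add: field_simps)
 qed
 show ?thesis
 proof (rule exI[of _ C], rule exI[of _ si], intro conjI allI impI C(1) si(1,2))
 fix py N V al be :: real
 assume p: "0 < py" "py <= si" and nn: "0 <= al" "0 <= be" "0 <= N" "0 <= V" and N: "N^2 = al^2 + be^2"
 have "N^2 <= (al + be)^2" unfolding N using nn by (simp add: power2_sum)
 then have "N <= al + be" using nn by (simp add: power2_le_iff_abs_le)
 then have "be * N <= be * (al + be)" using nn by (intro mult_left_mono)
 then have b1: "M * (al * be + be^2 + be * N) <= 2 * M * (al * be) + 2 * M * be^2"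
 using M mult_left_mono[of "be * N" "be * (al + be)" M] by (simp add: algebra_simps power2_eq_square)
 have sq: "2 * M * (al * be) <= e0 / 2 * al^2 + 2 * M^2 / e0 * be^2"
 proof -
 have "0 <= (e0 * al - 2 * M * be)^2 / (2 * e0)" using e0 by simp
 also have "... = e0 / 2 * al^2 + 2 * M^2 / e0 * be^2 - 2 * M * (al * be)" using e0 by (simp add: power2_eq_square field_simps)
 finally show ?thesis by simp
 qed
 have sq2: "T * (V * N) <= e0 / 4 * N^2 + T^2 / e0 * V^2"
 proof -
 have "0 <= (e0 * N - 2 * T * V)^2 / (4 * e0)" using e0 by simp
 also have "... = e0 / 4 * N^2 + T^2 / e0 * V^2 - T * (V * N)" using e0 by (simp add: power2_eq_square field_simps)
 finally show ?thesis by simp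
 qed
 have cl: "C * (2 * l * be^2) = 2 * M * be^2 + 2 * M^2 / e0 * be^2 + 3/2 * e0 * be^2"
 using arg_cong[OF C(2), of "%z. z * be^2"] by (simp add: algebra_simps)
 have sg: "T * (si * N^2) <= e0 / 4 * N^2" using mult_right_mono[OF si(3), of "N^2"] by (simp add: mult.assoc)
 have "e0 * N^2 - S * V^2 <= 2 * e0 * al^2 - (2 * M * (al * be) + 2 * M * be^2) - T * (si * N^2) - T * (V^2 + V * N) + C * (2 * l * be^2)"
 unfolding cl S_def using sq sq2 sg by (simp add: N algebra_simps)
 also have "... <= 2 * e0 * al^2 - M * (al * be + be^2 + be * N) - M * (si * N^2) - M * (V^2 + V * N)
 + C * (2 * l * be^2 - M * (si * N^2) - M * (V^2 + V * N))" (is "_ <= ?B")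
 using b1 by (simp add: T_def algebra_simps)
 finally have "py * (e0 * N^2 - S * V^2) <= py * ?B" using p by (intro mult_left_mono) auto
 moreover have "py * (S * V^2) <= 1 * V^2"
 proof -
 have "py * S <= si * S" using p S by (intro mult_right_mono) auto
 then have "py * S * V^2 <= 1 * V^2" using si(4) by (intro mult_right_mono) (auto simp: mult.commute)
 then show ?thesis by (simp add: mult.assoc)
 qed
 ultimately show "3 * V^2 + py * (e0 * N^2) <= 4 * V^2 + py * ?B" by (simp add: right_diff_distrib)
 qed
qed

lemma inner_smult_self: "(h *s (v :: complex^'n::finite)) #. (h *s w) = (norm h)^2 * (v #. w)"
 unfolding cmod_power2 by (simp add: inner_vec_def inner_complex_def sum_distrib_left power2_eq_square algebra_simps)

text \<open>Goodman's weighted energy: \<open>y = Q u\<close> carries the slowly dissipated part; its component along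
 the shock direction is controlled by compressivity, the others by the weight.\<close>

lemma lyapunov_constants:
 fixes E F0 :: "real^'n::finite^'n" and k :: 'n
 assumes K: "1 <= K" and l: "0 < l" and e0: "0 < e0"
 and ker: "F0 *v axis k 1 = 0" and neg: "!!y. y #. cm F0 y <= - l * (norm (y - (y $ k) *s axis k 1))^2"
 and Ek: "axis k 1 #. (E *v axis k 1) <= - e0" and nF0: "norm F0 <= K" and nE: "norm E <= K"
 shows "EX C si c. 0 < C & 0 < si & si <= 1 & 0 < c & (ALL F F1 G1 P Q D py v u.
 norm (F - F0) <= si --> norm (F1 - py *R E) <= si * py --> norm G1 <= K * py --> 0 < py --> py <= si -->
 norm P <= K --> norm Q <= K --> norm D <= K --> sym_mat P --> (ALL z :: complex^'n. 0 <= z #. cm P z) --> D ** Q = mat 1 -->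
 P = Q - 2 *R (P ** (F ** Q)) -->
 c * ((norm v)^2 + py * (norm u)^2) <= 4 * (norm v)^2 - cm P (v + u) #. cm (G1 + F1) (cm P (v + u))
 + cm Q (v - u) #. cm (G1 - F1) (cm Q (v - u)) + C * py * ((v + u) #. cm P (v + u) - (v - u) #. cm Q (v - (u :: complex^'n))))"
proof -
 \<comment> \<open>A common majorant of all coefficients, polynomials in \<open>K >= 1\<close> of
   degree at most 5, that occur in the two error bounds \<open>B\<close> and \<open>B2\<close>
   below.\<close>
 define M where "M = 200 * K ^ 5"
 have Kp: "1 <= K ^ i" "K ^ i <= K ^ 5" if "i <= 5" for i using K that by (simp_all add: one_le_power power_increasing)
 have M: "1 <= M" using Kp(1)[of 5] by (simp add: M_def)
 obtain C si where C: "0 < C" and si: "0 < si" "si <= 1" and sc: "ALL py N V al be. 0 < py --> py <= si --> 0 <= al --> 0 <= be --> 0 <= N --> 0 <= V --> N^2 = al^2 + be^2 -->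
 3 * V^2 + py * (e0 * N^2) <= 4 * V^2 + py * (2 * e0 * al^2 - M * (al * be + be^2 + be * N) - M * (si * N^2) - M * (V^2 + V * N)
 + C * (2 * l * be^2 - M * (si * N^2) - M * (V^2 + V * N)))"
 using lyapunov_scalar[OF e0 l M] by (elim exE conjE)
 define c where "c = min 3 (e0 / K^2)"
 have c: "0 < c" "c <= 3" "c * K^2 <= e0" using e0 K by (auto simp: c_def min_def field_simps)
 show ?thesis
 proof (rule exI[of _ C], rule exI[of _ si], rule exI[of _ c], intro conjI allI impI C si c(1))
 fix F F1 G1 P Q D :: "real^'n^'n" and py :: real and v u :: "complex^'n"
 assume hF: "norm (F - F0) <= si" and hF1: "norm (F1 - py *R E) <= si * py" and hG1: "norm G1 <= K * py" and py: "0 < py" "py <= si"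
 and nP: "norm P <= K" and nQ: "norm Q <= K" and nD: "norm D <= K" and sP: "sym_mat P" and pP: "ALL z :: complex^'n. 0 <= z #. cm P z"
 and DQ: "D ** Q = mat 1" and PQ: "P = Q - 2 *R (P ** (F ** Q))"
 define y where "y = cm Q u"
 define e where "e = (axis k 1 :: complex^'n)"
 define al where "al = norm (y $ k)"
 define y' where "y' = y - (y $ k) *s e"
 define be N V where "be = norm y'" "N = norm y" "V = norm v"
 have nn: "0 <= al" "0 <= be" "0 <= N" "0 <= V" by (simp_all add: al_def be_N_V_def)
 have y: "y = (y $ k) *s e + y'" by (simp add: y'_def)
 have ort: "((y $ k) *s e) #. y' = 0"
 unfolding inner_vec_def by (intro sum.neutral ballI) (simp add: e_def y'_def axis_def)
 have ne: "norm e = 1" by (simp add: e_def norm_axis_1)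
 have N2: "N^2 = al^2 + be^2"
 proof -
 have "N^2 = (norm ((y $ k) *s e + y'))^2" using y by (simp add: be_N_V_def)
 also have "... = (norm ((y $ k) *s e))^2 + (norm y')^2" using ort unfolding power2_norm_eq_inner by (simp add: inner_add_left inner_add_right inner_commute)
 finally show ?thesis by (simp add: al_def be_N_V_def ne)
 qed
 have ecv: "e = cv (axis k 1)" by (simp add: e_def cv_def vec_eq_iff axis_def)
 have F0e: "cm F0 ((y $ k) *s e) = 0" unfolding cm_smult ecv cm_cv ker by (simp add: cv_def vec_eq_iff)
 define R where "R = norm (cm F y)"
 have R: "R <= K * be + si * N" "0 <= R"
 proof -
 have "cm F y = cm F0 y' + cm (F - F0) y" by (subst (2) y) (simp add: cm.diff_left cm.diff_right y'_def F0e)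
 then show "R <= K * be + si * N" unfolding R_def be_N_V_def using norm_triangle_mono[OF cm_le[OF nF0] cm_le[OF hF]] by simp
 qed (simp add: R_def)
 define r1 r2 where "r1 = cm P v - 2 *R cm P (cm F y)" "r2 = cm Q v"
 define ro1 ro2 where "ro1 = norm r1" "ro2 = norm r2"
 have r1: "ro1 <= K * V + 2 * K * R" and r2: "ro2 <= K * V" and ro0: "0 <= ro1" "0 <= ro2"
 proof -
 have "norm (2 *R cm P (cm F y)) <= 2 * K * R" using cm_le[OF nP, of "cm F y"] by (simp add: R_def)
 then show "ro1 <= K * V + 2 * K * R" unfolding ro1_ro2_def r1_r2_def be_N_V_def using norm_triangle_ineq4 cm_le[OF nP, of v] by (smt (verit))
 show "ro2 <= K * V" unfolding ro1_ro2_def r1_r2_def be_N_V_def by (rule cm_le[OF nQ])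
 qed (simp_all add: ro1_ro2_def)
 \<comment> \<open>The resolvent identity shows that \<open>P u\<close> differs from
   \<open>y = Q u\<close> by a multiple of \<open>F y\<close>. As \<open>F\<close> is close to
   \<open>F0\<close>, whose kernel is the shock direction, this is controlled by \<open>be\<close>
   and a small multiple of \<open>N\<close>.\<close>
 have "cm P u = cm (Q - 2 *R (P ** (F ** Q))) u" using PQ by simp
 then have Pu: "cm P u = y - 2 *R cm P (cm F y)" by (simp add: cm.diff_left cm.scaleR_left cm_mult y_def)
 have Pa: "cm P (v + u) = y + r1" and Qb: "cm Q (v - u) = r2 - y"
 by (simp_all add: cm.add_right cm.diff_right Pu r1_r2_def y_def[symmetric] algebra_simps)
 have nF1: "norm F1 <= 2 * K * py"
 proof -
 have "norm F1 <= norm (F1 - py *R E) + norm (py *R E)" using norm_triangle_sub[of F1 "py *R E"] by linarith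
 moreover have "norm (py *R E) <= K * py" using py nE by (simp add: mult.commute mult_left_mono)
 moreover have "si * py <= K * py" using py si(2) K by (intro mult_right_mono) auto
 ultimately show ?thesis using hF1 by (simp add: mult.assoc)
 qed
 have nA: "norm (G1 + F1) <= 3 * K * py" "norm (G1 - F1) <= 3 * K * py"
 using norm_triangle_ineq[of G1 F1] norm_triangle_ineq4[of G1 F1] nF1 hG1 by (simp_all add: mult.assoc)
 have quad: "(a + r) #. cm X (a + r) <= a #. cm X a + 3 * K * py * (2 * norm a * norm r + (norm r)^2)"
 "(a + r) #. cm X (a + r) >= a #. cm X a - 3 * K * py * (2 * norm a * norm r + (norm r)^2)" if X: "norm X <= 3 * K * py" for X and a r :: "complex^'n"
 proof -
 have b: "\<bar>p #. cm X q\<bar> <= 3 * K * py * (norm p * norm q)" for p q :: "complex^'n"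
 using order_trans[OF inner_cm_bound[of p X q]] mult_right_mono[OF X, of "norm p * norm q"] by (simp add: mult.assoc)
 have "(a + r) #. cm X (a + r) = a #. cm X a + a #. cm X r + r #. cm X a + r #. cm X r"
 by (simp add: cm.add_right inner_add_left inner_add_right)
 then show "(a + r) #. cm X (a + r) <= a #. cm X a + 3 * K * py * (2 * norm a * norm r + (norm r)^2)"
 "(a + r) #. cm X (a + r) >= a #. cm X a - 3 * K * py * (2 * norm a * norm r + (norm r)^2)"
 using b[of a r] b[of r a] b[of r r] by (simp_all add: power2_eq_square algebra_simps abs_le_iff)
 qed
 have m1: "(y + r1) #. cm (G1 + F1) (y + r1) <= y #. cm (G1 + F1) y + 3 * K * py * (2 * N * ro1 + ro1^2)"
 using quad(1)[OF nA(1), of y r1] by (simp add: be_N_V_def ro1_ro2_def)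
 have m2: "(r2 - y) #. cm (G1 - F1) (r2 - y) >= y #. cm (G1 - F1) y - 3 * K * py * (2 * N * ro2 + ro2^2)"
 using quad(2)[OF nA(2), of "- y" r2] by (simp add: be_N_V_def ro1_ro2_def cm.minus_right)
 have yE: "y #. cm E y <= - e0 * al^2 + K * (2 * (al * be) + be^2)"
 proof -
 have b: "\<bar>p #. cm E q\<bar> <= K * (norm p * norm q)" for p q :: "complex^'n"
 using order_trans[OF inner_cm_bound[of p E q]] mult_right_mono[OF nE, of "norm p * norm q"] by (simp add: mult.assoc)
 have kk: "((y $ k) *s e) #. cm E ((y $ k) *s e) <= - e0 * al^2"
 unfolding cm_smult inner_smult_self unfolding ecv crd_inner al_def using mult_left_mono[OF Ek, of "(norm (y $ k))^2"] by (simp add: mult.commute)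
 have nk: "norm ((y $ k) *s e) = al" by (simp add: al_def ne)
 have "y #. cm E y = ((y $ k) *s e) #. cm E ((y $ k) *s e) + ((y $ k) *s e) #. cm E y' + y' #. cm E ((y $ k) *s e) + y' #. cm E y'"
 by (subst (1 2) y) (simp add: cm.add_right inner_add_left inner_add_right del: y'_def)
 then show ?thesis using kk b[of "(y $ k) *s e" y'] b[of y' "(y $ k) *s e"] b[of y' y'] unfolding nk be_N_V_def(1)[symmetric]
 by (simp add: power2_eq_square algebra_simps abs_le_iff)
 qed
 have yF1: "y #. cm F1 y <= py * (y #. cm E y) + py * (si * N^2)"
 proof -
 have "y #. cm F1 y = py * (y #. cm E y) + y #. cm (F1 - py *R E) y" by (simp add: cm.diff_left cm.scaleR_left inner_diff_right)
 moreover have "y #. cm (F1 - py *R E) y <= si * py * N * N"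
 using inner_cm_bound[of y "F1 - py *R E" y] mult_right_mono[OF hF1, of "N * N"] nn by (simp add: be_N_V_def mult.assoc)
 ultimately show ?thesis by (simp add: power2_eq_square mult_ac)
 qed
 \<comment> \<open>To leading order both vectors are \<open>y\<close> up to sign, so the terms with
   \<open>G1\<close> cancel and \<open>- 2 * (y #. cm F1 y)\<close> remains; with \<open>F1\<close>
   close to \<open>py *R E\<close> its component along the shock direction is
   \<open>2 * e0 * py * al^2\<close>.\<close>
 have T1: "- cm P (v + u) #. cm (G1 + F1) (cm P (v + u)) + cm Q (v - u) #. cm (G1 - F1) (cm Q (v - u)) >=
 py * (2 * e0 * al^2 - 2 * K * (2 * (al * be) + be^2) - 2 * (si * N^2) - 3 * K * (2 * N * ro1 + ro1^2 + 2 * N * ro2 + ro2^2))"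
 proof -
 have "py * (y #. cm E y) <= py * (- e0 * al^2 + K * (2 * (al * be) + be^2))" using yE py by (intro mult_left_mono) auto
 moreover have "y #. cm (G1 - F1) y - y #. cm (G1 + F1) y = - 2 * (y #. cm F1 y)" by (simp add: cm.diff_left cm.add_left inner_add_right inner_diff_right)
 ultimately show ?thesis unfolding Pa Qb using m1 m2 yF1 by (simp add: algebra_simps)
 qed
 have u: "norm u <= K * N"
 proof -
 have "u = cm D y" unfolding y_def cm_mult[symmetric] DQ by simp
 then show ?thesis using cm_le[OF nD, of y] by (simp add: be_N_V_def)
 qed
 \<comment> \<open>The derivative of the exponential weight meets the difference of the two
   inverses, which on \<open>u\<close> is \<open>- 2 * (y #. cm F y)\<close> plus a nonnegative
   square; across the shock direction \<open>F0\<close> is negative, hence the gain in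
   \<open>be\<close>.\<close>
 have T2: "(v + u) #. cm P (v + u) - (v - u) #. cm Q (v - u) >= 2 * l * be^2 - 2 * (si * N^2) - 2 * K * V^2 - 4 * K^2 * (V * N)"
 proof -
 have b: "\<bar>p #. cm X q\<bar> <= K * (norm p * norm q)" if "norm X <= K" for X and p q :: "complex^'n"
 using order_trans[OF inner_cm_bound[of p X q]] mult_right_mono[OF that, of "norm p * norm q"] by (simp add: mult.assoc)
 have "u #. cm P u - u #. cm Q u = - 2 * (cm P u #. cm F y)"
 unfolding cm_sym[OF sP] by (simp add: Pu y_def[symmetric] inner_diff_right)
 also have "... = - 2 * (y #. cm F y) + 4 * (cm F y #. cm P (cm F y))" by (simp add: Pu inner_diff_left inner_diff_right inner_commute algebra_simps)
 also have "... >= - 2 * (y #. cm F y)" using pP by simp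
 finally have 1: "- 2 * (y #. cm F y) <= u #. cm P u - u #. cm Q u" .
 have "y #. cm F y = y #. cm F0 y + y #. cm (F - F0) y" by (simp add: cm.diff_left inner_diff_right)
 moreover have "y #. cm (F - F0) y <= si * N^2"
 using inner_cm_bound[of y "F - F0" y] mult_right_mono[OF hF, of "N * N"] nn by (simp add: be_N_V_def mult.assoc power2_eq_square)
 moreover have "y #. cm F0 y <= - l * be^2" using neg[of y] by (simp add: be_N_V_def y'_def e_def)
 ultimately have 2: "2 * l * be^2 - 2 * (si * N^2) <= u #. cm P u - u #. cm Q u" using 1 by simp
 have Vu: "K * (V * norm u) <= K^2 * (V * N)"
 using mult_left_mono[OF u, of "K * V"] nn K by (simp add: power2_eq_square mult_ac)
 have "(v + u) #. cm P (v + u) - (v - u) #. cm Q (v - u) = (u #. cm P u - u #. cm Q u) + v #. cm P v - v #. cm Q v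
 + v #. cm P u + u #. cm P v + v #. cm Q u + u #. cm Q v"
 by (simp add: cm.add_right cm.diff_right inner_add_left inner_add_right inner_diff_left inner_diff_right)
 then show ?thesis
 using 2 Vu b[OF nP, of v v] b[OF nQ, of v v] b[OF nP, of v u] b[OF nP, of u v] b[OF nQ, of v u] b[OF nQ, of u v]
 unfolding be_N_V_def(3)[symmetric] by (simp add: power2_eq_square mult.commute[of "norm u" V] abs_le_iff)
 qed
 have B: "3 * K * (2 * N * ro1 + ro1^2 + 2 * N * ro2 + ro2^2) + 2 * K * (2 * (al * be) + be^2) + 2 * (si * N^2)
 <= M * (al * be + be^2 + be * N) + M * (si * N^2) + M * (V^2 + V * N)"
 proof -
 have "N * ro1 <= N * (K * V + 2 * K * (K * be + si * N))"
 proof -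
 have "2 * K * R <= 2 * K * (K * be + si * N)" using R(1) K by (intro mult_left_mono) auto
 then show ?thesis using nn r1 by (intro mult_left_mono) auto
 qed
 then have 1: "N * ro1 <= K * (V * N) + 2 * K^2 * (be * N) + 2 * K * (si * N^2)" by (simp add: power2_eq_square algebra_simps)
 have 2: "N * ro2 <= K * (V * N)" using mult_left_mono[OF r2 nn(3)] by (simp add: mult_ac)
 have 3: "ro2^2 <= K^2 * V^2" using power_mono[OF r2 ro0(2), of 2] by (simp add: power_mult_distrib)
 have sq: "(a + b)^2 <= 2 * a^2 + 2 * b^2" for a b :: real using zero_le_power2[of "a - b"] by (simp add: power2_sum power2_diff)
 have "ro1^2 <= 2 * (K * V)^2 + 2 * (2 * K * R)^2" using order_trans[OF power_mono[OF r1 ro0(1), of 2] sq] .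
 moreover have "R^2 <= 2 * (K * be)^2 + 2 * (si * N)^2" using order_trans[OF power_mono[OF R, of 2] sq] .
 moreover have "(si * N)^2 <= si * N^2"
 unfolding power_mult_distrib power2_eq_square[of si] using si by (intro mult_right_mono) (auto simp: mult_left_le)
 ultimately have "ro1^2 <= 2 * K^2 * V^2 + 8 * K^2 * (2 * K^2 * be^2 + 2 * (si * N^2))"
 using mult_left_mono[of "R^2" "2 * K^2 * be^2 + 2 * (si * N^2)" "8 * K^2"] by (simp add: power_mult_distrib)
 then have 4: "ro1^2 <= 2 * K^2 * V^2 + 16 * K^4 * be^2 + 16 * K^2 * (si * N^2)" by (simp add: algebra_simps flip: power_add)
 have "2 * N * ro1 + ro1^2 + 2 * N * ro2 + ro2^2 <= 4 * K * (V * N) + 4 * K^2 * (be * N) + (4 * K + 16 * K^2) * (si * N^2) + 3 * K^2 * V^2 + 16 * K^4 * be^2"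
 using 1 2 3 4 by (simp add: algebra_simps)
 then have "3 * K * (2 * N * ro1 + ro1^2 + 2 * N * ro2 + ro2^2) <= 3 * K * (4 * K * (V * N) + 4 * K^2 * (be * N) + (4 * K + 16 * K^2) * (si * N^2) + 3 * K^2 * V^2 + 16 * K^4 * be^2)"
 using K by (intro mult_left_mono) auto
 also have "... = 12 * K^ 2 * (V * N) + 12 * K^3 * (be * N) + (12 * K^ 2 + 48 * K^3) * (si * N^2) + 9 * K^3 * V^2 + 48 * K^5 * be^2"
 by (simp add: algebra_simps power2_eq_square power3_eq_cube numeral_eq_Suc)
 finally have 5: "3 * K * (2 * N * ro1 + ro1^2 + 2 * N * ro2 + ro2^2) <= 12 * K^ 2 * (V * N) + 12 * K^3 * (be * N) + (12 * K^ 2 + 48 * K^3) * (si * N^2) + 9 * K^3 * V^2 + 48 * K^5 * be^2" .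
 have kp: "1 <= K^5" "K <= K^5" "K^ 2 <= K^5" "K^3 <= K^5" using Kp(2)[of 0] Kp(2)[of 1] Kp(2)[of 2] Kp(2)[of 3] by simp_all
 have x: "0 <= V * N" "0 <= be * N" "0 <= si * N^2" "0 <= V^2" "0 <= be^2" "0 <= al * be" using nn si by auto
 have "12 * K^ 2 * (V * N) <= M * (V * N)" "12 * K^3 * (be * N) <= M * (be * N)" "(12 * K^ 2 + 48 * K^3 + 2) * (si * N^2) <= M * (si * N^2)"
 "9 * K^3 * V^2 <= M * V^2" "(48 * K^5 + 2 * K) * be^2 <= M * be^2" "4 * K * (al * be) <= M * (al * be)"
 unfolding M_def using kp by (intro mult_right_mono x; linarith)+
 then show ?thesis using 5 by (simp add: algebra_simps)
 qed
 have B2: "2 * (si * N^2) + 2 * K * V^2 + 4 * K^2 * (V * N) <= M * (si * N^2) + M * (V^2 + V * N)"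
 proof -
 have kp: "1 <= K^5" "K <= K^5" "K^ 2 <= K^5" using Kp(2)[of 0] Kp(2)[of 1] Kp(2)[of 2] by simp_all
 have x: "0 <= V * N" "0 <= si * N^2" "0 <= V^2" using nn si by auto
 have "2 * (si * N^2) <= M * (si * N^2)" "2 * K * V^2 <= M * V^2" "4 * K^2 * (V * N) <= M * (V * N)"
 unfolding M_def using kp by (intro mult_right_mono x; linarith)+
 then show ?thesis by (simp add: algebra_simps)
 qed
 have "3 * V^2 + py * (e0 * N^2) <= 4 * V^2 + py * (2 * e0 * al^2 - M * (al * be + be^2 + be * N) - M * (si * N^2) - M * (V^2 + V * N)
 + C * (2 * l * be^2 - M * (si * N^2) - M * (V^2 + V * N)))" using sc py nn N2 by blast
 also have "... <= 4 * V^2 + (py * (2 * e0 * al^2 - 2 * K * (2 * (al * be) + be^2) - 2 * (si * N^2) - 3 * K * (2 * N * ro1 + ro1^2 + 2 * N * ro2 + ro2^2))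
 + C * py * (2 * l * be^2 - 2 * (si * N^2) - 2 * K * V^2 - 4 * K^2 * (V * N)))"
 proof -
 have "py * (2 * e0 * al^2 - (M * (al * be + be^2 + be * N) + M * (si * N^2) + M * (V^2 + V * N)))
 <= py * (2 * e0 * al^2 - (3 * K * (2 * N * ro1 + ro1^2 + 2 * N * ro2 + ro2^2) + 2 * K * (2 * (al * be) + be^2) + 2 * (si * N^2)))"
 using B py by (intro mult_left_mono diff_left_mono) auto
 moreover have "(C * py) * (2 * l * be^2 - (M * (si * N^2) + M * (V^2 + V * N))) <= (C * py) * (2 * l * be^2 - (2 * (si * N^2) + 2 * K * V^2 + 4 * K^2 * (V * N)))"
 using B2 py C by (intro mult_left_mono diff_left_mono) auto
 ultimately show ?thesis by (simp add: algebra_simps)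
 qed
 also have "... <= 4 * V^2 + ((- cm P (v + u) #. cm (G1 + F1) (cm P (v + u)) + cm Q (v - u) #. cm (G1 - F1) (cm Q (v - u)))
 + C * py * ((v + u) #. cm P (v + u) - (v - u) #. cm Q (v - u)))"
 using T1 T2 C py by (intro add_mono mult_left_mono) auto
 finally have fin: "3 * V^2 + py * (e0 * N^2) <= 4 * V^2 + ((- cm P (v + u) #. cm (G1 + F1) (cm P (v + u)) + cm Q (v - u) #. cm (G1 - F1) (cm Q (v - u)))
 + C * py * ((v + u) #. cm P (v + u) - (v - u) #. cm Q (v - u)))" .
 have "c * (norm u)^2 <= c * (K^2 * N^2)"
 using power_mono[OF u, of 2] c(1) by (intro mult_left_mono) (auto simp: power_mult_distrib)
 also have "... <= e0 * N^2" using mult_right_mono[OF c(3), of "N^2"] by (simp add: mult.assoc)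
 finally have "py * (c * (norm u)^2) <= py * (e0 * N^2)" using py by (intro mult_left_mono) auto
 moreover have "c * V^2 <= 3 * V^2" using c(2) by (intro mult_right_mono) auto
 ultimately show "c * ((norm v)^2 + py * (norm u)^2) <= 4 * (norm v)^2 - cm P (v + u) #. cm (G1 + F1) (cm P (v + u))
 + cm Q (v - u) #. cm (G1 - F1) (cm Q (v - u)) + C * py * ((v + u) #. cm P (v + u) - (v - u) #. cm Q (v - u))"
 using fin unfolding be_N_V_def(3)[symmetric] by (simp add: algebra_simps)
 qed
qed

text \<open>The inequality is pointwise in the space variable and uniform over all coefficients near
  the base state, so its constants can be fixed before any shock is chosen.\<close>

definition goodman :: "real => real => real => real => real^'n::finite^'n => real^'n^'n => bool" where
 "goodman K C si c F0 E \<longleftrightarrow> (ALL F F1 G1 P Q D py v u.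
 norm (F - F0) <= si --> norm (F1 - py *R E) <= si * py --> norm G1 <= K * py --> 0 < py --> py <= si -->
 norm P <= K --> norm Q <= K --> norm D <= K --> sym_mat P --> (ALL z :: complex^'n. 0 <= z #. cm P z) --> D ** Q = mat 1 -->
 P = Q - 2 *R (P ** (F ** Q)) -->
 c * ((norm v)^2 + py * (norm u)^2) <= 4 * (norm v)^2 - cm P (v + u) #. cm (G1 + F1) (cm P (v + u))
 + cm Q (v - u) #. cm (G1 - F1) (cm Q (v - u)) + C * py * ((v + u) #. cm P (v + u) - (v - u) #. cm Q (v - (u :: complex^'n))))"

lemmas goodman_exists = lyapunov_constants[folded goodman_def]

section \<open>Stability for coefficient curves on the whole line\<close>

definition end_data :: "real^'n::finite^'n => real^'n^'n => real^'n^'n => ('n => real^'n) => ('n => real) => ('n => real) => bool" where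
 "end_data F G W r f g \<longleftrightarrow> sym_mat F & sym_mat G & (ALL i j. r i #. (W *v r j) = (if i = j then 1 else 0)) &
 (ALL j. F *v r j = f j *R (W *v r j)) & (ALL j. G *v r j = g j *R (W *v r j)) & (ALL j. \<bar>f j\<bar> < g j)"

lemma end_data_spectrum:
 assumes "end_data F G W r f g" "f k < 0" "0 < om" "P ** (G + F) = mat 1" "Q ** (G - F) = mat 1"
 shows "end_spectrum F G W (om *R P) (om *R Q) r f g k om"
proof -
 have "(om *R M) *v (N *v x) = om *R x" if "M ** N = mat 1" for M N :: "real^'a^'a" and x
 proof -
 have e: "(om *R M) *v y = om *R (M *v y)" for y by (simp add: matrix_vector_mult_def vec_eq_iff sum_distrib_left mult.assoc)
 show ?thesis unfolding e unfolding matrix_vector_mul_assoc that by simp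
 qed
 then show ?thesis using assms unfolding end_data_def end_spectrum_def by blast
qed

lemma end_data_minus:
 assumes "end_data F G W r f g"
 shows "end_data (- F) G W r (%j. - f j) g"
proof -
 have m: "(- M) *v x = - (M *v x)" for M :: "real^'a^'a" and x by (simp add: matrix_vector_mult_def vec_eq_iff sum_negf)
 have t: "transpose (- F) = - transpose F" by (simp add: transpose_def vec_eq_iff)
 show ?thesis using assms unfolding end_data_def sym_mat_def m t by simp
qed

text \<open>The right end is fast and the left end, after reflection, is slow with distinguished
  index k. \<open>py\<close> is both the derivative of the weight exponent \<open>h\<close> and the
  factor in front of the dissipation of \<open>dif\<close>. The pair \<open>(v0, u0)\<close> solves
  the system at \<open>ka = 0\<close> and decays at the left; it becomes the basis element of the
  slow graph whose \<open>mid\<close> does not vanish.\<close>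

theorem line_stable:
 fixes F G F1 G1 :: "real => real^'n::finite^'n"
 assumes gm: "goodman K C si c F0 E" and K: "1 <= K" and C: "0 < C" and c: "0 < c"
 and dF: "!!t. (F hvd F1 t) (at t)" and dG: "!!t. (G hvd G1 t) (at t)"
 and sym: "!!t. sym_mat (G t + F t)" "!!t. sym_mat (G t - F t)"
 and c0: "0 < c0" "(real CARD('n))^2 / c0 <= K"
 and pA: "!!t x. c0 * (norm x)^2 <= x #. ((G t + F t) *v x)" and pD: "!!t x. c0 * (norm x)^2 <= x #. ((G t - F t) *v x)"
 and nA: "!!t. norm (G t + F t) <= K" and nD: "!!t. norm (G t - F t) <= K"
 and hF: "!!t. norm (F t - F0) <= si" and hF1: "!!t. norm (F1 t - py t *R E) <= si * py t" and hG1: "!!t. norm (G1 t) <= K * py t"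
 and py: "!!t. 0 < py t" "!!t. py t <= si" "continuous_on UNIV py"
 and dh: "!!t. (h has_real_derivative py t) (at t)" and hb: "!!t. \<bar>h t\<bar> <= 1"
 and hlim: "(h ---> hp) at_top" "(h ---> hm) at_bot"
 and K1: "0 <= K1" and tq: "0 < tq"
 and cp: "!!t. 0 <= t ==> norm (F t - Fp) <= K1 * exp (- tq * t)" "!!t. 0 <= t ==> norm (G t - Gp) <= K1 * exp (- tq * t)"
 and cmi: "!!t. 0 <= t ==> norm (F (- t) - Fm) <= K1 * exp (- tq * t)" "!!t. 0 <= t ==> norm (G (- t) - Gm) <= K1 * exp (- tq * t)"
 and pp: "!!x. c0 * (norm x)^2 <= x #. ((Gp + Fp) *v x)" "!!x. c0 * (norm x)^2 <= x #. ((Gp - Fp) *v x)"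
 and pm: "!!x. c0 * (norm x)^2 <= x #. ((Gm + Fm) *v x)" "!!x. c0 * (norm x)^2 <= x #. ((Gm - Fm) *v x)"
 and sp: "sym_mat (Gp + Fp)" "sym_mat (Gp - Fp)" "sym_mat (Gm + Fm)" "sym_mat (Gm - Fm)"
 and ep: "end_data Fp Gp Wp rp fp gp" "!!j. fp j < 0"
 and em: "end_data Fm Gm Wm rm fm gm" "0 < fm k" "!!j. j ~= k ==> fm j < 0"
 and v0: "!!t. (v0 hvd F t *v v0 t) (at t)" "!!t. (u0 hvd G t *v v0 t) (at t)" "v0 0 ~= 0"
 "!!t. 0 <= t ==> norm (v0 (- t)) <= Cv * exp (- tq * t)" "!!t. 0 <= t ==> norm (u0 (- t)) <= Cv * exp (- tq * t)"
 shows "stable_pair (ev_minus F G) (ev_plus F G)"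
proof -
 have invex: "EX P. P ** A = mat 1 & A ** P = mat 1 & sym_mat P & norm P <= K"
 if "!!x. c0 * (norm x)^2 <= x #. (A *v x)" "sym_mat A" for A :: "real^'n^'n"
 using positive_inverse[OF c0(1) that] c0(2) by (meson order_trans)
 obtain P0 where P0: "!!t. P0 t ** (G t + F t) = mat 1" "!!t. (G t + F t) ** P0 t = mat 1" "!!t. sym_mat (P0 t)" "!!t. norm (P0 t) <= K"
 using invex[OF pA sym(1)] by metis
 obtain Q0 where Q0: "!!t. Q0 t ** (G t - F t) = mat 1" "!!t. (G t - F t) ** Q0 t = mat 1" "!!t. sym_mat (Q0 t)" "!!t. norm (Q0 t) <= K"
 using invex[OF pD sym(2)] by metis
 obtain Pp Qp Pm Qm where ip: "Pp ** (Gp + Fp) = mat 1" "(Gp + Fp) ** Pp = mat 1" "Qp ** (Gp - Fp) = mat 1" "(Gp - Fp) ** Qp = mat 1"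
 and im: "Pm ** (Gm + Fm) = mat 1" "(Gm + Fm) ** Pm = mat 1" "Qm ** (Gm - Fm) = mat 1" "(Gm - Fm) ** Qm = mat 1"
 using invex[OF pp(1) sp(1)] invex[OF pp(2) sp(2)] invex[OF pm(1) sp(3)] invex[OF pm(2) sp(4)] by metis
 \<comment> \<open>The weight: its logarithmic derivative \<open>C * py t\<close> contributes the
   term with \<open>C\<close> in \<open>goodman\<close>, and since \<open>h\<close> is bounded it
   changes all constants only by factors \<open>exp C\<close> and \<open>exp (- C)\<close>.\<close>
 define om where "om t = exp (C * h t)" for t
 define P Q where "P t = om t *R P0 t" "Q t = om t *R Q0 t" for t
 define P' Q' where "P' t = om t *R ((C * py t) *R P0 t - P0 t ** (G1 t + F1 t) ** P0 t)"
 "Q' t = om t *R ((C * py t) *R Q0 t - Q0 t ** (G1 t - F1 t) ** Q0 t)" for t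
 have om: "exp (- C) <= om t" "om t <= exp C" "0 < om t" for t
 proof -
 have "C * \<bar>h t\<bar> <= C * 1" using hb C by (intro mult_left_mono) auto
 then have "\<bar>C * h t\<bar> <= C" using C by (simp add: abs_mult)
 then show "exp (- C) <= om t" "om t <= exp C" "0 < om t" by (simp_all add: om_def abs_le_iff)
 qed
 have dA: "((%t. G t + F t) hvd G1 t + F1 t) (at t)" "((%t. G t - F t) hvd G1 t - F1 t) (at t)" for t
 by (intro has_vector_derivative_add has_vector_derivative_diff dF dG)+
 have dom: "(om has_real_derivative om t * (C * py t)) (at t)" for t
 unfolding om_def by (auto intro!: derivative_eq_intros dh)
 have dP: "(P hvd P' t) (at t)" for t
 unfolding P_Q_def P'_Q'_def
 using has_vector_derivative_scaleR[OF dom[of t] inverse_derivative[OF dA(1)[of t] P0(1,2,4)]]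
 by (simp add: algebra_simps)
 have dQ: "(Q hvd Q' t) (at t)" for t
 unfolding P_Q_def P'_Q'_def
 using has_vector_derivative_scaleR[OF dom[of t] inverse_derivative[OF dA(2)[of t] Q0(1,2,4)]]
 by (simp add: algebra_simps)
 have pinv: "c0 / K^2 * (norm a)^2 <= a #. cm R a"
 if A: "!!x. c0 * (norm x)^2 <= x #. (A *v x)" "norm A <= K" "A ** R = mat 1" for A R :: "real^'n^'n" and a
 proof -
 have a: "a = cm A (cm R a)" by (simp add: cm_mult[symmetric] A(3))
 have "norm a <= K * norm (cm R a)" using cm_le[OF A(2), of "cm R a"] by (simp add: a[symmetric])
 then have "(norm a)^2 <= K^2 * (norm (cm R a))^2" using power_mono[of "norm a" _ 2] by (simp add: power_mult_distrib[symmetric])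
 then have "c0 / K^2 * (norm a)^2 <= c0 / K^2 * (K^2 * (norm (cm R a))^2)" using c0(1) by (intro mult_left_mono) auto
 also have "... = c0 * (norm (cm R a))^2" using K by simp
 also have "... <= cm R a #. cm A (cm R a)" by (rule cm_pos[OF A(1)])
 finally show ?thesis by (simp add: a[symmetric] inner_commute)
 qed
 define cc where "cc = min (exp (- C) * c) (exp (- C) * (c0 / K^2))"
 have cc: "0 < cc" "cc <= exp (- C) * c" "cc <= exp (- C) * (c0 / K^2)" using c c0(1) K by (auto simp: cc_def)
 define K0 where "K0 = exp C * K"
 have K0: "0 < K0" "K <= K0" using K C by (auto simp: K0_def mult_le_cancel_right1)
 have pos: "cc * (norm a)^2 <= a #. cm (P t) a" "cc * (norm a)^2 <= a #. cm (Q t) a" for t a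
 proof -
 have *: "cc * (norm a)^2 <= a #. cm (om t *R R) a" if "c0 / K^2 * (norm a)^2 <= a #. cm R a" for R
 proof -
 have "cc * (norm a)^2 <= exp (- C) * (c0 / K^2) * (norm a)^2" using cc(3) by (intro mult_right_mono) auto
 also have "... = exp (- C) * (c0 / K^2 * (norm a)^2)" by simp
 also have "... <= om t * (a #. cm R a)" using that om[of t] c0(1) by (intro mult_mono) auto
 finally show ?thesis by (simp add: cm.scaleR_left)
 qed
 show "cc * (norm a)^2 <= a #. cm (P t) a" unfolding P_Q_def by (rule *[OF pinv[OF pA nA P0(2)]])
 show "cc * (norm a)^2 <= a #. cm (Q t) a" unfolding P_Q_def by (rule *[OF pinv[OF pD nD Q0(2)]])
 qed
 \<comment> \<open>The resolvent identity for the inverses of \<open>G + F\<close> and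
   \<open>G - F\<close>, which differ by \<open>2 F\<close>.\<close>
 have PQ: "P0 t = Q0 t - 2 *R (P0 t ** (F t ** Q0 t))" for t
 proof -
 have "P0 t ** ((G t - F t) - (G t + F t)) ** Q0 t = P0 t - Q0 t"
 proof -
 have e: "P0 t ** (X - Y) ** Q0 t = P0 t ** (X ** Q0 t) - P0 t ** Y ** Q0 t" for X Y by (simp only: mm.diff_left mm.diff_right matrix_mul_assoc)
 show ?thesis unfolding e P0 Q0 by simp
 qed
 moreover have "(G t - F t) - (G t + F t) = - (2 *R F t)" by (simp add: scaleR_2)
 ultimately have "P0 t - Q0 t = - (2 *R (P0 t ** (F t ** Q0 t)))" by (simp add: mm.minus_left mm.minus_right mm.scaleR_left mm.scaleR_right matrix_mul_assoc)
 then show ?thesis by (simp add: algebra_simps)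
 qed
 have diss: "cc * ((norm (mid x))^2 + py t * (norm (dif x))^2) <=
 fst x #. cm (P' t) (fst x) - snd x #. cm (Q' t) (snd x)
 + 2 * (cm (G t + F t) (mid x) #. cm (P t) (fst x)) + 2 * (cm (G t - F t) (mid x) #. cm (Q t) (snd x))" for t x
 proof -
 define v u where "v = mid x" "u = dif x"
 have x: "fst x = v + u" "snd x = v - u" unfolding v_u_def by (rule fst_mid_dif snd_mid_dif)+
 have z: "ALL z :: complex^'n. 0 <= z #. cm (P0 t) z"
 proof
 fix z :: "complex^'n"
 have "0 <= c0 / K^2 * (norm z)^2" using c0(1) by simp
 also have "... <= z #. cm (P0 t) z" by (rule pinv[OF pA nA P0(2)])
 finally show "0 <= z #. cm (P0 t) z" .
 qed
 define I where "I = 4 * (norm v)^2 - cm (P0 t) (v + u) #. cm (G1 t + F1 t) (cm (P0 t) (v + u))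
 + cm (Q0 t) (v - u) #. cm (G1 t - F1 t) (cm (Q0 t) (v - u)) + C * py t * ((v + u) #. cm (P0 t) (v + u) - (v - u) #. cm (Q0 t) (v - u))"
 have I: "c * ((norm v)^2 + py t * (norm u)^2) <= I"
 unfolding I_def using gm[unfolded goodman_def, THEN spec, THEN spec, THEN spec, THEN spec, THEN spec, THEN spec, THEN spec, THEN spec, THEN spec,
 THEN mp, THEN mp, THEN mp, THEN mp, THEN mp, THEN mp, THEN mp, THEN mp, THEN mp, THEN mp, THEN mp, THEN mp,
 OF hF hF1 hG1 py(1,2) P0(4) Q0(4) nD P0(3) z Q0(2) PQ] .
 have q: "a #. cm (R ** X ** R) a = cm R a #. cm X (cm R a)" if "sym_mat R" for R X :: "real^'n^'n" and a
 by (simp add: cm_mult matrix_mul_assoc[symmetric] cm_sym[OF that])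
 have w: "cm X w #. cm R a = w #. a" if "sym_mat X" "X ** R = mat 1" for X R :: "real^'n^'n" and w a
 by (simp add: cm_sym[OF that(1)] cm_mult[symmetric] that(2))
 have "om t * I = fst x #. cm (P' t) (fst x) - snd x #. cm (Q' t) (snd x)
 + 2 * (cm (G t + F t) (mid x) #. cm (P t) (fst x)) + 2 * (cm (G t - F t) (mid x) #. cm (Q t) (snd x))"
 unfolding P_Q_def cm.scaleR_left inner_scaleR_right w[OF sym(1) P0(2)] w[OF sym(2) Q0(2)]
 unfolding I_def P'_Q'_def cm.scaleR_left inner_scaleR_right cm.diff_left inner_diff_right q[OF P0(3)] q[OF Q0(3)] v_u_def(1)[symmetric] x
 by (simp add: power2_norm_eq_inner inner_add_right inner_diff_right inner_commute algebra_simps)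
 moreover have "cc * ((norm v)^2 + py t * (norm u)^2) <= om t * I"
 proof -
 have nn: "0 <= (norm v)^2 + py t * (norm u)^2" using py(1)[of t] by simp
 have "cc * ((norm v)^2 + py t * (norm u)^2) <= exp (- C) * c * ((norm v)^2 + py t * (norm u)^2)" using cc(2) nn by (rule mult_right_mono)
 also have "... <= om t * I" unfolding mult.assoc using I om[of t] nn c by (intro mult_mono) auto
 finally show ?thesis .
 qed
 ultimately show ?thesis unfolding v_u_def by simp
 qed
 have cont: "continuous_on UNIV (%t. G t + F t)" "continuous_on UNIV (%t. G t - F t)"
 by (intro continuous_at_imp_continuous_on ballI has_vector_derivative_continuous[OF dA(1)] has_vector_derivative_continuous[OF dA(2)])+
 have nP: "norm (P t) <= K0" "norm (Q t) <= K0" for t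
 unfolding P_Q_def K0_def using om[of t] P0(4)[of t] Q0(4)[of t] K by (auto intro!: mult_mono)
 have sPQ: "sym_mat (P t)" "sym_mat (Q t)" for t
 using P0(3)[of t] Q0(3)[of t] unfolding P_Q_def sym_mat_def by (simp_all add: transpose_scalar)
 have plus: "relaxation (%t. G t + F t) (%t. G t - F t) P Q P' Q' py cc K0"
 by (rule relaxation.intro)
 (use cont nA nD K0 nP sPQ dP dQ pos diss py(1) cc(1) order_trans continuous_on_subset[OF py(3)] in \<open>blast+\<close>)
 \<comment> \<open>Reversing the line exchanges the two components, hence \<open>P\<close> with
   \<open>Q\<close> and \<open>G + F\<close> with \<open>G - F\<close>; the derivative matrices
   change sign and the dissipation inequality is the old one with swapped entries.\<close>
 have minus: "relaxation (%t. G (- t) - F (- t)) (%t. G (- t) + F (- t)) (%t. Q (- t)) (%t. P (- t)) (%t. - Q' (- t)) (%t. - P' (- t)) (%t. py (- t)) cc K0"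
 proof (rule relaxation.intro)
 have neg: "continuous_on S (uminus :: real => real)" for S by (intro continuous_intros)
 show "continuous_on UNIV (%t. G (- t) - F (- t))" "continuous_on UNIV (%t. G (- t) + F (- t))" "continuous_on {0..} (%t. py (- t))"
 using continuous_on_compose2[OF cont(2) neg] continuous_on_compose2[OF cont(1) neg] continuous_on_compose2[OF py(3) neg] by simp_all
 show "((%t. Q (- t)) hvd - Q' (- t)) (at t)" "((%t. P (- t)) hvd - P' (- t)) (at t)" for t
 by (intro has_vector_derivative_reflect dP dQ)+
 show "cc * ((norm (mid x))^2 + py (- t) * (norm (dif x))^2) <= fst x #. cm (- Q' (- t)) (fst x) - snd x #. cm (- P' (- t)) (snd x)
 + 2 * (cm (G (- t) - F (- t)) (mid x) #. cm (Q (- t)) (fst x)) + 2 * (cm (G (- t) + F (- t)) (mid x) #. cm (P (- t)) (snd x))" for t x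
 proof -
 have m: "mid (snd x, fst x) = mid x" "norm (dif (snd x, fst x)) = norm (dif x)"
 by (simp_all add: mid_def dif_def add.commute norm_minus_commute)
 show ?thesis using diss[of "(snd x, fst x)" "- t"] unfolding m fst_conv snd_conv by (simp add: cm.minus_left)
 qed
 qed (use nA nD K0 nP sPQ pos py(1) cc(1) order_trans in \<open>blast+\<close>)
 have e0: "((%t. K1 * exp (- tq * t)) ---> 0) at_top"
 proof -
 have "((%t. exp (- tq * t)) ---> 0) at_top" using tq by (intro filterlim_compose[OF exp_at_bot]) real_asymp
 then show ?thesis using tendsto_mult_right_zero by blast
 qed
 have tl: "(X ---> X0) at_top" if "!!t. 0 <= t ==> norm (X t - X0) <= K1 * exp (- tq * t)" for X :: "real => real^'n^'n" and X0
 by (rule LIM_zero_cancel, rule Lim_null_comparison[OF _ e0]) (rule eventually_mono[OF eventually_ge_at_top[of 0]], rule that)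
 have two: "norm (a + b - (a' + b')) <= 2 * K1 * exp (- tq * t)" "norm (a - b - (a' - b')) <= 2 * K1 * exp (- tq * t)"
 if "norm (a - a') <= K1 * exp (- tq * t)" "norm (b - b') <= K1 * exp (- tq * t)" for a b a' b' :: "real^'n^'n" and t
 using that norm_triangle_ineq[of "a - a'" "b - b'"] norm_triangle_ineq4[of "a - a'" "b - b'"] by (simp_all add: algebra_simps)
 have omp: "(om ---> exp (C * hp)) at_top" "((%t. om (- t)) ---> exp (C * hm)) at_top"
 unfolding om_def using hlim(1) filterlim_compose[OF hlim(2) filterlim_uminus_at_bot_at_top] by (intro tendsto_intros; simp)+
 have limp: "(P ---> exp (C * hp) *R Pp) at_top" "(Q ---> exp (C * hp) *R Qp) at_top"
 unfolding P_Q_def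
 by (intro tendsto_scaleR omp inverse_tendsto[OF tendsto_add[OF tl[OF cp(2)] tl[OF cp(1)]] P0(1) ip(2) P0(4)]
 inverse_tendsto[OF tendsto_diff[OF tl[OF cp(2)] tl[OF cp(1)]] Q0(1) ip(4) Q0(4)]; assumption)+
 have limm: "((%t. P (- t)) ---> exp (C * hm) *R Pm) at_top" "((%t. Q (- t)) ---> exp (C * hm) *R Qm) at_top"
 unfolding P_Q_def
 by (intro tendsto_scaleR omp inverse_tendsto[OF tendsto_add[OF tl[OF cmi(2)] tl[OF cmi(1)]] P0(1) im(2) P0(4)]
 inverse_tendsto[OF tendsto_diff[OF tl[OF cmi(2)] tl[OF cmi(1)]] Q0(1) im(4) Q0(4)]; assumption)+
 have "end_spectrum Fp Gp Wp (exp (C * hp) *R Pp) (exp (C * hp) *R Qp) rp fp gp k (exp (C * hp))"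
 by (rule end_data_spectrum[OF ep(1) ep(2) _ ip(1) ip(3)]) simp
 note fe = relaxation.fast_end[OF plus this ep(2) tq _ two(1)[OF cp(2) cp(1)] two(2)[OF cp(2) cp(1)] limp]
 obtain R1 where R1: "ALL i j. (%ka. R1 ka $ i $ j) analytic_on Hplus" "ALL ka:Hplus - {0}. relaxation.is_graph (%t. G t + F t) (%t. G t - F t) ka (R1 ka)"
 "ALL b. relaxation.graph_form P Q (R1 0) b <= 0 & (relaxation.graph_form P Q (R1 0) b = 0 --> b = 0)" "ALL b. mid (R1 0 *v b, b) = 0 --> b = 0"
 by atomize_elim (rule fe, use K1 in auto)
 have im': "Qm ** (Gm + - Fm) = mat 1" "Pm ** (Gm - - Fm) = mat 1" using im by simp_all
 have es: "end_spectrum (- Fm) Gm Wm (exp (C * hm) *R Qm) (exp (C * hm) *R Pm) rm (%j. - fm j) gm k (exp (C * hm))"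
 by (rule end_data_spectrum[OF end_data_minus[OF em(1)] _ _ im']) (use em(2) in simp_all)
 have cA: "norm (G (- t) - F (- t) - (Gm + - Fm)) <= 2 * K1 * exp (- tq * t)" "norm (G (- t) + F (- t) - (Gm - - Fm)) <= 2 * K1 * exp (- tq * t)" if "0 <= t" for t
 using two[OF cmi(2)[OF that] cmi(1)[OF that]] by simp_all
 note se = relaxation.slow_end[OF minus es _ tq _ cA limm(2,1)]
 obtain R2 where R2: "ALL i j. (%ka. R2 ka $ i $ j) analytic_on Hplus" "ALL ka:Hplus - {0}. relaxation.is_graph (%t. G (- t) - F (- t)) (%t. G (- t) + F (- t)) ka (R2 ka)"
 "ALL b. relaxation.graph_form (%t. Q (- t)) (%t. P (- t)) (R2 0) b <= 0 & (relaxation.graph_form (%t. Q (- t)) (%t. P (- t)) (R2 0) b = 0 --> b = 0)"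
 "ALL u. bil (cv (rm k)) u = 0 --> u = R2 0 *v (- u)"
 and R2s: "ALL xq C. (ALL t. (xq hvd relaxation.B (%t. G (- t) - F (- t)) (%t. G (- t) + F (- t)) 0 t (xq t)) (at t)) -->
 (ALL t>=0. norm (xq t) <= C * exp (- tq * t)) --> fst (xq 0) = R2 0 *v snd (xq 0)"
 by atomize_elim (rule se, use K1 em(3) in auto)
 have blc: "bounded_linear (cv :: real^'n => complex^'n)"
 unfolding linear_conv_bounded_linear[symmetric] by (rule linearI) (simp_all add: cv_def vec_eq_iff scaleR_conv_of_real[where 'a = complex])
 have ncv: "norm (cv x) = norm x" for x :: "real^'n" by (simp add: cv_def norm_vec_def)
 \<comment> \<open>The reflected solution at \<open>ka = 0\<close> in relaxation variables.
   Reflection changes the sign of the component u.\<close>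
 define xq where "xq t = pr (cv (v0 (- t))) (- cv (u0 (- t)))" for t
 have dxq: "(xq hvd relaxation.B (%t. G (- t) - F (- t)) (%t. G (- t) + F (- t)) 0 t (xq t)) (at t)" for t
 proof -
 have dv: "((%t. cv (v0 (- t))) hvd cv (- (F (- t) *v v0 (- t)))) (at t)"
 by (rule bounded_linear.has_vector_derivative[OF blc has_vector_derivative_reflect[OF v0(1)]])
 have du: "((%t. - cv (u0 (- t))) hvd - cv (- (G (- t) *v v0 (- t)))) (at t)"
 by (rule has_vector_derivative_minus[OF bounded_linear.has_vector_derivative[OF blc has_vector_derivative_reflect[OF v0(2)]]])
 have e: "relaxation.B (%t. G (- t) - F (- t)) (%t. G (- t) + F (- t)) 0 t (xq t) = pr (cv (- (F (- t) *v v0 (- t)))) (- cv (- (G (- t) *v v0 (- t))))"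
 proof (rule pair_eqI)
 have b: "relaxation.B (%t. G (- t) - F (- t)) (%t. G (- t) + F (- t)) 0 t (xq t) = bop (G (- t) + (- F (- t))) (G (- t) - (- F (- t))) 0 (xq t)"
 unfolding relaxation.B_def[OF minus] bop_def by simp
 have n: "cv (- x) = - cv x" for x :: "real^'n" by (simp add: cv_def vec_eq_iff)
 show "mid (relaxation.B (%t. G (- t) - F (- t)) (%t. G (- t) + F (- t)) 0 t (xq t)) = mid (pr (cv (- (F (- t) *v v0 (- t)))) (- cv (- (G (- t) *v v0 (- t)))))"
 "dif (relaxation.B (%t. G (- t) - F (- t)) (%t. G (- t) + F (- t)) 0 t (xq t)) = dif (pr (cv (- (F (- t) *v v0 (- t)))) (- cv (- (G (- t) *v v0 (- t)))))"
 unfolding b mid_bop dif_bop cm.minus_left unfolding xq_def mid_pr dif_pr n cm_cv by simp_all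
 qed
 show ?thesis unfolding e unfolding xq_def pr_def
 by (intro has_vector_derivative_Pair has_vector_derivative_add has_vector_derivative_diff dv du)
 qed
 have "norm (xq t) <= (4 * Cv) * exp (- tq * t)" if "0 <= t" for t
 proof -
 have "norm (xq t) <= norm (cv (v0 (- t)) + - cv (u0 (- t))) + norm (cv (v0 (- t)) - - cv (u0 (- t)))" unfolding xq_def pr_def by (rule norm_Pair_le)
 also have "... <= 2 * (norm (v0 (- t)) + norm (u0 (- t)))"
 using norm_triangle_ineq[of "cv (v0 (- t))" "- cv (u0 (- t))"] norm_triangle_ineq[of "cv (v0 (- t))" "cv (u0 (- t))"] by (simp add: ncv)
 finally show ?thesis using v0(4,5)[OF that] by simp
 qed
 then have x0: "fst (xq 0) = R2 0 *v snd (xq 0)" using R2s[THEN spec, of xq, THEN spec, of "4 * Cv", THEN mp, THEN mp] dxq by blast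
 have orth: "rm i #. (Wm *v rm j) = (if i = j then 1 else 0)" for i j using em(1) unfolding end_data_def by blast
 show ?thesis
 proof (rule stable_pair_graphs[OF plus minus, where ?R1.0 = R1 and ?R2.0 = R2 and wv = "%j. cv (Wm *v rm j)" and k = k and ?a0.0 = "fst (xq 0)" and ?b0.0 = "snd (xq 0)"])
 show "cindep (%j. cv (Wm *v rm j))"
 unfolding cindep_def
 proof (intro allI impI)
 fix c i assume "(SUM j:UNIV. c j *s cv (Wm *v rm j)) = 0"
 then have "bil (cv (rm i)) (SUM j:UNIV. c j *s cv (Wm *v rm j)) = 0" by (simp add: bil_def)
 then show "c i = 0" by (simp add: bil_sum bil_smult bil_cv orth if_distrib[of complex_of_real] if_distrib[of "%z. _ * z"] sum.delta cong: if_cong)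
 qed
 show "cv (Wm *v rm j) = R2 0 *v (- cv (Wm *v rm j))" if "j ~= k" for j using R2(4) that by (simp add: bil_cv orth)
 show "R2 0 *v snd (xq 0) = fst (xq 0)" using x0 by simp
 have "mid (fst (xq 0), snd (xq 0)) = cv (v0 0)" by (simp add: xq_def)
 moreover have "cv (v0 0) ~= 0" using v0(3) ncv[of "v0 0"] by (metis norm_eq_zero)
 ultimately show "mid (fst (xq 0), snd (xq 0)) ~= 0" by simp
 show "Q (- 0) = Q 0" "P (- 0) = P 0" by simp_all
 show "(%ka. R1 ka $ i $ j) analytic_on Hplus" "(%ka. R2 ka $ i $ j) analytic_on Hplus" for i j
 by (rule R1(1)[THEN spec, THEN spec] R2(1)[THEN spec, THEN spec])+
 show "b = 0" if "mid (R1 0 *v b, b) = 0" for b by (rule R1(4)[THEN spec, THEN mp, OF that])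
 qed (rule R1(2)[THEN bspec] R1(3) R2(2)[THEN bspec] R2(3), assumption?)+
qed

section \<open>Direction and decay of the derivative of the profile\<close>

lemma norm_cv: "norm (cv x) = norm x" by (simp add: cv_def norm_vec_def)

lemma norm_mv: "norm (M *v x) <= norm M * norm (x :: real^'n::finite)" for M :: "real^'n^'n"
 using norm_cm[of M "cv x"] by (simp add: cm_cv norm_cv)

lemma inner_mv_bound: "\<bar>x #. (M *v y)\<bar> <= norm M * norm x * norm (y :: real^'n::finite)" for M :: "real^'n^'n"
 using order_trans[OF Cauchy_Schwarz_ineq2 mult_left_mono[OF norm_mv norm_ge_zero], of x M y] by (simp add: mult_ac)

lemma exp_weighted_nonincreasing:
 fixes p :: "real => real"
 assumes d: "!!t. T <= t ==> (p has_real_derivative p' t) (at t)" and b: "!!t. T <= t ==> p' t <= - a * p t" and t: "T <= s" "s <= t"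
 shows "p t * exp (a * t) <= p s * exp (a * s)"
proof (rule DERIV_nonpos_imp_nonincreasing[OF t(2)])
 fix x assume "s <= x" "x <= t"
 then have x: "T <= x" using t by simp
 have "((%t. p t * exp (a * t)) has_real_derivative p' x * exp (a * x) + a * exp (a * x) * p x) (at x)"
 by (auto intro!: derivative_eq_intros d x)
 moreover have "p' x * exp (a * x) <= (- a * p x) * exp (a * x)" by (intro mult_right_mono b x) simp
 then have "p' x * exp (a * x) + a * exp (a * x) * p x <= 0" by (simp add: mult_ac)
 ultimately show "EX y. ((%t. p t * exp (a * t)) has_real_derivative y) (at x) & y <= 0" by blast
qed

text \<open>\<open>D\<close> measures how far the solution lies outside the cone around the k-th
  axis, and \<open>D * exp (l * t)\<close> is nonincreasing. For a solution bounded at minus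
  infinity its limit there is at most 0, so \<open>D\<close> is never positive: a solution outside
  the cone would have to grow exponentially backwards.\<close>

lemma bounded_solution_in_cone:
 fixes y :: "real => real^'n::finite" and lam :: "'n => real"
 assumes d: "!!t. (y hvd M t *v y t) (at t)" and bd: "!!t. norm (y t) <= Bd"
 and M: "!!t. norm (M t - (\<chi> i j. if i = j then lam i else 0)) <= si"
 and lam: "lam k = 0" "!!j. j ~= k ==> lam j <= - l" and l: "0 < l" and et: "0 < et" "et <= 1" and si: "6 * si <= l * et^2"
 shows "(norm (y t))^2 <= (1 + et^2) * (y t $ k)^2"
proof -
 define D where "D t = (norm (y t))^2 - (1 + et^2) * (y t $ k)^2" for t
 define D' where "D' t = 2 * (y t #. (M t *v y t)) - (1 + et^2) * (2 * (y t $ k) * (M t *v y t) $ k)" for t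
 have dk: "((%t. y t $ k) has_real_derivative (M t *v y t) $ k) (at t)" for t
 unfolding has_real_derivative_iff_has_vector_derivative by (rule bounded_linear.has_vector_derivative[OF bounded_linear_vec_nth d])
 have dD: "(D has_real_derivative D' t) (at t)" for t
 proof -
 have "((%t. (norm (y t))^2) has_real_derivative 2 * (y t #. (M t *v y t))) (at t)"
 unfolding power2_norm_eq_inner using has_real_derivative_inner[OF d d, of t] by (simp add: inner_commute)
 moreover have "((%t. (y t $ k)^2) has_real_derivative 2 * (y t $ k) * (M t *v y t) $ k) (at t)"
 by (auto intro!: derivative_eq_intros dk)
 ultimately show ?thesis unfolding D_def D'_def by (intro DERIV_diff DERIV_cmult)
 qed
 have eta2: "et^2 <= 1" using et by (simp add: power_le_one)
 have "D' t <= - l * D t" for t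
 proof -
 define M0 :: "real^'n^'n" where "M0 = (\<chi> i j. if i = j then lam i else 0)"
 define w z where "w = y t" "z = (M t - M0) *v y t"
 have m0: "(M0 *v w) $ i = lam i * w $ i" for i
 by (simp add: M0_def matrix_vector_mult_def if_distrib[of "%z. z * _"] sum.delta cong: if_cong)
 have Mw: "M t *v y t = M0 *v w + z" by (simp add: w_z_def matrix_vector_mult_diff_rdistrib)
 have "w #. (M0 *v w) = (SUM i:UNIV. lam i * (w $ i)^2)" unfolding inner_vec_def m0 by (simp add: power2_eq_square mult_ac)
 also have "... <= (SUM i:UNIV. - l * (w $ i)^2 + (if i = k then l * (w $ k)^2 else 0))"
 proof (rule sum_mono)
 fix i
 show "lam i * (w $ i)^2 <= - l * (w $ i)^2 + (if i = k then l * (w $ k)^2 else 0)"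
 proof (cases "i = k")
 case False
 then show ?thesis using mult_right_mono[OF lam(2)[OF False] zero_le_power2[of "w $ i"]] by simp
 qed (simp add: lam(1))
 qed
 also have "... = - l * (norm w)^2 + l * (w $ k)^2"
 unfolding sum.distrib sum_distrib_left[symmetric] power2_norm_eq_inner inner_vec_def by (simp add: power2_eq_square)
 finally have 1: "w #. (M0 *v w) <= - l * (norm w)^2 + l * (w $ k)^2" .
 have nz: "norm z <= si * norm w" unfolding w_z_def using order_trans[OF norm_mv mult_right_mono[OF M[of t, folded M0_def]]] by simp
 have "\<bar>w #. z\<bar> <= norm w * norm z" by (rule Cauchy_Schwarz_ineq2)
 also have "... <= norm w * (si * norm w)" using nz by (intro mult_left_mono) auto
 finally have 2: "w #. z <= si * (norm w)^2" by (simp add: power2_eq_square mult_ac)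
 have "\<bar>w $ k * z $ k\<bar> <= norm w * norm z" unfolding abs_mult by (intro mult_mono component_le_norm_cart) auto
 also have "... <= norm w * (si * norm w)" using nz by (intro mult_left_mono) auto
 finally have 3: "- (w $ k * z $ k) <= si * (norm w)^2" by (simp add: power2_eq_square mult_ac abs_le_iff)
 have s0: "0 <= si * (norm w)^2" using order_trans[OF norm_ge_zero M] by simp
 have "(1 + et^2) * (- (w $ k * z $ k)) <= (1 + et^2) * (si * (norm w)^2)" using 3 by (intro mult_left_mono) auto
 also have "... <= 2 * (si * (norm w)^2)" using eta2 s0 by (intro mult_right_mono) auto
 finally have 4: "(1 + et^2) * (- (w $ k * z $ k)) <= 2 * (si * (norm w)^2)" .
 have 5: "6 * si * (norm w)^2 <= l * et^2 * (norm w)^2" using si by (intro mult_right_mono) auto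
 have 6: "l * et^2 * (norm w)^2 <= l * (norm w)^2 - l * (w $ k)^2 + l * et^2 * (w $ k)^2"
 proof -
 have "0 <= (norm w)^2 - (w $ k)^2" using component_le_norm_cart[of w k] by (simp add: abs_le_square_iff[symmetric])
 then have "et^2 * ((norm w)^2 - (w $ k)^2) <= 1 * ((norm w)^2 - (w $ k)^2)" using eta2 by (intro mult_right_mono)
 then have "l * (et^2 * ((norm w)^2 - (w $ k)^2)) <= l * ((norm w)^2 - (w $ k)^2)" using l by simp
 then show ?thesis by (simp add: algebra_simps)
 qed
 have "D' t = 2 * (w #. (M0 *v w)) + 2 * (w #. z) + 2 * ((1 + et^2) * (- (w $ k * z $ k)))"
 unfolding D'_def Mw by (simp add: inner_add_right m0 lam(1) w_z_def(1)[symmetric] algebra_simps)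
 also have "... <= - l * ((norm w)^2 - (1 + et^2) * (w $ k)^2)" using 1 2 4 5 6 by (simp add: algebra_simps)
 finally show ?thesis by (simp add: D_def w_z_def)
 qed
 note dec = exp_weighted_nonincreasing[OF dD this]
 have "\<forall>\<^sub>F s in at_bot. D t * exp (l * t) <= Bd^2 * exp (l * s)"
 unfolding eventually_at_bot_linorder
 proof (intro exI[of _ t] allI impI)
 fix s assume "s <= t"
 have "D s <= (norm (y s))^2" by (simp add: D_def)
 also have "... <= Bd^2" using bd[of s] by (intro power_mono) auto
 finally have "D s * exp (l * s) <= Bd^2 * exp (l * s)" by (intro mult_right_mono) auto
 then show "D t * exp (l * t) <= Bd^2 * exp (l * s)" by (rule order_trans[OF dec[OF order_refl \<open>s <= t\<close>]])
 qed
 moreover have "((%s. Bd^2 * exp (l * s)) ---> 0) at_bot" using l by real_asymp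
 ultimately have "D t * exp (l * t) <= 0" by (intro tendsto_lowerbound[of "%s. Bd^2 * exp (l * s)" 0 at_bot]) auto
 then have "D t <= 0" by (simp add: mult_le_0_iff not_le[symmetric])
 then show ?thesis by (simp add: D_def)
qed

text \<open>\<open>p = - (y #. (Mi *v y))\<close> decreases at a rate at least
  \<open>m^2 * \<bar>y\<bar>^2\<close> near the end and is bounded by a multiple of
  \<open>\<bar>y\<bar>^2\<close>, so it decays exponentially. It need not control \<open>y\<close>,
  since \<open>Mi\<close> may be indefinite; the norm is recovered from the decrease of
  \<open>p\<close> over intervals of length 1.\<close>

lemma exponential_decay:
 fixes y :: "real => real^'n::finite"
 assumes d: "!!t. (y hvd M t *v y t) (at t)" and bM: "!!t. norm (M t) <= Km"
 and lM: "(M ---> Mi) at_top" and s: "sym_mat Mi" and m: "0 < m" "!!x. m * norm x <= norm (Mi *v x)" and ly: "(y ---> 0) at_top"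
 shows "EX tq C. 0 < tq & 0 <= C & (ALL t>=0. norm (y t) <= C * exp (- tq * t))"
proof -
 define Ki where "Ki = norm Mi + 1"
 have Ki: "0 < Ki" "norm Mi <= Ki" by (simp_all add: Ki_def add_nonneg_pos)
 have "\<forall>\<^sub>F t in at_top. dist (M t) Mi < m^2 / (2 * Ki)" using lM m Ki by (intro tendstoD) auto
 then obtain T0 where T0: "!!t. T0 <= t ==> dist (M t) Mi < m^2 / (2 * Ki)" unfolding eventually_at_top_linorder by blast
 define T where "T = max 0 T0"
 define p where "p t = - (y t #. (Mi *v y t))" for t
 define p' where "p' t = - 2 * ((Mi *v y t) #. (M t *v y t))" for t
 have sy: "x #. (Mi *v z) = (Mi *v x) #. z" for x z :: "real^'n"
 using s unfolding sym_mat_def by (metis dot_lmul_matrix matrix_vector_mul(1) vector_transpose_matrix inner_commute)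
 have dp: "(p has_real_derivative p' t) (at t)" for t
 proof -
 have dm: "((%t. Mi *v y t) hvd Mi *v (M t *v y t)) (at t)"
 by (rule bounded_linear.has_vector_derivative[OF matrix_vector_mul_bounded_linear d])
 have e: "y t #. (Mi *v (M t *v y t)) = (Mi *v y t) #. (M t *v y t)" by (rule sy)
 from DERIV_minus[OF has_real_derivative_inner[OF d dm]] show ?thesis
 unfolding p_def p'_def by (simp add: e inner_commute[of "M t *v y t" "Mi *v y t"])
 qed
 have p'b: "p' t <= - (m^2 * (norm (y t))^2)" if t: "T <= t" for t
 proof -
 have e: "(Mi *v y t) #. (M t *v y t) = (norm (Mi *v y t))^2 + (Mi *v y t) #. ((M t - Mi) *v y t)"
 by (simp add: power2_norm_eq_inner matrix_vector_mult_diff_rdistrib inner_diff_right)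
 have "(m * norm (y t))^2 <= (norm (Mi *v y t))^2" using m by (intro power_mono) auto
 moreover have "\<bar>(Mi *v y t) #. ((M t - Mi) *v y t)\<bar> <= m^2 / 2 * (norm (y t))^2"
 proof -
 have "norm (M t - Mi) <= m^2 / (2 * Ki)" using T0[of t] t by (simp add: T_def dist_norm)
 then have "norm (M t - Mi) * norm (Mi *v y t) * norm (y t) <= m^2 / (2 * Ki) * (Ki * norm (y t)) * norm (y t)"
 using m Ki by (intro mult_mono order_trans[OF norm_mv] mult_right_mono) auto
 also have "... = m^2 / 2 * (norm (y t))^2" using Ki by (simp add: power2_eq_square)
 finally show ?thesis using order_trans[OF inner_mv_bound] by blast
 qed
 ultimately show ?thesis unfolding p'_def e by (simp add: power_mult_distrib abs_le_iff)
 qed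
 have pK: "p t <= Ki * (norm (y t))^2" for t
 proof -
 have "p t <= norm Mi * norm (y t) * norm (y t)" using inner_mv_bound[of "y t" Mi "y t"] by (simp add: p_def)
 also have "... <= Ki * norm (y t) * norm (y t)" using Ki by (intro mult_right_mono) auto
 finally show ?thesis by (simp add: power2_eq_square mult.assoc)
 qed
 have mono: "p t <= p s" if "T <= s" "s <= t" for s t
 proof -
 have "p' x <= - 0 * p x" if "T <= x" for x using p'b[OF that] by (smt (verit) mult_zero_left zero_le_power2 zero_le_mult_iff)
 from exp_weighted_nonincreasing[where T = T and a = 0, OF dp this that] show ?thesis by simp
 qed
 have pl: "(p ---> 0) at_top"
 proof -
 have "((%t. - (y t #. (Mi *v y t))) ---> - (0 #. (Mi *v 0))) at_top"
 by (intro tendsto_minus tendsto_inner ly bounded_linear.tendsto[OF matrix_vector_mul_bounded_linear])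
 then show ?thesis unfolding p_def by simp
 qed
 have p0: "0 <= p t" if "T <= t" for t
 by (rule tendsto_upperbound[OF pl eventually_mono[OF eventually_ge_at_top[of t]]]) (use mono that in auto)
 define a where "a = m^2 / Ki"
 have a: "0 < a" using m Ki by (simp add: a_def)
 have "p' t <= - a * p t" if "T <= t" for t
 proof -
 have "a * p t <= a * (Ki * (norm (y t))^2)" using a pK by (intro mult_left_mono) auto
 also have "... = m^2 * (norm (y t))^2" using Ki by (simp add: a_def)
 finally show ?thesis using p'b[OF that] by simp
 qed
 note dec = exp_weighted_nonincreasing[OF dp this]
 define n where "n t = (norm (y t))^2" for t
 have dn: "(n has_real_derivative 2 * (y t #. (M t *v y t))) (at t)" for t
 unfolding n_def power2_norm_eq_inner using has_real_derivative_inner[OF d d, of t] by (simp add: inner_commute)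
 have nb: "2 * (y t #. (M t *v y t)) <= - (- 2 * Km) * n t" for t
 proof -
 have "\<bar>y t #. (M t *v y t)\<bar> <= Km * norm (y t) * norm (y t)" by (rule order_trans[OF inner_mv_bound]) (intro mult_right_mono bM, auto)
 then show ?thesis by (simp add: n_def power2_eq_square mult_ac abs_le_iff)
 qed
 have Km: "0 <= Km" using order_trans[OF norm_ge_zero bM] .
 have ng: "n t <= n s * exp (2 * Km * (t - s))" if "s <= t" for s t
 proof -
 have "n t * exp (- 2 * Km * t) <= n s * exp (- 2 * Km * s)" by (rule exp_weighted_nonincreasing[OF dn nb order_refl that])
 then have "n t * exp (- 2 * Km * t) * exp (2 * Km * t) <= n s * exp (- 2 * Km * s) * exp (2 * Km * t)" by (intro mult_right_mono) auto
 then show ?thesis by (simp add: mult.assoc exp_add[symmetric] algebra_simps)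
 qed
 define C1 where "C1 = exp (2 * Km) / m^2 * (p T * exp (a * T)) * exp a"
 have far: "n t <= C1 * exp (- a * t)" if t: "T + 1 <= t" for t
 proof -
 \<comment> \<open>At some time z in the last unit interval \<open>\<bar>y\<bar>^2\<close> is
   bounded by the decrease of \<open>p\<close>, and over at most one unit of time it grows by at
   most \<open>exp (2 * Km)\<close>.\<close>
 obtain z where z: "t - 1 < z" "z < t" "p t - p (t - 1) = (t - (t - 1)) * p' z"
 using MVT2[of "t - 1" t p p'] dp by auto
 have "m^2 * n z <= p (t - 1)" using z p'b[of z] p0[of t] t by (simp add: n_def)
 also have "... <= p T * exp (a * T) * exp (- a * (t - 1))"
 proof -
 have "p (t - 1) * exp (a * (t - 1)) * exp (- a * (t - 1)) <= p T * exp (a * T) * exp (- a * (t - 1))"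
 using dec[where s = T and t = "t - 1"] t by (intro mult_right_mono) auto
 then show ?thesis by (simp add: mult.assoc exp_add[symmetric])
 qed
 finally have "n z <= (p T * exp (a * T) * exp (- a * (t - 1))) / m^2" using m by (simp add: pos_le_divide_eq mult.commute)
 moreover have "n t <= n z * exp (2 * Km)"
 proof -
 have "2 * Km * (t - z) <= 2 * Km * 1" using z Km by (intro mult_left_mono) auto
 then have "n z * exp (2 * Km * (t - z)) <= n z * exp (2 * Km)" by (intro mult_left_mono) (auto simp: n_def)
 then show ?thesis using ng[of z t] z by simp
 qed
 ultimately have "n t <= (p T * exp (a * T) * exp (- a * (t - 1))) / m^2 * exp (2 * Km)" using mult_right_mono[of "n z" _ "exp (2 * Km)"] by fastforce
 also have "... = C1 * exp (- a * t)" by (simp add: C1_def exp_diff exp_minus right_diff_distrib field_simps)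
 finally show ?thesis .
 qed
 define C2 where "C2 = n 0 * exp (2 * Km * (T + 1)) * exp (a * (T + 1)) + C1"
 have C1: "0 <= C1" using p0[of T] by (simp add: C1_def)
 have C2: "0 <= C2" using C1 by (simp add: C2_def n_def)
 have all: "n t <= C2 * exp (- a * t)" if t: "0 <= t" for t
 proof (cases "T + 1 <= t")
 case True
 have "C1 * exp (- a * t) <= C2 * exp (- a * t)" by (intro mult_right_mono) (auto simp: C2_def n_def)
 then show ?thesis by (rule order_trans[OF far[OF True]])
 next
 case False
 have "n t <= n 0 * exp (2 * Km * (t - 0))" by (rule ng[OF t])
 also have "... <= n 0 * exp (2 * Km * (T + 1))" using False Km by (intro mult_left_mono) (auto simp: n_def mult_left_mono)
 also have "... <= n 0 * exp (2 * Km * (T + 1)) * (exp (a * (T + 1)) * exp (- a * t))"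
 proof -
 have "1 <= exp (a * (T + 1)) * exp (- a * t)" unfolding exp_add[symmetric] using mult_left_mono[of t "T + 1" a] False a by simp
 from mult_left_mono[OF this, of "n 0 * exp (2 * Km * (T + 1))"] show ?thesis by (simp add: n_def)
 qed
 also have "... <= C2 * exp (- a * t)" unfolding C2_def distrib_right using C1 by (simp add: mult.assoc)
 finally show ?thesis .
 qed
 have "norm (y t) <= sqrt C2 * exp (- (a / 2) * t)" if "0 <= t" for t
 proof -
 have "norm (y t) = sqrt (n t)" by (simp add: n_def)
 also have "... <= sqrt (C2 * exp (- a * t))" using all[OF that] by simp
 also have "exp (- a * t) = (exp (- (a / 2) * t))^2" by (simp flip: exp_double)
 finally show ?thesis by (simp add: real_sqrt_mult)
 qed
 then show ?thesis using a C2 by (intro exI[of _ "a/2"] exI[of _ "sqrt C2"]) auto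
qed

text \<open>A kernel vector is orthogonal to all \<open>W *v r j\<close>, because the entries
  \<open>f j\<close> do not vanish, and these vectors form a basis.\<close>

lemma end_data_bounded_below:
 assumes e: "end_data F G W r f g" and f: "!!j. f j ~= 0"
 shows "EX m>0. ALL x. m * norm x <= norm (F *v x)"
proof -
 have z: "x = 0" if "F *v x = 0" for x
 proof -
 define R where "R = (\<chi> i j. r j $ i)"
 have rj: "r j #. (W *v r i) = (if j = i then 1 else 0)" "F *v r j = f j *R (W *v r j)" "transpose F = F" for i j using e unfolding end_data_def sym_mat_def by auto
 have "(W *v r j) #. x = 0" for j
 proof -
 have "f j * ((W *v r j) #. x) = (F *v r j) #. x" by (simp add: rj)
 also have "... = r j #. (F *v x)" using rj(3) by (metis dot_lmul_matrix vector_transpose_matrix)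
 finally show ?thesis using that f by simp
 qed
 then have w: "transpose (W ** R) *v x = 0"
 by (simp add: vec_eq_iff matrix_vector_mult_def transpose_def matrix_matrix_mult_def R_def inner_vec_def)
 have "transpose R ** (W ** R) = mat 1"
 proof -
 have "(transpose R ** (W ** R)) $ i $ j = r i #. (W *v r j)" for i j
 by (simp add: matrix_matrix_mult_def transpose_def R_def inner_vec_def matrix_vector_mult_def)
 then show ?thesis by (simp add: vec_eq_iff rj mat_def)
 qed
 then have "transpose (W ** R) ** R = mat 1" by (metis matrix_transpose_mul transpose_mat transpose_transpose)
 then have "R ** transpose (W ** R) = mat 1" by (simp add: matrix_left_right_inverse)
 then have "x = R *v (transpose (W ** R) *v x)" unfolding matrix_vector_mul_assoc by simp
 from this[unfolded w] show "x = 0" by simp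
 qed
 have "inj ((*v) F)"
 using z by (intro injI) (metis eq_iff_diff_eq_0 matrix_vector_mult_diff_distrib)
 then obtain m where "m > 0" "!!x. m * norm x <= norm (F *v x)" using linear_inj_bounded_below_pos[of "(*v) F"] by auto
 then show ?thesis by blast
qed

section \<open>Derivatives of the fluxes\<close>

text \<open>The coinductive notion of smoothness is unfolded three times: for \<open>f\<close>, for
  its partial derivatives, and for the second ones, whose differentiability supplies the continuity
  of \<open>H\<close>.\<close>

lemma smooth_jacobian:
 fixes f :: "real^'n::finite => real^'n"
 assumes S: "open S" and f: "smooth_on S f"
 shows "EX H. (ALL l. continuous_on S (H l)) & (ALL x:S. (f has_derivative (%h. jac f x *v h)) (at x) &
 (jac f has_derivative (%h. SUM l:UNIV. h $ l *R H l x)) (at x))"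
proof -
 define D where "D j x = frechet_derivative f (at x within S) (axis j 1)" for j x
 have at: "at x within S = at x" if "x : S" for x using at_within_open[OF that S] .
 have fd: "f differentiable_on S" and sD: "smooth_on S (D j)" for j
 using f[unfolded smooth_on.simps[of S f]] unfolding D_def by auto
 define D2 where "D2 l j x = frechet_derivative (D j) (at x within S) (axis l 1)" for l j x
 have Dd: "D j differentiable_on S" and sD2: "smooth_on S (D2 l j)" for j l
 using sD[of j, unfolded smooth_on.simps[of S "D j"]] unfolding D2_def by auto
 have cD2: "continuous_on S (D2 l j)" for l j
 using sD2[of l j, unfolded smooth_on.simps[of S "D2 l j"]] by (auto intro: differentiable_imp_continuous_on)
 define cl where "cl j v = (\<chi> i j'. if j' = j then v $ i else 0)" for j :: 'n and v :: "real^'n"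
 have bcl: "bounded_linear (cl j)" for j
 unfolding linear_conv_bounded_linear[symmetric] by (rule linearI) (simp_all add: cl_def vec_eq_iff)
 have ax: "h = (SUM l:UNIV. h $ l *R axis l 1)" for h :: "real^'n"
 by (simp add: vec_eq_iff axis_def if_distrib[of "%z. _ * z"] sum.delta cong: if_cong)
 have fdx: "(f has_derivative frechet_derivative f (at x)) (at x)" and Ddx: "(D j has_derivative frechet_derivative (D j) (at x)) (at x)" if "x : S" for x j
 using fd Dd[of j] that at[OF that] unfolding differentiable_on_def by (metis frechet_derivative_works)+
 have jD: "jac f x = (SUM j:UNIV. cl j (D j x))" if "x : S" for x
 by (simp add: jac_def matrix_def cl_def D_def at[OF that] vec_eq_iff sum.delta')
 define H where "H l x = (SUM j:UNIV. cl j (D2 l j x))" for l x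
 have "continuous_on S (H l)" for l
 unfolding H_def by (intro continuous_on_sum bounded_linear.continuous_on[OF bcl] cD2)
 moreover have "(f has_derivative (%h. jac f x *v h)) (at x)" if "x : S" for x
 unfolding jac_def matrix_vector_mul(2)[OF has_derivative_linear[OF fdx[OF that]]] using fdx[OF that] by simp
 moreover have "(jac f has_derivative (%h. SUM l:UNIV. h $ l *R H l x)) (at x)" if x: "x : S" for x
 proof -
 have "((%x. SUM j:UNIV. cl j (D j x)) has_derivative (%h. SUM j:UNIV. cl j (frechet_derivative (D j) (at x) h))) (at x)"
 by (intro has_derivative_sum bounded_linear.has_derivative[OF bcl] Ddx x)
 then have 1: "(jac f has_derivative (%h. SUM j:UNIV. cl j (frechet_derivative (D j) (at x) h))) (at x)"
 by (rule has_derivative_transform_within_open[OF _ S x]) (simp add: jD)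
 have "(SUM j:UNIV. cl j (frechet_derivative (D j) (at x) h)) = (SUM l:UNIV. h $ l *R H l x)" for h
 proof -
 have "frechet_derivative (D j) (at x) h = (SUM l:UNIV. h $ l *R D2 l j x)" for j
 proof -
 have lin: "linear (frechet_derivative (D j) (at x))" by (rule has_derivative_linear[OF Ddx[OF x]])
 show ?thesis by (subst ax[of h]) (simp add: linear_sum[OF lin] linear_cmul[OF lin] D2_def at[OF x])
 qed
 then have "(SUM j:UNIV. cl j (frechet_derivative (D j) (at x) h)) = (SUM j:UNIV. SUM l:UNIV. h $ l *R cl j (D2 l j x))"
 by (simp add: linear_sum[OF bounded_linear.linear[OF bcl]] linear_cmul[OF bounded_linear.linear[OF bcl]])
 also have "... = (SUM l:UNIV. h $ l *R H l x)" unfolding H_def scaleR_sum_right by (rule sum.swap)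
 finally show ?thesis .
 qed
 then show ?thesis using 1 by simp
 qed
 ultimately show ?thesis by (intro exI[of _ H]) blast
qed

lemma has_vector_derivative_field_compose:
 assumes X: "(X hvd d) (at t)" and Ph: "(Ph has_derivative Ph') (at (X t))"
 shows "((%t. Ph (X t)) hvd Ph' d) (at t)"
 using has_derivative_compose[OF X[unfolded has_vector_derivative_def] Ph] linear_cmul[OF has_derivative_linear[OF Ph]]
 unfolding has_vector_derivative_def by simp

lemma scaleR_mv: "(a *R M) *v x = a *R (M *v x)" for M :: "real^'n::finite^'n"
 by (simp add: matrix_vector_mult_def vec_eq_iff sum_distrib_left mult.assoc)
lemma minus_mv: "(- M) *v x = - (M *v x)" for M :: "real^'n::finite^'n"
 by (simp add: matrix_vector_mult_def vec_eq_iff sum_negf)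

section \<open>From a profile to coefficient curves\<close>

text \<open>\<open>ta\<close> orients the line so that, apart from the k-th, all characteristic
  speeds relative to the shock are negative; for \<open>ta = -1\<close> the profile is run backwards
  and \<open>F\<close> changes sign. The derivative of the profile, up to the sign
  \<open>ta\<close>, is a bounded solution of \<open>y' = F y\<close>, so it lies in a narrow cone
  about the k-th axis. Hence the coefficients vary to leading order only in the direction k, with
  speed \<open>y $ k\<close>, as the energy estimate requires.\<close>

lemma profile_stable:
 fixes Fv Gv :: "real^'n::finite => real^'n^'n" and FH GH :: "'n => real^'n => real^'n^'n" and fb gb :: "real^'n => real^'n"
 and phi :: "real => real^'n" and lam :: "'n => real"
 defines "F0 \<equiv> (\<chi> i j. if i = j then lam i else 0)"
 assumes ta: "ta = 1 \<or> ta = -1" and gm: "goodman K C si c F0 E" and K: "1 <= K" and C: "0 < C" and c: "0 < c"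
 and lam: "lam k = 0" "!!j. j ~= k ==> lam j <= - l" and l: "0 < l" and et: "0 < et" "et <= 1" "6 * si2 <= l * et^2" and si2: "si2 <= si"
 and c0: "0 < c0" "(real CARD('n))^2 / c0 <= K" and ro: "ro <= 1"
 and dfb: "!!v. v : ball 0 ro ==> (fb has_derivative (%h. Fv v *v h)) (at v)" "!!v. v : ball 0 ro ==> (gb has_derivative (%h. Gv v *v h)) (at v)"
 and dFv: "!!v. v : ball 0 ro ==> (Fv has_derivative (%h. SUM l:UNIV. h $ l *R FH l v)) (at v)"
 "!!v. v : ball 0 ro ==> (Gv has_derivative (%h. SUM l:UNIV. h $ l *R GH l v)) (at v)"
 and sy: "!!v. v : ball 0 ro ==> sym_mat (Gv v + Fv v)" "!!v. v : ball 0 ro ==> sym_mat (Gv v - Fv v)"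
 and pos: "!!v x. v : ball 0 ro ==> c0 * (norm x)^2 <= x #. ((Gv v + Fv v) *v x)" "!!v x. v : ball 0 ro ==> c0 * (norm x)^2 <= x #. ((Gv v - Fv v) *v x)"
 and nrm: "!!v. v : ball 0 ro ==> norm (Gv v + Fv v) <= K" "!!v. v : ball 0 ro ==> norm (Gv v - Fv v) <= K"
 and cF: "!!v. v : ball 0 ro ==> norm (ta *R Fv v - F0) <= si2"
 and cE: "!!v h. v : ball 0 ro ==> (norm h)^2 <= (1 + et^2) * (h $ k)^2 ==> norm ((SUM l:UNIV. h $ l *R FH l v) - h $ k *R E) <= si * \<bar>h $ k\<bar>"
 and cG: "!!v h. v : ball 0 ro ==> (norm h)^2 <= (1 + et^2) * (h $ k)^2 ==> norm (SUM l:UNIV. h $ l *R GH l v) <= K * \<bar>h $ k\<bar>"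
 and sm: "!!v. v : ball 0 ro ==> norm (fb v - fb wm) <= si"
 and phi: "!!t. (phi hvd (fb (phi t) - fb wm)) (at t)" "!!t. phi t : ball 0 ro"
 and lims: "((%t. phi (ta * t)) ---> wp) at_top" "((%t. phi (ta * t)) ---> wm) at_bot"
 and w: "wp : ball 0 ro" "wm : ball 0 ro" "fb wp = fb wm" "ta * wm $ k < ta * wp $ k"
 and ep: "end_data (ta *R Fv wp) (Gv wp) Wp rp fp gp" "!!j. fp j < 0"
 and em: "end_data (ta *R Fv wm) (Gv wm) Wm rm fm gm" "0 < fm k" "!!j. j ~= k ==> fm j < 0"
 shows "stable_pair (ev_minus (%t. ta *R Fv (phi (ta * t))) (%t. Gv (phi (ta * t)))) (ev_plus (%t. ta *R Fv (phi (ta * t))) (%t. Gv (phi (ta * t))))"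
proof -
 have tt: "ta * ta = 1" "\<bar>ta\<bar> = 1" using ta by auto
 define X where "X t = phi (ta * t)" for t
 define y where "y t = fb (X t) - fb wm" for t
 define F G where "F t = ta *R Fv (X t)" "G t = Gv (X t)" for t
 define F1 where "F1 t = (SUM l:UNIV. y t $ l *R FH l (X t))" for t
 define G1 where "G1 t = (SUM l:UNIV. (ta *R y t) $ l *R GH l (X t))" for t
 have XB: "X t : ball 0 ro" for t using phi(2) by (simp add: X_def)
 have dX: "(X hvd ta *R y t) (at t)" for t
 proof -
 have "((%t. ta * t) hvd ta) (at t)"
 unfolding has_real_derivative_iff_has_vector_derivative[symmetric] by (auto intro!: derivative_eq_intros)
 from vector_diff_chain_at[OF this phi(1)] show ?thesis by (simp add: o_def X_def[abs_def] y_def)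
 qed
 have dF: "(F hvd F1 t) (at t)" for t
 proof -
 have "(F hvd ta *R (SUM l:UNIV. (ta *R y t) $ l *R FH l (X t))) (at t)"
 unfolding F_G_def(1)[abs_def]
 by (rule bounded_linear.has_vector_derivative[OF bounded_linear_scaleR_right has_vector_derivative_field_compose[OF dX dFv(1)[OF XB]]])
 moreover have "ta *R (SUM l:UNIV. (ta *R y t) $ l *R FH l (X t)) = F1 t"
 by (simp add: F1_def scaleR_sum_right mult.assoc[symmetric] tt)
 ultimately show ?thesis by simp
 qed
 have dG: "(G hvd G1 t) (at t)" for t
 unfolding F_G_def(2)[abs_def] G1_def by (rule has_vector_derivative_field_compose[OF dX dFv(2)[OF XB]])
 have dy: "(y hvd F t *v y t) (at t)" for t
 proof -
 have "((%t. fb (X t) - fb wm) hvd Fv (X t) *v (ta *R y t) - 0) (at t)"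
 by (intro has_vector_derivative_diff has_vector_derivative_const has_vector_derivative_field_compose[OF dX dfb(1)[OF XB]])
 then show ?thesis unfolding y_def[symmetric] F_G_def scaleR_mv by (simp add: matrix_vector_mult_scaleR)
 qed
 have hF2: "norm (F t - F0) <= si2" for t unfolding F_G_def by (rule cF[OF XB])
 have hF: "norm (F t - F0) <= si" for t by (rule order_trans[OF hF2 si2])
 have yb: "norm (y t) <= si" for t unfolding y_def by (rule sm[OF XB])
 \<comment> \<open>The bounded-solution argument on the whole line fixes the direction of the
   profile's derivative without any expansion of the profile in the amplitude.\<close>
 have cone: "(norm (y t))^2 <= (1 + et^2) * (y t $ k)^2" for t
 by (rule bounded_solution_in_cone[OF dy yb hF2[unfolded F0_def] lam l et])
 define Kf where "Kf = norm F0 + si"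
 have nF: "norm (F t) <= Kf" for t using hF[of t] norm_triangle_sub[of "F t" F0] unfolding Kf_def by linarith
 have lF: "(F ---> ta *R Fv wp) at_top" "(F ---> ta *R Fv wm) at_bot"
 and lG: "(G ---> Gv wp) at_top" "(G ---> Gv wm) at_bot"
 and ly: "(y ---> 0) at_top" "(y ---> 0) at_bot"
 proof -
 have cc: "isCont Fv v" "isCont Gv v" "isCont fb v" if "v : ball 0 ro" for v
 using has_derivative_continuous[OF dFv(1)[OF that]] has_derivative_continuous[OF dFv(2)[OF that]] has_derivative_continuous[OF dfb(1)[OF that]] by simp_all
 note l1 = isCont_tendsto_compose[OF cc(1)[OF w(1)] lims(1)] isCont_tendsto_compose[OF cc(1)[OF w(2)] lims(2)]
 note l2 = isCont_tendsto_compose[OF cc(2)[OF w(1)] lims(1)] isCont_tendsto_compose[OF cc(2)[OF w(2)] lims(2)]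
 note l3 = isCont_tendsto_compose[OF cc(3)[OF w(1)] lims(1)] isCont_tendsto_compose[OF cc(3)[OF w(2)] lims(2)]
 show "(F ---> ta *R Fv wp) at_top" "(F ---> ta *R Fv wm) at_bot"
 unfolding F_G_def[abs_def] X_def using tendsto_scaleR[OF tendsto_const[of ta] l1(1)] tendsto_scaleR[OF tendsto_const[of ta] l1(2)] by simp_all
 show "(G ---> Gv wp) at_top" "(G ---> Gv wm) at_bot" unfolding F_G_def[abs_def] X_def using l2 by simp_all
 show "(y ---> 0) at_top" "(y ---> 0) at_bot"
 unfolding y_def[abs_def] X_def using tendsto_diff[OF l3(1) tendsto_const[of "fb wm"]] tendsto_diff[OF l3(2) tendsto_const[of "fb wm"]] w(3) by simp_all
 qed
 define h where "h t = ta * X t $ k" for t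
 have dh: "(h has_real_derivative y t $ k) (at t)" for t
 proof -
 have "((%t. X t $ k) has_real_derivative (ta *R y t) $ k) (at t)"
 unfolding has_real_derivative_iff_has_vector_derivative by (rule bounded_linear.has_vector_derivative[OF bounded_linear_vec_nth dX])
 from DERIV_cmult[OF this, of ta] show ?thesis by (simp add: h_def[abs_def] mult.assoc[symmetric] tt)
 qed
 have hl: "(h ---> ta * wp $ k) at_top" "(h ---> ta * wm $ k) at_bot"
 unfolding h_def X_def by (intro tendsto_mult tendsto_const tendsto_vec_nth lims)+
 have refl: "((%t. y (- t)) hvd (- F (- t)) *v y (- t)) (at t)" for t
 unfolding minus_mv by (rule has_vector_derivative_reflect[OF dy])
 \<comment> \<open>A zero would propagate to the whole line by uniqueness and make the k-th
   component of the profile constant, against its different end values.\<close>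
 have ynz: "y t0 ~= 0" for t0
 proof
 assume z: "y t0 = 0"
 have Fb: "norm (F t *v x) <= Kf * norm x" for t x by (rule order_trans[OF norm_mv mult_right_mono[OF nF]]) simp
 have y0: "y t = 0" for t
 proof (cases "t0 <= t")
 case True then show ?thesis by (intro differential_inequality_zero[of t0 t y "%t. F t *v y t" Kf]) (use dy Fb z in auto)
 next
 case False
 have "y (- (- t)) = 0"
 by (rule differential_inequality_zero[of "- t0" "- t" "%t. y (- t)" "%t. (- F (- t)) *v y (- t)" Kf])
 (use refl Fb z False in \<open>auto simp: minus_mv\<close>)
 then show ?thesis by simp
 qed
 have "h t = h 0" for t by (rule DERIV_isconst_all) (use dh y0 in \<open>metis zero_index\<close>)
 then have "h = (%t. h 0)" by (simp add: fun_eq_iff)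
 then have "(h ---> h 0) at_top" "(h ---> h 0) at_bot" by (metis tendsto_const)+
 then have "ta * wp $ k = h 0" "ta * wm $ k = h 0" using hl tendsto_unique[OF trivial_limit_at_top_linorder] tendsto_unique[OF trivial_limit_at_bot_linorder] by blast+
 then show False using w(4) by simp
 qed
 have yk: "y t $ k ~= 0" for t
 proof
 assume "y t $ k = 0"
 then have "(norm (y t))^2 <= 0" using cone[of t] by simp
 then show False using ynz[of t] by simp
 qed
 have cy: "continuous_on UNIV (%t. y t $ k)"
 by (intro continuous_on_component continuous_at_imp_continuous_on ballI has_vector_derivative_continuous[OF dy])
 \<comment> \<open>The k-th component never vanishes by the cone condition, so it has one sign, and
   the order of the end values decides which.\<close>
 have py: "0 < y t $ k" for t
 proof (rule ccontr)
 assume "\<not> 0 < y t $ k"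
 then have n: "y t $ k < 0" using yk[of t] by simp
 have neg: "y s $ k <= 0" for s
 proof (rule ccontr)
 assume "\<not> y s $ k <= 0"
 moreover have "connected (range (%t. y t $ k))" by (rule connected_continuous_image[OF cy connected_UNIV])
 ultimately have "0 : range (%t. y t $ k)" using connectedD_interval[of "range (%t. y t $ k)" "y t $ k" "y s $ k" 0] n by auto
 then obtain u where "0 = y u $ k" by (elim rangeE)
 then show False using yk[of u] by simp
 qed
 have mono: "h b <= h a" if "a <= b" for a b by (rule DERIV_nonpos_imp_nonincreasing[OF that]) (use dh neg in blast)
 have "ta * wp $ k <= h 0" by (rule tendsto_upperbound[OF hl(1) eventually_mono[OF eventually_ge_at_top[of 0]]]) (use mono in auto)
 moreover have "h 0 <= ta * wm $ k" by (rule tendsto_lowerbound[OF hl(2) eventually_mono[OF eventually_le_at_bot[of 0]]]) (use mono in auto)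
 ultimately show False using w(4) by simp
 qed
 have pyy: "y t $ k <= norm (y t)" for t using component_le_norm_cart[of "y t" k] by simp
 have hF1: "norm (F1 t - (y t $ k) *R E) <= si * y t $ k" for t unfolding F1_def using cE[OF XB cone[of t]] py[of t] by simp
 have hG1: "norm (G1 t) <= K * y t $ k" for t
 proof -
 have "(norm (ta *R y t))^2 <= (1 + et^2) * ((ta *R y t) $ k)^2" using cone[of t] ta by auto
 from cG[OF XB this] show ?thesis unfolding G1_def using py[of t] tt(2) by (simp add: abs_mult)
 qed
 obtain m1 m2 where m1: "0 < m1" "!!x. m1 * norm x <= norm ((ta *R Fv wp) *v x)" and m2: "0 < m2" "!!x. m2 * norm x <= norm ((ta *R Fv wm) *v x)"
 using end_data_bounded_below[OF ep(1)] end_data_bounded_below[OF em(1)] ep(2) em(2,3) by (metis less_irrefl)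
 have sF: "sym_mat (ta *R Fv wp)" "sym_mat (- (ta *R Fv wm))"
 using ep(1) end_data_minus[OF em(1)] unfolding end_data_def by blast+
 obtain tqp Cp where p: "0 < tqp" "0 <= Cp" "ALL t>=0. norm (y t) <= Cp * exp (- tqp * t)"
 using exponential_decay[OF dy nF lF(1) sF(1) m1 ly(1)] by blast
 have "EX tq C. 0 < tq & 0 <= C & (ALL t>=0. norm (y (- t)) <= C * exp (- tq * t))"
 proof (rule exponential_decay[OF refl _ _ sF(2) m2(1)])
 show "norm (- F (- t)) <= Kf" for t using nF by simp
 show "((%t. - F (- t)) ---> - (ta *R Fv wm)) at_top" by (intro tendsto_minus filterlim_compose[OF lF(2) filterlim_uminus_at_bot_at_top])
 show "m2 * norm x <= norm ((- (ta *R Fv wm)) *v x)" for x using m2(2) by (simp add: minus_mv)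
 show "((%t. y (- t)) ---> 0) at_top" by (rule filterlim_compose[OF ly(2) filterlim_uminus_at_bot_at_top])
 qed
 then obtain tqm Cm where q: "0 < tqm" "0 <= Cm" "ALL t>=0. norm (y (- t)) <= Cm * exp (- tqm * t)" by blast
 define tq Cy where "tq = min tqp tqm" "Cy = max Cp Cm"
 have tq: "0 < tq" and Cy: "0 <= Cy" using p q by (auto simp: tq_Cy_def)
 have dec: "norm (y t) <= Cy * exp (- tq * t)" "norm (y (- t)) <= Cy * exp (- tq * t)" if t: "0 <= t" for t
 proof -
 have "Cp * exp (- tqp * t) <= Cy * exp (- tq * t)" "Cm * exp (- tqm * t) <= Cy * exp (- tq * t)"
 using t p(2) q(2) by (auto simp: tq_Cy_def intro!: mult_mono mult_right_mono)
 then show "norm (y t) <= Cy * exp (- tq * t)" "norm (y (- t)) <= Cy * exp (- tq * t)" using p(3) q(3) t order_trans by blast+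
 qed
 have sg: "0 <= si" using order_trans[OF norm_ge_zero hF] .
 define K3 where "K3 = si + norm E + K"
 have K3: "0 <= K3" using sg K by (simp add: K3_def)
 have n1: "norm (F1 t) <= K3 * norm (y t)" "norm (G1 t) <= K3 * norm (y t)" for t
 proof -
 have "norm (F1 t) <= norm ((y t $ k) *R E) + norm (F1 t - (y t $ k) *R E)" by (rule norm_triangle_sub)
 also have "... <= y t $ k * norm E + si * y t $ k" using hF1[of t] py[of t] by simp
 also have "... <= K3 * (y t $ k)" using K py[of t] by (simp add: K3_def algebra_simps)
 also have "... <= K3 * norm (y t)" by (rule mult_left_mono[OF pyy K3])
 finally show "norm (F1 t) <= K3 * norm (y t)" .
 have "K * y t $ k <= K3 * norm (y t)" using sg K py[of t] pyy by (intro mult_mono) (auto simp: K3_def)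
 then show "norm (G1 t) <= K3 * norm (y t)" using hG1[of t] by simp
 qed
 have n2: "norm (F1 t) <= (K3 * Cy) * exp (- tq * t)" "norm (G1 t) <= (K3 * Cy) * exp (- tq * t)"
 "norm (- F1 (- t)) <= (K3 * Cy) * exp (- tq * t)" "norm (- G1 (- t)) <= (K3 * Cy) * exp (- tq * t)" if "0 <= t" for t
 unfolding norm_minus_cancel mult.assoc
 using order_trans[OF n1(1) mult_left_mono[OF dec(1)[OF that] K3]] order_trans[OF n1(2) mult_left_mono[OF dec(1)[OF that] K3]]
 order_trans[OF n1(1) mult_left_mono[OF dec(2)[OF that] K3]] order_trans[OF n1(2) mult_left_mono[OF dec(2)[OF that] K3]] by blast+
 \<comment> \<open>The companion of \<open>y\<close> in the system at \<open>ka = 0\<close>: it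
   satisfies \<open>u' = G y\<close>, and normalized at \<open>wm\<close> it inherits the
   exponential decay of \<open>y\<close> at the left.\<close>
 define u0 where "u0 t = ta *R (gb (X t) - gb wm)" for t
 have du: "(u0 hvd G t *v y t) (at t)" for t
 proof -
 have "((%t. gb (X t) - gb wm) hvd Gv (X t) *v (ta *R y t) - 0) (at t)"
 by (intro has_vector_derivative_diff has_vector_derivative_const has_vector_derivative_field_compose[OF dX dfb(2)[OF XB]])
 from bounded_linear.has_vector_derivative[OF bounded_linear_scaleR_right[of ta] this] show ?thesis
 unfolding u0_def[symmetric] F_G_def by (simp add: matrix_vector_mult_scaleR tt)
 qed
 have lu: "(u0 ---> 0) at_bot"
 proof -
 have "isCont gb wm" using has_derivative_continuous[OF dfb(2)[OF w(2)]] by simp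
 from tendsto_scaleR[OF tendsto_const[of ta] tendsto_diff[OF isCont_tendsto_compose[OF this lims(2)] tendsto_const[of "gb wm"]]]
 show ?thesis unfolding u0_def[abs_def] X_def by simp
 qed
 have nG: "norm (G t) <= K" for t
 proof -
 have "2 *R G t = (G t + Fv (X t)) + (G t - Fv (X t))" by (simp add: scaleR_2)
 then have "norm (2 *R G t) <= K + K" using norm_triangle_mono[OF nrm(1)[OF XB[of t]] nrm(2)[OF XB[of t]]] by (simp add: F_G_def)
 then show ?thesis by simp
 qed
 have un: "norm (u0 (- t)) <= K * Cy / tq * exp (- tq * t)" if "0 <= t" for t
 proof -
 have "norm (u0 (- t) - 0) <= K * Cy / tq * exp (- tq * t)"
 proof (rule exp_tail_bound[where y = "%t. u0 (- t)" and y' = "%t. - (G (- t) *v y (- t))", OF _ _ tq _ that])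
 show "((%t. u0 (- t)) hvd - (G (- s) *v y (- s))) (at s)" for s by (rule has_vector_derivative_reflect[OF du])
 show "norm (- (G (- s) *v y (- s))) <= K * Cy * exp (- tq * s)" if "0 <= s" for s
 unfolding norm_minus_cancel mult.assoc using K by (intro order_trans[OF norm_mv] mult_mono nG dec(2) that) auto
 show "((%t. u0 (- t)) ---> 0) at_top" by (rule filterlim_compose[OF lu filterlim_uminus_at_bot_at_top])
 qed
 then show ?thesis by simp
 qed
 define K1 where "K1 = K3 * Cy / tq"
 define Cv where "Cv = Cy + K * Cy / tq"
 have KC: "0 <= K * Cy / tq" using K Cy tq by simp
 have swap: "Gv v + ta *R Fv v = Gv v + Fv v & Gv v - ta *R Fv v = Gv v - Fv v \<or> Gv v + ta *R Fv v = Gv v - Fv v & Gv v - ta *R Fv v = Gv v + Fv v" for v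
 using ta by auto
 have sy': "sym_mat (Gv v + ta *R Fv v)" "sym_mat (Gv v - ta *R Fv v)" and pos': "c0 * (norm x)^2 <= x #. ((Gv v + ta *R Fv v) *v x)" "c0 * (norm x)^2 <= x #. ((Gv v - ta *R Fv v) *v x)"
 and nrm': "norm (Gv v + ta *R Fv v) <= K" "norm (Gv v - ta *R Fv v) <= K" if "v : ball 0 ro" for v x
 using swap[of v] sy[OF that] pos[OF that, of x] nrm[OF that] by (elim disjE conjE; simp)+
 have "stable_pair (ev_minus F G) (ev_plus F G)"
 proof (rule line_stable[OF gm K C c dF dG _ _ c0, where py = "%t. y t $ k" and h = h and hp = "ta * wp $ k" and hm = "ta * wm $ k" and ?K1.0 = K1 and tq = tq
 and Fp = "ta *R Fv wp" and Gp = "Gv wp" and Fm = "ta *R Fv wm" and Gm = "Gv wm" and ?v0.0 = y and ?u0.0 = u0 and Cv = Cv and k = k and Wp = Wp and rp = rp and fp = fp and gp = gp and Wm = Wm and rm = rm and fm = fm and gm = gm])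
 show "sym_mat (G t + F t)" "sym_mat (G t - F t)" "norm (G t + F t) <= K" "norm (G t - F t) <= K" for t
 unfolding F_G_def by (intro sy' nrm' XB)+
 show "c0 * (norm x)^2 <= x #. ((G t + F t) *v x)" "c0 * (norm x)^2 <= x #. ((G t - F t) *v x)" for t x
 unfolding F_G_def by (intro pos' XB)+
 show "y t $ k <= si" for t using order_trans[OF pyy yb] .
 show "\<bar>h t\<bar> <= 1" for t
 proof -
 have "\<bar>X t $ k\<bar> <= norm (X t)" by (rule component_le_norm_cart)
 also have "... <= 1" using XB[of t] ro by simp
 finally show ?thesis by (simp add: h_def abs_mult tt)
 qed
 show "0 <= K1" unfolding K1_def using K3 Cy tq by simp
 show "norm (F t - ta *R Fv wp) <= K1 * exp (- tq * t)" "norm (G t - Gv wp) <= K1 * exp (- tq * t)" if "0 <= t" for t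
 unfolding K1_def by (rule exp_tail_bound[OF dF n2(1) tq lF(1) that] exp_tail_bound[OF dG n2(2) tq lG(1) that]; assumption)+
 show "norm (F (- t) - ta *R Fv wm) <= K1 * exp (- tq * t)" "norm (G (- t) - Gv wm) <= K1 * exp (- tq * t)" if "0 <= t" for t
 unfolding K1_def
 by (rule exp_tail_bound[where y = "%t. F (- t)", OF has_vector_derivative_reflect[OF dF] n2(3) tq filterlim_compose[OF lF(2) filterlim_uminus_at_bot_at_top] that]
 exp_tail_bound[where y = "%t. G (- t)", OF has_vector_derivative_reflect[OF dG] n2(4) tq filterlim_compose[OF lG(2) filterlim_uminus_at_bot_at_top] that]; assumption)+
 show "norm (y (- t)) <= Cv * exp (- tq * t)" if "0 <= t" for t
 by (rule order_trans[OF dec(2)[OF that] mult_right_mono]) (use KC in \<open>simp_all add: Cv_def\<close>)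
 show "norm (u0 (- t)) <= Cv * exp (- tq * t)" if "0 <= t" for t
 by (rule order_trans[OF un[OF that] mult_right_mono]) (use Cy in \<open>simp_all add: Cv_def\<close>)
 show "c0 * (norm x)^2 <= x #. ((Gv wp + ta *R Fv wp) *v x)" "c0 * (norm x)^2 <= x #. ((Gv wp - ta *R Fv wp) *v x)"
 "c0 * (norm x)^2 <= x #. ((Gv wm + ta *R Fv wm) *v x)" "c0 * (norm x)^2 <= x #. ((Gv wm - ta *R Fv wm) *v x)" for x
 by (intro pos' w)+
 show "sym_mat (Gv wp + ta *R Fv wp)" "sym_mat (Gv wp - ta *R Fv wp)" "sym_mat (Gv wm + ta *R Fv wm)" "sym_mat (Gv wm - ta *R Fv wm)"
 by (intro sy' w)+
 qed (fact hF hF1 hG1 py cy dh hl tq ep em dy du ynz | assumption)+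
 then show ?thesis unfolding F_G_def[abs_def] X_def .
qed

section \<open>Genuine nonlinearity and positivity near the base state\<close>

lemma bounded_bilinear_mv: "bounded_bilinear ((*v) :: real^'n::finite^'n => real^'n => real^'n)"
 unfolding bilinear_conv_bounded_bilinear[symmetric] bilinear_def
 by (auto intro!: linearI simp: matrix_vector_mult_def vec_eq_iff sum.distrib[symmetric] sum_distrib_left algebra_simps)

interpretation mv: bounded_bilinear "(*v) :: real^'n::finite^'n => real^'n => real^'n" by (rule bounded_bilinear_mv)

lemma sym_inner: "sym_mat M ==> x #. (M *v z) = (M *v x) #. z" for M :: "real^'n::finite^'n"
 unfolding sym_mat_def by (metis dot_lmul_matrix vector_transpose_matrix inner_commute)

text \<open>Differentiate \<open>(a - mu b) rk = 0\<close> in the direction \<open>rk 0\<close> and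
  pair with \<open>rk 0\<close>. The matrix is symmetric and annihilates \<open>rk 0\<close>, so the
  derivative of \<open>rk\<close> drops out; written with difference quotients, the argument uses
  only continuity of \<open>rk\<close>.\<close>

lemma genuine_nonlinearity:
 fixes a b :: "real^'n::finite => real^'n^'n" and mu :: "real^'n => real" and rk :: "real^'n => real^'n"
 assumes da: "(a has_derivative a') (at 0)" and db: "(b has_derivative b') (at 0)" and dm: "(mu has_derivative mu') (at 0)"
 and cr: "isCont rk 0" and s: "sym_mat (a 0)" "sym_mat (b 0)"
 and eq: "\<forall>\<^sub>F v in nhds 0. a v *v rk v = mu v *R (b v *v rk v)" and n: "rk 0 #. (b 0 *v rk 0) = 1"
 shows "rk 0 #. ((a' (rk 0) - mu 0 *R b' (rk 0)) *v rk 0) = mu' (rk 0)"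
proof -
 define h where "h = rk 0"
 define X where "X t = t *R h" for t :: real
 have X0: "X 0 = 0" by (simp add: X_def)
 have dX: "(X hvd h) (at 0)"
 unfolding X_def[abs_def] has_vector_derivative_def by (rule bounded_linear_imp_has_derivative[OF bounded_linear_scaleR_left])
 define N where "N t = a (X t) - mu (X t) *R b (X t)" for t
 have dN: "(N hvd a' h - (mu 0 *R b' h + mu' h *R b 0)) (at 0)"
 proof -
 have 1: "((%t. a (X t)) hvd a' h) (at 0)" and 2: "((%t. b (X t)) hvd b' h) (at 0)"
 and 3: "((%t. mu (X t)) hvd mu' h) (at 0)"
 by (rule has_vector_derivative_field_compose[OF dX], simp add: X0 da db dm)+
 from has_vector_derivative_scaleR[OF 3[unfolded has_real_derivative_iff_has_vector_derivative[symmetric]] 2]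
 show ?thesis unfolding N_def[abs_def] using 1 by (intro has_vector_derivative_diff) (simp_all add: X0)
 qed
 have lX: "(X ---> 0) (at 0)" using has_vector_derivative_continuous[OF dX] by (simp add: continuous_at X0)
 have lr: "((%t. rk (X t)) ---> h) (at 0)" using isCont_tendsto_compose[OF cr lX] by (simp add: h_def)
 have lim: "((%t. h #. (((1 / (t - 0)) *R (N t - N 0)) *v rk (X t))) ---> h #. ((a' h - (mu 0 *R b' h + mu' h *R b 0)) *v h)) (at 0)"
 by (intro tendsto_inner tendsto_const mv.tendsto lr dN[unfolded has_vector_derivative_quotient])
 have N0h: "N 0 *v h = 0" using eventually_nhds_x_imp_x[OF eq] by (simp add: N_def X0 h_def mv.diff_left scaleR_mv)
 have sN: "sym_mat (N 0)" using s unfolding sym_mat_def by (simp add: N_def X0 transpose_def vec_eq_iff)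
 have "\<forall>\<^sub>F t in at 0. a (X t) *v rk (X t) = mu (X t) *R (b (X t) *v rk (X t))"
 using eq lX by (rule eventually_compose_filterlim)
 then have "\<forall>\<^sub>F t in at 0. h #. (((1 / (t - 0)) *R (N t - N 0)) *v rk (X t)) = 0"
 proof eventually_elim
 case (elim t)
 then have "N t *v rk (X t) = 0" by (simp add: N_def mv.diff_left scaleR_mv)
 \<comment> \<open>This removes the increment of the eigenvector, leaving only the increment of the
   matrix in the quotient.\<close>
 moreover have "h #. (N 0 *v rk (X t)) = 0" by (simp add: sym_inner[OF sN] N0h)
 ultimately show ?case by (simp add: scaleR_mv mv.diff_left inner_diff_right)
 qed
 then have "((%t. h #. (((1 / (t - 0)) *R (N t - N 0)) *v rk (X t))) ---> 0) (at 0)" by (rule tendsto_eventually)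
 then have "h #. ((a' h - (mu 0 *R b' h + mu' h *R b 0)) *v h) = 0" by (rule tendsto_unique[OF trivial_limit_at lim])
 then show ?thesis using n by (simp add: h_def[symmetric] mv.diff_left mv.add_left scaleR_mv inner_diff_right inner_add_right)
qed

lemma pos_def_lower:
 assumes "pos_def (M :: real^'n::finite^'n)"
 shows "EX p>0. ALL x. p * (norm x)^2 <= x #. (M *v x)"
proof -
 have "EX u:sphere 0 1. ALL x:sphere 0 1. u #. (M *v u) <= x #. (M *v x)"
 proof (rule continuous_attains_inf)
 show "continuous_on (sphere 0 1) (%x. x #. (M *v x))"
 by (intro continuous_on_inner continuous_on_id) (rule linear_continuous_on[OF matrix_vector_mul_bounded_linear])
 qed auto
 then obtain u where u: "norm u = 1" "!!x. norm x = 1 ==> u #. (M *v u) <= x #. (M *v x)" by auto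
 have "0 < u #. (M *v u)" using assms u(1) unfolding pos_def_def by (metis norm_zero zero_neq_one)
 moreover have "u #. (M *v u) * (norm x)^2 <= x #. (M *v x)" for x
 proof (cases "x = 0")
 case False
 define z where "z = (1 / norm x) *R x"
 have x: "x = norm x *R z" using False by (simp add: z_def)
 have "u #. (M *v u) <= z #. (M *v z)" using False by (intro u(2)) (simp add: z_def)
 then have "(u #. (M *v u)) * (norm x)^2 <= (z #. (M *v z)) * (norm x)^2" by (intro mult_right_mono) auto
 also have "... = x #. (M *v x)" by (subst (2 3) x) (simp add: matrix_vector_mult_scaleR power2_eq_square)
 finally show ?thesis .
 qed simp
 ultimately show ?thesis by blast
qed

text \<open>On the normalized eigenvector the two positive forms take the values
  \<open>1 + m\<close> and \<open>1 - m\<close>.\<close>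

lemma relative_speed_bound:
 assumes "r #. (b *v r) = 1" "a *v r = m *R (b *v r)" "0 < p" "!!x. p * (norm x)^2 <= x #. ((b + a) *v x)" "!!x. p * (norm x)^2 <= x #. ((b - a) *v (x :: real^'n::finite))"
 shows "\<bar>m\<bar> < 1"
proof -
 have "r ~= 0" using assms(1) by auto
 then have "0 < p * (norm r)^2" using assms(3) by simp
 then show ?thesis using assms(4)[of r] assms(5)[of r] assms(1,2) by (simp add: mv.add_left mv.diff_left inner_add_right inner_diff_right)
qed

text \<open>The eigenvectors survive the Lorentz boost and the speeds transform by velocity
  addition. The required \<open>\<bar>m - s\<bar> < 1 - s * m\<close> is the positivity of
  \<open>(1 - s) * (1 + m)\<close> and \<open>(1 + s) * (1 - m)\<close>.\<close>

lemma end_data_boost: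
 fixes a b :: "real^'n::finite^'n"
 assumes s: "sym_mat a" "sym_mat b" and o: "!!i j. r i #. (b *v r j) = (if i = j then 1 else 0)" and e: "!!j. a *v r j = m j *R (b *v r j)"
 and m: "!!j. \<bar>m j\<bar> < 1" and sp: "\<bar>s\<bar> < 1" and ta: "\<bar>ta\<bar> = 1" and ga: "0 < ga"
 shows "end_data (ta *R (ga *R (a - s *R b))) (ga *R (b - s *R a)) b r (%j. ta * (ga * (m j - s))) (%j. ga * (1 - s * m j))"
proof -
 have "\<bar>ta * (ga * (m j - s))\<bar> < ga * (1 - s * m j)" for j
 proof -
 have "0 < (1 - s) * (1 + m j)" "0 < (1 + s) * (1 - m j)" using m[of j] sp by (intro mult_pos_pos; simp add: abs_less_iff)+
 then have "\<bar>m j - s\<bar> < 1 - s * m j" by (simp add: abs_less_iff algebra_simps)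
 then show ?thesis using ta ga by (simp add: abs_mult)
 qed
 then show ?thesis
 using s o unfolding end_data_def sym_mat_def
 by (auto simp: scaleR_mv mv.diff_left e transpose_def vec_eq_iff algebra_simps)
qed

lemma cone_component:
 assumes "(norm (h :: real^'n::finite))^2 <= (1 + et^2) * (h $ k)^2" "0 < et" "l ~= k"
 shows "\<bar>h $ l\<bar> <= et * \<bar>h $ k\<bar>"
proof -
 have "(\<Sum>i\<in>{k, l}. (h $ i)^2) <= (SUM i:UNIV. (h $ i)^2)" by (rule sum_mono2) auto
 also have "... = (norm h)^2" by (simp only: power2_norm_eq_inner inner_vec_def) (simp add: power2_eq_square)
 finally have "(h $ l)^2 <= (et * \<bar>h $ k\<bar>)^2" using assms by (simp add: power_mult_distrib algebra_simps)
 then show ?thesis using assms(2) by (simp add: abs_le_square_iff[symmetric] abs_mult)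
qed

text \<open>In a narrow cone every component off the axis is at most
  \<open>et * \<bar>h $ k\<bar>\<close>, so a directional derivative is its k-th partial derivative
  up to a small multiple of \<open>\<bar>h $ k\<bar>\<close>.\<close>

lemma cone_sums:
 fixes h :: "real^'n::finite" and H :: "'n => real^'n^'n"
 assumes h: "(norm h)^2 <= (1 + et^2) * (h $ k)^2" "0 < et" "et <= 1" and c: "!!l. norm (H l - H0 l) <= d"
 shows "norm ((SUM l:UNIV. h $ l *R H l) - h $ k *R H0 k) <= (real CARD('n) * d + et * (SUM l:UNIV. norm (H0 l))) * \<bar>h $ k\<bar>"
 and "norm (SUM l:UNIV. h $ l *R H l) <= (SUM l:UNIV. norm (H l)) * \<bar>h $ k\<bar>"
proof -
 have h1: "\<bar>h $ l\<bar> <= \<bar>h $ k\<bar>" for l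
 using cone_component[OF h(1,2), of l] h(2,3) mult_right_mono[of et 1 "\<bar>h $ k\<bar>"] by (cases "l = k") auto
 show "norm (SUM l:UNIV. h $ l *R H l) <= (SUM l:UNIV. norm (H l)) * \<bar>h $ k\<bar>"
 unfolding sum_distrib_right by (rule order_trans[OF norm_sum sum_mono]) (use h1 in \<open>simp add: mult.commute mult_left_mono\<close>)
 have "(SUM l:UNIV. h $ l *R H l) - h $ k *R H0 k = (SUM l:UNIV. h $ l *R (H l - H0 l) + (if l = k then 0 else h $ l *R H0 l))"
 proof -
 have "(SUM l:UNIV. if l = k then 0 else h $ l *R H0 l) = (SUM l:UNIV. h $ l *R H0 l - (if l = k then h $ k *R H0 k else 0))" by (intro sum.cong) auto
 then show ?thesis by (simp add: sum.distrib sum_subtractf scaleR_diff_right)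
 qed
 moreover have "norm (h $ l *R (H l - H0 l) + (if l = k then 0 else h $ l *R H0 l)) <= \<bar>h $ k\<bar> * d + et * \<bar>h $ k\<bar> * norm (H0 l)" for l
 proof -
 have "norm (h $ l *R (H l - H0 l)) <= \<bar>h $ k\<bar> * d" using h1[of l] c[of l] by (simp add: mult_mono)
 moreover have "norm (if l = k then 0 else h $ l *R H0 l) <= et * \<bar>h $ k\<bar> * norm (H0 l)"
 using cone_component[OF h(1,2), of l] h(2) by (auto intro: mult_right_mono)
 ultimately show ?thesis by (rule norm_triangle_mono)
 qed
 ultimately have "norm ((SUM l:UNIV. h $ l *R H l) - h $ k *R H0 k) <= (SUM l:UNIV. \<bar>h $ k\<bar> * d + et * \<bar>h $ k\<bar> * norm (H0 l))"
 by (simp only:) (rule order_trans[OF norm_sum sum_mono])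
 also have "... = (real CARD('n) * d + et * (SUM l:UNIV. norm (H0 l))) * \<bar>h $ k\<bar>"
 by (simp add: sum.distrib sum_distrib_left sum_distrib_right algebra_simps)
 finally show "norm ((SUM l:UNIV. h $ l *R H l) - h $ k *R H0 k) <= (real CARD('n) * d + et * (SUM l:UNIV. norm (H0 l))) * \<bar>h $ k\<bar>" .
qed

lemma eventually_close:
 assumes "isCont Ph x" "0 < e"
 shows "\<forall>\<^sub>F p in nhds x. norm (Ph p - Ph x) < (e :: real)"
proof -
 have "(Ph ---> Ph x) (nhds x)" using assms(1) unfolding continuous_at tendsto_at_iff_tendsto_nhds .
 from tendstoD[OF this assms(2)] show ?thesis by (simp add: dist_norm)
qed

lemma diagonal_negative:
 fixes lam :: "'n::finite => real" and y :: "complex^'n"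
 assumes "lam k = 0" "!!j. j ~= k ==> lam j <= - l"
 shows "y #. cm (\<chi> i j. if i = j then lam i else 0) y <= - l * (norm (y - (y $ k) *s axis k 1))^2"
proof -
 have m: "cm (\<chi> i j. if i = j then lam i else 0) y $ i = lam i *R y $ i" for i
 by (simp add: cm_def if_distrib[of "%z. z *R _"] sum.delta cong: if_cong)
 have "y #. cm (\<chi> i j. if i = j then lam i else 0) y = (SUM i:UNIV. lam i * (norm (y $ i))^2)"
 unfolding inner_vec_def m by (simp add: power2_norm_eq_inner)
 also have "... <= (SUM i:UNIV. - l * (norm ((y - (y $ k) *s axis k 1) $ i))^2)"
 proof (rule sum_mono)
 fix i show "lam i * (norm (y $ i))^2 <= - l * (norm ((y - (y $ k) *s axis k 1) $ i))^2"
 proof (cases "i = k")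
 case False then show ?thesis using mult_right_mono[OF assms(2)[OF False] zero_le_power2[of "norm (y $ i)"]] by (simp add: axis_def)
 qed (simp add: assms axis_def)
 qed
 also have "... = - l * (norm (y - (y $ k) *s axis k 1))^2"
 unfolding sum_distrib_left[symmetric] by (simp add: power2_norm_eq_inner inner_vec_def)
 finally show ?thesis .
qed

lemma negative_factor: "(0 :: real) < x * y ==> y < 0 ==> x < 0"
 by (auto simp: zero_less_mult_iff)

lemma perturbed_lower:
 fixes M M0 :: "real^'n::finite^'n"
 assumes "!!x. q * (norm x)^2 <= x #. (M0 *v x)" "norm (M - M0) <= q / 2"
 shows "q / 2 * (norm x)^2 <= x #. (M *v x)"
proof -
 have "\<bar>x #. ((M - M0) *v x)\<bar> <= q / 2 * norm x * norm x"
 by (rule order_trans[OF inner_mv_bound]) (intro mult_right_mono assms(2), auto)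
 then have "- (q / 2 * (norm x)^2) <= x #. ((M - M0) *v x)" unfolding power2_eq_square mult.assoc by linarith
 moreover have "x #. ((M - M0) *v x) = x #. (M *v x) - x #. (M0 *v x)"
 by (simp only: mv.diff_left inner_diff_right)
 moreover have "q * (norm x)^2 = q / 2 * (norm x)^2 + q / 2 * (norm x)^2" by simp
 ultimately show ?thesis using assms(1)[of x] by linarith
qed

text \<open>For \<open>ta = -1\<close> stability is known for the reversed line, and
  \<open>stable_pair_reflect\<close> carries it back; the reflected bundles are exactly the original
  ones with their roles exchanged.\<close>

lemma spectrally_stable_if:
 fixes f g :: "real^'n::finite => real^'n"
 assumes F: "!!t. jac (fboost f g s) (phi t) = Fv (phi t)" "!!t. jac (gboost f g s) (phi t) = Gv (phi t)"
 and st: "stable_pair (ev_minus (%t. ta *R Fv (phi (ta * t))) (%t. Gv (phi (ta * t)))) (ev_plus (%t. ta *R Fv (phi (ta * t))) (%t. Gv (phi (ta * t))))"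
 and ta: "ta = 1 \<or> ta = -1"
 shows "spectrally_stable f g s phi"
proof -
 define X Y where "X t = Fv (phi t)" "Y t = Gv (phi t)" for t
 have "stable_pair (ev_minus X Y) (ev_plus X Y)"
 using ta
 proof
 assume "ta = 1" then show ?thesis using st unfolding X_Y_def[abs_def] by (simp only: mult_1 scaleR_one)
 next
 assume "ta = -1"
 then have "stable_pair (ev_minus (%t. - X (- t)) (%t. Y (- t))) (ev_plus (%t. - X (- t)) (%t. Y (- t)))" using st unfolding X_Y_def by (simp only: mult_minus_left mult_1 scaleR_minus_left scaleR_one)
 from stable_pair_reflect[OF this] show ?thesis
 unfolding ev_plus_reflect[of X Y, abs_def] ev_minus_reflect[of X Y, abs_def] .
 qed
 moreover have "evans_plus f g s phi = ev_plus X Y" "evans_minus f g s phi = ev_minus X Y"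
 unfolding evans_plus_def[abs_def] ev_plus_def[abs_def] evans_minus_def[abs_def] ev_minus_def[abs_def] A_mat_def F X_Y_def by (rule refl)+
 moreover have "spectrally_stable f g s phi = stable_pair (evans_minus f g s phi) (evans_plus f g s phi)"
 unfolding spectrally_stable_def stable_pair_def by (rule refl)
 ultimately show ?thesis by (simp only:)
qed

section \<open>Small extreme shocks: constants uniform in the amplitude\<close>

theorem theorem2p3:
  fixes k :: "'n::{finite,linorder}"
    and f g :: "(real, 'n) vec \<Rightarrow> (real, 'n) vec"
    and \<Omega> :: "((real, 'n) vec) set"
    and \<delta> :: real
    and mu :: "'n \<Rightarrow> (real, 'n) vec \<Rightarrow> real"
    and r :: "'n \<Rightarrow> (real, 'n) vec \<Rightarrow> (real, 'n) vec"
    and \<epsilon>0 :: real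
    and vm vp :: "real \<Rightarrow> (real, 'n) vec"
    and s :: "real \<Rightarrow> real"
  assumes \<Omega>: "open \<Omega>" "0 \<in> \<Omega>"
    and k_extreme: "(\<forall>j. k \<le> j) \<or> (\<forall>j. j \<le> k)"
    and smooth_fg: "smooth_on \<Omega> f" "smooth_on \<Omega> g"
    and fg0: "f 0 = 0" "g 0 = 0"
    and A1: "\<forall>v\<in>\<Omega>. sym_mat (jac f v) \<and> sym_mat (jac g v)" "pos_def (jac g 0)"
    and A2: "card {m::real. \<exists>x. x \<noteq> 0 \<and> jac f 0 *v x = m *\<^sub>R (jac g 0 *v x)} = card (UNIV :: 'n set)"
    and A4: "pos_def (jac g 0 + jac f 0)" "pos_def (jac g 0 - jac f 0)"
    and eig_ball: "0 < \<delta>" "ball 0 \<delta> \<subseteq> \<Omega>"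
    and eig_smooth: "\<forall>j. smooth_on (ball 0 \<delta>) (mu j) \<and> smooth_on (ball 0 \<delta>) (r j)"
    and eig_order: "\<forall>v\<in>ball 0 \<delta>. \<forall>i j. i < j \<longrightarrow> mu i v < mu j v"
    and eig_eq: "\<forall>v\<in>ball 0 \<delta>. \<forall>j. jac f v *v r j v = mu j v *\<^sub>R (jac g v *v r j v)"
    and eig_norm: "\<forall>v\<in>ball 0 \<delta>. \<forall>i j. r i v \<bullet> (jac g v *v r j v) = (if i = j then 1 else 0)"
    and A3: "frechet_derivative (mu k) (at 0) (r k 0) \<noteq> 0"
    and sign_rk: "frechet_derivative (mu k) (at 0) (r k 0) < 0"
    and coords: "\<exists>lam. jac f 0 - mu k 0 *\<^sub>R jac g 0 = (\<chi> i j. if i = j then lam i else 0)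
                   \<and> lam k = 0 \<and> (\<forall>j. j < k \<longrightarrow> lam j < 0) \<and> (\<forall>j. k < j \<longrightarrow> lam j > 0)"
    and coords_rk: "\<exists>c>0. r k 0 = c *\<^sub>R axis k 1"
    and fam_smooth: "0 < \<epsilon>0" "smooth_on {0..\<epsilon>0} vm" "smooth_on {0..\<epsilon>0} vp" "smooth_on {0..\<epsilon>0} s"
    and fam_shock: "\<forall>\<epsilon>\<in>{0<..\<epsilon>0}. k_shock f g mu k (vm \<epsilon>) (vp \<epsilon>) (s \<epsilon>)"
    and fam_speed: "s 0 = mu k 0" "(s has_real_derivative 0) (at 0 within {0..\<epsilon>0})"
    and fam_asym: "\<exists>C. \<forall>\<epsilon>\<in>{0..\<epsilon>0}. norm (vp \<epsilon> - \<epsilon> *\<^sub>R axis k 1) \<le> C * \<epsilon>\<^sup>2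
                                   \<and> norm (vm \<epsilon> + \<epsilon> *\<^sub>R axis k 1) \<le> C * \<epsilon>\<^sup>2"
    and fam_comp: "\<forall>\<epsilon>\<in>{0..\<epsilon>0}. vp \<epsilon> $ k = \<epsilon> \<and> vm \<epsilon> $ k = - \<epsilon>"
    and fam_unique: "\<forall>\<epsilon>\<in>{0<..\<epsilon>0}.
         {v \<in> ball 0 (3 * \<epsilon>). f v - s \<epsilon> *\<^sub>R g v = f (vm \<epsilon>) - s \<epsilon> *\<^sub>R g (vm \<epsilon>)} = {vm \<epsilon>, vp \<epsilon>}"
  shows "\<exists>\<epsilon>1. 0 < \<epsilon>1 \<and> \<epsilon>1 \<le> \<epsilon>0 \<and>
           (\<forall>\<epsilon>\<in>{0<..\<epsilon>1}. \<forall>phi. is_profile f g (s \<epsilon>) (vm \<epsilon>) (vp \<epsilon>) \<epsilon> phi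
               \<longrightarrow> spectrally_stable f g (s \<epsilon>) phi)"
proof -
 define my where "my = mu k 0"
 define a b where "a = jac f" "b = jac g"
 define ek :: "(real, 'n) vec" where "ek = axis k 1"
 have z0: "(0 :: (real, 'n) vec) : ball 0 \<delta>" using eig_ball(1) by simp
 obtain Ha where Ha: "!!l. continuous_on \<Omega> (Ha l)" "!!x. x \<in> \<Omega> ==> (f has_derivative (%h. a x *v h)) (at x)"
 "!!x. x \<in> \<Omega> ==> (a has_derivative (%h. SUM l:UNIV. h $ l *R Ha l x)) (at x)"
 using smooth_jacobian[OF \<Omega>(1) smooth_fg(1)] unfolding a_b_def by blast
 obtain Hb where Hb: "!!l. continuous_on \<Omega> (Hb l)" "!!x. x \<in> \<Omega> ==> (g has_derivative (%h. b x *v h)) (at x)"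
 "!!x. x \<in> \<Omega> ==> (b has_derivative (%h. SUM l:UNIV. h $ l *R Hb l x)) (at x)"
 using smooth_jacobian[OF \<Omega>(1) smooth_fg(2)] unfolding a_b_def by blast
 have sab: "sym_mat (a v)" "sym_mat (b v)" if "v \<in> \<Omega>" for v using A1(1) that unfolding a_b_def by blast+
 have eig: "a v *v r j v = mu j v *R (b v *v r j v)" "r i v #. (b v *v r j v) = (if i = j then 1 else 0)" if "v : ball 0 \<delta>" for v i j
 using eig_eq eig_norm that unfolding a_b_def by blast+
 obtain p1 p2 where p: "0 < p1" "!!x. p1 * (norm x)^2 <= x #. ((b 0 + a 0) *v x)" "0 < p2" "!!x. p2 * (norm x)^2 <= x #. ((b 0 - a 0) *v x)"
 using pos_def_lower[OF A4(1)] pos_def_lower[OF A4(2)] unfolding a_b_def by blast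
 define p where "p = min p1 p2"
 have pp: "0 < p" "p * (norm x)^2 <= x #. ((b 0 + a 0) *v x)" "p * (norm x)^2 <= x #. ((b 0 - a 0) *v x)" for x
 using p(1,3) order_trans[OF mult_right_mono p(2)[of x], of p] order_trans[OF mult_right_mono p(4)[of x], of p] by (simp_all add: p_def)
 have my1: "\<bar>my\<bar> < 1"
 unfolding my_def by (rule relative_speed_bound[OF _ eig(1)[OF z0] pp]) (simp add: eig(2)[OF z0])
 have ga: "0 < lgamma s" if "\<bar>s\<bar> < 1" for s
 using that by (simp add: lgamma_def abs_square_less_1)
 define Fv where "Fv s v = lgamma s *R (a v - s *R b v)" for s v
 define Gv where "Gv s v = lgamma s *R (b v - s *R a v)" for s v
 define FH where "FH s l v = lgamma s *R (Ha l v - s *R Hb l v)" for s l v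
 define GH where "GH s l v = lgamma s *R (Hb l v - s *R Ha l v)" for s l v
 have cl: "isCont lgamma my"
 proof -
 have "my^2 < 1" using my1 by (simp add: abs_square_less_1)
 then show ?thesis unfolding lgamma_def[abs_def] by (intro continuous_intros) simp
 qed
 have c1: "isCont (%q. fst q) (my, 0 :: (real, 'n) vec)" by (rule continuous_fst[OF continuous_ident])
 have c2: "isCont (%q. snd q) (my, 0 :: (real, 'n) vec)" by (rule continuous_snd[OF continuous_ident])
 have "isCont (%q. lgamma (fst q)) (my, 0 :: (real, 'n) vec)"
 by (rule isCont_o2[OF c1]) (simp only: fst_conv cl)
 note c0 = this c1
 have cs: "isCont (%q. Ph (snd q)) (my, 0 :: (real, 'n) vec)" if "isCont Ph 0" for Ph :: "(real, 'n) vec => 'x::topological_space"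
 by (rule isCont_o2[OF c2]) (simp only: snd_conv that)
 have "isCont (Ha l) 0" "isCont (Hb l) 0" for l
 using Ha(1)[of l] Hb(1)[of l] \<Omega> unfolding continuous_on_eq_continuous_at[OF \<Omega>(1)] by blast+
 note ca = has_derivative_continuous[OF Ha(3)[OF \<Omega>(2)]] has_derivative_continuous[OF Hb(3)[OF \<Omega>(2)]]
 has_derivative_continuous[OF Ha(2)[OF \<Omega>(2)]] has_derivative_continuous[OF Hb(2)[OF \<Omega>(2)]] this
 note cc = cs[OF ca(1)] cs[OF ca(2)] cs[OF ca(3)] cs[OF ca(4)] cs[OF ca(5)] cs[OF ca(6)]
 have cF: "isCont (%q. Fv (fst q) (snd q)) (my, 0)" and cG: "isCont (%q. Gv (fst q) (snd q)) (my, 0)"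
 and cFH: "isCont (%q. FH (fst q) l (snd q)) (my, 0)" and cGH: "isCont (%q. GH (fst q) l (snd q)) (my, 0)"
 and cf: "isCont (%q. fboost f g (fst q) (snd q)) (my, 0)" for l
 unfolding Fv_def Gv_def FH_def GH_def fboost_def by (intro continuous_scaleR continuous_diff c0 cc)+
 obtain lam0 where lam0: "a 0 - my *R b 0 = (\<chi> i j. if i = j then lam0 i else 0)" "lam0 k = 0" "!!j. j < k ==> lam0 j < 0" "!!j. k < j ==> 0 < lam0 j"
 using coords unfolding a_b_def my_def by blast
 \<comment> \<open>The orientation: for the largest speed the line is kept, for the smallest it is
   reversed. In both cases the matrix \<open>F0\<close> below is negative semidefinite with kernel
   spanned by the k-th axis.\<close>
 obtain ta :: real where ta: "ta = 1 & (ALL j. j <= k) \<or> ta = -1 & (ALL j. k <= j)" using k_extreme by blast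
 have ta': "ta = 1 \<or> ta = -1" "\<bar>ta\<bar> = 1" using ta by auto
 define lam where "lam j = ta * (lgamma my * lam0 j)" for j
 have "lam j < 0" if j: "j ~= k" for j
 using ta
 proof
 assume t: "ta = 1 & (ALL j. j <= k)"
 then have "lam0 j < 0" using lam0(3) j order_le_less by blast
 then show ?thesis using t mult_pos_neg[OF ga[OF my1]] by (simp add: lam_def)
 next
 assume t: "ta = -1 & (ALL j. k <= j)"
 then have "0 < lam0 j" using lam0(4) j order_le_less by blast
 then show ?thesis using t mult_pos_pos[OF ga[OF my1]] by (simp add: lam_def)
 qed
 then have lam: "lam k = 0" "!!j. j ~= k ==> lam j < 0" using lam0(2) by (simp_all add: lam_def)
 obtain l where l: "0 < l" "!!j. j ~= k ==> lam j <= - l"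
 proof -
 define l where "l = Min (insert 1 ((%j. - lam j) ` (UNIV - {k})))"
 have "0 < l" unfolding l_def by (subst Min_gr_iff) (use lam(2) in auto)
 moreover have "l <= - lam j" if "j ~= k" for j unfolding l_def by (rule Min_le) (use that in auto)
 ultimately show thesis using that by (metis le_minus_iff)
 qed
 define F0 :: "((real, 'n) vec, 'n) vec" where "F0 = (\<chi> i j. if i = j then lam i else 0)"
 have F0: "F0 = ta *R Fv my 0" unfolding Fv_def lam0(1) F0_def lam_def by (simp add: vec_eq_iff)
 define E where "E = FH my k 0"
 define e0 where "e0 = - (ek #. (E *v ek))"
 \<comment> \<open>Here (A3) enters: the k-th diagonal entry of \<open>E\<close>, the derivative of
   the boosted Jacobian along the shock direction, is up to the positive factors
   \<open>lgamma my\<close> and the cube of \<open>cr\<close> the derivative of \<open>mu k\<close>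
   along \<open>r k 0\<close>, which the sign convention makes negative.\<close>
 have e0: "0 < e0"
 proof -
 obtain cr where cr: "0 < cr" "r k 0 = cr *R ek" using coords_rk unfolding ek_def by blast
 define mu' where "mu' = frechet_derivative (mu k) (at 0)"
 have at0: "at 0 within ball 0 \<delta> = at (0 :: (real, 'n) vec)" using at_within_open[OF z0] by simp
 have sk: "smooth_on (ball 0 \<delta>) (mu k)" "smooth_on (ball 0 \<delta>) (r k)" using eig_smooth by blast+
 have "mu k differentiable_on ball 0 \<delta>" by (rule smooth_on.cases[OF sk(1)]) simp
 moreover have "r k differentiable_on ball 0 \<delta>" by (rule smooth_on.cases[OF sk(2)]) simp
 ultimately have dm: "(mu k has_derivative mu') (at 0)" and "r k differentiable (at 0)"
 using z0 unfolding differentiable_on_def mu'_def at0[symmetric] by (auto simp: frechet_derivative_works)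
 then have rc: "isCont (r k) 0" by (simp add: differentiable_imp_continuous_within)
 have ev: "\<forall>\<^sub>F v in nhds 0. a v *v r k v = mu k v *R (b v *v r k v)"
 by (rule eventually_mono[OF eventually_nhds_in_open[OF open_ball z0]]) (rule eig(1))
 have gn: "r k 0 #. (((SUM l:UNIV. r k 0 $ l *R Ha l 0) - mu k 0 *R (SUM l:UNIV. r k 0 $ l *R Hb l 0)) *v r k 0) = mu' (r k 0)"
 by (rule genuine_nonlinearity[OF Ha(3)[OF \<Omega>(2)] Hb(3)[OF \<Omega>(2)] dm rc sab[OF \<Omega>(2)] ev]) (simp add: eig(2)[OF z0])
 have sm: "(SUM l:UNIV. r k 0 $ l *R H l) = cr *R H k" for H :: "'n => ((real, 'n) vec, 'n) vec"
 proof -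
 have "(SUM l:UNIV. r k 0 $ l *R H l) = (SUM l:UNIV. if l = k then cr *R H k else 0)"
 by (intro sum.cong refl) (simp add: cr(2) ek_def axis_def)
 then show ?thesis by simp
 qed
 have "cr * cr * cr * (ek #. ((Ha k 0 - my *R Hb k 0) *v ek)) = mu' (r k 0)"
 using gn unfolding sm unfolding cr(2) my_def[symmetric]
 by (simp add: scaleR_mv mv.diff_left mv.scaleR_right inner_diff_right algebra_simps)
 then have "cr * cr * cr * (ek #. ((Ha k 0 - my *R Hb k 0) *v ek)) < 0" using sign_rk unfolding mu'_def by simp
 then have "ek #. ((Ha k 0 - my *R Hb k 0) *v ek) < 0" using cr(1) by (simp add: mult_less_0_iff)
 then have "lgamma my * (ek #. ((Ha k 0 - my *R Hb k 0) *v ek)) < 0" using ga[OF my1] by (simp add: mult_pos_neg)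
 then show ?thesis unfolding e0_def E_def FH_def by (simp add: scaleR_mv)
 qed
 \<comment> \<open>At the base state the matrices \<open>Gv + Fv\<close> and \<open>Gv - Fv\<close>
   are multiples of \<open>b + a\<close> and \<open>b - a\<close> with factors at least
   \<open>lgamma my * (1 - \<bar>my\<bar>)\<close>, so (A4) passes to the boosted fluxes.\<close>
 define q where "q = lgamma my * (1 - \<bar>my\<bar>) * p"
 have q: "0 < q" unfolding q_def using ga[OF my1] my1 pp(1) by simp
 have GF: "Gv my 0 + Fv my 0 = (lgamma my * (1 - my)) *R (b 0 + a 0)" "Gv my 0 - Fv my 0 = (lgamma my * (1 + my)) *R (b 0 - a 0)"
 by (simp_all add: Gv_def Fv_def algebra_simps)
 have q1: "q * (norm x)^2 <= x #. ((Gv my 0 + Fv my 0) *v x)" and q2: "q * (norm x)^2 <= x #. ((Gv my 0 - Fv my 0) *v x)" for x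
 proof -
 have *: "q * (norm x)^2 <= lgamma my * t * y" if "1 - \<bar>my\<bar> <= t" "p * (norm x)^2 <= y" for t y
 unfolding q_def mult.assoc[of _ p] using that ga[OF my1] my1 pp(1) by (intro mult_mono) auto
 show "q * (norm x)^2 <= x #. ((Gv my 0 + Fv my 0) *v x)" unfolding GF scaleR_mv inner_scaleR_right by (rule *[OF _ pp(2)]) simp
 show "q * (norm x)^2 <= x #. ((Gv my 0 - Fv my 0) *v x)" unfolding GF scaleR_mv inner_scaleR_right by (rule *[OF _ pp(3)]) simp
 qed
 define S where "S = (SUM l:UNIV. norm (FH my l 0))"
 define S' where "S' = (SUM l:UNIV. norm (GH my l 0) + 1)"
 \<comment> \<open>One constant for everything the energy estimate has to bound: the inverses,
   through \<open>q / 2\<close> as lower bound in a neighbourhood, the matrices with a margin of 1,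
   and the derivatives of \<open>Gv\<close>.\<close>
 define K where "K = 1 + (real CARD('n))^2 / (q / 2) + (norm (Gv my 0 + Fv my 0) + 1) + (norm (Gv my 0 - Fv my 0) + 1) + norm F0 + norm E + S'"
 have S0: "0 <= S" "0 <= S'" unfolding S_def S'_def by (auto intro: sum_nonneg)
 have n0: "0 <= (real CARD('n))^2 / (q / 2)" using q by simp
 have K: "1 <= K" "(real CARD('n))^2 / (q / 2) <= K" "norm (Gv my 0 + Fv my 0) + 1 <= K" "norm (Gv my 0 - Fv my 0) + 1 <= K" "norm F0 <= K" "norm E <= K" "S' <= K"
 using S0 n0 norm_ge_zero[of "Gv my 0 + Fv my 0"] norm_ge_zero[of "Gv my 0 - Fv my 0"] norm_ge_zero[of F0] norm_ge_zero[of E] unfolding K_def by linarith+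
 have ker: "F0 *v axis k 1 = 0"
 by (simp add: F0_def vec_eq_iff matrix_vector_mult_def axis_def if_distrib[of "%z. _ * z"] sum.delta lam(1) cong: if_cong)
 have Ek: "axis k 1 #. (E *v axis k 1) <= - e0" by (simp add: e0_def ek_def)
 obtain C si c where C: "0 < C" and si: "0 < si" "si <= 1" and c: "0 < c" and gm: "goodman K C si c F0 E"
 using goodman_exists[OF K(1) l(1) e0 ker diagonal_negative[where lam = lam and k = k and l = l, OF lam(1) l(2), folded F0_def] Ek K(5,6)] by blast
 \<comment> \<open>The opening of the cone, such that the components off the axis contribute at most
   half of the tolerance \<open>si\<close>; the other half is left to the variation of the
   derivatives, through \<open>d1\<close>.\<close>
 define et where "et = min 1 (si / (2 * (S + 1)))"
 have et: "0 < et" "et <= 1" "et * S <= si / 2"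
 proof -
 show "0 < et" "et <= 1" using si S0 by (simp_all add: et_def)
 have "et * S <= si / (2 * (S + 1)) * (S + 1)" using S0 si by (intro mult_mono) (auto simp: et_def)
 also have "... = si / 2" using S0 by (simp add: field_simps)
 finally show "et * S <= si / 2" .
 qed
 define si2 where "si2 = min si (l * et^2 / 6)"
 have si2: "0 < si2" "si2 <= si" "6 * si2 <= l * et^2" using si l(1) et by (auto simp: si2_def)
 define d1 where "d1 = si / (2 * real CARD('n))"
 have d1: "0 < d1" "real CARD('n) * d1 = si / 2" using si by (simp_all add: d1_def)
 have fb0: "fboost f g my 0 = 0" by (simp add: fboost_def fg0)
 \<comment> \<open>All smallness requirements as finitely many strict inequalities that hold at
   speed \<open>my\<close> and state 0. Each is open in the pair of speed and state, so they hold
   jointly in a neighbourhood, independently of the amplitude.\<close>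
 define good where "good s v \<longleftrightarrow> norm (Fv s v - Fv my 0) < si2 & norm (Gv s v + Fv s v - (Gv my 0 + Fv my 0)) < min (q/2) 1 &
 norm (Gv s v - Fv s v - (Gv my 0 - Fv my 0)) < min (q/2) 1 & (ALL l. norm (FH s l v - FH my l 0) < d1) & (ALL l. norm (GH s l v - GH my l 0) < 1) &
 norm (fboost f g s v - 0) < si / 2 & norm (s - my) < 1 - \<bar>my\<bar> & norm (b v + a v - (b 0 + a 0)) < p / 2 & norm (b v - a v - (b 0 - a 0)) < p / 2 & norm (v - 0) < \<delta>" for s v
 have "\<forall>\<^sub>F x in nhds (my, 0). good (fst x) (snd x)"
 proof -
 have m: "0 < min (q/2) 1" "0 < si / 2" "0 < 1 - \<bar>my\<bar>" "0 < p / 2" using q si my1 pp(1) by auto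
 have i: "isCont (%x. snd x) (my, 0 :: (real, 'n) vec)" by (intro continuous_intros)
 note 1 = eventually_close[OF cF si2(1)] eventually_close[OF isCont_add[OF cG cF] m(1)] eventually_close[OF isCont_diff[OF cG cF] m(1)]
 eventually_close[OF cf m(2)] eventually_close[OF c0(2) m(3)] eventually_close[OF isCont_add[OF cc(2,1)] m(4)]
 eventually_close[OF isCont_diff[OF cc(2,1)] m(4)] eventually_close[OF i eig_ball(1)]
 have 2: "\<forall>\<^sub>F x in nhds (my, 0). ALL l. norm (FH (fst x) l (snd x) - FH my l 0) < d1"
 by (rule eventually_all_finite) (use eventually_close[OF cFH d1(1)] in simp)
 have 3: "\<forall>\<^sub>F x in nhds (my, 0). ALL l. norm (GH (fst x) l (snd x) - GH my l 0) < 1"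
 by (rule eventually_all_finite) (use eventually_close[OF cGH zero_less_one] in simp)
 show ?thesis unfolding good_def using 1[simplified fst_conv snd_conv fb0] 2 3 by (intro eventually_conj) simp_all
 qed
 then obtain d where d: "0 < d" and dd: "ALL x. dist x (my, 0) < d --> good (fst x) (snd x)" unfolding eventually_nhds_metric by blast
 have gd: "good s v" if "\<bar>s - my\<bar> < d / 2" "norm v < d / 2" for s v
 proof -
 have "dist (s, v) (my, 0) <= \<bar>s - my\<bar> + norm v" using norm_Pair_le[of "s - my" v] by (simp add: dist_norm)
 then show ?thesis using that dd[rule_format, of "(s, v)"] by simp
 qed
 obtain e where e: "0 < e" "!!\<epsilon>. \<epsilon> \<in> {0..\<epsilon>0} ==> \<bar>\<epsilon>\<bar> < e ==> \<bar>s \<epsilon> - my\<bar> < d / 2"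
 proof -
 have "continuous (at 0 within {0..\<epsilon>0}) s" by (rule has_field_derivative_imp_has_derivative[OF fam_speed(2), THEN has_derivative_continuous])
 moreover have "0 < d / 2" using d by simp
 ultimately have "EX e>0. ALL x:{0..\<epsilon>0}. dist x 0 < e --> dist (s x) (s 0) < d / 2" unfolding continuous_within_eps_delta by blast
 then show thesis using that fam_speed(1) by (auto simp: dist_real_def my_def)
 qed
 \<comment> \<open>\<open>e / 2\<close> keeps the speed near \<open>my\<close>,
   \<open>d / 12\<close> keeps the ball of radius \<open>3 * \<epsilon>\<close> in the good
   neighbourhood, and \<open>1/3\<close> makes that radius at most 1, which bounds the weight
   exponent.\<close>
 define \<epsilon>1 where "\<epsilon>1 = min \<epsilon>0 (min (e / 2) (min (d / 12) (1/3)))"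
 have "0 < \<epsilon>1" "\<epsilon>1 <= \<epsilon>0" using fam_smooth(1) e(1) d by (auto simp: \<epsilon>1_def)
 moreover have "spectrally_stable f g (s \<epsilon>) phi" if \<epsilon>: "\<epsilon> \<in> {0<..\<epsilon>1}" and prof: "is_profile f g (s \<epsilon>) (vm \<epsilon>) (vp \<epsilon>) \<epsilon> phi" for \<epsilon> phi
 proof -
 have e3: "0 < \<epsilon>" "\<epsilon> \<in> {0<..\<epsilon>0}" "\<epsilon> \<in> {0..\<epsilon>0}" "3 * \<epsilon> < d / 2" "3 * \<epsilon> <= 1" "\<bar>\<epsilon>\<bar> < e" using \<epsilon> e(1) d by (auto simp: \<epsilon>1_def)
 have good: "good (s \<epsilon>) v" if "v : ball 0 (3 * \<epsilon>)" for v by (rule gd[OF e(2)[OF e3(3,6)]]) (use that e3(4) in simp)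
 define s0 where "s0 = s \<epsilon>"
 define B :: "(real, 'n) vec set" where "B = ball 0 (3 * \<epsilon>)"
 note gB = good[folded B_def s0_def, unfolded good_def]
 have BI: "0 : B" using e3(1) by (simp add: B_def)
 have BD: "v : ball 0 \<delta>" "v \<in> \<Omega>" if "v : B" for v using gB[OF that] eig_ball(2) by (auto simp: subset_iff)
 have s1: "\<bar>s0\<bar> < 1" using gB[OF BI] by (simp add: abs_if split: if_splits)
 note ga0 = ga[OF s1]
 have df: "(fboost f g s0 has_derivative (%h. Fv s0 v *v h)) (at v)" "(gboost f g s0 has_derivative (%h. Gv s0 v *v h)) (at v)" if "v : B" for v
 unfolding fboost_def[abs_def] gboost_def[abs_def] Fv_def Gv_def scaleR_mv mv.diff_left
 by (intro has_derivative_scaleR_right has_derivative_diff Ha(2) Hb(2) BD that)+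
 have dFG: "(Fv s0 has_derivative (%h. SUM l:UNIV. h $ l *R FH s0 l v)) (at v)" "(Gv s0 has_derivative (%h. SUM l:UNIV. h $ l *R GH s0 l v)) (at v)" if "v : B" for v
 proof -
 have e1: "(SUM l:UNIV. h $ l *R (t *R (X l - s0 *R Y l))) = t *R ((SUM l:UNIV. h $ l *R X l) - s0 *R (SUM l:UNIV. h $ l *R Y l))" for h :: "(real, 'n) vec" and t and X Y :: "'n => ((real, 'n) vec, 'n) vec"
 by (simp add: scaleR_sum_right scaleR_diff_right sum_subtractf mult_ac)
 show "(Fv s0 has_derivative (%h. SUM l:UNIV. h $ l *R FH s0 l v)) (at v)" "(Gv s0 has_derivative (%h. SUM l:UNIV. h $ l *R GH s0 l v)) (at v)"
 unfolding Fv_def[abs_def] Gv_def[abs_def] FH_def GH_def e1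
 by (intro has_derivative_scaleR_right has_derivative_diff Ha(3) Hb(3) BD that)+
 qed
 have jac: "jac (fboost f g s0) v = Fv s0 v" "jac (gboost f g s0) v = Gv s0 v" if "v : B" for v
 unfolding jac_def frechet_derivative_at[OF df(1)[OF that], symmetric] frechet_derivative_at[OF df(2)[OF that], symmetric] by simp_all
 \<comment> \<open>The description of the solution set yields both that the end states lie in the
   ball and the Rankine-Hugoniot relation.\<close>
 have "{v : ball 0 (3 * \<epsilon>). f v - s \<epsilon> *R g v = f (vm \<epsilon>) - s \<epsilon> *R g (vm \<epsilon>)} = {vm \<epsilon>, vp \<epsilon>}" using fam_unique e3(2) by blast
 then have vB: "vm \<epsilon> \<in> B" "vp \<epsilon> \<in> B" and RH: "fboost f g s0 (vp \<epsilon>) = fboost f g s0 (vm \<epsilon>)"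
 unfolding B_def s0_def fboost_def by auto
 have comp: "vp \<epsilon> $ k = \<epsilon>" "vm \<epsilon> $ k = - \<epsilon>" using fam_comp e3(3) by blast+
 have ks: "mu k (vp \<epsilon>) < s0" "s0 < mu k (vm \<epsilon>)" "!!j. j ~= k ==> (mu j (vm \<epsilon>) - s0) * (mu j (vp \<epsilon>) - s0) > 0"
 using fam_shock e3(2) unfolding k_shock_def s0_def by blast+
 have ord: "mu i v < mu j v" if "v : B" "i < j" for i j v using eig_order BD(1)[OF that(1)] that(2) by blast
 \<comment> \<open>The end states on the right and on the left after orientation.\<close>
 define wp wm where "wp = (if ta = 1 then vp \<epsilon> else vm \<epsilon>)" "wm = (if ta = 1 then vm \<epsilon> else vp \<epsilon>)"
 have ph: "!!t. (phi hvd (fboost f g s0 (phi t) - fboost f g s0 (vm \<epsilon>))) (at t)" "!!t. phi t : B" "(phi ---> vm \<epsilon>) at_bot" "(phi ---> vp \<epsilon>) at_top"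
 using prof unfolding is_profile_def B_def s0_def by blast+
 have wB: "wp : B" "wm : B" and wf: "fboost f g s0 wm = fboost f g s0 (vm \<epsilon>)" "fboost f g s0 wp = fboost f g s0 wm"
 using vB RH by (simp_all add: wp_wm_def)
 have mub: "\<bar>mu j v\<bar> < 1" if "v : B" for j v
 proof (rule relative_speed_bound[OF _ eig(1)[OF BD(1)[OF that]]])
 show "r j v #. (b v *v r j v) = 1" by (simp add: eig(2)[OF BD(1)[OF that]])
 show "0 < p / 2" using pp(1) by simp
 show "p / 2 * (norm x)^2 <= x #. ((b v + a v) *v x)" "p / 2 * (norm x)^2 <= x #. ((b v - a v) *v x)" for x
 using gB[OF that] by (intro perturbed_lower[OF pp(2)] perturbed_lower[OF pp(3)]; simp)+
 qed
 have ed: "end_data (ta *R Fv s0 v) (Gv s0 v) (b v) (%j. r j v) (%j. ta * (lgamma s0 * (mu j v - s0))) (%j. lgamma s0 * (1 - s0 * mu j v))" if "v : B" for v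
 unfolding Fv_def Gv_def
 by (rule end_data_boost[OF sab[OF BD(2)[OF that]] eig(2)[OF BD(1)[OF that]] eig(1)[OF BD(1)[OF that]] mub[OF that] s1 ta'(2) ga0])
 \<comment> \<open>Since k is extreme, the Lax inequality for \<open>mu k\<close> passes through the
   ordering of the speeds to all of them: at \<open>wp\<close> every characteristic enters the
   shock.\<close>
 have fp: "ta * (lgamma s0 * (mu j wp - s0)) < 0" for j
 proof -
 have "ta * (mu j wp - s0) < 0"
 using ta
 proof
 assume t: "ta = 1 & (ALL j. j <= k)"
 then have "mu j (vp \<epsilon>) <= mu k (vp \<epsilon>)" using ord[OF vB(2), of j k] by (cases "j = k") (auto simp: order_le_less)
 then show ?thesis using t ks(1) by (simp add: wp_wm_def)
 next
 assume t: "ta = -1 & (ALL j. k <= j)"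
 then have "mu k (vm \<epsilon>) <= mu j (vm \<epsilon>)" using ord[OF vB(1), of k j] by (cases "j = k") (auto simp: order_le_less)
 then show ?thesis using t ks(2) by (simp add: wp_wm_def)
 qed
 from mult_pos_neg[OF ga0 this] show ?thesis by (simp add: mult_ac)
 qed
 have fk: "0 < ta * (lgamma s0 * (mu k wm - s0))" using ta ks(1,2) ga0 by (auto simp: wp_wm_def mult_pos_neg)
 \<comment> \<open>For \<open>j ~= k\<close> the relative speeds at the two end states have the same
   sign by the shock condition, and at \<open>wp\<close> the sign is already known.\<close>
 have fm: "ta * (lgamma s0 * (mu j wm - s0)) < 0" if "j ~= k" for j
 proof -
 have "0 < (mu j wm - s0) * (mu j wp - s0)" using ks(3)[OF that] by (simp add: wp_wm_def mult.commute)
 then have "0 < (lgamma s0 * lgamma s0) * ((mu j wm - s0) * (mu j wp - s0))" using ga0 by simp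
 also have "... = (ta * (lgamma s0 * (mu j wm - s0))) * (ta * (lgamma s0 * (mu j wp - s0)))" using ta'(1) by auto
 finally show ?thesis by (rule negative_factor) (rule fp)
 qed
 have "stable_pair (ev_minus (%t. ta *R Fv s0 (phi (ta * t))) (%t. Gv s0 (phi (ta * t)))) (ev_plus (%t. ta *R Fv s0 (phi (ta * t))) (%t. Gv s0 (phi (ta * t))))"
 proof (rule profile_stable[OF ta'(1) gm[unfolded F0_def] K(1) C c lam(1) l(2,1) et(1,2) si2(3,2) _ K(2) e3(5) df[unfolded B_def] dFG[unfolded B_def],
 where wp = wp and wm = wm and Wp = "b wp" and rp = "%j. r j wp" and fp = "%j. ta * (lgamma s0 * (mu j wp - s0))" and gp = "%j. lgamma s0 * (1 - s0 * mu j wp)"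
 and Wm = "b wm" and rm = "%j. r j wm" and fm = "%j. ta * (lgamma s0 * (mu j wm - s0))" and gm = "%j. lgamma s0 * (1 - s0 * mu j wm)"], unfold B_def[symmetric] F0_def[symmetric])
 show "0 < q / 2" using q by simp
 show "sym_mat (Gv s0 v + Fv s0 v)" "sym_mat (Gv s0 v - Fv s0 v)" if "v : B" for v
 using sab[OF BD(2)[OF that]] unfolding sym_mat_def Fv_def Gv_def by (simp_all add: transpose_def vec_eq_iff)
 show "q / 2 * (norm x)^2 <= x #. ((Gv s0 v + Fv s0 v) *v x)" "q / 2 * (norm x)^2 <= x #. ((Gv s0 v - Fv s0 v) *v x)" if "v : B" for v x
 using gB[OF that] by (intro perturbed_lower[OF q1] perturbed_lower[OF q2]; simp)+
 show "norm (Gv s0 v + Fv s0 v) <= K" "norm (Gv s0 v - Fv s0 v) <= K" if "v : B" for v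
 using gB[OF that] K(3,4) norm_triangle_sub[of "Gv s0 v + Fv s0 v" "Gv my 0 + Fv my 0"] norm_triangle_sub[of "Gv s0 v - Fv s0 v" "Gv my 0 - Fv my 0"]
 unfolding min_less_iff_conj by linarith+
 show "norm (ta *R Fv s0 v - F0) <= si2" if "v : B" for v
 unfolding F0 scaleR_diff_right[symmetric] norm_scaleR ta'(2) using gB[OF that] by simp
 show "norm ((SUM l:UNIV. h $ l *R FH s0 l v) - h $ k *R E) <= si * \<bar>h $ k\<bar>" if v: "v : B" and h: "(norm h)^2 <= (1 + et^2) * (h $ k)^2" for v h
 proof -
 have "norm ((SUM l:UNIV. h $ l *R FH s0 l v) - h $ k *R FH my k 0) <= (real CARD('n) * d1 + et * S) * \<bar>h $ k\<bar>"
 unfolding S_def by (rule cone_sums(1)[OF h et(1,2)]) (use gB[OF v] in \<open>simp add: less_imp_le\<close>)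
 also have "... <= si * \<bar>h $ k\<bar>" using d1(2) et(3) by (intro mult_right_mono) auto
 finally show ?thesis unfolding E_def .
 qed
 show "norm (SUM l:UNIV. h $ l *R GH s0 l v) <= K * \<bar>h $ k\<bar>" if v: "v : B" and h: "(norm h)^2 <= (1 + et^2) * (h $ k)^2" for v h
 proof -
 have "norm (SUM l:UNIV. h $ l *R GH s0 l v) <= (SUM l:UNIV. norm (GH s0 l v)) * \<bar>h $ k\<bar>"
 by (rule cone_sums(2)[OF h et(1,2), where ?H0.0 = "%l. GH my l 0" and d = 1]) (use gB[OF v] in \<open>simp add: less_imp_le\<close>)
 also have "... <= S' * \<bar>h $ k\<bar>" unfolding S'_def
 proof (intro mult_right_mono sum_mono)
 fix l show "norm (GH s0 l v) <= norm (GH my l 0) + 1" using gB[OF v] norm_triangle_sub[of "GH s0 l v" "GH my l 0"] by (meson add_left_mono less_imp_le order_trans)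
 qed simp
 also have "... <= K * \<bar>h $ k\<bar>" using K(7) by (intro mult_right_mono) auto
 finally show ?thesis .
 qed
 show "norm (fboost f g s0 v - fboost f g s0 wm) <= si" if "v : B" for v
 using gB[OF that] gB[OF wB(2)] norm_triangle_ineq4[of "fboost f g s0 v" "fboost f g s0 wm"] by simp
 show "(phi hvd fboost f g s0 (phi t) - fboost f g s0 wm) (at t)" for t unfolding wf(1) by (rule ph(1))
 show "((%t. phi (ta * t)) ---> wp) at_top" "((%t. phi (ta * t)) ---> wm) at_bot"
 using ta'(1) ph(3,4) filterlim_compose[OF ph(3) filterlim_uminus_at_bot_at_top] filterlim_compose[OF ph(4) filterlim_uminus_at_top_at_bot]
 by (auto simp: wp_wm_def)
 show "ta * wm $ k < ta * wp $ k" using ta'(1) comp e3(1) by (auto simp: wp_wm_def)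
 qed (fact ph wB wf ed[OF wB(1)] ed[OF wB(2)] fp fk fm | assumption)+
 then show ?thesis unfolding s0_def[symmetric] by (rule spectrally_stable_if[where Fv = "Fv s0" and Gv = "Gv s0" and ta = ta and phi = phi and f = f and g = g and s = s0, OF jac(1)[OF ph(2)] jac(2)[OF ph(2)] _ ta'(1)])
 qed
 ultimately show ?thesis by blast
qed

end
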